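(* The space $X$ (defined in the context by the norming set $L$) is hereditarily indecomposable.
   Context: $\mathbb N=\{1,2,\dots\}$; $c_{00}$ is the space of finitely supported real sequences with standard basis $(e_i)$. For finite sets, $E<F$ means $\max E<\min F$ or one of them is empty; for vectors, $x<y$ means $\operatorname{supp}x<\operatorname{supp}y$; $n\le E$ means $n\le\min E$. Schreier families: $\mathcal F_0=\{\emptyset\}\cup\{\{n\}:n\in\mathbb N\}$, $\mathcal F_{n+1}=\{\emptyset\}\cup\{\bigcup_{i=1}^kA_i: k\in\mathbb N,\ A_i\in\mathcal F_n,\ k\le A_1<\dots<A_k\}$. A finite sequence $(E_i)_{i=1}^d$ of nonempty finite subsets of $\mathbb N$ is $\mathcal M$-admissible if $E_1<\dots<E_d$ and $\{\min E_1,\dots,\min E_d\}\in\mathcal M$; functionals are admissible if their supports are. Fix integers $(m_j)_{j\ge1}$ with $m_1=2$, $m_j>m_{j-1}^{m_{j-1}}$ for $j\ge2$. Set $k_1=1$ and, for $n\ge2$, choose a positive integer $t_n$ with $2^{t_n}\ge m_n^2$ and set $k_n=t_n(k_{n-1}+1)+1$. Let $\mathcal M_j=\mathcal F_{k_j}$. The set $K$: $K_j^0=\{\pm e_n:n\in\mathbb N\}$ for all $j$; $K^n=\bigcup_jK_j^n$; for $j\ge2$, $K_j^{n+1}=K_j^n\cup\{\frac1{m_j}(f_1+\dots+f_d): f_i\in K^n,\ (f_i)_{i=1}^d\ \mathcal M_j\text{-admissible}\}$; $K_1^{n+1}=K_1^n\cup\{\frac12(f_1+\dots+f_d): f_i\in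 K^n,\ d\le\min\operatorname{supp}f_1<\dots<\min\operatorname{supp}f_d,\ \operatorname{supp}f_i\cap\operatorname{supp}f_l=\emptyset\ (i\ne l)\}$; $K=\bigcup_nK^n$; $\mathcal A_j=\bigcup_{n\ge1}(K_j^n\setminus K^0)$. Let $G=\{(x_1^*,\dots,x_k^* ):k\in\mathbb N,\ x_i^*\in K,\ x_1^*<\dots<x_k^*\}$ and fix a one-to-one function $\Phi:G\to\{2j\}_{j=1}^\infty$ such that for every $(x_1^*,\dots,x_k^* )\in G$, if $j_1$ is minimal with $x_1^*\in\mathcal A_{j_1}$ and $j_l=\Phi(x_1^*,\dots,x_{l-1}^* )$ for $l=2,\dots,k$, then $\Phi(x_1^*,\dots,x_k^* )>\max\{j_1,\dots,j_k\}$ (the entry $j_1$ being omitted if $x_1^*\in K^0$ and no such $j_1$ exists). The set $L$: $L_j^0=\{\pm e_n:n\in\mathbb N\}$ for all $j$. Given $\{L_j^n\}_j$, put $L^n=\bigcup_jL_j^n$, and $L_1^{n+1}=\pm L_1^n\cup\{\frac12(x_1^*+\dots+x_d^* ): d\in\mathbb N,\ x_i^*\in L^n,\ d\le\min\operatorname{supp}x_1^*<\dots<\min\operatorname{supp}x_d^*,\ \operatorname{supp}x_i^*\cap\operatorname{supp}x_l^*=\emptyset\ (i\ne l)\}$; for $j\ge1$, $L_{2j}^{n+1}=\pm L_{2j}^n\cup\{\frac1{m_{2j}}(x_1^*+\dots+x_d^* ): d\in\mathbb N,\ x_i^*\in L^n,\ (\operatorname{supp}x_i^* )_{i=1}^d\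 \mathcal M_{2j}\text{-admissible}\}$; $L_{2j+1}'^{\,n+1}=\pm L_{2j+1}^n\cup\{\frac1{m_{2j+1}}(x_1^*+\dots+x_d^* ): d\in\mathbb N,\ x_1^*\in L_{2k}^n\text{ for some }k>2j+1,\ x_i^*\in L^n_{\Phi(x_1^*,\dots,x_{i-1}^* )}\text{ for }1<i\le d,\ (\operatorname{supp}x_i^* )_{i=1}^d\ \mathcal M_{2j+1}\text{-admissible}\}$; $L_{2j+1}^{n+1}=\{E_sx^*: x^*\in L_{2j+1}'^{\,n+1},\ s\in\mathbb N\}$, where $E_s=\{s,s+1,\dots\}$ and $E_sx^*$ is the restriction of $x^*$ to $E_s$. Set $\mathcal B_j=\bigcup_{n\ge1}(L_j^n\setminus L^0)$ and $L=L^0\cup\bigcup_j\mathcal B_j$. The space $X$ is the completion of $c_{00}$ under $\|x\|=\sup_{f\in L}f(x)$. A Banach space is hereditarily indecomposable if no closed subspace of it is a topological direct sum of two infinite dimensional closed subspaces. *)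

theory Defs
  imports "HOL-Analysis.Analysis"
begin

text \<open>The index set $\{1,2,\dots\}$ is rendered inside \<^typ>\<open>nat\<close>: vectors and functionals are
  functions on \<^typ>\<open>nat\<close> which vanish at \<open>0\<close>.\<close>

definition supp :: "(nat \<Rightarrow> real) \<Rightarrow> nat set" where
  "supp x = {i. x i \<noteq> 0}"

definition c00 :: "(nat \<Rightarrow> real) set" where
  "c00 = {x. finite (supp x) \<and> x 0 = 0}"

definition unit_vec :: "nat \<Rightarrow> nat \<Rightarrow> real" where
  "unit_vec n = (\<lambda>i. if i = n then 1 else 0)"

definition signed_units :: "(nat \<Rightarrow> real) set" where
  "signed_units = {unit_vec n |n. 1 \<le> n} \<union> {- unit_vec n |n. 1 \<le> n}"

definition pm :: "(nat \<Rightarrow> real) set \<Rightarrow> (nat \<Rightarrow> real) set" where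
  "pm A = A \<union> uminus ` A"

definition tail_restrict :: "nat \<Rightarrow> (nat \<Rightarrow> real) \<Rightarrow> nat \<Rightarrow> real" where
  "tail_restrict s x = (\<lambda>i. if s \<le> i then x i else 0)"

definition scaled_sum :: "nat \<Rightarrow> (nat \<Rightarrow> real) list \<Rightarrow> nat \<Rightarrow> real" where
  "scaled_sum a fs = (\<lambda>i. 1 / real a * (\<Sum>f\<leftarrow>fs. f i))"

definition set_less :: "nat set \<Rightarrow> nat set \<Rightarrow> bool" where
  "set_less E F \<longleftrightarrow> (\<forall>a\<in>E. \<forall>b\<in>F. a < b)"

text \<open>The sets \<open>A\<^sub>i\<close> may be empty, so $k \le A_1 < \dots < A_k$ has to be read as: the \<open>A\<^sub>i\<close> are
  pairwise ordered and \<open>k\<close> bounds all of them from below. For nonempty \<open>A\<^sub>i\<close> this is the literal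
  chain of inequalities, and empty \<open>A\<^sub>i\<close> then contribute no further sets.\<close>

primrec schreier :: "nat \<Rightarrow> nat set set" where
  "schreier 0 = {{}} \<union> {{n} |n. 1 \<le> n}"
| "schreier (Suc n) = {{}} \<union> {\<Union>(set As) |As. As \<noteq> [] \<and> set As \<subseteq> schreier n \<and>
     sorted_wrt set_less As \<and> (\<forall>a\<in>\<Union>(set As). length As \<le> a)}"

definition admissible :: "nat set set \<Rightarrow> nat set list \<Rightarrow> bool" where
  "admissible M Es \<longleftrightarrow> (\<forall>E\<in>set Es. finite E \<and> E \<noteq> {}) \<and> sorted_wrt set_less Es \<and>
     Min ` set Es \<in> M"

text \<open>The condition for index 1: $d \le \min E_1 < \dots < \min E_d$ with pairwise disjoint \<open>E\<^sub>i\<close>.\<close>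

definition disjoint_admissible :: "nat set list \<Rightarrow> bool" where
  "disjoint_admissible Es \<longleftrightarrow> (\<forall>E\<in>set Es. finite E \<and> E \<noteq> {}) \<and>
     length Es \<le> Min (hd Es) \<and> sorted_wrt (\<lambda>E F. Min E < Min F \<and> E \<inter> F = {}) Es"

text \<open>\<open>K_stage m k n j\<close> is $K_j^n$ and \<open>L_stage m k \<Phi> n j\<close> is $L_j^n$. Only indices \<open>j \<ge> 1\<close> are
  meaningful; the value at \<open>j = 0\<close> is never used. The function \<open>\<Phi>\<close> is only constrained on
  \<open>G_set m k\<close>.\<close>

primrec K_stage :: "(nat \<Rightarrow> nat) \<Rightarrow> (nat \<Rightarrow> nat) \<Rightarrow> nat \<Rightarrow> nat \<Rightarrow> (nat \<Rightarrow> real) set" where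
  "K_stage m k 0 = (\<lambda>j. signed_units)"
| "K_stage m k (Suc n) = (\<lambda>j. K_stage m k n j \<union>
     (if j = 1
      then {scaled_sum 2 fs |fs. fs \<noteq> [] \<and> set fs \<subseteq> (\<Union>i\<in>{1..}. K_stage m k n i) \<and>
              disjoint_admissible (map supp fs)}
      else {scaled_sum (m j) fs |fs. fs \<noteq> [] \<and> set fs \<subseteq> (\<Union>i\<in>{1..}. K_stage m k n i) \<and>
              admissible (schreier (k j)) (map supp fs)}))"

definition K_set :: "(nat \<Rightarrow> nat) \<Rightarrow> (nat \<Rightarrow> nat) \<Rightarrow> (nat \<Rightarrow> real) set" where
  "K_set m k = (\<Union>n. \<Union>j\<in>{1..}. K_stage m k n j)"

definition A_set :: "(nat \<Rightarrow> nat) \<Rightarrow> (nat \<Rightarrow> nat) \<Rightarrow> nat \<Rightarrow> (nat \<Rightarrow> real) set" where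
  "A_set m k j = (\<Union>n\<in>{1..}. K_stage m k n j - signed_units)"

definition G_set :: "(nat \<Rightarrow> nat) \<Rightarrow> (nat \<Rightarrow> nat) \<Rightarrow> (nat \<Rightarrow> real) list set" where
  "G_set m k = {xs. xs \<noteq> [] \<and> set xs \<subseteq> K_set m k \<and> sorted_wrt (\<lambda>x y. set_less (supp x) (supp y)) xs}"

text \<open>In the last conjunct \<open>j\<close> plays the role of \<open>j\<^sub>1\<close>; if \<open>x\<^sub>1\<close> lies in no \<open>A_set m k j\<close>, nothing is
  required of it. The values \<open>\<Phi> (take l xs)\<close> are the indices $j_{l+1}$.\<close>

definition coding_function :: "(nat \<Rightarrow> nat) \<Rightarrow> (nat \<Rightarrow> nat) \<Rightarrow> ((nat \<Rightarrow> real) list \<Rightarrow> nat) \<Rightarrow> bool" where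
  "coding_function m k \<Phi> \<longleftrightarrow>
     inj_on \<Phi> (G_set m k) \<and> \<Phi> ` G_set m k \<subseteq> {2 * j |j. 1 \<le> j} \<and>
     (\<forall>xs\<in>G_set m k.
        (\<forall>l. 1 \<le> l \<and> l < length xs \<longrightarrow> \<Phi> (take l xs) < \<Phi> xs) \<and>
        (\<forall>j. 1 \<le> j \<and> hd xs \<in> A_set m k j \<and> (\<forall>i. 1 \<le> i \<and> i < j \<longrightarrow> hd xs \<notin> A_set m k i)
             \<longrightarrow> j < \<Phi> xs))"

primrec L_stage :: "(nat \<Rightarrow> nat) \<Rightarrow> (nat \<Rightarrow> nat) \<Rightarrow> ((nat \<Rightarrow> real) list \<Rightarrow> nat) \<Rightarrow>
    nat \<Rightarrow> nat \<Rightarrow> (nat \<Rightarrow> real) set" where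
  "L_stage m k \<Phi> 0 = (\<lambda>j. signed_units)"
| "L_stage m k \<Phi> (Suc n) = (\<lambda>j.
     if j = 1 then
       pm (L_stage m k \<Phi> n j) \<union>
       {scaled_sum 2 fs |fs. fs \<noteq> [] \<and> set fs \<subseteq> (\<Union>i\<in>{1..}. L_stage m k \<Phi> n i) \<and>
          disjoint_admissible (map supp fs)}
     else if even j then
       pm (L_stage m k \<Phi> n j) \<union>
       {scaled_sum (m j) fs |fs. fs \<noteq> [] \<and> set fs \<subseteq> (\<Union>i\<in>{1..}. L_stage m k \<Phi> n i) \<and>
          admissible (schreier (k j)) (map supp fs)}
     else
       {tail_restrict s x |s x. 1 \<le> s \<and> x \<in>
          pm (L_stage m k \<Phi> n j) \<union>
          {scaled_sum (m j) fs |fs. fs \<noteq> [] \<and> (\<exists>r>j. hd fs \<in> L_stage m k \<Phi> n (2 * r)) \<and>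
             (\<forall>i. 1 \<le> i \<and> i < length fs \<longrightarrow> fs ! i \<in> L_stage m k \<Phi> n (\<Phi> (take i fs))) \<and>
             admissible (schreier (k j)) (map supp fs)}})"

definition B_set :: "(nat \<Rightarrow> nat) \<Rightarrow> (nat \<Rightarrow> nat) \<Rightarrow> ((nat \<Rightarrow> real) list \<Rightarrow> nat) \<Rightarrow>
    nat \<Rightarrow> (nat \<Rightarrow> real) set" where
  "B_set m k \<Phi> j = (\<Union>n\<in>{1..}. L_stage m k \<Phi> n j - signed_units)"

definition L_set :: "(nat \<Rightarrow> nat) \<Rightarrow> (nat \<Rightarrow> nat) \<Rightarrow> ((nat \<Rightarrow> real) list \<Rightarrow> nat) \<Rightarrow>
    (nat \<Rightarrow> real) set" where
  "L_set m k \<Phi> = signed_units \<union> (\<Union>j\<in>{1..}. B_set m k \<Phi> j)"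

definition norm_by :: "(nat \<Rightarrow> real) set \<Rightarrow> (nat \<Rightarrow> real) \<Rightarrow> real" where
  "norm_by D x = (SUP f\<in>D. \<Sum>i\<in>supp x. f i * x i)"

text \<open>The closed subspace \<open>X\<close> of a Banach space, with embedding \<open>\<iota>\<close>, is a completion of \<open>c00\<close>
  under the norm \<open>N\<close>.\<close>

definition is_completion :: "((nat \<Rightarrow> real) \<Rightarrow> real) \<Rightarrow> ((nat \<Rightarrow> real) \<Rightarrow> 'b::banach) \<Rightarrow> 'b set \<Rightarrow> bool"
  where "is_completion N \<iota> X \<longleftrightarrow>
     (\<forall>x\<in>c00. \<forall>y\<in>c00. \<forall>a b. \<iota> (\<lambda>i. a * x i + b * y i) = a *\<^sub>R \<iota> x + b *\<^sub>R \<iota> y) \<and>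
     (\<forall>x\<in>c00. norm (\<iota> x) = N x) \<and> X = closure (\<iota> ` c00)"

definition infinite_dimensional :: "'b::real_vector set \<Rightarrow> bool" where
  "infinite_dimensional S \<longleftrightarrow> \<not> (\<exists>B. finite B \<and> S \<subseteq> span B)"

text \<open>Addition is a homeomorphism of $Y \times Z$ onto \<open>W\<close>. In particular it is bijective, so \<open>W\<close> is
  the algebraic direct sum of \<open>Y\<close> and \<open>Z\<close>; continuity of the inverse is that of the projections.\<close>

definition topological_direct_sum :: "'b::real_normed_vector set \<Rightarrow> 'b set \<Rightarrow> 'b set \<Rightarrow> bool" where
  "topological_direct_sum W Y Z \<longleftrightarrow> subspace W \<and> subspace Y \<and> subspace Z \<and>
     (\<exists>g. homeomorphism (Y \<times> Z) W (\<lambda>(y, z). y + z) g)"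

definition hereditarily_indecomposable :: "'b::real_normed_vector set \<Rightarrow> bool" where
  "hereditarily_indecomposable X \<longleftrightarrow>
     \<not> (\<exists>W Y Z. W \<subseteq> X \<and> closed W \<and> closed Y \<and> closed Z \<and>
          infinite_dimensional Y \<and> infinite_dimensional Z \<and> topological_direct_sum W Y Z)"

end

theory Submission
  imports Defs
begin

text \<open>In any two infinite dimensional subspaces one finds vectors $x_0, x_1, \ldots$, taken from the two
  subspaces alternately, and functionals $x_l^* \in L$ with $x_l^*(x_l) = 1$, such that the weight of
  $x_{l+1}^*$ is the code of $(x_0^*, \ldots, x_l^*)$. For an average with small nonincreasing coefficients
  $a_l$ and an odd index $j$, the functional $m_j^{-1} \sum_l x_l^*$ shows that
  $\|\sum_l a_l x_l\| \ge 1/m_j$. In $\sum_l (-1)^l a_l x_l$, on the other hand, a functional of weight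
  $m_j$ sees an alternating sum of a monotone sequence as long as its code agrees with that of the
  dependent sequence, and because $\Phi$ is injective it has the wrong weights afterwards. This makes the
  alternating sum arbitrarily small compared to $1/m_j$, so the sum of the two subspaces is not direct
  with bounded projections.\<close>

text \<open>Every upper estimate is reduced to counting starting points. If a vector lives on
  \<open>{d l..<d (Suc l)}\<close>, the members of a disjoint family that start before
  \<open>d l\<close> number at most \<open>d l\<close>, so the index 1 operation bounds their joint
  action by twice the norm, however their supports interlace. Only members starting inside the block
  escape, and an average that is small on the set of all starting points hardly sees such blocks.
  The obstacle is to keep the complexity of that set bounded. A functional is unfolded along its
  tree until the coefficient is small or an index \<open>J\<close> or larger is met; each level
  costs \<open>k (J - 1)\<close>. About \<open>log2 (m J)\<close> halvings bring a coefficient below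
  \<open>1 / m J\<close>, and since \<open>2 ^ t J\<close> dominates the square of
  \<open>m J\<close>, this uses only about half of the \<open>t J\<close> levels that fit below
  \<open>k J\<close>. The spare half pays for passing to children and for a second unfolding by
  \<open>p\<close> levels. The parameter \<open>p\<close> is fixed first, from the ratio wanted in
  the end, and \<open>J0\<close> afterwards with \<open>2 ^ (2 * p + 2) \<le> m J0\<close>; the
  final error \<open>2400 / (m J0 * 2 ^ p)\<close> is then small against
  \<open>1 / m J0\<close>.\<close>

subsection \<open>Schreier families and averages\<close>

text \<open>In contrast to \<open>schreier\<close>, the pieces need not be successive. This accommodates functionals whose
  supports are disjoint but interlaced, which the index \<open>1\<close> operation produces.\<close>

primrec wide :: "nat \<Rightarrow> nat set set" where
  "wide 0 = {G. 0 \<notin> G \<and> (\<exists>x. G \<subseteq> {x})}"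
| "wide (Suc n) = {G. 0 \<notin> G \<and> (\<exists>q Gs. G = (\<Union>p<q. Gs p) \<and> (\<forall>p<q. Gs p \<in> wide n) \<and> (\<forall>x\<in>G. q \<le> x))}"

lemma wide_pos: "G \<in> wide n \<Longrightarrow> 0 \<notin> G"
  by (cases n) auto

lemma wide_Suc: assumes "G \<in> wide n" shows "G \<in> wide (Suc n)"
proof -
  have "G = (\<Union>p<(1::nat). (\<lambda>_. G) p)" "\<forall>p<(1::nat). (\<lambda>_. G) p \<in> wide n" "\<forall>x\<in>G. 1 \<le> x"
    using assms wide_pos[OF assms] by (auto simp: Suc_le_eq intro: gr0I)
  then show ?thesis using wide_pos[OF assms]
    unfolding wide.simps mem_Collect_eq by (intro conjI exI[of _ 1] exI[of _ "\<lambda>_. G"]) auto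
qed

lemma wide_mono: assumes "a \<le> b" "G \<in> wide a" shows "G \<in> wide b"
  using assms by (induction b rule: dec_induct) (auto simp del: wide.simps intro: wide_Suc)

lemma wide_subset: "G \<in> wide n \<Longrightarrow> G' \<subseteq> G \<Longrightarrow> G' \<in> wide n"
proof (induction n arbitrary: G G')
  case 0 then show ?case by auto
next
  case (Suc n)
  then obtain q Gs where q: "G = (\<Union>p<q. Gs p)" "\<forall>p<q. Gs p \<in> wide n" "\<forall>x\<in>G. q \<le> x" "0 \<notin> G"
    by auto
  have "\<forall>p<q. Gs p \<inter> G' \<in> wide n" using q(2) Suc.IH by blast
  moreover have "G' = (\<Union>p<q. Gs p \<inter> G')" using q(1) Suc.prems by auto
  ultimately show ?case using q Suc.prems
    by (simp, intro conjI exI[of _ q] exI[of _ "\<lambda>p. Gs p \<inter> G'"]) auto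
qed

lemma wide_empty [simp]: "{} \<in> wide n"
  using wide_subset wide_mono[of 0 n "{}"] by auto

text \<open>Spreading to the right. The points are labelled by \<open>f\<close>, so the pieces can
  be pulled back to \<open>A\<close> and pushed forward along \<open>g\<close>. Injectivity is asked
  of \<open>f\<close> only: two points may be moved to the same place.\<close>

lemma wide_image_ge:
  assumes "f ` A \<in> wide n" "inj_on f A" "\<And>x. x \<in> A \<Longrightarrow> f x \<le> g x"
  shows "g ` A \<in> wide n"
  using assms
proof (induction n arbitrary: A)
  case 0
  then obtain c where c: "f ` A \<subseteq> {c}" "0 \<notin> f ` A" by auto
  show ?case
  proof (cases "A = {}")
    case False
    then obtain x where x: "x \<in> A" by auto
    have "A \<subseteq> {x}" using c(1) x 0(2) unfolding inj_on_def by blast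
    moreover have "0 < g x" using 0(3)[OF x] c(2) x by (metis gr0I image_eqI le_zero_eq)
    ultimately show ?thesis using x by auto
  qed auto
next
  case (Suc n)
  then obtain q Gs where q: "f ` A = (\<Union>p<q. Gs p)" "\<forall>p<q. Gs p \<in> wide n"
    "\<forall>x\<in>f ` A. q \<le> x" "0 \<notin> f ` A"
    unfolding wide.simps mem_Collect_eq by blast
  let ?A = "\<lambda>p. {x\<in>A. f x \<in> Gs p}"
  have "g ` ?A p \<in> wide n" if "p < q" for p
  proof (rule Suc.IH)
    show "f ` ?A p \<in> wide n" using q(2) that by (blast intro: wide_subset)
    show "inj_on f (?A p)" using Suc.prems(2) by (rule inj_on_subset) auto
    show "\<And>x. x \<in> ?A p \<Longrightarrow> f x \<le> g x" using Suc.prems(3) by auto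
  qed
  moreover have "g ` A = (\<Union>p<q. g ` ?A p)" using q(1) by blast
  moreover have "\<forall>x\<in>g ` A. q \<le> x" using q(3) Suc.prems(3) by (auto intro: order_trans)
  moreover have "0 \<notin> g ` A" using q(4) Suc.prems(3) by (auto) (metis imageI le_zero_eq)
  ultimately show ?case by (simp, intro conjI exI[of _ q] exI[of _ "\<lambda>p. g ` ?A p"]) auto
qed

lemma wide_Suc_UN:
  assumes "finite I" "card I \<le> q" "\<And>i. i \<in> I \<Longrightarrow> G i \<in> wide n"
    "\<And>i x. i \<in> I \<Longrightarrow> x \<in> G i \<Longrightarrow> q \<le> x"
  shows "(\<Union>i\<in>I. G i) \<in> wide (Suc n)"
proof -
  obtain h where h: "bij_betw h {..<card I} I"
    using assms(1) ex_bij_betw_nat_finite[of I] by (auto simp: atLeast0LessThan)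
  have "(\<Union>i\<in>I. G i) = (\<Union>p<card I. G (h p))"
    using h by (force simp: bij_betw_def)
  moreover have "\<forall>p<card I. G (h p) \<in> wide n"
    using h assms(3) by (auto simp: bij_betw_def)
  moreover have "\<forall>x\<in>(\<Union>i\<in>I. G i). card I \<le> x" using assms(2,4) by fastforce
  moreover have "0 \<notin> (\<Union>i\<in>I. G i)" using assms(3) wide_pos by auto
  ultimately show ?thesis by (simp, intro conjI exI[of _ "card I"] exI[of _ "\<lambda>p. G (h p)"]) auto
qed

lemma wide_1: assumes "finite A" "card A \<le> q" "\<And>x. x \<in> A \<Longrightarrow> q \<le> x"
  shows "A \<in> wide 1"
proof -
  have "0 \<notin> A" using assms by (metis card_0_eq empty_iff le_zero_eq)
  then have "(\<Union>i\<in>A. {i}) \<in> wide (Suc 0)"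
    using assms by (intro wide_Suc_UN[of _ q]) (auto intro: gr0I)
  then show ?thesis by simp
qed

text \<open>Levels add up: a lower bound \<open>q\<close> for the labels passes to the sets
  \<open>G x\<close>, which begin at their labels or later. In this way the starting points of all
  children inherit the level of their parents plus that of one family of children.\<close>

lemma wide_bind:
  assumes "f ` A \<in> wide a" "inj_on f A"
    "\<And>x. x \<in> A \<Longrightarrow> G x \<in> wide b" "\<And>x y. x \<in> A \<Longrightarrow> y \<in> G x \<Longrightarrow> f x \<le> y"
  shows "(\<Union>x\<in>A. G x) \<in> wide (a + b)"
  using assms
proof (induction a arbitrary: A)
  case 0
  then obtain c where c: "f ` A \<subseteq> {c}" by auto
  show ?case
  proof (cases "A = {}")
    case False
    then obtain x where x: "x \<in> A" by auto
    have "A \<subseteq> {x}" using c(1) x 0(2) unfolding inj_on_def by blast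
    then have "A = {x}" using x by auto
    then show ?thesis using 0 by (simp)
  qed auto
next
  case (Suc n)
  then obtain q Gs where q: "f ` A = (\<Union>p<q. Gs p)" "\<forall>p<q. Gs p \<in> wide n"
    "\<forall>x\<in>f ` A. q \<le> x" "0 \<notin> f ` A"
    unfolding wide.simps mem_Collect_eq by blast
  let ?A = "\<lambda>p. {x\<in>A. f x \<in> Gs p}"
  have "(\<Union>x\<in>?A p. G x) \<in> wide (n + b)" if "p < q" for p
  proof (rule Suc.IH)
    show "f ` ?A p \<in> wide n" using q(2) that by (blast intro: wide_subset)
    show "inj_on f (?A p)" using Suc.prems(2) by (rule inj_on_subset) auto
  qed (use Suc.prems in auto)
  then have "(\<Union>p\<in>{..<q}. (\<Union>x\<in>?A p. G x)) \<in> wide (Suc (n + b))"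
    by (intro wide_Suc_UN[of _ q]) (use q(3) Suc.prems(4) in \<open>auto intro: order_trans\<close>)
  moreover have "(\<Union>x\<in>A. G x) = (\<Union>p\<in>{..<q}. (\<Union>x\<in>?A p. G x))" using q(1) by blast
  ultimately show ?case by (simp del: wide.simps)
qed

section \<open>Schreier families: heredity, spreading and convolution\<close>

lemma schreier_pos: "A \<in> schreier n \<Longrightarrow> 0 \<notin> A"
proof (induction n arbitrary: A)
  case (Suc n) then show ?case by (auto simp: subset_iff)
qed auto

lemma schreier_Suc: assumes "A \<in> schreier n" shows "A \<in> schreier (Suc n)"
proof -
  have "\<exists>As. A = \<Union>(set As) \<and> As \<noteq> [] \<and> set As \<subseteq> schreier n \<and>
     sorted_wrt set_less As \<and> (\<forall>a\<in>\<Union>(set As). length As \<le> a)"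
    using assms schreier_pos[OF assms] by (intro exI[of _ "[A]"]) (auto simp: Suc_le_eq intro: gr0I)
  then show ?thesis unfolding schreier.simps by blast
qed

lemma schreier_mono: assumes "a \<le> b" "G \<in> schreier a" shows "G \<in> schreier b"
  using assms by (induction b rule: dec_induct) (auto simp del: schreier.simps intro: schreier_Suc)

lemma schreier_SucI:
  assumes "set As \<subseteq> schreier n" "sorted_wrt set_less As" "\<And>a. a \<in> \<Union>(set As) \<Longrightarrow> length As \<le> a"
  shows "\<Union>(set As) \<in> schreier (Suc n)"
  proof (cases "As = []")
  case False
  then show ?thesis unfolding schreier.simps using assms by blast
qed auto

lemma schreier_SucE:
  assumes "A \<in> schreier (Suc n)"
  obtains As where "A = \<Union>(set As)" "set As \<subseteq> schreier n" "sorted_wrt set_less As"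
    "\<And>a. a \<in> A \<Longrightarrow> length As \<le> a"
proof (cases "A = {}")
  case True
  then show ?thesis using that[of "[]"] by auto
next
  case False
  then show ?thesis using assms that by auto
qed

lemma schreier_subset: "G \<in> schreier n \<Longrightarrow> G' \<subseteq> G \<Longrightarrow> G' \<in> schreier n"
proof (induction n arbitrary: G G')
  case 0 then show ?case by auto
next
  case (Suc n)
  from Suc.prems(1) obtain As where As: "G = \<Union>(set As)" "set As \<subseteq> schreier n"
    "sorted_wrt set_less As" "\<And>a. a \<in> G \<Longrightarrow> length As \<le> a" by (rule schreier_SucE) blast
  have "\<Union>(set (map (\<lambda>E. E \<inter> G') As)) \<in> schreier (Suc n)"
  proof (rule schreier_SucI)
    show "set (map (\<lambda>E. E \<inter> G') As) \<subseteq> schreier n" using As(2) Suc.IH by fastforce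
    show "sorted_wrt set_less (map (\<lambda>E. E \<inter> G') As)" using As(3)
      unfolding sorted_wrt_map by (rule sorted_wrt_mono_rel[rotated]) (auto simp: set_less_def)
  qed (use As Suc.prems in auto)
  moreover have "\<Union>(set (map (\<lambda>E. E \<inter> G') As)) = G'" using As(1) Suc.prems by auto
  ultimately show ?case by (simp only:)
qed

text \<open>In contrast to \<open>wide_image_ge\<close>, the map has to respect the order, because
  the pieces must remain successive.\<close>

lemma schreier_image_ge:
  assumes "f ` A \<in> schreier n" "inj_on f A" "\<And>x. x \<in> A \<Longrightarrow> f x \<le> g x"
    "\<And>x y. x \<in> A \<Longrightarrow> y \<in> A \<Longrightarrow> f x < f y \<Longrightarrow> g x < g y"
  shows "g ` A \<in> schreier n"
  using assms
proof (induction n arbitrary: A)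
  case 0
  show ?case
  proof (cases "A = {}")
    case False
    then obtain c where c: "f ` A = {c}" "c \<ge> 1" using 0 by auto
    then obtain x where x: "x \<in> A" by auto
    have "A = {x}" using c(1) x 0(2) unfolding inj_on_def by blast
    then show ?thesis using 0(3)[OF x] c x by auto
  qed auto
next
  case (Suc n)
  from Suc.prems(1) obtain As where As: "f ` A = \<Union>(set As)" "set As \<subseteq> schreier n"
    "sorted_wrt set_less As" "\<And>a. a \<in> f ` A \<Longrightarrow> length As \<le> a" by (rule schreier_SucE) blast
  let ?h = "\<lambda>E. g ` {x\<in>A. f x \<in> E}"
  have "\<Union>(set (map ?h As)) \<in> schreier (Suc n)"
  proof (rule schreier_SucI)
    show "set (map ?h As) \<subseteq> schreier n"
    proof
      fix B assume "B \<in> set (map ?h As)"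
      then obtain E where E: "E \<in> set As" "B = ?h E" by auto
      have "f ` {x\<in>A. f x \<in> E} \<subseteq> E" by auto
      then have "f ` {x\<in>A. f x \<in> E} \<in> schreier n" using E As(2) schreier_subset by blast
      then show "B \<in> schreier n" unfolding E(2)
        by (rule Suc.IH) (use Suc.prems in \<open>auto intro: inj_on_subset\<close>)
    qed
    show "sorted_wrt set_less (map ?h As)" using As(3)
      unfolding sorted_wrt_map by (rule sorted_wrt_mono_rel[rotated])
        (use Suc.prems(4) in \<open>auto simp: set_less_def\<close>)
    fix a assume "a \<in> \<Union>(set (map ?h As))"
    then obtain x where "x \<in> A" "a = g x" by auto
    then show "length (map ?h As) \<le> a" using As(4) Suc.prems(3) by (auto intro: order_trans)
  qed
  moreover have "\<Union>(set (map ?h As)) = g ` A" using As(1) by auto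
  ultimately show ?case by (simp only:)
qed

text \<open>The convolution property of Schreier families. Each set is attached to a point
  \<open>p\<close> below it; in the application \<open>p\<close> is the smallest starting point in a
  block of functionals.\<close>

lemma schreier_bind:
  assumes "P \<in> schreier a" "\<And>p. p \<in> P \<Longrightarrow> A p \<in> schreier b" "\<And>p x. p \<in> P \<Longrightarrow> x \<in> A p \<Longrightarrow> p \<le> x"
    "\<And>p p'. p \<in> P \<Longrightarrow> p' \<in> P \<Longrightarrow> p < p' \<Longrightarrow> set_less (A p) (A p')"
  shows "(\<Union>p\<in>P. A p) \<in> schreier (a + b)"
  using assms
proof (induction a arbitrary: P)
  case 0
  then have "P = {} \<or> (\<exists>p. P = {p})" by auto
  then show ?case
  proof
    assume "P = {}"
    then show ?thesis by (auto intro: schreier_mono[of 0])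
  next
    assume "\<exists>p. P = {p}"
    then show ?thesis using 0 by auto
  qed
next
  case (Suc n)
  from Suc.prems(1) obtain As where As: "P = \<Union>(set As)" "set As \<subseteq> schreier n"
    "sorted_wrt set_less As" "\<And>a. a \<in> P \<Longrightarrow> length As \<le> a" by (rule schreier_SucE) blast
  let ?h = "\<lambda>E. \<Union>p\<in>E. A p"
  have "\<Union>(set (map ?h As)) \<in> schreier (Suc (n + b))"
  proof (rule schreier_SucI)
    show "set (map ?h As) \<subseteq> schreier (n + b)"
    proof
      fix B assume "B \<in> set (map ?h As)"
      then obtain E where E: "E \<in> set As" "B = ?h E" by auto
      then have "E \<subseteq> P" "E \<in> schreier n" using As by auto
      then show "B \<in> schreier (n + b)" unfolding E(2)
        by (intro Suc.IH) (use Suc.prems in \<open>blast+\<close>)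
    qed
    show "sorted_wrt set_less (map ?h As)" using As(3)
      unfolding sorted_wrt_map
      by (rule sorted_wrt_mono_rel[rotated])
        (use Suc.prems(4) As(1) in \<open>auto simp: set_less_def\<close>, meson UnionI)
    fix a assume "a \<in> \<Union>(set (map ?h As))"
    then show "length (map ?h As) \<le> a" using As(1,4) Suc.prems(3) by (force intro: order_trans)
  qed
  moreover have "\<Union>(set (map ?h As)) = ?h P" using As(1) by auto
  ultimately show ?case unfolding add_Suc by (simp only:)
qed

lemma schreier_subset_wide: "schreier n \<subseteq> wide n"
proof (induction n)
  case (Suc n)
  show ?case
  proof
    fix A assume A: "A \<in> schreier (Suc n)"
    then obtain As where As: "A = \<Union>(set As)" "set As \<subseteq> schreier n" "sorted_wrt set_less As"
      "\<And>a. a \<in> A \<Longrightarrow> length As \<le> a" by (rule schreier_SucE) blast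
    have "(\<Union>i\<in>{..<length As}. As ! i) \<in> wide (Suc n)"
    proof (rule wide_Suc_UN[of _ "length As"])
      fix i x assume i: "i \<in> {..<length As}"
      then have "As ! i \<in> set As" by simp
      then show "As ! i \<in> wide n" using As(2) Suc by blast
      show "length As \<le> x" if "x \<in> As ! i" using that \<open>As ! i \<in> set As\<close> As(1,4) by blast
    qed auto
    moreover have "(\<Union>i\<in>{..<length As}. As ! i) = A" unfolding As(1)
      by (auto simp: set_conv_nth)
    ultimately show "A \<in> wide (Suc n)" by (simp only:)
  qed
qed auto

text \<open>Vectors will live on the intervals \<open>{d k..<d (Suc k)}\<close>, so a set of
  starting points matters only through the intervals that it meets; several points in one interval
  count once.\<close>

definition hit_mass :: "(nat \<Rightarrow> nat) \<Rightarrow> (nat \<Rightarrow> real) \<Rightarrow> nat \<Rightarrow> nat \<Rightarrow> nat set \<Rightarrow> real" where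
  "hit_mass d a k0 k1 G = (\<Sum>k\<in>{k0..<k1}. if G \<inter> {d k..<d (Suc k)} = {} then 0 else a k)"

lemma hit_mass_mono:
  assumes "\<And>k. 0 \<le> a k" "G \<subseteq> G'" shows "hit_mass d a k0 k1 G \<le> hit_mass d a k0 k1 G'"
  unfolding hit_mass_def using assms by (intro sum_mono) auto

lemma hit_mass_UN:
  assumes "\<And>k. 0 \<le> a k"
  shows "hit_mass d a k0 k1 (\<Union>i<(q::nat). Gs i) \<le> (\<Sum>i<q. hit_mass d a k0 k1 (Gs i))"
proof (induction q)
  case 0 then show ?case by (simp add: hit_mass_def)
next
  case (Suc q)
  have "hit_mass d a k0 k1 (\<Union>i<Suc q. Gs i) \<le> hit_mass d a k0 k1 (\<Union>i<q. Gs i) + hit_mass d a k0 k1 (Gs q)"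
    unfolding hit_mass_def sum.distrib[symmetric] using assms
    by (intro sum_mono) (auto simp: lessThan_Suc Int_Un_distrib2)
  then show ?case using Suc by simp
qed

lemma hit_mass_le_sum:
  assumes "\<And>k. 0 \<le> a k" shows "hit_mass d a k0 k1 G \<le> sum a {k0..<k1}"
  unfolding hit_mass_def using assms by (intro sum_mono) auto

lemma growth_mono:
  fixes d :: "nat \<Rightarrow> nat"
  assumes "\<And>k. 2 * d k \<le> d (Suc k)" "i \<le> j" shows "d i \<le> d j"
  using assms(2) by (induction j rule: dec_induct) (use assms(1) in \<open>auto intro: order_trans[rotated]\<close>, metis add_leD1 le_trans mult_2)

lemma growth_disjoint:
  fixes d :: "nat \<Rightarrow> nat"
  assumes "\<And>k. 2 * d k \<le> d (Suc k)" "x \<in> {d i..<d (Suc i)}" "x \<in> {d j..<d (Suc j)}" shows "i = j"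
proof (rule ccontr)
  assume "i \<noteq> j"
  then consider "Suc i \<le> j" | "Suc j \<le> i" by linarith
  then show False
  proof cases
    case 1 then have "d (Suc i) \<le> d j" using assms(1) growth_mono by blast
    then show False using assms by auto
  next
    case 2 then have "d (Suc j) \<le> d i" using assms(1) growth_mono by blast
    then show False using assms by auto
  qed
qed

text \<open>Averages run over intervals of indices, not over arbitrary sets, because in a dependent sequence
  the code depends on all previous terms.\<close>

definition averages ::
  "(nat \<Rightarrow> nat) \<Rightarrow> (nat \<Rightarrow> nat) \<Rightarrow> nat \<Rightarrow> nat \<Rightarrow> nat \<Rightarrow> nat \<Rightarrow> (nat \<Rightarrow> real) \<Rightarrow> bool" where
  "averages d p n M k0 k1 b \<longleftrightarrow> k0 < k1 \<and> (\<forall>k. 0 \<le> b k) \<and> sum b {k0..<k1} = real M \<and>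
     (\<exists>As. length As = M \<and> set As \<subseteq> schreier n \<and> sorted_wrt set_less As \<and> \<Union>(set As) = p ` {k0..<k1}) \<and>
     (\<forall>k\<in>{k0..<k1}. 1 / real (d k1) ^ n \<le> b k \<and> b k \<le> 1 / real (d k0) ^ n) \<and>
     (\<forall>k\<in>{k0..<k1}. \<forall>k'\<in>{k0..<k1}. k \<le> k' \<longrightarrow> b k' \<le> b k)"

text \<open>Monotonicity across the seam \<open>k1\<close> holds because \<open>1 / d k1 ^ n\<close>
  bounds the first coefficients from below and the second ones from above. The two-sided bounds in
  \<open>averages\<close> are carried for this purpose.\<close>

lemma averages_append:
  assumes a: "averages d p n 1 k0 k1 a" and b: "averages d p n M k1 k2 b"
    and d: "\<And>k. 1 \<le> d k" "\<And>k. 2 * d k \<le> d (Suc k)" and p: "\<And>k. p k \<in> {d k..<d (Suc k)}"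
  shows "averages d p n (Suc M) k0 k2 (\<lambda>k. if k < k1 then a k else b k)" (is "averages _ _ _ _ _ _ ?c")
proof -
  have k: "k0 < k1" "k1 < k2" using a b by (auto simp: averages_def)
  have un: "{k0..<k2} = {k0..<k1} \<union> {k1..<k2}" using k by auto
  have dm: "d i \<le> d j" if "i \<le> j" for i j using growth_mono[of d, OF d(2)] that .
  obtain As where As: "length As = 1" "set As \<subseteq> schreier n" "sorted_wrt set_less As" "\<Union>(set As) = p ` {k0..<k1}"
    using a by (auto simp: averages_def)
  obtain Bs where Bs: "length Bs = M" "set Bs \<subseteq> schreier n" "sorted_wrt set_less Bs" "\<Union>(set Bs) = p ` {k1..<k2}"
    using b by (auto simp: averages_def)
  have pl: "p i < p j" if "i < j" for i j
  proof -
    have "d (Suc i) \<le> d j" using dm that by simp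
    then show ?thesis using p[of i] p[of j] by auto
  qed
  have "set_less A B" if "A \<in> set As" "B \<in> set Bs" for A B
    unfolding set_less_def
  proof (intro ballI)
    fix x y assume "x \<in> A" "y \<in> B"
    then have "x \<in> p ` {k0..<k1}" "y \<in> p ` {k1..<k2}" using As(4) Bs(4) that by blast+
    then show "x < y" using pl by force
  qed
  then have "sorted_wrt set_less (As @ Bs)" using As Bs by (auto simp: sorted_wrt_append)
  moreover have "\<Union>(set (As @ Bs)) = p ` {k0..<k2}" using As(4) Bs(4) by (auto simp: un image_Un)
  ultimately have list: "\<exists>As. length As = Suc M \<and> set As \<subseteq> schreier n \<and> sorted_wrt set_less As \<and> \<Union>(set As) = p ` {k0..<k2}"
    using As Bs by (intro exI[of _ "As @ Bs"]) auto
  have s: "sum ?c {k0..<k2} = real (Suc M)"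
  proof -
    have "sum ?c {k0..<k2} = sum ?c {k0..<k1} + sum ?c {k1..<k2}"
      using k by (intro sum.atLeastLessThan_concat[symmetric]) auto
    moreover have "sum ?c {k0..<k1} = sum a {k0..<k1}" by (rule sum.cong) auto
    moreover have "sum ?c {k1..<k2} = sum b {k1..<k2}" by (rule sum.cong) auto
    ultimately show ?thesis using a b by (auto simp: averages_def)
  qed
  have inv: "1 / real (d j) ^ n \<le> 1 / real (d i) ^ n" if "i \<le> j" for i j
    using dm[OF that] d(1)[of i] by (intro divide_left_mono power_mono mult_pos_pos zero_less_power) auto
  have lo: "1 / real (d k1) ^ n \<le> a k" "a k \<le> 1 / real (d k0) ^ n" if "k \<in> {k0..<k1}" for k
    using a that by (auto simp: averages_def)
  have hi: "1 / real (d k2) ^ n \<le> b k" "b k \<le> 1 / real (d k1) ^ n" if "k \<in> {k1..<k2}" for k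
    using b that by (auto simp: averages_def)
  have bd: "1 / real (d k2) ^ n \<le> ?c k \<and> ?c k \<le> 1 / real (d k0) ^ n" if "k \<in> {k0..<k2}" for k
  proof (cases "k < k1")
    case True
    then have "k \<in> {k0..<k1}" using that by auto
    then show ?thesis using lo[of k] inv[of k1 k2] True k by auto
  next
    case False
    then have "k \<in> {k1..<k2}" using that by auto
    then show ?thesis using hi[of k] inv[of k0 k1] False k by auto
  qed
  have mo: "?c k' \<le> ?c k" if "k \<in> {k0..<k2}" "k' \<in> {k0..<k2}" "k \<le> k'" for k k'
  proof -
    consider "k' < k1" | "k < k1" "k1 \<le> k'" | "k1 \<le> k" by linarith
    then show ?thesis
    proof cases
      case 1 then show ?thesis using that a by (auto simp: averages_def)
    next
      case 2 then show ?thesis using that lo(1)[of k] hi(2)[of k'] by auto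
    next
      case 3 then show ?thesis using that b by (auto simp: averages_def)
    qed
  qed
  show ?thesis unfolding averages_def
    using k list s bd mo a b by (auto simp: averages_def)
qed

text \<open>Repeated averages: the next level is the mean of \<open>d k0\<close> consecutive
  averages of the previous level. If \<open>c / d k0\<close> bounds the mass at one level, then
  \<open>1 + 2 * c\<close> bounds it at the next one before the division by \<open>d k0\<close>.
  Iterating \<open>1 + 2 * c\<close> from 1 gives \<open>2 ^ Suc n - 1\<close>.\<close>

lemma special_convex_combination:
  fixes d p :: "nat \<Rightarrow> nat"
  assumes d: "\<And>k. 1 \<le> d k" "\<And>k. 2 * d k \<le> d (Suc k)" and p: "\<And>k. p k \<in> {d k..<d (Suc k)}"
  shows "\<exists>k1 a. averages d p (Suc n) 1 k0 k1 a \<and>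
    (\<forall>G\<in>wide n. hit_mass d a k0 k1 G \<le> (2 ^ Suc n - 1) / d k0)"
proof (induction n arbitrary: k0)
  case 0
  define k1 where "k1 = k0 + d k0"
  define a where "a = (\<lambda>k::nat. 1 / real (d k0))"
  have dp: "real (d k) > 0" for k using d(1)[of k] by linarith
  have dm: "d i \<le> d j" if "i \<le> j" for i j using growth_mono[of d, OF d(2)] that .
  have pl: "p i < p j" if "i < j" for i j
  proof -
    have "d (Suc i) \<le> d j" using dm that by simp
    then show ?thesis using p[of i] p[of j] by auto
  qed
  have pp: "d k0 \<le> p k" if "k0 \<le> k" for k using p[of k] dm[OF that] by auto
  have "\<Union>(set (map (\<lambda>k. {p k}) [k0..<k1])) \<in> schreier (Suc 0)"
  proof (rule schreier_SucI)
    show "set (map (\<lambda>k. {p k}) [k0..<k1]) \<subseteq> schreier 0"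
      using pp d(1)[of k0] by (auto) (metis One_nat_def le_trans)
    show "sorted_wrt set_less (map (\<lambda>k. {p k}) [k0..<k1])"
      unfolding sorted_wrt_map by (rule sorted_wrt_mono_rel[of _ "(<)"]) (auto simp: set_less_def pl)
  qed (use pp in \<open>auto simp: k1_def\<close>)
  moreover have "\<Union>(set (map (\<lambda>k. {p k}) [k0..<k1])) = p ` {k0..<k1}" by auto
  ultimately have sch: "p ` {k0..<k1} \<in> schreier (Suc 0)" by (simp only:)
  have "averages d p (Suc 0) 1 k0 k1 a"
    unfolding averages_def
  proof (intro conjI)
    show "\<exists>As. length As = 1 \<and> set As \<subseteq> schreier (Suc 0) \<and> sorted_wrt set_less As \<and> \<Union> (set As) = p ` {k0..<k1}"
      using sch by (intro exI[of _ "[p ` {k0..<k1}]"]) auto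
    show "\<forall>k\<in>{k0..<k1}. 1 / real (d k1) ^ Suc 0 \<le> a k \<and> a k \<le> 1 / real (d k0) ^ Suc 0"
      using dp[of k0] dp[of k1] dm[of k0 k1] by (auto simp: a_def k1_def field_simps)
  qed (use dp[of k0] in \<open>auto simp: k1_def a_def\<close>)
  moreover have "hit_mass d a k0 k1 G \<le> (2 ^ Suc 0 - 1) / d k0" if G: "G \<in> wide 0" for G
  proof -
    obtain x where x: "G \<subseteq> {x}" using G unfolding wide.simps by blast
    have "hit_mass d a k0 k1 G \<le> hit_mass d a k0 k1 {x}"
      using x by (intro hit_mass_mono) (auto simp: a_def)
    also have "\<dots> = (\<Sum>k\<in>{k0..<k1}. if x \<in> {d k..<d (Suc k)} then 1 / d k0 else 0)"
      unfolding hit_mass_def a_def by (intro sum.cong) auto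
    also have "\<dots> \<le> 1 / d k0"
    proof (cases "\<exists>k. x \<in> {d k..<d (Suc k)}")
      case True
      then obtain k where k: "x \<in> {d k..<d (Suc k)}" by auto
      have "(\<Sum>k\<in>{k0..<k1}. if x \<in> {d k..<d (Suc k)} then 1 / d k0 else 0) =
        (\<Sum>k'\<in>{k0..<k1}. if k' = k then 1 / real (d k0) else 0)"
        using growth_disjoint[of d, OF d(2)] k by (intro sum.cong) auto
      then show ?thesis by (simp)
    next
      case False
      then have "(\<Sum>k\<in>{k0..<k1}. if x \<in> {d k..<d (Suc k)} then 1 / real (d k0) else 0) = 0"
        by (intro sum.neutral) auto
      then show ?thesis using dp[of k0] by auto
    qed
    finally show ?thesis by simp
  qed
  ultimately show ?case by blast
next
  case (Suc n)
  define c where "c = (2 ^ Suc n - 1 :: real)"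
  have c0: "c \<ge> 0" unfolding c_def using two_realpow_ge_one[of "Suc n"] by linarith
  have dp: "real (d k) > 0" for k using d(1)[of k] by linarith
  have dm: "d i \<le> d j" if "i \<le> j" for i j using growth_mono[of d, OF d(2)] that .
  have IH: "\<exists>k1 a. averages d p (Suc n) 1 k0 k1 a \<and> (\<forall>G\<in>wide n. hit_mass d a k0 k1 G \<le> c / d k0)" for k0
    using Suc.IH[of k0] unfolding c_def by blast
  \<comment> \<open>Two invariants for \<open>Suc M\<close> concatenated averages. The one for
    unions of \<open>q\<close> sets does not grow with \<open>M\<close>: since \<open>d\<close>
    doubles, the contributions are dominated by a geometric series. It is needed to prove the other
    one.\<close>
  have key: "\<exists>k1 b. averages d p (Suc n) (Suc M) k0 k1 b \<and>
      (\<forall>(q::nat) (Gs :: nat \<Rightarrow> nat set). (\<forall>i<q. Gs i \<in> wide n) \<longrightarrow> hit_mass d b k0 k1 (\<Union>i<q. Gs i) \<le> 2 * q * c / d k0) \<and>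
      (\<forall>G\<in>wide (Suc n). hit_mass d b k0 k1 G \<le> 1 + 2 * c)" for M k0
  proof (induction M arbitrary: k0)
    case 0
    obtain k1 a where a: "averages d p (Suc n) 1 k0 k1 a" "\<forall>G\<in>wide n. hit_mass d a k0 k1 G \<le> c / d k0"
      using IH by blast
    have a0: "0 \<le> a k" for k using a(1) by (auto simp: averages_def)
    have "hit_mass d a k0 k1 (\<Union>i<q. Gs i) \<le> 2 * q * c / d k0" if "\<forall>i<q. Gs i \<in> wide n" for q :: nat and Gs :: "nat \<Rightarrow> nat set"
    proof -
      have "hit_mass d a k0 k1 (\<Union>i<q. Gs i) \<le> (\<Sum>i<q. hit_mass d a k0 k1 (Gs i))"
        by (rule hit_mass_UN) (rule a0)
      also have "\<dots> \<le> (\<Sum>i<q. c / d k0)" using that a(2) by (intro sum_mono) auto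
      also have "\<dots> \<le> 2 * q * c / d k0" using c0 dp[of k0] by (simp add: divide_right_mono)
      finally show ?thesis .
    qed
    moreover have "hit_mass d a k0 k1 G \<le> 1 + 2 * c" for G
      using hit_mass_le_sum[of a d k0 k1 G] a0 a(1) c0 by (auto simp: averages_def)
    ultimately show ?case using a(1) by (intro exI[of _ k1] exI[of _ a]) auto
  next
    case (Suc M)
    obtain k1 a where a: "averages d p (Suc n) 1 k0 k1 a" "\<forall>G\<in>wide n. hit_mass d a k0 k1 G \<le> c / d k0"
      using IH by blast
    obtain k2 b where b: "averages d p (Suc n) (Suc M) k1 k2 b"
      and b1: "\<And>(q::nat) (Gs :: nat \<Rightarrow> nat set). (\<forall>i<q. Gs i \<in> wide n) \<Longrightarrow> hit_mass d b k1 k2 (\<Union>i<q. Gs i) \<le> 2 * q * c / d k1"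
      and b2: "\<And>G. G\<in>wide (Suc n) \<Longrightarrow> hit_mass d b k1 k2 G \<le> 1 + 2 * c"
      using Suc.IH[of k1] by blast
    have k: "k0 < k1" "k1 < k2" using a b by (auto simp: averages_def)
    have a0: "0 \<le> a k" for k using a(1) by (auto simp: averages_def)
    let ?c = "\<lambda>k. if k < k1 then a k else b k"
    have av: "averages d p (Suc n) (Suc (Suc M)) k0 k2 ?c"
      using averages_append[OF a(1) b d p] .
    have split: "hit_mass d ?c k0 k2 G = hit_mass d a k0 k1 G + hit_mass d b k1 k2 G" for G
    proof -
      have "hit_mass d ?c k0 k2 G = hit_mass d ?c k0 k1 G + hit_mass d ?c k1 k2 G"
        unfolding hit_mass_def using k by (simp add: sum.atLeastLessThan_concat)
      moreover have "hit_mass d ?c k0 k1 G = hit_mass d a k0 k1 G"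
        unfolding hit_mass_def by (rule sum.cong) auto
      moreover have "hit_mass d ?c k1 k2 G = hit_mass d b k1 k2 G"
        unfolding hit_mass_def by (rule sum.cong) auto
      ultimately show ?thesis by simp
    qed
    have d2: "2 * d k0 \<le> d k1"
      using d(2)[of k0] dm[of "Suc k0" k1] k by linarith
    have A: "hit_mass d ?c k0 k2 (\<Union>i<q. Gs i) \<le> 2 * q * c / d k0" if "\<forall>i<q. Gs i \<in> wide n" for q :: nat and Gs :: "nat \<Rightarrow> nat set"
    proof -
      have "hit_mass d a k0 k1 (\<Union>i<q. Gs i) \<le> (\<Sum>i<q. hit_mass d a k0 k1 (Gs i))"
        by (rule hit_mass_UN) (rule a0)
      also have "\<dots> \<le> (\<Sum>i<q. c / d k0)" using that a(2) by (intro sum_mono) auto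
      also have "\<dots> = q * c / d k0" by simp
      finally have 1: "hit_mass d a k0 k1 (\<Union>i<q. Gs i) \<le> q * c / d k0" .
      have "2 * q * c / d k1 \<le> 2 * q * c / (2 * d k0)"
        using d2 dp[of k0] dp[of k1] c0 by (intro divide_left_mono) (auto simp: mult_nonneg_nonneg)
      also have "\<dots> = q * c / d k0" by simp
      finally have "hit_mass d b k1 k2 (\<Union>i<q. Gs i) \<le> q * c / d k0" using b1[OF that] by linarith
      moreover have "2 * q * c / d k0 = q * c / d k0 + q * c / d k0" by (simp add: add_divide_distrib[symmetric])
      ultimately show ?thesis using 1 split by (simp only:)
    qed
    \<comment> \<open>If \<open>G\<close> has a point below \<open>d k1\<close>, it has at most
      \<open>d k1\<close> pieces; the first average then contributes at most 1, and the invariant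
      for unions bounds all later ones together by \<open>2 * c\<close>. Otherwise the first average
      is missed altogether.\<close>
    have B: "hit_mass d ?c k0 k2 G \<le> 1 + 2 * c" if G: "G \<in> wide (Suc n)" for G
    proof (cases "\<exists>x\<in>G. x < d k1")
      case False
      have "G \<inter> {d k..<d (Suc k)} = {}" if "k < k1" for k
        using False dm[of "Suc k" k1] that by fastforce
      then have "hit_mass d a k0 k1 G = 0" unfolding hit_mass_def by (intro sum.neutral) auto
      then show ?thesis using split b2[OF G] by simp
    next
      case True
      obtain q Gs where q: "G = (\<Union>p<q. Gs p)" "\<forall>p<q. Gs p \<in> wide n" "\<forall>x\<in>G. q \<le> x"
        using G by auto
      have qd: "q \<le> d k1" using True q(3) by fastforce
      have "hit_mass d b k1 k2 G \<le> 2 * q * c / d k1" using b1[OF q(2)] q(1) by simp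
      also have "\<dots> \<le> 2 * c" using qd dp[of k1] c0 by (simp add: field_simps mult_left_mono)
      finally show ?thesis using hit_mass_le_sum[of a d k0 k1 G] a0 a(1) split
        by (auto simp: averages_def)
    qed
    show ?case using av A B by blast
  qed
  \<comment> \<open>All points lie at or above \<open>d k0\<close>, so \<open>d k0\<close> is an
    admissible number of pieces for the next Schreier family.\<close>
  define N where "N = d k0"
  have N1: "N \<ge> 1" using d(1) N_def by auto
  obtain k1 b where b: "averages d p (Suc n) N k0 k1 b"
    and b2: "\<And>G. G\<in>wide (Suc n) \<Longrightarrow> hit_mass d b k0 k1 G \<le> 1 + 2 * c"
    using key[of "N - 1" k0] N1 by auto
  have k: "k0 < k1" using b by (auto simp: averages_def)
  define a where "a = (\<lambda>k. b k / N)"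
  have Np: "real N > 0" using N1 by simp
  obtain As where As: "length As = N" "set As \<subseteq> schreier (Suc n)" "sorted_wrt set_less As" "\<Union>(set As) = p ` {k0..<k1}"
    using b by (auto simp: averages_def)
  have "\<Union>(set As) \<in> schreier (Suc (Suc n))"
  proof (rule schreier_SucI[OF As(2,3)])
    fix x assume "x \<in> \<Union>(set As)"
    then obtain k where "k \<ge> k0" "x = p k" using As(4) by auto
    then show "length As \<le> x" using p[of k] dm[of k0 k] As(1) N_def by auto
  qed
  then have sch: "p ` {k0..<k1} \<in> schreier (Suc (Suc n))" using As(4) by (simp only:)
  have "averages d p (Suc (Suc n)) 1 k0 k1 a"
    unfolding averages_def
  proof (intro conjI)
    show "\<exists>As. length As = 1 \<and> set As \<subseteq> schreier (Suc (Suc n)) \<and> sorted_wrt set_less As \<and> \<Union> (set As) = p ` {k0..<k1}"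
      using sch by (intro exI[of _ "[p ` {k0..<k1}]"]) auto
    show "sum a {k0..<k1} = real 1" unfolding a_def sum_divide_distrib[symmetric]
      using b Np by (auto simp: averages_def)
    show "\<forall>k\<in>{k0..<k1}. 1 / real (d k1) ^ Suc (Suc n) \<le> a k \<and> a k \<le> 1 / real (d k0) ^ Suc (Suc n)"
    proof
      fix k assume kk: "k \<in> {k0..<k1}"
      have 1: "1 / real (d k1) ^ Suc n \<le> b k" "b k \<le> 1 / real (d k0) ^ Suc n"
        using b kk by (auto simp: averages_def)
      have "1 / real (d k1) ^ Suc (Suc n) = (1 / real (d k1) ^ Suc n) / d k1" by simp
      also have "\<dots> \<le> b k / d k1" using 1 dp[of k1] by (intro divide_right_mono) auto
      also have "\<dots> \<le> b k / N" using b dm[of k0 k1] k Np dp[of k1]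
        by (intro divide_left_mono) (auto simp: averages_def N_def)
      finally have "1 / real (d k1) ^ Suc (Suc n) \<le> a k" unfolding a_def .
      moreover have "a k \<le> (1 / real (d k0) ^ Suc n) / N" unfolding a_def
        using 1 Np by (intro divide_right_mono) auto
      ultimately show "1 / real (d k1) ^ Suc (Suc n) \<le> a k \<and> a k \<le> 1 / real (d k0) ^ Suc (Suc n)"
        by (simp add: N_def mult.commute)
    qed
    show "\<forall>k\<in>{k0..<k1}. \<forall>k'\<in>{k0..<k1}. k \<le> k' \<longrightarrow> a k' \<le> a k"
      using b Np unfolding a_def by (auto simp: averages_def divide_right_mono)
  qed (use b Np k in \<open>auto simp: averages_def a_def\<close>)
  moreover have "hit_mass d a k0 k1 G \<le> (2 ^ Suc (Suc n) - 1) / d k0" if "G \<in> wide (Suc n)" for G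
  proof -
    have "hit_mass d a k0 k1 G = hit_mass d b k0 k1 G / N"
      unfolding hit_mass_def a_def sum_divide_distrib by (intro sum.cong) auto
    also have "\<dots> \<le> (1 + 2 * c) / N" using b2[OF that] Np by (intro divide_right_mono) auto
    also have "1 + 2 * c = 2 ^ Suc (Suc n) - 1" by (simp add: c_def)
    finally show ?thesis by (simp add: N_def)
  qed
  ultimately show ?case by blast
qed

subsection \<open>Functionals with disjoint supports\<close>

definition restr :: "nat set \<Rightarrow> (nat \<Rightarrow> real) \<Rightarrow> nat \<Rightarrow> real" where
  "restr I f = (\<lambda>i. if i \<in> I then f i else 0)"

definition ip :: "(nat \<Rightarrow> real) \<Rightarrow> (nat \<Rightarrow> real) \<Rightarrow> real" where
  "ip f x = (\<Sum>i\<in>supp x. f i * x i)"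

definition mn :: "(nat \<Rightarrow> real) \<Rightarrow> nat" where
  "mn f = Min (supp f)"

text \<open>Sets replace lists: functionals with disjoint nonempty supports are distinct, so nothing
  is lost, and restrictions, sign changes and unions become operations on sets. For
  \<open>a = 0\<close> the value is the zero function.\<close>

definition avg :: "nat \<Rightarrow> (nat \<Rightarrow> real) set \<Rightarrow> nat \<Rightarrow> real" where
  "avg a H = (\<lambda>i. 1 / real a * (\<Sum>f\<in>H. f i))"

definition disjoint_supports :: "(nat \<Rightarrow> real) set \<Rightarrow> bool" where
  "disjoint_supports H \<longleftrightarrow> (\<forall>f\<in>H. \<forall>g\<in>H. f \<noteq> g \<longrightarrow> supp f \<inter> supp g = {})"

text \<open>Ordering by \<open>mn\<close> avoids the choice of an enumeration; on a block family
  \<open>mn\<close> is injective.\<close>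

definition successive :: "(nat \<Rightarrow> real) set \<Rightarrow> bool" where
  "successive H \<longleftrightarrow> (\<forall>f\<in>H. \<forall>g\<in>H. mn f < mn g \<longrightarrow> set_less (supp f) (supp g))"

definition blocks :: "(nat \<Rightarrow> real) set \<Rightarrow> bool" where
  "blocks H \<longleftrightarrow> finite H \<and> disjoint_supports H \<and> (\<forall>f\<in>H. finite (supp f) \<and> supp f \<noteq> {})"

lemma supp_restr [simp]: "supp (restr I f) = supp f \<inter> I"
  by (auto simp: supp_def restr_def)

lemma fun_minus_minus [simp]: "- (- f) = (f :: nat \<Rightarrow> real)"
  by (rule ext) simp

lemma supp_uminus [simp]: "supp (- f) = supp f"
  by (auto simp: supp_def)

lemma supp_zero [simp]: "supp (\<lambda>_. 0) = {}"
  by (auto simp: supp_def)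

lemma supp_empty_iff: "supp f = {} \<longleftrightarrow> f = (\<lambda>_. 0)"
  by (auto simp: supp_def)

lemma mn_uminus [simp]: "mn (- f) = mn f"
  by (simp add: mn_def)

lemma restr_uminus: "restr I (- f) = - restr I f"
  by (auto simp: restr_def)

lemma restr_restr [simp]: "restr I (restr J f) = restr (I \<inter> J) f"
  by (auto simp: restr_def)

lemma restr_id: "supp f \<subseteq> I \<Longrightarrow> restr I f = f"
  by (rule ext) (auto simp: restr_def supp_def)

lemma restr_zero: "supp f \<inter> I = {} \<Longrightarrow> restr I f = (\<lambda>_. 0)"
  by (rule ext) (auto simp: restr_def supp_def)

lemma tail_restrict_eq: "tail_restrict s f = restr {s..} f"
  by (auto simp: tail_restrict_def restr_def)

lemma mn_in: "finite (supp f) \<Longrightarrow> supp f \<noteq> {} \<Longrightarrow> mn f \<in> supp f"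
  by (simp add: mn_def)

lemma mn_le: "finite (supp f) \<Longrightarrow> i \<in> supp f \<Longrightarrow> mn f \<le> i"
  by (simp add: mn_def)

lemma mn_restr_ge:
  assumes "finite (supp f)" "supp f \<inter> I \<noteq> {}" shows "mn f \<le> mn (restr I f)"
  using mn_in[of "restr I f"] assms by (auto intro: mn_le)

lemma blocks_inj_mn: assumes "blocks H" shows "inj_on mn H"
proof (rule inj_onI)
  fix f g assume "f \<in> H" "g \<in> H" "mn f = mn g"
  then have "mn f \<in> supp f \<inter> supp g" using assms mn_in[of f] mn_in[of g] by (auto simp: blocks_def)
  then show "f = g" using assms \<open>f \<in> H\<close> \<open>g \<in> H\<close> by (auto simp: blocks_def disjoint_supports_def)
qed

lemma blocks_subset: "blocks H \<Longrightarrow> H' \<subseteq> H \<Longrightarrow> blocks H'"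
  unfolding blocks_def disjoint_supports_def by (auto intro: finite_subset)

lemma blocks_unique: "blocks H \<Longrightarrow> f \<in> H \<Longrightarrow> g \<in> H \<Longrightarrow> i \<in> supp f \<Longrightarrow> i \<in> supp g \<Longrightarrow> f = g"
  unfolding blocks_def disjoint_supports_def by blast

lemma blocks_card_less:
  assumes "blocks H" "\<And>h. h \<in> H \<Longrightarrow> mn h < d" "\<And>h. h \<in> H \<Longrightarrow> h 0 = 0"
  shows "card H \<le> d"
proof -
  have "card H = card (mn ` H)" using blocks_inj_mn[OF assms(1)] by (simp add: card_image)
  also have "\<dots> \<le> card {..<d}" using assms by (intro card_mono) auto
  finally show ?thesis by simp
qed

lemma blocks_sum_eq:
  assumes "blocks H" "f \<in> H" "i \<in> supp f" shows "(\<Sum>g\<in>H. c g * g i) = c f * f i"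
proof -
  have "(\<Sum>g\<in>H. c g * g i) = (\<Sum>g\<in>H. if g = f then c f * f i else 0)"
  proof (rule sum.cong)
    fix g assume "g \<in> H"
    then have "g \<noteq> f \<Longrightarrow> i \<notin> supp g" using blocks_unique[OF assms(1,2)] assms(3) by blast
    then show "c g * g i = (if g = f then c f * f i else 0)" by (auto simp: supp_def)
  qed simp
  then show ?thesis using assms by (simp add: blocks_def)
qed

lemma blocks_sum_zero:
  assumes "\<And>f. f \<in> H \<Longrightarrow> i \<notin> supp f" shows "(\<Sum>g\<in>H. c g * g i) = 0"
  using assms by (intro sum.neutral) (auto simp: supp_def)

lemma supp_avg:
  assumes "blocks H" "a > 0" shows "supp (avg a H) = \<Union>(supp ` H)"
proof (intro set_eqI iffI)
  fix i assume "i \<in> \<Union>(supp ` H)"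
  then obtain f where f: "f \<in> H" "i \<in> supp f" by auto
  then have "(\<Sum>g\<in>H. g i) = f i" using blocks_sum_eq[OF assms(1) f, of "\<lambda>_. 1"] by simp
  then show "i \<in> supp (avg a H)" using f assms by (simp add: supp_def avg_def)
next
  fix i assume "i \<in> supp (avg a H)"
  then show "i \<in> \<Union>(supp ` H)" using blocks_sum_zero[of H i "\<lambda>_. 1"]
    by (auto simp: supp_def avg_def)
qed

lemma avg_bound:
  assumes "blocks H" "\<And>f. f \<in> H \<Longrightarrow> \<bar>f i\<bar> \<le> 1" shows "\<bar>avg a H i\<bar> \<le> 1 / real a"
proof (cases "\<exists>f\<in>H. i \<in> supp f")
  case True
  then obtain f where f: "f \<in> H" "i \<in> supp f" by auto
  then have "(\<Sum>g\<in>H. g i) = f i" using blocks_sum_eq[OF assms(1) f, of "\<lambda>_. 1"] by simp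
  then show ?thesis using assms(2)[OF f(1)] by (simp add: avg_def abs_mult field_simps divide_right_mono)
next
  case False
  then show ?thesis using blocks_sum_zero[of H i "\<lambda>_. 1"] by (auto simp: avg_def)
qed

lemma avg_uminus: "avg a (uminus ` H) = - avg a H"
proof
  fix i
  have "(\<Sum>f\<in>uminus ` H. f i) = - (\<Sum>f\<in>H. f i)"
    by (subst sum.reindex) (auto simp: sum_negf intro!: inj_onI dest: arg_cong[of _ _ uminus])
  then show "avg a (uminus ` H) i = (- avg a H) i" by (simp add: avg_def)
qed

lemma blocks_uminus: assumes "blocks H" shows "blocks (uminus ` H)"
proof -
  have "supp f \<inter> supp g = {}" if "f \<in> H" "g \<in> H" "- f \<noteq> - g" for f g
    using assms that unfolding blocks_def disjoint_supports_def by metis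
  then show ?thesis using assms unfolding blocks_def disjoint_supports_def by simp
qed

text \<open>Members that restrict to zero are removed, since members of a block family must have
  nonempty support.\<close>

definition restr_family :: "nat set \<Rightarrow> (nat \<Rightarrow> real) set \<Rightarrow> (nat \<Rightarrow> real) set" where
  "restr_family I H = restr I ` {h\<in>H. supp h \<inter> I \<noteq> {}}"

lemma blocks_restr_family: "blocks H \<Longrightarrow> blocks (restr_family I H)"
proof -
  assume H: "blocks H"
  have "supp f \<inter> supp g = {}" if fg: "f \<in> restr_family I H" "g \<in> restr_family I H" "f \<noteq> g" for f g
  proof -
    obtain f' g' where *: "f' \<in> H" "f = restr I f'" "g' \<in> H" "g = restr I g'"
      using fg(1,2) unfolding restr_family_def by auto
    then have "supp f' \<inter> supp g' = {}" using H fg(3) unfolding blocks_def disjoint_supports_def by metis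
    then show ?thesis using * by auto
  qed
  then have "disjoint_supports (restr_family I H)" unfolding disjoint_supports_def by blast
  then show ?thesis using H unfolding blocks_def by (auto simp: restr_family_def)
qed

lemma restr_family_inj: assumes "blocks H" shows "inj_on (restr I) {h\<in>H. supp h \<inter> I \<noteq> {}}"
proof (rule inj_onI)
  fix f g assume *: "f \<in> {h\<in>H. supp h \<inter> I \<noteq> {}}" "g \<in> {h\<in>H. supp h \<inter> I \<noteq> {}}" "restr I f = restr I g"
  then obtain i where "i \<in> supp f" "i \<in> I" by auto
  moreover have "supp f \<inter> I = supp g \<inter> I" using *(3) supp_restr by metis
  ultimately show "f = g" using blocks_unique[OF assms, of f g i] * by auto
qed

text \<open>The removed members would contribute the value of \<open>\<phi>\<close> at the zero
  function, hence the condition on \<open>\<phi>\<close>. On the remaining ones restriction is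
  injective, because their supports are disjoint.\<close>

lemma sum_restr_family:
  assumes "blocks H" "\<phi> (\<lambda>_. 0) = (0::real)"
  shows "sum \<phi> (restr_family I H) = (\<Sum>h\<in>H. \<phi> (restr I h))"
proof -
  have "sum \<phi> (restr_family I H) = (\<Sum>h\<in>{h\<in>H. supp h \<inter> I \<noteq> {}}. \<phi> (restr I h))"
    unfolding restr_family_def using restr_family_inj[OF assms(1)] by (simp add: sum.reindex)
  also have "\<dots> = (\<Sum>h\<in>H. \<phi> (restr I h))"
    using assms by (intro sum.mono_neutral_left) (auto simp: blocks_def restr_zero)
  finally show ?thesis .
qed

lemma avg_restr_family: assumes "blocks H" shows "avg a (restr_family I H) = restr I (avg a H)"
proof
  fix i
  have "(\<Sum>f\<in>restr_family I H. f i) = (\<Sum>h\<in>H. restr I h i)"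
    using sum_restr_family[OF assms, of "\<lambda>f. f i"] by simp
  then show "avg a (restr_family I H) i = restr I (avg a H) i"
    by (auto simp: avg_def restr_def)
qed

lemma card_restr_family: "finite H \<Longrightarrow> card (restr_family I H) \<le> card H"
  unfolding restr_family_def by (rule order_trans[OF card_image_le]) (auto intro: card_mono)

lemma restr_family_wide: assumes "blocks H" "mn ` H \<in> wide n" shows "mn ` restr_family I H \<in> wide n"
proof -
  let ?A = "{h\<in>H. supp h \<inter> I \<noteq> {}}"
  have "(\<lambda>h. mn (restr I h)) ` ?A \<in> wide n"
  proof (rule wide_image_ge[of mn])
    show "mn ` ?A \<in> wide n" using assms(2) by (rule wide_subset) auto
    show "inj_on mn ?A" using blocks_inj_mn[OF assms(1)] by (rule inj_on_subset) auto
    show "\<And>x. x \<in> ?A \<Longrightarrow> mn x \<le> mn (restr I x)" using assms(1) by (auto simp: blocks_def intro!: mn_restr_ge)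
  qed
  then show ?thesis unfolding restr_family_def by (simp add: image_image)
qed

text \<open>Restriction moves each starting point to the right, and for successive supports the
  order of the starting points is kept, so this is an instance of spreading.\<close>

lemma restr_family_schreier:
  assumes "blocks H" "successive H" "mn ` H \<in> schreier n"
  shows "mn ` restr_family I H \<in> schreier n" "successive (restr_family I H)"
proof -
  let ?A = "{h\<in>H. supp h \<inter> I \<noteq> {}}"
  have lt: "mn x < mn y \<longleftrightarrow> mn (restr I x) < mn (restr I y)" if "x \<in> ?A" "y \<in> ?A" for x y
  proof -
    have fin: "finite (supp x)" "finite (supp y)" using that assms(1) by (auto simp: blocks_def)
    have 1: "mn (restr I x) \<in> supp x" "mn (restr I y) \<in> supp y"
      using mn_in[of "restr I x"] mn_in[of "restr I y"] that fin by auto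
    have 2: "mn (restr I u) < mn (restr I v)" if "mn u < mn v" "u \<in> ?A" "v \<in> ?A"
       "mn (restr I u) \<in> supp u" "mn (restr I v) \<in> supp v" for u v
      using that assms(2) by (auto simp: successive_def set_less_def)
    show ?thesis
    proof (cases "mn x" "mn y" rule: linorder_cases)
      case equal
      then have "x = y" using that blocks_inj_mn[OF assms(1)] by (auto dest: inj_onD)
      then show ?thesis by simp
    qed (use 2[OF _ that] 2[OF _ that(2,1)] 1 in \<open>auto dest: less_asym\<close>)
  qed
  have "(\<lambda>h. mn (restr I h)) ` ?A \<in> schreier n"
  proof (rule schreier_image_ge[of mn])
    show "mn ` ?A \<in> schreier n" using assms(3) by (rule schreier_subset) auto
    show "inj_on mn ?A" using blocks_inj_mn[OF assms(1)] by (rule inj_on_subset) auto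
    show "\<And>x. x \<in> ?A \<Longrightarrow> mn x \<le> mn (restr I x)" using assms(1) by (auto simp: blocks_def intro!: mn_restr_ge)
    show "\<And>x y. x \<in> ?A \<Longrightarrow> y \<in> ?A \<Longrightarrow> mn x < mn y \<Longrightarrow> mn (restr I x) < mn (restr I y)" using lt by blast
  qed
  then show "mn ` restr_family I H \<in> schreier n" unfolding restr_family_def by (simp add: image_image)
  show "successive (restr_family I H)" unfolding successive_def restr_family_def
  proof clarsimp
    fix x y assume *: "x \<in> H" "supp x \<inter> I \<noteq> {}" "y \<in> H" "supp y \<inter> I \<noteq> {}" "mn (restr I x) < mn (restr I y)"
    then have "mn x < mn y" using lt[of x y] by auto
    then have "set_less (supp x) (supp y)" using * assms(2) by (auto simp: successive_def)
    then show "set_less (supp x \<inter> I) (supp y \<inter> I)" by (auto simp: set_less_def)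
  qed
qed

lemma set_less_sorted_mn:
  assumes "\<forall>f\<in>set fs. finite (supp f) \<and> supp f \<noteq> {}" "sorted_wrt (\<lambda>f g. set_less (supp f) (supp g)) fs"
  shows "sorted_wrt (\<lambda>f g. mn f < mn g \<and> supp f \<inter> supp g = {}) fs"
  using assms
proof (induction fs)
  case (Cons f fs)
  have "mn f < mn g \<and> supp f \<inter> supp g = {}" if "g \<in> set fs" for g
  proof -
    have "set_less (supp f) (supp g)" using Cons.prems that by auto
    moreover have "mn f \<in> supp f" "mn g \<in> supp g" using Cons.prems that by (auto intro: mn_in)
    ultimately show ?thesis by (auto simp: set_less_def)
  qed
  then show ?case using Cons by auto
qed auto

lemma sorted_mn_blocks:
  assumes "\<forall>f\<in>set fs. finite (supp f) \<and> supp f \<noteq> {}" "sorted_wrt (\<lambda>f g. mn f < mn g \<and> supp f \<inter> supp g = {}) fs"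
  shows "distinct fs" "blocks (set fs)"
proof -
  have "distinct fs \<and> disjoint_supports (set fs)"
    using assms by (induction fs) (auto simp: disjoint_supports_def)
  then show "distinct fs" "blocks (set fs)" using assms(1) by (auto simp: blocks_def)
qed

lemma scaled_sum_avg: "distinct fs \<Longrightarrow> scaled_sum a fs = avg a (set fs)"
  by (simp add: scaled_sum_def avg_def sum_list_distinct_conv_sum_set)

lemma mn_image: "Min ` set (map supp fs) = mn ` set fs"
  by (auto simp: mn_def image_image)

lemma admissible_list:
  assumes "admissible M (map supp fs)"
  shows "distinct fs" "blocks (set fs)" "successive (set fs)" "mn ` set fs \<in> M"
    "sorted_wrt (\<lambda>f g. set_less (supp f) (supp g)) fs"
proof -
  have a: "\<forall>f\<in>set fs. finite (supp f) \<and> supp f \<noteq> {}" 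
    and b: "sorted_wrt (\<lambda>f g. set_less (supp f) (supp g)) fs"
    using assms by (auto simp: admissible_def sorted_wrt_map)
  show "mn ` set fs \<in> M" using assms mn_image[of fs] by (auto simp: admissible_def)
  show "distinct fs" "blocks (set fs)" using sorted_mn_blocks[OF a set_less_sorted_mn[OF a b]] by auto
  show "sorted_wrt (\<lambda>f g. set_less (supp f) (supp g)) fs" by fact
  show "successive (set fs)" unfolding successive_def
  proof (intro ballI impI)
    fix f g assume fg: "f \<in> set fs" "g \<in> set fs" "mn f < mn g"
    then obtain i j where ij: "i < length fs" "j < length fs" "f = fs ! i" "g = fs ! j" by (auto simp: in_set_conv_nth)
    have "i \<noteq> j" using fg ij by auto
    moreover have "\<not> j < i"
    proof
      assume "j < i"
      then have "mn g < mn f" using set_less_sorted_mn[OF a b] ij by (auto simp: sorted_wrt_iff_nth_less)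
      then show False using fg by simp
    qed
    ultimately show "set_less (supp f) (supp g)" using b ij by (auto simp: sorted_wrt_iff_nth_less)
  qed
qed

lemma disjoint_admissible_list:
  assumes "disjoint_admissible (map supp fs)" "fs \<noteq> []"
  shows "distinct fs" "blocks (set fs)" "\<And>f. f \<in> set fs \<Longrightarrow> card (set fs) \<le> mn f"
proof -
  have a: "\<forall>f\<in>set fs. finite (supp f) \<and> supp f \<noteq> {}" 
    and b: "sorted_wrt (\<lambda>f g. mn f < mn g \<and> supp f \<inter> supp g = {}) fs"
    and c: "length fs \<le> mn (hd fs)"
    using assms by (auto simp: disjoint_admissible_def sorted_wrt_map mn_def hd_map)
  show d: "distinct fs" "blocks (set fs)" using sorted_mn_blocks[OF a b] by auto
  fix f assume "f \<in> set fs"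
  then have "mn (hd fs) \<le> mn f" using b assms(2) by (cases fs) auto
  then show "card (set fs) \<le> mn f" using c d by (simp add: distinct_card)
qed

text \<open>The way back from sets to the lists in the definition of the stages: sort by starting
  point.\<close>

lemma blocks_list:
  assumes "blocks H"
  obtains fs where "set fs = H" "distinct fs" "sorted_wrt (\<lambda>f g. mn f < mn g) fs"
proof -
  obtain gs where gs: "set gs = H" "distinct gs" using finite_distinct_list assms by (auto simp: blocks_def)
  define fs where "fs = sort_key mn gs"
  have s: "set fs = H" "distinct fs" using gs by (auto simp: fs_def)
  have "distinct (map mn fs)" using s blocks_inj_mn[OF assms] by (simp add: distinct_map)
  moreover have "sorted (map mn fs)" by (simp add: fs_def)
  ultimately have "sorted_wrt (<) (map mn fs)" by (simp add: strict_sorted_iff)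
  then show ?thesis using that[of fs] s by (simp add: sorted_wrt_map)
qed

lemma avg_admissible:
  assumes "blocks H" "successive H" "mn ` H \<in> M" "H \<noteq> {}"
  obtains fs where "set fs = H" "fs \<noteq> []" "admissible M (map supp fs)" "avg a H = scaled_sum a fs"
proof -
  obtain fs where fs: "set fs = H" "distinct fs" "sorted_wrt (\<lambda>f g. mn f < mn g) fs"
    using blocks_list[OF assms(1)] .
  have "sorted_wrt (\<lambda>f g. set_less (supp f) (supp g)) fs"
    using fs(3) by (rule sorted_wrt_mono_rel[rotated]) (use assms(2) fs(1) in \<open>auto simp: successive_def\<close>)
  then have "admissible M (map supp fs)"
    unfolding admissible_def using assms fs mn_image[of fs] by (auto simp: blocks_def sorted_wrt_map)
  then show ?thesis using that[of fs] fs assms(4) scaled_sum_avg[OF fs(2)] by auto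
qed

lemma avg_disjoint_admissible:
  assumes "blocks H" "\<And>h. h \<in> H \<Longrightarrow> card H \<le> mn h" "H \<noteq> {}"
  obtains fs where "set fs = H" "fs \<noteq> []" "disjoint_admissible (map supp fs)" "avg a H = scaled_sum a fs"
proof -
  obtain fs where fs: "set fs = H" "distinct fs" "sorted_wrt (\<lambda>f g. mn f < mn g) fs"
    using blocks_list[OF assms(1)] .
  have ne: "fs \<noteq> []" using assms fs by auto
  have "sorted_wrt (\<lambda>f g. mn f < mn g \<and> supp f \<inter> supp g = {}) fs"
    using fs(3) by (rule sorted_wrt_mono_rel[rotated])
      (use blocks_unique[OF assms(1)] fs(1) in blast)
  moreover have "length fs \<le> mn (hd fs)" using assms(2)[of "hd fs"] fs ne by (auto simp: distinct_card[symmetric])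
  ultimately have "disjoint_admissible (map supp fs)"
    unfolding disjoint_admissible_def using assms(1) fs ne by (auto simp: blocks_def sorted_wrt_map mn_def hd_map)
  then show ?thesis using that[of fs] fs ne scaled_sum_avg[OF fs(2)] by auto
qed

lemma signed_units_supp:
  assumes "f \<in> signed_units" shows "\<exists>n\<ge>1. supp f = {n} \<and> \<bar>f n\<bar> = 1"
  using assms by (auto simp: signed_units_def supp_def unit_vec_def)

lemma signed_units_uminus: "f \<in> signed_units \<Longrightarrow> - f \<in> signed_units"
  unfolding signed_units_def by force

lemma signed_units_restr: assumes "f \<in> signed_units" shows "restr I f = (\<lambda>_. 0) \<or> restr I f = f"
proof -
  obtain n where "supp f = {n}" using signed_units_supp[OF assms] by auto
  then show ?thesis using restr_id[of f I] restr_zero[of f I] by (cases "n \<in> I") auto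
qed

lemma ip_alt: assumes "finite A" "supp x \<subseteq> A" shows "ip f x = (\<Sum>i\<in>A. f i * x i)"
  unfolding ip_def using assms by (intro sum.mono_neutral_left) (auto simp: supp_def)

lemma ip_sum_left: "ip (\<lambda>i. \<Sum>g\<in>F. w g * g i) x = (\<Sum>g\<in>F. w g * ip g x)"
  unfolding ip_def sum_distrib_left sum_distrib_right by (subst sum.swap) (simp add: mult.assoc)

lemma ip_avg: "ip (avg a H) x = 1 / real a * (\<Sum>g\<in>H. ip g x)"
  using ip_sum_left[of "\<lambda>_. 1 / real a" H x] by (simp add: avg_def sum_distrib_left)

lemma ip_uminus_left [simp]: "ip (- f) x = - ip f x"
  unfolding ip_def by (simp add: sum_negf)

lemma ip_zero_left [simp]: "ip (\<lambda>_. 0) x = 0"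
  unfolding ip_def by simp

lemma ip_disjoint: "supp f \<inter> supp x = {} \<Longrightarrow> ip f x = 0"
  unfolding ip_def by (intro sum.neutral) (auto simp: supp_def)

lemma ip_restr: "supp x \<subseteq> I \<Longrightarrow> ip (restr I f) x = ip f x"
  unfolding ip_def by (intro sum.cong) (auto simp: restr_def)

lemma c00_supp: "x \<in> c00 \<Longrightarrow> finite (supp x)"
  by (simp add: c00_def)

lemma supp_sum_subset: "supp (\<lambda>i. \<Sum>k\<in>A. a k * x k i) \<subseteq> (\<Union>k\<in>A. supp (x k))"
proof
  fix i assume "i \<in> supp (\<lambda>i. \<Sum>k\<in>A. a k * x k i)"
  then have "(\<Sum>k\<in>A. a k * x k i) \<noteq> 0" by (simp add: supp_def)
  then obtain k where "k \<in> A" "a k * x k i \<noteq> 0" by (meson sum.neutral)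
  then show "i \<in> (\<Union>k\<in>A. supp (x k))" by (auto simp: supp_def)
qed

lemma c00_sum: "finite A \<Longrightarrow> (\<And>k. k \<in> A \<Longrightarrow> x k \<in> c00) \<Longrightarrow> (\<lambda>i. \<Sum>k\<in>A. a k * x k i) \<in> c00"
  using supp_sum_subset[where A = A and a = a and x = x] by (auto simp: c00_def intro: finite_subset)

lemma ip_sum_right:
  assumes "finite A" "\<And>k. k \<in> A \<Longrightarrow> x k \<in> c00"
  shows "ip f (\<lambda>i. \<Sum>k\<in>A. a k * x k i) = (\<Sum>k\<in>A. a k * ip f (x k))"
proof -
  let ?S = "\<Union>k\<in>A. supp (x k)"
  have fin: "finite ?S" using assms by (auto simp: c00_def)
  have "ip f (\<lambda>i. \<Sum>k\<in>A. a k * x k i) = (\<Sum>i\<in>?S. f i * (\<Sum>k\<in>A. a k * x k i))"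
    using fin supp_sum_subset by (rule ip_alt)
  also have "\<dots> = (\<Sum>i\<in>?S. \<Sum>k\<in>A. a k * (f i * x k i))"
    by (simp add: sum_distrib_left mult.left_commute)
  also have "\<dots> = (\<Sum>k\<in>A. \<Sum>i\<in>?S. a k * (f i * x k i))" by (rule sum.swap)
  also have "\<dots> = (\<Sum>k\<in>A. a k * ip f (x k))"
  proof (rule sum.cong)
    fix k assume "k \<in> A"
    then have "ip f (x k) = (\<Sum>i\<in>?S. f i * x k i)" using fin by (intro ip_alt) auto
    then show "(\<Sum>i\<in>?S. a k * (f i * x k i)) = a k * ip f (x k)" by (simp add: sum_distrib_left)
  qed simp
  finally show ?thesis .
qed

lemma ip_scale_right:
  assumes "x \<in> c00" shows "ip f (\<lambda>i. c * x i) = c * ip f x"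
  using ip_sum_right[of "{()}" "\<lambda>_. x" f "\<lambda>_. c"] assms by simp

lemma c00_scale: "x \<in> c00 \<Longrightarrow> (\<lambda>i. c * x i) \<in> c00"
  using c00_sum[of "{()}" "\<lambda>_. x" "\<lambda>_. c"] by simp

subsection \<open>The norming sets\<close>

lemma K_stage_Suc_subset: "K_stage m k n j \<subseteq> K_stage m k (Suc n) j"
  by auto

lemma K_stage_mono: "n \<le> n' \<Longrightarrow> K_stage m k n j \<subseteq> K_stage m k n' j"
  by (induction n' rule: dec_induct) (use K_stage_Suc_subset in blast)+

lemma map_supp_uminus: "map supp (map uminus fs) = map supp fs"
  by simp

lemma scaled_sum_uminus: "- scaled_sum a fs = scaled_sum a (map uminus fs)"
proof
  fix i
  have "(\<Sum>f\<leftarrow>map uminus fs. f i) = - (\<Sum>f\<leftarrow>fs. f i)" by (induction fs) auto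
  then show "(- scaled_sum a fs) i = scaled_sum a (map uminus fs) i" by (simp add: scaled_sum_def)
qed

text \<open>The stages of \<open>K\<close> carry no explicit sign, in contrast to those of
  \<open>L\<close>. Symmetry starts with the signed units and is passed on by changing all signs in
  a sum.\<close>

lemma K_stage_uminus: "f \<in> K_stage m k n j \<Longrightarrow> - f \<in> K_stage m k n j"
proof (induction n arbitrary: f j)
  case 0 then show ?case using signed_units_uminus[of f] unfolding K_stage.simps by blast
next
  case (Suc n)
  have sub: "set (map uminus fs) \<subseteq> (\<Union>i\<in>{1..}. K_stage m k n i)" if "set fs \<subseteq> (\<Union>i\<in>{1..}. K_stage m k n i)" for fs
    using that Suc.IH by fastforce
  show ?case
  proof (cases "f \<in> K_stage m k n j")
    case True then show ?thesis using Suc.IH by simp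
  next
    case False
    then obtain fs where fs: "f = scaled_sum (if j = 1 then 2 else m j) fs" "fs \<noteq> []"
      "set fs \<subseteq> (\<Union>i\<in>{1..}. K_stage m k n i)"
      "if j = 1 then disjoint_admissible (map supp fs) else admissible (schreier (k j)) (map supp fs)"
      using Suc.prems by (auto split: if_splits)
    have f': "- f = scaled_sum (if j = 1 then 2 else m j) (map uminus fs)"
      "if j = 1 then disjoint_admissible (map supp (map uminus fs))
       else admissible (schreier (k j)) (map supp (map uminus fs))"
      using fs(1,4) scaled_sum_uminus unfolding map_supp_uminus by auto
    have ne: "map uminus fs \<noteq> []" using fs(2) by simp
    show ?thesis
    proof (cases "j = 1")
      case True
      then have "- f \<in> {scaled_sum 2 fs |fs. fs \<noteq> [] \<and> set fs \<subseteq> (\<Union>i\<in>{1..}. K_stage m k n i) \<and> disjoint_admissible (map supp fs)}"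
        using f' ne sub[OF fs(3)] by (intro CollectI exI[of _ "map uminus fs"]) (simp del: set_map map_map)
      then show ?thesis unfolding K_stage.simps True by (intro UnI2) (simp only: if_True simp_thms)
    next
      case False
      then have "- f \<in> {scaled_sum (m j) fs |fs. fs \<noteq> [] \<and> set fs \<subseteq> (\<Union>i\<in>{1..}. K_stage m k n i) \<and> admissible (schreier (k j)) (map supp fs)}"
        using f' ne sub[OF fs(3)] by (intro CollectI exI[of _ "map uminus fs"]) (simp del: set_map map_map)
      then show ?thesis unfolding K_stage.simps by (intro UnI2) (simp only: False if_False simp_thms)
    qed
  qed
qed

lemma K_setI: "f \<in> K_stage m k n j \<Longrightarrow> 1 \<le> j \<Longrightarrow> f \<in> K_set m k"
  unfolding K_set_def by (intro UN_I[of n] UN_I[of j]) auto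

lemma K_setE: assumes "f \<in> K_set m k" obtains n j where "f \<in> K_stage m k n j" "1 \<le> j"
  using assms unfolding K_set_def by auto

lemma K_set_uminus: "f \<in> K_set m k \<Longrightarrow> - f \<in> K_set m k"
  by (elim K_setE) (rule K_setI[OF K_stage_uminus])

lemma K_set_common_stage:
  assumes "finite H" "H \<subseteq> K_set m k" shows "\<exists>n. H \<subseteq> (\<Union>i\<in>{1..}. K_stage m k n i)"
  using assms
proof (induction H rule: finite_induct)
  case (insert f H)
  then obtain n n' i where "H \<subseteq> (\<Union>i\<in>{1..}. K_stage m k n i)" "f \<in> K_stage m k n' i" "i \<ge> 1"
    using K_setE[of f m k] by (metis insert_subset)
  then have *: "H \<subseteq> (\<Union>i\<in>{1..}. K_stage m k n i)" "f \<in> K_stage m k n' i" "i \<ge> 1" by auto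
  have "H \<subseteq> (\<Union>i\<in>{1..}. K_stage m k (max n n') i)" using *(1) K_stage_mono[of n "max n n'" m k] by fastforce
  moreover have "f \<in> K_stage m k (max n n') i" using *(2) K_stage_mono[of n' "max n n'" m k] by auto
  ultimately have "insert f H \<subseteq> (\<Union>i\<in>{1..}. K_stage m k (max n n') i)" using *(3) by auto
  then show ?case by blast
qed auto

lemma K_set_avg:
  assumes "blocks H" "H \<subseteq> K_set m k" "H \<noteq> {}" "successive H" "mn ` H \<in> schreier (k j)" "2 \<le> j"
  shows "avg (m j) H \<in> K_set m k"
proof -
  obtain n where n: "H \<subseteq> (\<Union>i\<in>{1..}. K_stage m k n i)"
    using K_set_common_stage assms by (metis blocks_def)
  obtain fs where "set fs = H" "fs \<noteq> []" "admissible (schreier (k j)) (map supp fs)" "avg (m j) H = scaled_sum (m j) fs"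
    using avg_admissible[OF assms(1,4,5,3)] .
  then have "avg (m j) H \<in> K_stage m k (Suc n) j" using assms(6) n by auto
  then show ?thesis using assms(6) by (intro K_setI[of _ m k "Suc n" j]) auto
qed

lemma K_set_avg_1:
  assumes "blocks H" "H \<subseteq> K_set m k" "H \<noteq> {}" "\<And>h. h \<in> H \<Longrightarrow> card H \<le> mn h"
  shows "avg 2 H \<in> K_set m k"
proof -
  obtain n where n: "H \<subseteq> (\<Union>i\<in>{1..}. K_stage m k n i)"
    using K_set_common_stage assms by (metis blocks_def)
  obtain fs where "set fs = H" "fs \<noteq> []" "disjoint_admissible (map supp fs)" "avg 2 H = scaled_sum 2 fs"
    using avg_disjoint_admissible[OF assms(1,4,3)] .
  then have "avg 2 H \<in> K_stage m k (Suc n) 1" using n by auto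
  then show ?thesis by (intro K_setI[of _ m k "Suc n" 1]) auto
qed

text \<open>Intervals, bounded or not. These are the sets to which functionals of a given index may
  be restricted without changing the index.\<close>

definition order_convex :: "nat set \<Rightarrow> bool" where
  "order_convex I \<longleftrightarrow> (\<forall>a\<in>I. \<forall>c\<in>I. \<forall>b. a \<le> b \<and> b \<le> c \<longrightarrow> b \<in> I)"

lemma order_convex_atLeast [simp]: "order_convex {s..}" by (auto simp: order_convex_def)
lemma order_convex_Ico [simp]: "order_convex {a..<b}" by (auto simp: order_convex_def)
lemma order_convex_lessThan [simp]: "order_convex {..<b}" by (auto simp: order_convex_def)
lemma order_convex_Int: "order_convex A \<Longrightarrow> order_convex B \<Longrightarrow> order_convex (A \<inter> B)"
  unfolding order_convex_def by blast

section \<open>Growth of the parameters and stages of the norming set\<close>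

locale coded_space =
  fixes m t k :: "nat \<Rightarrow> nat" and \<Phi> :: "(nat \<Rightarrow> real) list \<Rightarrow> nat"
  assumes m_1: "m 1 = 2"
    and m_step: "\<And>j. 2 \<le> j \<Longrightarrow> m (j - 1) ^ m (j - 1) < m j"
    and t_bound: "\<And>n. 2 \<le> n \<Longrightarrow> 0 < t n \<and> (m n)\<^sup>2 \<le> 2 ^ t n"
    and k_1: "k 1 = 1"
    and k_step: "\<And>n. 2 \<le> n \<Longrightarrow> k n = t n * (k (n - 1) + 1) + 1"
    and coding: "coding_function m k \<Phi>"
begin

lemma m_ge_2: "1 \<le> j \<Longrightarrow> 2 \<le> m j"
proof (induction j rule: dec_induct)
  case (step n)
  have "m n ^ 1 \<le> m n ^ m n" using step by (intro power_increasing) auto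
  then have "m n \<le> m n ^ m n" by simp
  then show ?case using m_step[of "Suc n"] step by (simp only: diff_Suc_1) linarith
qed (use m_1 in simp)

lemma m_sq: assumes "1 \<le> j" shows "(m j)\<^sup>2 < m (Suc j)"
proof -
  have "m j ^ 2 \<le> m j ^ m j" using m_ge_2[OF assms] by (intro power_increasing) auto
  then show ?thesis using m_step[of "Suc j"] assms by simp
qed

lemma m_less_Suc: "1 \<le> j \<Longrightarrow> m j < m (Suc j)"
  using m_sq[of j] m_ge_2[of j] by (auto simp: power2_eq_square) (metis le_square le_less_trans)

lemma m_mono: "1 \<le> i \<Longrightarrow> i \<le> j \<Longrightarrow> m i \<le> m j"
  by (rotate_tac, induction j rule: dec_induct) (use m_less_Suc in \<open>auto intro: order_trans less_imp_le\<close>)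

lemma m_ge_index: "1 \<le> j \<Longrightarrow> j < m j"
  by (induction j rule: dec_induct) (use m_1 m_less_Suc in \<open>auto simp: less_eq_Suc_le intro: order_trans[rotated]\<close>)

lemma m_ge_5: "2 \<le> j \<Longrightarrow> 5 \<le> m j"
  using m_mono[of 2 j] m_sq[of 1] m_1 by (auto simp: numeral_2_eq_2)

lemma k_Suc: "1 \<le> n \<Longrightarrow> k (Suc n) = t (Suc n) * (k n + 1) + 1"
  using k_step[of "Suc n"] by simp

lemma k_less_Suc: assumes "1 \<le> n" shows "k n < k (Suc n)"
proof -
  have "1 * (k n + 1) \<le> t (Suc n) * (k n + 1)" using t_bound[of "Suc n"] assms by (intro mult_le_mono1) auto
  then show ?thesis using k_Suc[OF assms] by simp
qed

lemma k_mono: "1 \<le> i \<Longrightarrow> i \<le> j \<Longrightarrow> k i \<le> k j"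
  by (rotate_tac, induction j rule: dec_induct) (use k_less_Suc in \<open>auto intro: order_trans less_imp_le\<close>)

lemma k_ge_1: "1 \<le> j \<Longrightarrow> 1 \<le> k j"
  using k_mono[of 1 j] k_1 by simp

abbreviation Ls :: "nat \<Rightarrow> nat \<Rightarrow> (nat \<Rightarrow> real) set" where
  "Ls \<equiv> L_stage m k \<Phi>"

text \<open>The special sequences of the Gowers-Maurey construction, which go back to Maurey and
  Rosenthal, relative to stage \<open>n\<close>.\<close>

definition special :: "nat \<Rightarrow> nat \<Rightarrow> (nat \<Rightarrow> real) list \<Rightarrow> bool" where
  "special n j fs \<longleftrightarrow> fs \<noteq> [] \<and> (\<exists>r>j. hd fs \<in> Ls n (2 * r)) \<and>
     (\<forall>i. 1 \<le> i \<and> i < length fs \<longrightarrow> fs ! i \<in> Ls n (\<Phi> (take i fs))) \<and>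
     admissible (schreier (k j)) (map supp fs)"

lemma Ls_0: "Ls 0 j = signed_units" by simp

lemma Ls_Suc_odd: "odd j \<Longrightarrow> j \<noteq> 1 \<Longrightarrow> Ls (Suc n) j =
   {restr {s..} x |s x. 1 \<le> s \<and> x \<in> pm (Ls n j) \<union> {scaled_sum (m j) fs |fs. special n j fs}}"
  unfolding L_stage.simps special_def tail_restrict_eq by (simp only: if_False if_True simp_thms)

lemma Ls_Suc_even: "even j \<Longrightarrow> Ls (Suc n) j = pm (Ls n j) \<union>
   {scaled_sum (m j) fs |fs. fs \<noteq> [] \<and> set fs \<subseteq> (\<Union>i\<in>{1..}. Ls n i) \<and> admissible (schreier (k j)) (map supp fs)}"
  by auto

lemma Ls_Suc_1: "Ls (Suc n) 1 = pm (Ls n 1) \<union>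
   {scaled_sum 2 fs |fs. fs \<noteq> [] \<and> set fs \<subseteq> (\<Union>i\<in>{1..}. Ls n i) \<and> disjoint_admissible (map supp fs)}"
  by simp

declare L_stage.simps [simp del]

lemma Ls_cases [consumes 1, case_names pm one even tail special]:
  assumes "f \<in> Ls (Suc n) j"
  obtains (pm) g where "g \<in> Ls n j" "f = g \<or> f = - g"
  | (one) H where "j = 1" "blocks H" "H \<noteq> {}" "H \<subseteq> (\<Union>i\<in>{1..}. Ls n i)" "\<And>h. h \<in> H \<Longrightarrow> card H \<le> mn h" "f = avg 2 H"
  | (even) H where "even j" "blocks H" "H \<noteq> {}" "H \<subseteq> (\<Union>i\<in>{1..}. Ls n i)" "successive H" "mn ` H \<in> schreier (k j)" "f = avg (m j) H"
  | (tail) g s where "odd j" "j \<noteq> 1" "1 \<le> s" "g \<in> Ls n j" "f = restr {s..} g \<or> f = restr {s..} (- g)"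
  | (special) fs s where "odd j" "j \<noteq> 1" "1 \<le> s" "special n j fs" "f = restr {s..} (scaled_sum (m j) fs)"
proof -
  consider "j = 1" | "even j" | "odd j" "j \<noteq> 1" by auto
  then show ?thesis
  proof cases
    case 1
    then consider "f \<in> pm (Ls n j)" | fs where "f = scaled_sum 2 fs" "fs \<noteq> []"
      "set fs \<subseteq> (\<Union>i\<in>{1..}. Ls n i)" "disjoint_admissible (map supp fs)"
      using assms unfolding 1 Ls_Suc_1 by blast
    then show ?thesis
    proof cases
      case 1 then show ?thesis using pm by (auto simp: pm_def)
    next
      case (2 fs) then show ?thesis
        using one[of "set fs"] \<open>j = 1\<close> disjoint_admissible_list[OF 2(4,2)] scaled_sum_avg[of fs 2] by auto
    qed
  next
    case 2
    then consider "f \<in> pm (Ls n j)" | fs where "f = scaled_sum (m j) fs" "fs \<noteq> []"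
      "set fs \<subseteq> (\<Union>i\<in>{1..}. Ls n i)" "admissible (schreier (k j)) (map supp fs)"
      using assms unfolding Ls_Suc_even[OF 2] by blast
    then show ?thesis
    proof cases
      case 1 then show ?thesis using pm by (auto simp: pm_def)
    next
      case (2 fs) then show ?thesis
        using even[of "set fs"] \<open>even j\<close> admissible_list[OF 2(4)] scaled_sum_avg[of fs "m j"] by auto
    qed
  next
    case 3
    then show ?thesis using assms unfolding Ls_Suc_odd[OF 3] pm_def using tail special by blast
  qed
qed

lemma Ls_wf: "f \<in> Ls n j \<Longrightarrow> finite (supp f) \<and> f 0 = 0"
proof (induction n arbitrary: f j)
  case 0
  then have "f \<in> signed_units" unfolding Ls_0 .
  then obtain n where n: "n \<ge> 1" "supp f = {n}" using signed_units_supp[of f] by auto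
  then have "0 \<notin> supp f" by auto
  then show ?case using n by (simp add: supp_def)
next
  case (Suc n)
  \<comment> \<open>The index is not assumed to be positive here, so the denominator may be 0; the
    average is then zero.\<close>
  have avg0: "finite (supp (avg a H)) \<and> avg a H 0 = 0" if "blocks H" "\<And>h. h \<in> H \<Longrightarrow> finite (supp h) \<and> h 0 = 0" for a H
  proof (cases "a > 0")
    case True
    then have "finite (supp (avg a H))" using that supp_avg[OF that(1)] by (auto simp: blocks_def)
    moreover have "(\<Sum>f\<in>H. f 0) = 0" using that(2) by (intro sum.neutral) auto
    ultimately show ?thesis by (simp add: avg_def)
  next
    case False then show ?thesis by (simp add: avg_def)
  qed
  show ?case using Suc.prems
  proof (cases rule: Ls_cases)
    case (pm g)
    then have "supp f = supp g" using supp_uminus[of g] by metis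
    moreover have "f 0 = g 0 \<or> f 0 = - g 0" using pm(2) by auto
    ultimately show ?thesis using Suc.IH[of g j] pm(1) by auto
  next
    case (one H) then show ?thesis using Suc.IH avg0[of H 2] by blast
  next
    case (even H) then show ?thesis using Suc.IH avg0[of H "m j"] by blast
  next
    case (tail g s)
    have "finite (supp g) \<and> g 0 = 0" using Suc.IH[OF tail(4)] .
    moreover have "supp f = supp g \<inter> {s..}" using tail(5) supp_restr supp_uminus by metis
    moreover have "f 0 = 0 \<or> f 0 = g 0 \<or> f 0 = - g 0" using tail(5) by (auto simp: restr_def)
    ultimately show ?thesis by auto
  next
    case (special fs s)
    have "finite (supp h) \<and> h 0 = 0" if h: "h \<in> set fs" for h
    proof -
      obtain i where i: "i < length fs" "h = fs ! i" using h by (auto simp: in_set_conv_nth)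
      have "\<exists>j'. h \<in> Ls n j'"
      proof (cases "i = 0")
        case True then show ?thesis using special(4) i by (auto simp: special_def hd_conv_nth)
      next
        case False
        then have "fs ! i \<in> Ls n (\<Phi> (take i fs))" using special(4) i by (simp add: special_def)
        then show ?thesis using i by blast
      qed
      then show ?thesis using Suc.IH by blast
    qed
    moreover note sp = admissible_list(1,2)[of "schreier (k j)" fs] special(4)
    ultimately have "finite (supp (scaled_sum (m j) fs)) \<and> scaled_sum (m j) fs 0 = 0"
      using avg0[of "set fs" "m j"] scaled_sum_avg[of fs "m j"] by (simp add: special_def)
    then show ?thesis unfolding special(5) supp_restr by (auto simp: restr_def)
  qed
qed

lemma restr_ge_1: "f 0 = 0 \<Longrightarrow> restr {1..} f = f"
  by (rule restr_id) (auto simp: supp_def Suc_le_eq intro: gr0I)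

lemma Ls_pm_Suc: assumes "f \<in> Ls n j" shows "f \<in> Ls (Suc n) j" "- f \<in> Ls (Suc n) j"
proof -
  have p: "f \<in> pm (Ls n j)" "- f \<in> pm (Ls n j)" using assms by (auto simp: pm_def)
  have z: "f 0 = 0" "(- f) 0 = 0" using Ls_wf[OF assms] by auto
  consider "j = 1" | "even j" | "odd j" "j \<noteq> 1" by auto
  then have "f \<in> Ls (Suc n) j \<and> - f \<in> Ls (Suc n) j"
  proof cases
    case 1 then show ?thesis using p unfolding 1 Ls_Suc_1 by blast
  next
    case 2 then show ?thesis using p unfolding Ls_Suc_even[OF 2] by blast
  next
    case 3
    \<comment> \<open>For odd indices other than 1 a stage consists of tails. The tail from 1 loses
      nothing, because functionals vanish at 0.\<close>
    have "restr {1..} f \<in> Ls (Suc n) j" "restr {1..} (- f) \<in> Ls (Suc n) j"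
      unfolding Ls_Suc_odd[OF 3] using p by blast+
    then show ?thesis using restr_ge_1[of f] restr_ge_1[of "- f"] z by simp
  qed
  then show "f \<in> Ls (Suc n) j" "- f \<in> Ls (Suc n) j" by auto
qed

lemma Ls_mono: "n \<le> n' \<Longrightarrow> f \<in> Ls n j \<Longrightarrow> f \<in> Ls n' j"
  by (induction n' rule: dec_induct) (use Ls_pm_Suc in blast)+

lemma Ls_avg_even:
  assumes "even j" "blocks H" "H \<noteq> {}" "H \<subseteq> (\<Union>i\<in>{1..}. Ls n i)" "successive H" "mn ` H \<in> schreier (k j)"
  shows "avg (m j) H \<in> Ls (Suc n) j"
proof -
  obtain fs where "set fs = H" "fs \<noteq> []" "admissible (schreier (k j)) (map supp fs)" "avg (m j) H = scaled_sum (m j) fs"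
    using avg_admissible[OF assms(2,5,6,3)] .
  then show ?thesis using assms unfolding Ls_Suc_even[OF assms(1)] by blast
qed

lemma Ls_avg_1:
  assumes "blocks H" "H \<noteq> {}" "H \<subseteq> (\<Union>i\<in>{1..}. Ls n i)" "\<And>h. h \<in> H \<Longrightarrow> card H \<le> mn h"
  shows "avg 2 H \<in> Ls (Suc n) 1"
proof -
  obtain fs where "set fs = H" "fs \<noteq> []" "disjoint_admissible (map supp fs)" "avg 2 H = scaled_sum 2 fs"
    using avg_disjoint_admissible[OF assms(1,4,2)] .
  then show ?thesis using assms unfolding Ls_Suc_1 by blast
qed

lemma order_convex_lower: "order_convex {x. \<exists>y\<in>A. x \<le> (y::nat)}"
  unfolding order_convex_def by (auto intro: order_trans)

text \<open>Cutting a special sequence on the right changes only its last surviving member. The code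
  at a position depends only on the members before it, which are intact, and the truncated member
  keeps its index by hypothesis. A cut on the left would change the codes; that is why tails are
  built into the definition of the odd stages.\<close>

lemma special_restr_lower:
  assumes sp: "special n j fs" and D: "\<And>x y. y \<in> D \<Longrightarrow> x \<le> y \<Longrightarrow> x \<in> D"
    and IH: "\<And>f j. f \<in> Ls n j \<Longrightarrow> restr D f = (\<lambda>_. 0) \<or> restr D f \<in> Ls n j"
    and ne: "restr D (scaled_sum (m j) fs) \<noteq> (\<lambda>_. 0)"
  shows "\<exists>gs. special n j gs \<and> restr D (scaled_sum (m j) fs) = scaled_sum (m j) gs"
proof -
  have adm: "admissible (schreier (k j)) (map supp fs)" using sp by (simp add: special_def)
  note al = admissible_list[OF adm]
  let ?P = "\<lambda>f. supp f \<inter> D \<noteq> {}"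
  define us where "us = takeWhile ?P fs"
  have full: "supp (fs ! i) \<subseteq> D" if ii: "i < i'" "i' < length fs" "?P (fs ! i')" for i i'
  proof
    fix x assume x: "x \<in> supp (fs ! i)"
    obtain y where y: "y \<in> supp (fs ! i')" "y \<in> D" using ii(3) by blast
    have "set_less (supp (fs ! i)) (supp (fs ! i'))" using al(5) ii by (auto simp: sorted_wrt_iff_nth_less)
    then have "x < y" using x y by (auto simp: set_less_def)
    then show "x \<in> D" using D y by (meson less_imp_le)
  qed
  have ut: "us = take (length us) fs" unfolding us_def by (rule takeWhile_eq_take)
  have ul: "length us \<le> length fs" unfolding us_def by (rule length_takeWhile_le)
  have un: "us ! i = fs ! i" if "i < length us" for i
    using ut that by (metis nth_take)
  have uP: "?P (fs ! i)" if "i < length us" for i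
    using un[OF that] that set_takeWhileD[of "us ! i" ?P fs] nth_mem[OF that] unfolding us_def by metis
  have uN: "\<not> ?P (fs ! i)" if "length us \<le> i" "i < length fs" for i
  proof
    assume P: "?P (fs ! i)"
    have "\<not> ?P (fs ! length us)" unfolding us_def
      using nth_length_takeWhile[of ?P fs] that unfolding us_def by auto
    moreover have "?P (fs ! length us)"
    proof (cases "length us = i")
      case False
      then have "supp (fs ! length us) \<subseteq> D" using full[of "length us" i] that P by auto
      moreover have "supp (fs ! length us) \<noteq> {}" using al(2) that by (auto simp: blocks_def)
      ultimately show ?thesis by auto
    qed (use P in simp)
    ultimately show False by simp
  qed
  have us_set: "set us = {f\<in>set fs. ?P f}"
  proof (intro set_eqI iffI)
    fix f assume "f \<in> set us"
    then obtain i where "i < length us" "f = us ! i" by (auto simp: in_set_conv_nth)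
    then show "f \<in> {f\<in>set fs. ?P f}" using un[of i] uP[of i] ul by auto
  next
    fix f assume f: "f \<in> {f\<in>set fs. ?P f}"
    then obtain i where i: "i < length fs" "f = fs ! i" by (auto simp: in_set_conv_nth)
    then have "\<not> length us \<le> i" using uN[of i] f by blast
    then have "i < length us" by simp
    then show "f \<in> set us" using un[of i] i(2) nth_mem by metis
  qed
  define gs where "gs = map (restr D) us"
  have gset: "set gs = restr_family D (set fs)" unfolding gs_def restr_family_def using us_set by simp
  \<comment> \<open>A member followed by another survivor lies entirely in \<open>D\<close>, so all
    proper initial segments, and with them the codes, stay the same.\<close>
  have gid: "gs ! i = fs ! i" if "Suc i < length us" for i
    unfolding gs_def using that un[of i] full[of i "Suc i"] uP[of "Suc i"] ul by (simp add: restr_id)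
  have gsd: "distinct gs" unfolding gs_def distinct_map
    using al(1) ut restr_family_inj[OF al(2), of D] us_set by (metis distinct_take)
  have eq: "restr D (scaled_sum (m j) fs) = scaled_sum (m j) gs"
    using scaled_sum_avg[OF al(1)] scaled_sum_avg[OF gsd] gset avg_restr_family[OF al(2), of "m j" D] by simp
  have une: "us \<noteq> []"
  proof
    assume "us = []"
    then have "scaled_sum (m j) gs = (\<lambda>_. 0)" by (simp add: gs_def scaled_sum_def)
    then show False using ne eq by simp
  qed
  have glen: "length gs = length us" by (simp add: gs_def)
  have gnz: "gs ! i \<noteq> (\<lambda>_. 0)" if "i < length us" for i
    using that uP[OF that] un[OF that] by (auto simp: gs_def supp_empty_iff[symmetric])
  have tk: "take i gs = take i fs" if "i < length us" for i
    using that gid glen ul by (intro nth_equalityI) auto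
  have gr: "gs ! i = restr D (fs ! i)" if "i < length us" for i
    using that un by (simp add: gs_def)
  have "special n j gs" unfolding special_def
  proof (intro conjI allI impI)
    show "gs \<noteq> []" using une by (simp add: gs_def)
    obtain r where r: "r > j" "hd fs \<in> Ls n (2 * r)" using sp by (auto simp: special_def)
    have fne: "fs \<noteq> []" using sp by (simp add: special_def)
    have "gs ! 0 \<in> Ls n (2 * r)"
      using IH[of "fs ! 0" "2 * r"] r gr[of 0] gnz[of 0] une fne by (auto simp: hd_conv_nth)
    then show "\<exists>r>j. hd gs \<in> Ls n (2 * r)" using r une by (auto simp: hd_conv_nth gs_def)
    show "gs ! i \<in> Ls n (\<Phi> (take i gs))" if i: "1 \<le> i \<and> i < length gs" for i
    proof -
      have "fs ! i \<in> Ls n (\<Phi> (take i fs))" using sp i ul glen by (simp add: special_def)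
      then have "restr D (fs ! i) \<in> Ls n (\<Phi> (take i fs))"
        using IH gr[of i] gnz[of i] i glen by force
      then show ?thesis using gr[of i] tk[of i] i glen by simp
    qed
    show "admissible (schreier (k j)) (map supp gs)" unfolding admissible_def
    proof (intro conjI)
      show "\<forall>E\<in>set (map supp gs). finite E \<and> E \<noteq> {}"
        using blocks_restr_family[OF al(2), of D] gset by (auto simp: blocks_def)
      have "sorted_wrt (\<lambda>f g. set_less (supp f) (supp g)) gs" unfolding sorted_wrt_iff_nth_less
      proof (intro allI impI)
        fix i i' assume *: "i < i'" "i' < length gs"
        then have "set_less (supp (fs ! i)) (supp (fs ! i'))"
          using al(5) ul glen by (auto simp: sorted_wrt_iff_nth_less)
        then show "set_less (supp (gs ! i)) (supp (gs ! i'))"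
          using gr[of i] gr[of i'] * glen by (auto simp: set_less_def)
      qed
      then show "sorted_wrt set_less (map supp gs)" by (simp add: sorted_wrt_map)
      show "Min ` set (map supp gs) \<in> schreier (k j)"
        unfolding mn_image gset using restr_family_schreier(1)[OF al(2,3,4)] .
    qed
  qed
  then show ?thesis using eq by blast
qed

lemma Ls_restr: "f \<in> Ls n j \<Longrightarrow> order_convex I \<Longrightarrow> restr I f = (\<lambda>_. 0) \<or> restr I f \<in> Ls n j"
proof (induction n arbitrary: f j I)
  case 0
  then show ?case using signed_units_restr[of f I] unfolding Ls_0 by auto
next
  case (Suc n)
  have cutsub: "restr_family I H \<subseteq> (\<Union>i\<in>{1..}. Ls n i)" if H: "H \<subseteq> (\<Union>i\<in>{1..}. Ls n i)" for H
  proof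
    fix g assume "g \<in> restr_family I H"
    then obtain h where h: "h \<in> H" "supp h \<inter> I \<noteq> {}" "g = restr I h" unfolding restr_family_def by blast
    then obtain i where i: "i \<ge> 1" "h \<in> Ls n i" using H by auto
    have "restr I h \<noteq> (\<lambda>_. 0)" using h(2) by (simp add: supp_empty_iff[symmetric])
    then show "g \<in> (\<Union>i\<in>{1..}. Ls n i)" using Suc.IH[OF i(2) Suc.prems(2)] i(1) h(3) by auto
  qed
  show ?case using Suc.prems(1)
  proof (cases rule: Ls_cases)
    case (pm g)
    have "restr I f = restr I g \<or> restr I f = - restr I g" using pm(2) restr_uminus by auto
    moreover have "restr I g = (\<lambda>_. 0) \<or> restr I g \<in> Ls n j" using Suc.IH[OF pm(1) Suc.prems(2)] .
    moreover have "- (\<lambda>_. 0) = (\<lambda>_::nat. 0::real)" by (rule ext) simp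
    ultimately show ?thesis using Ls_pm_Suc[of "restr I g" n j] by metis
  next
    case (one H)
    have eq: "restr I f = avg 2 (restr_family I H)" using avg_restr_family[OF one(2)] one(6) by simp
    show ?thesis
    proof (cases "restr_family I H = {}")
      case True then show ?thesis using eq by (simp add: avg_def)
    next
      case False
      have "card (restr_family I H) \<le> mn g" if g: "g \<in> restr_family I H" for g
      proof -
        obtain h where h: "h \<in> H" "supp h \<inter> I \<noteq> {}" "g = restr I h" using g by (auto simp: restr_family_def)
        have "card (restr_family I H) \<le> card H" using one(2) by (intro card_restr_family) (auto simp: blocks_def)
        also have "\<dots> \<le> mn h" using one(5) h by blast
        also have "\<dots> \<le> mn g" using h one(2) by (auto intro!: mn_restr_ge simp: blocks_def)
        finally show ?thesis .
      qed
      then show ?thesis using Ls_avg_1[OF blocks_restr_family[OF one(2)] False cutsub[OF one(4)]] eq one(1) by simp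
    qed
  next
    case (even H)
    have eq: "restr I f = avg (m j) (restr_family I H)" using avg_restr_family[OF even(2)] even(7) by simp
    show ?thesis
    proof (cases "restr_family I H = {}")
      case True then show ?thesis using eq by (simp add: avg_def)
    next
      case False
      then show ?thesis using Ls_avg_even[OF even(1) blocks_restr_family[OF even(2)] False cutsub[OF even(4)]
          restr_family_schreier(2,1)[OF even(2,5,6)]] eq by simp
    qed
  next
    case (tail g s)
    have "restr I f = restr {s..} (restr I g) \<or> restr I f = restr {s..} (- restr I g)"
      using tail(5) by (auto simp: Int_commute restr_uminus)
    moreover have "restr I g = (\<lambda>_. 0) \<or> restr I g \<in> Ls n j" using Suc.IH[OF tail(4) Suc.prems(2)] .
    moreover have "restr {s..} (- (\<lambda>_. 0)) = (\<lambda>_. 0)" "restr {s..} (\<lambda>_. 0) = (\<lambda>_. 0)"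
      by (auto simp: restr_def)
    then have "restr I f = (\<lambda>_. 0)" if "restr I g = (\<lambda>_. 0)"
      using calculation(1) unfolding that by metis
    moreover have "restr I f \<in> Ls (Suc n) j" if "restr I g \<in> Ls n j"
      unfolding Ls_Suc_odd[OF tail(1,2)] pm_def using tail(3) calculation(1) that by blast
    ultimately show ?thesis
      using \<open>restr I g = (\<lambda>_. 0) \<Longrightarrow> restr I f = (\<lambda>_. 0)\<close> by blast
  next
    case (special fs s)
    let ?A = "I \<inter> {s..}"
    let ?y = "scaled_sum (m j) fs"
    have eq: "restr I f = restr ?A ?y" using special(5) by simp
    show ?thesis
    proof (cases "restr ?A ?y = (\<lambda>_. 0)")
      case True then show ?thesis using eq by simp
    next
      case nz: False
      then have Ane: "?A \<noteq> {}" using restr_zero[of ?y ?A] by auto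
      define D where "D = {x. \<exists>y\<in>?A. x \<le> y}"
      define s' where "s' = (LEAST x. x \<in> ?A)"
      have s'A: "s' \<in> ?A" unfolding s'_def using Ane by (metis LeastI ex_in_conv)
      have s'le: "s' \<le> x" if "x \<in> ?A" for x unfolding s'_def using that by (rule Least_le)
      have AD: "?A = {s'..} \<inter> D"
      proof (intro set_eqI iffI)
        fix x assume "x \<in> {s'..} \<inter> D"
        then obtain y where "y \<in> ?A" "x \<le> y" "s' \<le> x" by (auto simp: D_def)
        then show "x \<in> ?A" using s'A Suc.prems(2) unfolding order_convex_def by fastforce
      qed (use s'le in \<open>auto simp: D_def\<close>)
      have eq2: "restr ?A ?y = restr {s'..} (restr D ?y)" by (simp add: AD)
      have nz2: "restr D ?y \<noteq> (\<lambda>_. 0)"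
      proof
        assume "restr D ?y = (\<lambda>_. 0)"
        then have "restr ?A ?y = restr {s'..} (\<lambda>_. 0)" using eq2 by simp
        then show False using nz by (auto simp: restr_def)
      qed
      have Dc: "order_convex D" unfolding D_def by (rule order_convex_lower)
      obtain gs where gs: "special n j gs" "restr D ?y = scaled_sum (m j) gs"
        using special_restr_lower[OF special(4) _ Suc.IH[OF _ Dc] nz2] by (auto simp: D_def intro: order_trans)
      have "s' \<ge> 1" using s'A special(3) by auto
      then show ?thesis unfolding Ls_Suc_odd[OF special(1,2)] using eq eq2 gs by auto
    qed
  qed
qed

section \<open>Functionals of a given index, and their place in \<open>K\<close>\<close>

definition Lc :: "nat \<Rightarrow> (nat \<Rightarrow> real) set" where "Lc j = (\<Union>n. Ls n j)"

definition LL :: "(nat \<Rightarrow> real) set" where "LL = (\<Union>j\<in>{1..}. Lc j)"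

text \<open>Stage 0 puts the signed units into every \<open>Lc j\<close>, so removing them in
  \<open>B_set\<close> and adding them again makes no difference. For the same reason units have to
  be treated separately whenever an index is meant to give a factor \<open>1 / m j\<close>.\<close>

lemma L_set_eq: "L_set m k \<Phi> = LL"
proof -
  have "signed_units \<subseteq> Lc 1" unfolding Lc_def using Ls_0 by blast
  moreover have "f \<in> signed_units \<or> (\<exists>n\<in>{1..}. f \<in> Ls n j - signed_units)" if "f \<in> Ls n j" for n j f
    using that by (cases n) (auto simp: Ls_0)
  then have "Lc j \<subseteq> signed_units \<union> B_set m k \<Phi> j" for j
    unfolding Lc_def B_set_def by blast
  moreover have "B_set m k \<Phi> j \<subseteq> Lc j" for j unfolding Lc_def B_set_def by blast
  moreover have "(1::nat) \<in> {1..}" by simp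
  ultimately show ?thesis unfolding L_set_def LL_def by blast
qed

lemma LcI: "f \<in> Ls n j \<Longrightarrow> f \<in> Lc j" by (auto simp: Lc_def)
lemma LL_I: "f \<in> Lc j \<Longrightarrow> 1 \<le> j \<Longrightarrow> f \<in> LL" by (auto simp: LL_def)

lemma Lc_uminus: "f \<in> Lc j \<Longrightarrow> - f \<in> Lc j" unfolding Lc_def using Ls_pm_Suc(2) by blast
lemma LL_uminus: "f \<in> LL \<Longrightarrow> - f \<in> LL" unfolding LL_def using Lc_uminus by blast

lemma Lc_restr: "f \<in> Lc j \<Longrightarrow> order_convex I \<Longrightarrow> restr I f = (\<lambda>_. 0) \<or> restr I f \<in> Lc j"
  unfolding Lc_def using Ls_restr by blast
lemma LL_restr: "f \<in> LL \<Longrightarrow> order_convex I \<Longrightarrow> restr I f = (\<lambda>_. 0) \<or> restr I f \<in> LL"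
  unfolding LL_def using Lc_restr by blast

lemma Lc_wf: "f \<in> Lc j \<Longrightarrow> finite (supp f) \<and> f 0 = 0" unfolding Lc_def using Ls_wf by blast
lemma LL_wf: "f \<in> LL \<Longrightarrow> finite (supp f) \<and> f 0 = 0" unfolding LL_def using Lc_wf by blast

lemma signed_units_Lc: "f \<in> signed_units \<Longrightarrow> f \<in> Lc j" unfolding Lc_def using Ls_0 by blast

lemma LL_common_stage:
  assumes "finite H" "H \<subseteq> LL" shows "\<exists>n. H \<subseteq> (\<Union>i\<in>{1..}. Ls n i)"
  using assms
proof (induction H rule: finite_induct)
  case (insert f H)
  then obtain n n' i where *: "H \<subseteq> (\<Union>i\<in>{1..}. Ls n i)" "f \<in> Ls n' i" "i \<ge> 1"
    by (auto simp: LL_def Lc_def)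
  have "H \<subseteq> (\<Union>i\<in>{1..}. Ls (max n n') i)" using *(1) Ls_mono[of n "max n n'"] by fastforce
  moreover have "f \<in> Ls (max n n') i" using *(2) Ls_mono[of n' "max n n'"] by simp
  ultimately have "insert f H \<subseteq> (\<Union>i\<in>{1..}. Ls (max n n') i)" using *(3) by auto
  then show ?case by blast
qed auto

lemma Lc_avg_even:
  assumes "even j" "blocks H" "H \<noteq> {}" "H \<subseteq> LL" "successive H" "mn ` H \<in> schreier (k j)"
  shows "avg (m j) H \<in> Lc j"
proof -
  obtain n where "H \<subseteq> (\<Union>i\<in>{1..}. Ls n i)" using LL_common_stage assms by (metis blocks_def)
  then show ?thesis using Ls_avg_even[OF assms(1-3) _ assms(5,6)] LcI by blast
qed

lemma Lc_avg_1:
  assumes "blocks H" "H \<noteq> {}" "H \<subseteq> LL" "\<And>h. h \<in> H \<Longrightarrow> card H \<le> mn h"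
  shows "avg 2 H \<in> Lc 1"
proof -
  obtain n where "H \<subseteq> (\<Union>i\<in>{1..}. Ls n i)" using LL_common_stage assms by (metis blocks_def)
  then show ?thesis using Ls_avg_1[OF assms(1,2) _ assms(4)] LcI by blast
qed

lemma \<Phi>_even: "xs \<in> G_set m k \<Longrightarrow> even (\<Phi> xs) \<and> 2 \<le> \<Phi> xs"
  using coding unfolding coding_function_def by fastforce

lemma \<Phi>_inj: "xs \<in> G_set m k \<Longrightarrow> ys \<in> G_set m k \<Longrightarrow> \<Phi> xs = \<Phi> ys \<Longrightarrow> xs = ys"
  using coding unfolding coding_function_def by (auto dest: inj_onD)

lemma \<Phi>_mono: "xs \<in> G_set m k \<Longrightarrow> 1 \<le> l \<Longrightarrow> l < length xs \<Longrightarrow> \<Phi> (take l xs) < \<Phi> xs"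
  using coding unfolding coding_function_def by blast

lemma G_set_take:
  assumes "sorted_wrt (\<lambda>f g. set_less (supp f) (supp g)) fs" "1 \<le> i" "i \<le> length fs"
    "\<And>l. l < i \<Longrightarrow> fs ! l \<in> K_set m k"
  shows "take i fs \<in> G_set m k"
proof -
  have "set (take i fs) \<subseteq> K_set m k" using assms by (auto simp: in_set_conv_nth)
  then show ?thesis unfolding G_set_def using assms by (auto intro: sorted_wrt_take)
qed

text \<open>That the indices in a special sequence are positive needs a proof. The properties of
  \<open>\<Phi>\<close> are available on lists over \<open>K_set\<close> only, so membership of all
  earlier terms must be known before the next index is; hence the strong induction.\<close>

lemma special_members:
  assumes sp: "special n j fs" and IH: "\<And>f j. 1 \<le> j \<Longrightarrow> f \<in> Ls n j \<Longrightarrow> f \<noteq> (\<lambda>_. 0) \<Longrightarrow> f \<in> K_set m k"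
    and "i < length fs"
  shows "(\<exists>i'\<ge>1. fs ! i \<in> Ls n i') \<and> fs ! i \<in> K_set m k"
  using assms(3)
proof (induction i rule: less_induct)
  case (less i)
  have adm: "admissible (schreier (k j)) (map supp fs)" using sp by (simp add: special_def)
  have ne: "fs ! i \<noteq> (\<lambda>_. 0)" using admissible_list(2)[OF adm] less(2) by (auto simp: blocks_def supp_empty_iff[symmetric])
  have "\<exists>i'\<ge>1. fs ! i \<in> Ls n i'"
  proof (cases "i = 0")
    case True
    obtain r where "r > j" "hd fs \<in> Ls n (2 * r)" using sp by (auto simp: special_def)
    then show ?thesis using True less(2) by (intro exI[of _ "2 * r"]) (auto simp: hd_conv_nth)
  next
    case False
    have "take i fs \<in> G_set m k"
      by (rule G_set_take[OF admissible_list(5)[OF adm]]) (use less False in auto)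
    then have "1 \<le> \<Phi> (take i fs)" using \<Phi>_even by fastforce
    then show ?thesis using sp False less(2) by (auto simp: special_def)
  qed
  then show ?case using IH ne by blast
qed

text \<open>This inclusion makes the coding function applicable to functionals from
  \<open>L\<close>. A special functional qualifies because its members do and the special condition
  is simply forgotten. Tails may be empty, hence the exclusion of zero.\<close>

lemma Ls_subset_K: "1 \<le> j \<Longrightarrow> f \<in> Ls n j \<Longrightarrow> f \<noteq> (\<lambda>_. 0) \<Longrightarrow> f \<in> K_set m k"
proof (induction n arbitrary: f j)
  case 0
  then have "f \<in> K_stage m k 0 1" by (simp add: Ls_0)
  then show ?case by (rule K_setI) simp
next
  case (Suc n)
  have sub: "H \<subseteq> K_set m k" if "blocks H" "H \<subseteq> (\<Union>i\<in>{1..}. Ls n i)" for H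
  proof
    fix h assume "h \<in> H"
    then have "h \<noteq> (\<lambda>_. 0)" "\<exists>i\<ge>1. h \<in> Ls n i" using that by (auto simp: blocks_def supp_empty_iff[symmetric])
    then show "h \<in> K_set m k" using Suc.IH by blast
  qed
  show ?case using Suc.prems(2)
  proof (cases rule: Ls_cases)
    case (pm g)
    have "g \<noteq> (\<lambda>_. 0)" using pm(2) Suc.prems(3) by (auto simp: fun_eq_iff)
    then show ?thesis using Suc.IH[OF Suc.prems(1) pm(1)] pm(2) K_set_uminus by blast
  next
    case (one H) then show ?thesis using K_set_avg_1[OF one(2) sub[OF one(2,4)] one(3,5)] by simp
  next
    case (even H)
    have "2 \<le> j" using even(1) Suc.prems(1) by (cases "j = 1") auto
    then show ?thesis using K_set_avg[OF even(2) sub[OF even(2,4)] even(3,5,6)] even(7) by simp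
  next
    case (tail g s)
    have "order_convex {s..}" by (auto simp: order_convex_def)
    then have "restr {s..} g = (\<lambda>_. 0) \<or> restr {s..} g \<in> Ls n j" using Ls_restr[OF tail(4)] by blast
    moreover have "restr {s..} g \<noteq> (\<lambda>_. 0)" using tail(5) Suc.prems(3) restr_uminus[of "{s..}" g] by (auto simp: fun_eq_iff)
    ultimately have "restr {s..} g \<in> K_set m k" using Suc.IH[OF Suc.prems(1)] by blast
    then show ?thesis using tail(5) K_set_uminus restr_uminus by metis
  next
    case (special fs s)
    have adm: "admissible (schreier (k j)) (map supp fs)" using special by (simp add: special_def)
    note al = admissible_list[OF adm]
    let ?H = "restr_family {s..} (set fs)"
    have eq: "f = avg (m j) ?H" using special(5) avg_restr_family[OF al(2)] scaled_sum_avg[OF al(1)] by simp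
    have "?H \<subseteq> (\<Union>i\<in>{1..}. Ls n i)"
    proof
      fix g assume "g \<in> ?H"
      then obtain h where h: "h \<in> set fs" "supp h \<inter> {s..} \<noteq> {}" "g = restr {s..} h" by (auto simp: restr_family_def)
      then obtain i where "i < length fs" "h = fs ! i" by (auto simp: in_set_conv_nth)
      then obtain i' where i': "i' \<ge> 1" "h \<in> Ls n i'" using special_members[OF special(4), where i = i] Suc.IH by metis
      have "order_convex {s..}" by (auto simp: order_convex_def)
      then show "g \<in> (\<Union>i\<in>{1..}. Ls n i)" using Ls_restr[OF i'(2), of "{s..}"] h(2,3) i'(1)
        by (auto simp: supp_empty_iff[symmetric])
    qed
    then have "?H \<subseteq> K_set m k" using sub blocks_restr_family[OF al(2)] by blast
    moreover have "?H \<noteq> {}" using eq Suc.prems(3) by (auto simp: avg_def)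
    moreover have "2 \<le> j" using special Suc.prems(1) by auto
    ultimately show ?thesis
      using K_set_avg[of ?H m k j] blocks_restr_family[OF al(2)] restr_family_schreier[OF al(2,3,4)] eq by simp
  qed
qed

lemma LL_subset_K: "f \<in> LL \<Longrightarrow> f \<noteq> (\<lambda>_. 0) \<Longrightarrow> f \<in> K_set m k"
  unfolding LL_def Lc_def by (auto intro: Ls_subset_K)

end

text \<open>Free choice of signs, which will turn a sum of values into a sum of absolute
  values.\<close>

lemma blocks_signs:
  assumes "blocks H" "\<And>g. g \<in> H \<Longrightarrow> s g = g \<or> s g = - g"
  shows "blocks (s ` H)" "inj_on s H" "\<And>g. g \<in> H \<Longrightarrow> supp (s g) = supp g" "mn ` s ` H = mn ` H"
proof -
  show sp: "supp (s g) = supp g" if "g \<in> H" for g using assms(2)[OF that] supp_uminus[of g] by metis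
  show "inj_on s H"
  proof (rule inj_onI)
    fix f g assume *: "f \<in> H" "g \<in> H" "s f = s g"
    then have "supp f = supp g" using sp by metis
    moreover obtain i where "i \<in> supp f" using * assms(1) by (auto simp: blocks_def)
    ultimately show "f = g" using blocks_unique[OF assms(1) *(1,2)] by auto
  qed
  have "supp (s f) \<inter> supp (s g) = {}" if "f \<in> H" "g \<in> H" "s f \<noteq> s g" for f g
    using that assms(1) sp[OF that(1)] sp[OF that(2)] unfolding blocks_def disjoint_supports_def by metis
  then show "blocks (s ` H)" using assms(1) sp unfolding blocks_def disjoint_supports_def by auto
  show "mn ` s ` H = mn ` H" using sp by (force simp: mn_def image_image)
qed

section \<open>Disjoint families in \<open>L\<close> and the decomposition of functionals by
  index\<close>

context coded_space
begin

definition fam :: "(nat \<Rightarrow> real) set \<Rightarrow> bool" where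
  "fam H \<longleftrightarrow> blocks H \<and> H \<subseteq> LL"

lemma fam_blocks: "fam H \<Longrightarrow> blocks H" by (simp add: fam_def)
lemma fam_LL: "fam H \<Longrightarrow> h \<in> H \<Longrightarrow> h \<in> LL" by (auto simp: fam_def)
lemma fam_subset: "fam H \<Longrightarrow> H' \<subseteq> H \<Longrightarrow> fam H'" using blocks_subset by (auto simp: fam_def)
lemma fam_finite: "fam H \<Longrightarrow> finite H" by (simp add: fam_def blocks_def)
lemma fam_ne: "fam H \<Longrightarrow> h \<in> H \<Longrightarrow> finite (supp h) \<and> supp h \<noteq> {}" by (simp add: fam_def blocks_def)
lemma fam_inj_mn: "fam H \<Longrightarrow> inj_on mn H" by (simp add: fam_def blocks_inj_mn)

lemma fam_restr: assumes "fam H" "order_convex I" shows "fam (restr_family I H)"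
proof -
  have "g \<in> LL" if g: "g \<in> restr_family I H" for g
  proof -
    obtain h where h: "h \<in> H" "supp h \<inter> I \<noteq> {}" "g = restr I h" using g by (auto simp: restr_family_def)
    have "restr I h \<noteq> (\<lambda>_. 0)" using h(2) by (simp add: supp_empty_iff[symmetric])
    then show ?thesis using LL_restr[OF fam_LL[OF assms(1) h(1)] assms(2)] h by auto
  qed
  then show ?thesis using blocks_restr_family assms(1) by (auto simp: fam_def)
qed

lemma fam_card_less: assumes "fam H" "\<And>h. h \<in> H \<Longrightarrow> mn h < d" shows "card H \<le> d"
  by (rule blocks_card_less[OF fam_blocks[OF assms(1)] assms(2)]) (use fam_LL[OF assms(1)] LL_wf in blast)+

lemma fam_uminus: "fam H \<Longrightarrow> fam (uminus ` H)"
  using blocks_uminus LL_uminus by (auto simp: fam_def)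

lemma special_member_ex:
  assumes "special n j fs" "h \<in> set fs" shows "\<exists>j'. h \<in> Ls n j'"
proof -
  obtain i where i: "i < length fs" "h = fs ! i" using assms(2) by (auto simp: in_set_conv_nth)
  show ?thesis
  proof (cases "i = 0")
    case True then show ?thesis using assms(1) i by (auto simp: special_def hd_conv_nth)
  next
    case False
    then have "fs ! i \<in> Ls n (\<Phi> (take i fs))" using assms(1) i by (simp add: special_def)
    then show ?thesis using i by blast
  qed
qed

lemma special_member_LL:
  assumes "special n j fs" "i < length fs" shows "fs ! i \<in> LL" "fs ! i \<in> K_set m k"
proof -
  have "(\<exists>i'\<ge>1. fs ! i \<in> Ls n i') \<and> fs ! i \<in> K_set m k"
    using special_members[OF assms(1) _ assms(2)] Ls_subset_K by metis
  then show "fs ! i \<in> LL" "fs ! i \<in> K_set m k" by (auto simp: LL_def Lc_def)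
qed

lemma special_avg:
  assumes "special n j fs"
  shows "fam (set fs)" "scaled_sum (m j) fs = avg (m j) (set fs)" "mn ` set fs \<in> schreier (k j)" "distinct fs"
proof -
  have adm: "admissible (schreier (k j)) (map supp fs)" using assms by (simp add: special_def)
  note al = admissible_list[OF adm]
  have "set fs \<subseteq> LL" using special_member_LL(1)[OF assms] by (auto simp: in_set_conv_nth)
  then show "fam (set fs)" using al(2) by (simp add: fam_def)
  show "scaled_sum (m j) fs = avg (m j) (set fs)" "mn ` set fs \<in> schreier (k j)" "distinct fs"
    using al scaled_sum_avg by auto
qed

lemma Ls_bound: "f \<in> Ls n j \<Longrightarrow> \<bar>f i\<bar> \<le> 1"
proof (induction n arbitrary: f j)
  case 0
  then have "f \<in> signed_units" unfolding Ls_0 .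
  then obtain n where n: "supp f = {n}" "\<bar>f n\<bar> = 1" using signed_units_supp[of f] by auto
  have "f i = 0" if "i \<noteq> n" using n(1) that unfolding supp_def by blast
  then show ?case using n(2) by (cases "i = n") auto
next
  case (Suc n)
  have avg: "\<bar>avg a H i\<bar> \<le> 1" if "blocks H" "\<And>h. h \<in> H \<Longrightarrow> \<bar>h i\<bar> \<le> 1" for a H
  proof -
    have "\<bar>avg a H i\<bar> \<le> 1 / real a" using avg_bound[OF that(1)] that(2) by blast
    also have "\<dots> \<le> 1" by (cases "a = 0") auto
    finally show ?thesis .
  qed
  show ?case using Suc.prems
  proof (cases rule: Ls_cases)
    case (pm g) then show ?thesis using Suc.IH[OF pm(1)] by auto
  next
    case (one H) then show ?thesis using avg[OF one(2)] Suc.IH by blast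
  next
    case (even H) then show ?thesis using avg[OF even(2)] Suc.IH by blast
  next
    case (tail g s) then show ?thesis using Suc.IH[OF tail(4)] by (auto simp: restr_def)
  next
    case (special fs s)
    have "\<bar>scaled_sum (m j) fs i\<bar> \<le> 1" unfolding special_avg(2)[OF special(4)]
      using avg[OF fam_blocks[OF special_avg(1)[OF special(4)]]] special_member_ex[OF special(4)] Suc.IH by blast
    then show ?thesis using special(5) by (auto simp: restr_def)
  qed
qed

lemma LL_bound: "f \<in> LL \<Longrightarrow> \<bar>f i\<bar> \<le> 1"
  unfolding LL_def Lc_def using Ls_bound by blast

text \<open>A common form for all functionals of index \<open>j\<close>. The weaker condition
  \<open>wide\<close> replaces the Schreier condition because it also covers index 1, where the
  supports may interlace, and because it survives restriction.\<close>

definition decomposed :: "nat \<Rightarrow> (nat \<Rightarrow> real) \<Rightarrow> bool" where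
  "decomposed j f \<longleftrightarrow> f \<in> signed_units \<or> f = (\<lambda>_. 0) \<or> (\<exists>H. fam H \<and> f = avg (m j) H \<and> mn ` H \<in> wide (k j))"

lemma decomposed_uminus: assumes "decomposed j f" shows "decomposed j (- f)"
  using assms unfolding decomposed_def
proof (elim disjE exE conjE)
  assume "f = (\<lambda>_. 0)"
  then have "- f = (\<lambda>_. 0)" by auto
  then show "- f \<in> signed_units \<or> - f = (\<lambda>_. 0) \<or> (\<exists>H. fam H \<and> - f = avg (m j) H \<and> mn ` H \<in> wide (k j))" by blast
next
  fix H assume H: "fam H" "f = avg (m j) H" "mn ` H \<in> wide (k j)"
  have "mn ` uminus ` H = mn ` H" by (simp add: image_image)
  then have "fam (uminus ` H) \<and> - f = avg (m j) (uminus ` H) \<and> mn ` uminus ` H \<in> wide (k j)"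
    using fam_uminus[OF H(1)] avg_uminus[of "m j" H] H(2,3) by metis
  then show "- f \<in> signed_units \<or> - f = (\<lambda>_. 0) \<or> (\<exists>H. fam H \<and> - f = avg (m j) H \<and> mn ` H \<in> wide (k j))" by blast
qed (use signed_units_uminus in blast)

lemma decomposed_restr: assumes "decomposed j f" "order_convex I" shows "decomposed j (restr I f)"
  using assms(1) unfolding decomposed_def
proof (elim disjE exE conjE)
  assume "f = (\<lambda>_. 0)"
  then have "restr I f = (\<lambda>_. 0)" by (auto simp: restr_def)
  then show "restr I f \<in> signed_units \<or> restr I f = (\<lambda>_. 0) \<or> (\<exists>H. fam H \<and> restr I f = avg (m j) H \<and> mn ` H \<in> wide (k j))" by blast
next
  fix H assume H: "fam H" "f = avg (m j) H" "mn ` H \<in> wide (k j)"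
  then have "fam (restr_family I H) \<and> restr I f = avg (m j) (restr_family I H) \<and> mn ` restr_family I H \<in> wide (k j)"
    using fam_restr[OF H(1) assms(2)] avg_restr_family[OF fam_blocks[OF H(1)]] restr_family_wide[OF fam_blocks[OF H(1)]] by auto
  then show "restr I f \<in> signed_units \<or> restr I f = (\<lambda>_. 0) \<or> (\<exists>H. fam H \<and> restr I f = avg (m j) H \<and> mn ` H \<in> wide (k j))" by blast
qed (use signed_units_restr[of f I] in auto)

lemma Ls_decomposed: "1 \<le> j \<Longrightarrow> f \<in> Ls n j \<Longrightarrow> decomposed j f"
proof (induction n arbitrary: f)
  case 0 then show ?case by (simp add: Ls_0 decomposed_def)
next
  case (Suc n)
  have LL: "H \<subseteq> LL" if H: "H \<subseteq> (\<Union>i\<in>{1..}. Ls n i)" for H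
  proof
    fix x assume "x \<in> H"
    then obtain i where "i \<in> {1..}" "x \<in> Ls n i" using H by blast
    then show "x \<in> LL" using LL_I[OF LcI] by simp
  qed
  show ?case using Suc.prems(2)
  proof (cases rule: Ls_cases)
    case (pm g)
    then show ?thesis using Suc.IH[OF Suc.prems(1) pm(1)] decomposed_uminus by blast
  next
    case (one H)
    have fin: "finite H" using one(2) by (simp add: blocks_def)
    have "mn ` H \<in> wide 1"
      by (rule wide_1[of _ "card H"]) (use fin one(5) in \<open>auto intro: card_image_le\<close>)
    then have "fam H \<and> f = avg (m j) H \<and> mn ` H \<in> wide (k j)"
      unfolding fam_def using one(2,6) LL[OF one(4)] one(1) m_1 k_1 by metis
    then show ?thesis unfolding decomposed_def by blast
  next
    case (even H)
    then show ?thesis unfolding decomposed_def fam_def using LL schreier_subset_wide by blast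
  next
    case (tail g s)
    then show ?thesis using Suc.IH[OF Suc.prems(1) tail(4)] decomposed_uminus decomposed_restr order_convex_atLeast by blast
  next
    case (special fs s)
    have "decomposed j (scaled_sum (m j) fs)" unfolding decomposed_def
      using special_avg[OF special(4)] schreier_subset_wide by blast
    then show ?thesis using decomposed_restr special(5) by simp
  qed
qed

lemma Lc_decompose:
  assumes "1 \<le> j" "f \<in> Lc j" "f \<notin> signed_units" "f \<noteq> (\<lambda>_. 0)"
  obtains H where "fam H" "f = avg (m j) H" "mn ` H \<in> wide (k j)"
  using assms Ls_decomposed unfolding Lc_def decomposed_def by blast

lemma Lc_bound:
  assumes "1 \<le> j" "f \<in> Lc j" "f \<notin> signed_units" shows "\<bar>f i\<bar> \<le> 1 / m j"
proof (cases "f = (\<lambda>_. 0)")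
  case False
  then obtain H where H: "fam H" "f = avg (m j) H" using Lc_decompose assms by metis
  then show ?thesis using avg_bound[OF fam_blocks[OF H(1)]] LL_bound fam_LL by metis
qed auto

text \<open>Signs and tails accumulate along the stages, but a tail of a tail is a tail, so one sign
  and one tail remain.\<close>

lemma Ls_special_cases:
  assumes "odd j" "j \<noteq> 1" "f \<in> Ls n j"
  shows "f \<in> signed_units \<or> f = (\<lambda>_. 0) \<or>
    (\<exists>n fs c s. special n j fs \<and> (c = 1 \<or> c = - 1) \<and> f = (\<lambda>i. c * restr {s..} (scaled_sum (m j) fs) i))"
  using assms(3)
proof (induction n arbitrary: f)
  case 0 then show ?case by (simp add: Ls_0)
next
  case (Suc n)
  let ?S = "\<lambda>f. \<exists>n fs c s. special n j fs \<and> (c = 1 \<or> c = - 1) \<and> f = (\<lambda>i. c * restr {s..} (scaled_sum (m j) fs) i)"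
  have neg: "?S (- f)" if S: "?S f" for f
  proof -
    obtain n fs c s where "special n j fs" "c = 1 \<or> c = - 1" "f = (\<lambda>i. c * restr {s..} (scaled_sum (m j) fs) i)" using S by blast
    then have "special n j fs \<and> (- c = 1 \<or> - c = - 1) \<and> - f = (\<lambda>i. - c * restr {s..} (scaled_sum (m j) fs) i)" by auto
    then show ?thesis by blast
  qed
  have tl: "?S (restr {s..} f)" if S: "?S f" for f s
  proof -
    obtain n fs c s' where "special n j fs" "c = 1 \<or> c = - 1" "f = (\<lambda>i. c * restr {s'..} (scaled_sum (m j) fs) i)" using S by blast
    then have "special n j fs \<and> (c = 1 \<or> c = - 1) \<and> restr {s..} f = (\<lambda>i. c * restr {max s s'..} (scaled_sum (m j) fs) i)"
      by (auto simp: restr_def)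
    then show ?thesis by blast
  qed
  let ?P = "\<lambda>f. f \<in> signed_units \<or> f = (\<lambda>_. 0) \<or> ?S f"
  have neg': "?P (- g)" if g: "?P g" for g
  proof -
    have "- (\<lambda>_. 0) = (\<lambda>_::nat. 0::real)" by (rule ext) simp
    then show ?thesis using g neg[of g] signed_units_uminus[of g]
      by (elim disjE[of "g \<in> signed_units"] disjE[of "g = (\<lambda>_. 0)"]) (simp_all only: simp_thms)
  qed
  have tl': "?P (restr {s..} g)" if g: "?P g" for g s
  proof -
    have "restr {s..} (\<lambda>_. 0) = (\<lambda>_. 0)" by (simp add: restr_def)
    moreover have "restr {s..} g \<in> signed_units \<or> restr {s..} g = (\<lambda>_. 0)" if "g \<in> signed_units"
      using signed_units_restr[OF that, of "{s..}"] that by (elim disjE) (simp_all only: simp_thms)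
    ultimately show ?thesis using g tl[of g s]
      by (elim disjE[of "g \<in> signed_units"] disjE[of "g = (\<lambda>_. 0)"]) (simp_all only: simp_thms, blast)
  qed
  show ?case using Suc.prems
  proof (cases rule: Ls_cases)
    case (pm g)
    show ?thesis using pm(2) Suc.IH[OF pm(1)] neg'[OF Suc.IH[OF pm(1)]] by (elim disjE[of "f = g"]) (simp_all only: )
  next
    case (one H) then show ?thesis using assms by simp
  next
    case (even H) then show ?thesis using assms by simp
  next
    case (tail g s)
    show ?thesis using tail(5) tl'[OF Suc.IH[OF tail(4)], of s] tl'[OF neg'[OF Suc.IH[OF tail(4)]], of s]
      by (elim disjE[of "f = restr {s..} g"]) (simp_all only: )
  next
    case (special fs s)
    then have "special n j fs \<and> ((1::real) = 1 \<or> (1::real) = - 1) \<and> f = (\<lambda>i. 1 * restr {s..} (scaled_sum (m j) fs) i)" by simp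
    then show ?thesis by blast
  qed
qed

subsection \<open>The norm\<close>

definition N :: "(nat \<Rightarrow> real) \<Rightarrow> real" where "N x = norm_by (L_set m k \<Phi>) x"

lemma N_eq: "N x = (SUP f\<in>LL. ip f x)"
  unfolding N_def norm_by_def L_set_eq ip_def ..

lemma ip_l1: "f \<in> LL \<Longrightarrow> \<bar>ip f x\<bar> \<le> (\<Sum>i\<in>supp x. \<bar>x i\<bar>)"
proof -
  assume f: "f \<in> LL"
  have "\<bar>ip f x\<bar> \<le> (\<Sum>i\<in>supp x. \<bar>f i * x i\<bar>)" unfolding ip_def by (rule sum_abs)
  also have "\<dots> \<le> (\<Sum>i\<in>supp x. \<bar>x i\<bar>)"
  proof (rule sum_mono)
    fix i show "\<bar>f i * x i\<bar> \<le> \<bar>x i\<bar>"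
      using mult_right_mono[OF LL_bound[OF f, of i], of "\<bar>x i\<bar>"] by (simp add: abs_mult)
  qed
  finally show ?thesis .
qed

lemma unit_LL: "1 \<le> i \<Longrightarrow> unit_vec i \<in> LL"
  by (rule LL_I[of _ 1]) (auto intro!: signed_units_Lc simp: signed_units_def)

lemma LL_ne: "LL \<noteq> {}" using unit_LL by blast

lemma bdd_LL: "bdd_above ((\<lambda>f. ip f x) ` LL)"
  using ip_l1[of _ x] by (intro bdd_aboveI[of _ "\<Sum>i\<in>supp x. \<bar>x i\<bar>"]) (auto dest: abs_le_D1)

lemma ip_le_N': "f \<in> LL \<Longrightarrow> ip f x \<le> N x"
  unfolding N_eq using bdd_LL by (rule cSUP_upper2) auto

lemma ip_le_N: "f \<in> LL \<Longrightarrow> \<bar>ip f x\<bar> \<le> N x"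
  using ip_le_N'[of f x] ip_le_N'[of "- f" x] LL_uminus[of f] by (auto simp: abs_le_iff)

lemma N_leI: "(\<And>f. f \<in> LL \<Longrightarrow> ip f x \<le> B) \<Longrightarrow> N x \<le> B"
  unfolding N_eq using LL_ne by (rule cSUP_least)

lemma N_nonneg: "0 \<le> N x"
  using ip_le_N[of "unit_vec 1" x] unit_LL[of 1] by linarith

lemma N_le_l1: "N x \<le> (\<Sum>i\<in>supp x. \<bar>x i\<bar>)"
  by (rule N_leI) (use ip_l1 in \<open>auto dest: abs_le_D1\<close>)

lemma coord_le_N: assumes "x \<in> c00" shows "\<bar>x i\<bar> \<le> N x"
proof (cases "x i = 0")
  case True then show ?thesis using N_nonneg by simp
next
  case False
  then have i: "1 \<le> i" "i \<in> supp x" "finite (supp x)" using assms by (auto simp: c00_def supp_def Suc_le_eq intro: gr0I)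
  have "ip (unit_vec i) x = (\<Sum>i'\<in>supp x. if i' = i then x i else 0)"
    unfolding ip_def by (intro sum.cong) (auto simp: unit_vec_def)
  then have "ip (unit_vec i) x = x i" using i by simp
  then show ?thesis using ip_le_N[OF unit_LL[OF i(1)], of x] by simp
qed

lemma N_pos: assumes "x \<in> c00" "supp x \<noteq> {}" shows "0 < N x"
proof -
  obtain i where "x i \<noteq> 0" using assms by (auto simp: supp_def)
  then show ?thesis using coord_le_N[OF assms(1), of i] by linarith
qed

lemma N_attain: assumes "c < N x" obtains f where "f \<in> LL" "c < ip f x"
proof -
  have "\<exists>f\<in>LL. c < ip f x" using assms unfolding N_eq by (subst (asm) less_cSUP_iff[OF LL_ne bdd_LL])
  then show ?thesis using that by blast
qed

lemma N_sum_le: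
  assumes "finite A" "\<And>k. k \<in> A \<Longrightarrow> x k \<in> c00"
  shows "N (\<lambda>i. \<Sum>k\<in>A. a k * x k i) \<le> (\<Sum>k\<in>A. \<bar>a k\<bar> * N (x k))"
proof (rule N_leI)
  fix f assume f: "f \<in> LL"
  have "ip f (\<lambda>i. \<Sum>k\<in>A. a k * x k i) = (\<Sum>k\<in>A. a k * ip f (x k))" using assms by (rule ip_sum_right)
  also have "\<dots> \<le> (\<Sum>k\<in>A. \<bar>a k\<bar> * N (x k))"
  proof (rule sum_mono)
    fix k
    have "a k * ip f (x k) \<le> \<bar>a k\<bar> * \<bar>ip f (x k)\<bar>" by (metis abs_ge_self abs_mult)
    also have "\<dots> \<le> \<bar>a k\<bar> * N (x k)" using ip_le_N[OF f] by (intro mult_left_mono) auto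
    finally show "a k * ip f (x k) \<le> \<bar>a k\<bar> * N (x k)" .
  qed
  finally show "ip f (\<lambda>i. \<Sum>k\<in>A. a k * x k i) \<le> (\<Sum>k\<in>A. \<bar>a k\<bar> * N (x k))" .
qed

lemma N_scale_le: "x \<in> c00 \<Longrightarrow> N (\<lambda>i. c * x i) \<le> \<bar>c\<bar> * N x"
  using N_sum_le[of "{()}" "\<lambda>_. x" "\<lambda>_. c"] by simp

lemma N_scale: assumes "x \<in> c00" shows "N (\<lambda>i. c * x i) = \<bar>c\<bar> * N x"
proof (cases "c = 0")
  case True
  have "N (\<lambda>i. c * x i) \<le> 0" using N_scale_le[OF assms, of c] True by simp
  then show ?thesis using N_nonneg[of "\<lambda>i. c * x i"] True by simp
next
  case False
  have "N x \<le> \<bar>1 / c\<bar> * N (\<lambda>i. c * x i)"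
    using N_scale_le[OF c00_scale[OF assms, of c], of "1 / c"] False by simp
  then have "\<bar>c\<bar> * N x \<le> N (\<lambda>i. c * x i)" using False by (simp add: field_simps)
  then show ?thesis using N_scale_le[OF assms, of c] by simp
qed

lemma ip_restr_right: assumes "x \<in> c00" shows "ip f (restr I x) = ip (restr I f) x"
proof -
  have "ip f (restr I x) = (\<Sum>i\<in>supp x. f i * restr I x i)"
    using c00_supp[OF assms] by (intro ip_alt) auto
  also have "\<dots> = ip (restr I f) x" unfolding ip_def by (intro sum.cong) (auto simp: restr_def)
  finally show ?thesis .
qed

lemma N_restr: assumes "x \<in> c00" "order_convex I" shows "N (restr I x) \<le> N x"
proof (rule N_leI)
  fix f assume f: "f \<in> LL"
  show "ip f (restr I x) \<le> N x"
    unfolding ip_restr_right[OF assms(1)] using LL_restr[OF f assms(2)] ip_le_N'[of "restr I f" x] N_nonneg[of x]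
    by auto
qed

text \<open>After everything below \<open>d\<close> has been cut off, at most \<open>d\<close>
  functionals remain and all of them start at \<open>d\<close> or later. With suitable signs they
  are admissible for index 1, however they interlace, and the factor 2 undoes the weight of that
  operation.\<close>

lemma fam_l1:
  assumes "fam H" "card H \<le> d" "supp x \<subseteq> {d..}"
  shows "(\<Sum>h\<in>H. \<bar>ip h x\<bar>) \<le> 2 * N x"
proof -
  let ?H = "restr_family {d..} H"
  have fH: "fam ?H" by (rule fam_restr[OF assms(1)]) simp
  have eq: "(\<Sum>h\<in>H. \<bar>ip h x\<bar>) = (\<Sum>h\<in>?H. \<bar>ip h x\<bar>)"
    using sum_restr_family[OF fam_blocks[OF assms(1)], of "\<lambda>h. \<bar>ip h x\<bar>" "{d..}"] ip_restr[OF assms(3)] by simp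
  show ?thesis
  proof (cases "?H = {}")
    case True then show ?thesis using eq N_nonneg[of x] by simp
  next
    case False
    define s where "s = (\<lambda>g. if ip g x \<ge> 0 then g else - g)"
    have "s g = g \<or> s g = - g" for g by (simp add: s_def)
    note bs = blocks_signs[OF fam_blocks[OF fH] this]
    have "s ` ?H \<subseteq> LL" using fam_LL[OF fH] LL_uminus by (auto simp: s_def)
    moreover have "card (s ` ?H) \<le> mn h" if h: "h \<in> s ` ?H" for h
    proof -
      have "card (s ` ?H) \<le> card ?H" using fam_finite[OF fH] by (rule card_image_le)
      also have "\<dots> \<le> card H" using fam_finite[OF assms(1)] by (rule card_restr_family)
      also have "\<dots> \<le> d" by fact
      also have "d \<le> mn h"
      proof -
        obtain g where g: "g \<in> ?H" "supp h = supp g" using h bs(3) by auto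
        then have "supp h \<subseteq> {d..}" by (auto simp: restr_family_def)
        moreover have "mn h \<in> supp h" using fam_ne[OF fH g(1)] g(2) by (intro mn_in) auto
        ultimately show ?thesis by auto
      qed
      finally show ?thesis .
    qed
    ultimately have "avg 2 (s ` ?H) \<in> Lc 1" using False by (intro Lc_avg_1 bs(1)) auto
    then have "\<bar>ip (avg 2 (s ` ?H)) x\<bar> \<le> N x" by (intro ip_le_N LL_I) auto
    moreover have "(\<Sum>g\<in>s ` ?H. ip g x) = (\<Sum>h\<in>?H. \<bar>ip h x\<bar>)"
      using bs(2) by (subst sum.reindex) (auto simp: s_def intro!: sum.cong)
    ultimately show ?thesis using eq unfolding ip_avg by simp
  qed
qed

section \<open>Unfolding functionals along their trees\<close>

lemma fam_UN:
  assumes "fam H" "\<And>h. h \<in> H \<Longrightarrow> fam (F h)" "\<And>h g. h \<in> H \<Longrightarrow> g \<in> F h \<Longrightarrow> supp g \<subseteq> supp h"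
  shows "fam (\<Union>h\<in>H. F h)" "\<And>h h'. h \<in> H \<Longrightarrow> h' \<in> H \<Longrightarrow> h \<noteq> h' \<Longrightarrow> F h \<inter> F h' = {}"
proof -
  show dj: "F h \<inter> F h' = {}" if hh: "h \<in> H" "h' \<in> H" "h \<noteq> h'" for h h'
  proof (rule ccontr)
    assume "F h \<inter> F h' \<noteq> {}"
    then obtain g where g: "g \<in> F h" "g \<in> F h'" by auto
    obtain i where "i \<in> supp g" using fam_ne[OF assms(2)[OF hh(1)] g(1)] by auto
    then show False using assms(3)[OF hh(1) g(1)] assms(3)[OF hh(2) g(2)] blocks_unique[OF fam_blocks[OF assms(1)] hh(1,2)] hh(3) by auto
  qed
  have "f = g" if fg: "f \<in> (\<Union>h\<in>H. F h)" "g \<in> (\<Union>h\<in>H. F h)" and i: "i \<in> supp f" "i \<in> supp g" for f g i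
  proof -
    obtain h h' where h: "h \<in> H" "f \<in> F h" "h' \<in> H" "g \<in> F h'" using fg by auto
    then have "h = h'" using blocks_unique[OF fam_blocks[OF assms(1)]] assms(3) i by blast
    then show ?thesis using blocks_unique[OF fam_blocks[OF assms(2)[OF h(1)]]] h i by auto
  qed
  then have "disjoint_supports (\<Union>h\<in>H. F h)" unfolding disjoint_supports_def by blast
  moreover have "finite (\<Union>h\<in>H. F h)" using fam_finite assms by blast
  ultimately show "fam (\<Union>h\<in>H. F h)" using assms(2) unfolding fam_def blocks_def by blast
qed

text \<open>Coefficients arise separately for every parent \<open>h\<close>. As the families of
  children are disjoint, they can be merged into one function of the child alone.\<close>

lemma common_weight:
  assumes "\<And>h h'. h \<in> H \<Longrightarrow> h' \<in> H \<Longrightarrow> h \<noteq> h' \<Longrightarrow> F h \<inter> F h' = {}"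
  shows "\<exists>w. \<forall>h\<in>H. \<forall>g\<in>F h. w g = c h g"
proof (intro exI ballI)
  fix h g assume hg: "h \<in> H" "g \<in> F h"
  have "(SOME h'. h' \<in> H \<and> g \<in> F h') = h"
    using hg assms by (intro some_equality) auto
  then show "c (SOME h'. h' \<in> H \<and> g \<in> F h') g = c h g" by simp
qed

text \<open>A cut through the tree of \<open>h\<close>: a branch ends at a signed unit, at the first
  functional of index \<open>J\<close> or more, or after \<open>r\<close> levels, when its
  coefficient has been halved \<open>r\<close> times.\<close>

definition expansion :: "nat \<Rightarrow> nat \<Rightarrow> (nat \<Rightarrow> real) \<Rightarrow> (nat \<Rightarrow> real) set \<Rightarrow> ((nat \<Rightarrow> real) \<Rightarrow> real) \<Rightarrow> bool" where
  "expansion J r h F w \<longleftrightarrow> fam F \<and> (\<forall>g\<in>F. 0 \<le> w g \<and> w g \<le> 1 \<and> supp g \<subseteq> supp h) \<and> h = (\<lambda>i. \<Sum>g\<in>F. w g * g i) \<and>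
    (\<forall>g\<in>F. w g \<le> (1/2) ^ r \<or> g \<in> signed_units \<or> (\<exists>s\<ge>J. g \<in> Lc s))"

lemma expansion_cong:
  assumes "expansion J r h F w" "\<And>g. g \<in> F \<Longrightarrow> v g = w g" shows "expansion J r h F v"
proof -
  have "(\<Sum>g\<in>F. w g * g i) = (\<Sum>g\<in>F. v g * g i)" for i using assms(2) by (intro sum.cong) auto
  then have "h = (\<lambda>i. \<Sum>g\<in>F. v g * g i)" using assms(1) unfolding expansion_def by metis
  moreover have p: "\<forall>g\<in>F. 0 \<le> w g \<and> w g \<le> 1 \<and> supp g \<subseteq> supp h" "fam F"
    "\<forall>g\<in>F. w g \<le> (1/2) ^ r \<or> g \<in> signed_units \<or> (\<exists>s\<ge>J. g \<in> Lc s)"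
    using assms(1) unfolding expansion_def by blast+
  have "\<forall>g\<in>F. 0 \<le> v g \<and> v g \<le> 1 \<and> supp g \<subseteq> supp h" using p(1) assms(2) by simp
  moreover have "\<forall>g\<in>F. v g \<le> (1/2) ^ r \<or> g \<in> signed_units \<or> (\<exists>s\<ge>J. g \<in> Lc s)" using p(3) assms(2) by simp
  ultimately show ?thesis using p(2) unfolding expansion_def by blast
qed

text \<open>A functional of index \<open>s < J\<close> is replaced by its children. The weight
  \<open>m s \<ge> 2\<close> at least halves the coefficient, and the starting points gain at most
  the level \<open>k (J - 1)\<close>; the single starting point of \<open>h\<close> has level
  0.\<close>

lemma expand:
  assumes "2 \<le> J" "h \<in> LL" "supp h \<noteq> {}"
  shows "\<exists>F w. expansion J r h F w \<and> mn ` F \<in> wide (r * k (J - 1))"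
  using assms(2,3)
proof (induction r arbitrary: h)
  case 0
  have "fam {h}" using 0 LL_wf by (auto simp: fam_def blocks_def disjoint_supports_def)
  moreover have "mn h \<noteq> 0"
    using mn_in[of h] LL_wf[OF 0(1)] 0(2) unfolding supp_def by (metis mem_Collect_eq)
  ultimately show ?case unfolding expansion_def by (intro exI[of _ "{h}"] exI[of _ "\<lambda>_. 1"]) auto
next
  case (Suc r)
  let ?\<kappa> = "k (J - 1)"
  show ?case
  proof (cases "h \<in> signed_units \<or> (\<exists>s\<ge>J. h \<in> Lc s)")
    case True
    have "fam {h}" using Suc.prems LL_wf by (auto simp: fam_def blocks_def disjoint_supports_def)
    moreover have "mn h \<noteq> 0"
      using mn_in[of h] LL_wf[OF Suc.prems(1)] Suc.prems(2) unfolding supp_def by (metis mem_Collect_eq)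
    then have "mn ` {h} \<in> wide 0" by auto
    then have "mn ` {h} \<in> wide (Suc r * ?\<kappa>)" by (rule wide_mono[rotated]) simp
    ultimately show ?thesis using True unfolding expansion_def by (intro exI[of _ "{h}"] exI[of _ "\<lambda>_. 1"]) auto
  next
    case False
    obtain s where s: "1 \<le> s" "h \<in> Lc s" using Suc.prems(1) by (auto simp: LL_def)
    have sJ: "s < J" using False s by (meson not_le)
    have "h \<noteq> (\<lambda>_. 0)" using Suc.prems(2) by auto
    then obtain H where H: "fam H" "h = avg (m s) H" "mn ` H \<in> wide (k s)"
      using Lc_decompose[OF s] False by blast
    have ms: "2 \<le> m s" using m_ge_2[OF s(1)] .
    have sH: "supp h = \<Union>(supp ` H)" using supp_avg[OF fam_blocks[OF H(1)], of "m s"] H(2) ms by simp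
    have "\<forall>g\<in>H. \<exists>F w. expansion J r g F w \<and> mn ` F \<in> wide (r * ?\<kappa>)"
      using Suc.IH fam_LL[OF H(1)] fam_ne[OF H(1)] by blast
    then obtain F w where E: "\<And>g. g \<in> H \<Longrightarrow> expansion J r g (F g) (w g)"
      and Fw: "\<And>g. g \<in> H \<Longrightarrow> mn ` F g \<in> wide (r * ?\<kappa>)" by metis
    have F: "fam (F g) \<and> (\<forall>f\<in>F g. 0 \<le> w g f \<and> w g f \<le> 1 \<and> supp f \<subseteq> supp g) \<and>
      g = (\<lambda>i. \<Sum>f\<in>F g. w g f * f i) \<and> mn ` F g \<in> wide (r * ?\<kappa>) \<and>
      (\<forall>f\<in>F g. w g f \<le> (1/2) ^ r \<or> f \<in> signed_units \<or> (\<exists>s\<ge>J. f \<in> Lc s))" if "g \<in> H" for g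
      using E[OF that] Fw[OF that] unfolding expansion_def by blast
    have un: "fam (\<Union>g\<in>H. F g)" "\<And>g g'. g \<in> H \<Longrightarrow> g' \<in> H \<Longrightarrow> g \<noteq> g' \<Longrightarrow> F g \<inter> F g' = {}"
      using fam_UN[of H F] H(1) F by blast+
    obtain v where v: "\<forall>g\<in>H. \<forall>f\<in>F g. v f = w g f / m s"
      using common_weight[of H F "\<lambda>g f. w g f / m s"] un(2) by blast
    have rep: "h = (\<lambda>i. \<Sum>f\<in>(\<Union>g\<in>H. F g). v f * f i)"
    proof
      fix i
      have "(\<Sum>f\<in>(\<Union>g\<in>H. F g). v f * f i) = (\<Sum>g\<in>H. \<Sum>f\<in>F g. v f * f i)"
        using un(2) fam_finite[OF H(1)] F fam_finite by (intro sum.UNION_disjoint) auto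
      also have "\<dots> = (\<Sum>g\<in>H. 1 / m s * g i)"
      proof (rule sum.cong)
        fix g assume g: "g \<in> H"
        have "(\<Sum>f\<in>F g. v f * f i) = 1 / m s * (\<Sum>f\<in>F g. w g f * f i)"
          unfolding sum_distrib_left using v g by (intro sum.cong) auto
        also have "(\<Sum>f\<in>F g. w g f * f i) = g i" using F[OF g] by metis
        finally show "(\<Sum>f\<in>F g. v f * f i) = 1 / m s * g i" .
      qed simp
      finally show "h i = (\<Sum>f\<in>(\<Union>g\<in>H. F g). v f * f i)" using H(2) by (simp add: avg_def sum_distrib_left)
    qed
    have "(\<Union>g\<in>H. mn ` F g) \<in> wide (?\<kappa> + r * ?\<kappa>)"
    proof (rule wide_bind[of mn])
      show "mn ` H \<in> wide ?\<kappa>" by (rule wide_mono[OF k_mono H(3)]) (use s sJ in auto)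
      show "inj_on mn H" using fam_inj_mn[OF H(1)] .
      show "\<And>x. x \<in> H \<Longrightarrow> mn ` F x \<in> wide (r * ?\<kappa>)" using F by blast
      show "mn x \<le> y" if xy: "x \<in> H" "y \<in> mn ` F x" for x y
      proof -
        obtain f where f: "f \<in> F x" "y = mn f" using xy(2) by auto
        then have "y \<in> supp f" using F[OF xy(1)] fam_ne mn_in by metis
        then have "y \<in> supp x" using F[OF xy(1)] f by blast
        then show ?thesis using fam_ne[OF H(1) xy(1)] by (intro mn_le) auto
      qed
    qed
    then have wd: "mn ` (\<Union>g\<in>H. F g) \<in> wide (Suc r * ?\<kappa>)" by (simp add: image_UN)
    have wt: "0 \<le> v f \<and> v f \<le> 1 \<and> supp f \<subseteq> supp h" "v f \<le> (1/2) ^ Suc r \<or> f \<in> signed_units \<or> (\<exists>s\<ge>J. f \<in> Lc s)"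
      if f: "f \<in> (\<Union>g\<in>H. F g)" for f
    proof -
      obtain g where g: "g \<in> H" "f \<in> F g" using f by auto
      have vf: "v f = w g f / m s" using v g by blast
      have w01: "0 \<le> w g f" "w g f \<le> 1" "supp f \<subseteq> supp g" using F[OF g(1)] g(2) by auto
      have half: "w g f / m s \<le> w g f / 2" using ms w01 by (intro divide_left_mono) auto
      show "0 \<le> v f \<and> v f \<le> 1 \<and> supp f \<subseteq> supp h" 
      proof (intro conjI)
        show "0 \<le> v f" using vf w01(1) by simp
        show "v f \<le> 1" using vf half w01 by linarith
        show "supp f \<subseteq> supp h" using w01(3) sH g(1) by blast
      qed
      show "v f \<le> (1/2) ^ Suc r \<or> f \<in> signed_units \<or> (\<exists>s\<ge>J. f \<in> Lc s)"
      proof -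
        have "w g f \<le> (1/2) ^ r \<or> f \<in> signed_units \<or> (\<exists>s\<ge>J. f \<in> Lc s)" using F[OF g(1)] g(2) by blast
        then show ?thesis using vf half by auto
      qed
    qed
    have "expansion J (Suc r) h (\<Union>g\<in>H. F g) v" unfolding expansion_def using un(1) rep wt by blast
    then show ?thesis using wd by blast
  qed
qed

lemma expand_fam:
  assumes "2 \<le> J" "fam H" "mn ` H \<in> wide n"
  obtains F w where "fam (\<Union>h\<in>H. F h)" "\<And>h h'. h \<in> H \<Longrightarrow> h' \<in> H \<Longrightarrow> h \<noteq> h' \<Longrightarrow> F h \<inter> F h' = {}"
    "\<And>h. h \<in> H \<Longrightarrow> expansion J r h (F h) w" "mn ` (\<Union>h\<in>H. F h) \<in> wide (n + r * k (J - 1))"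
proof -
  let ?\<kappa> = "k (J - 1)"
  have "\<forall>g\<in>H. \<exists>F w. expansion J r g F w \<and> mn ` F \<in> wide (r * ?\<kappa>)"
    using expand[OF assms(1)] fam_LL[OF assms(2)] fam_ne[OF assms(2)] by blast
  then obtain F w where E: "\<And>g. g \<in> H \<Longrightarrow> expansion J r g (F g) (w g)"
    and Fw: "\<And>g. g \<in> H \<Longrightarrow> mn ` F g \<in> wide (r * ?\<kappa>)" by metis
  have F: "fam (F g)" "\<And>f. f \<in> F g \<Longrightarrow> supp f \<subseteq> supp g" if "g \<in> H" for g
    using E[OF that] unfolding expansion_def by blast+
  have un: "fam (\<Union>g\<in>H. F g)" "\<And>g g'. g \<in> H \<Longrightarrow> g' \<in> H \<Longrightarrow> g \<noteq> g' \<Longrightarrow> F g \<inter> F g' = {}"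
    using fam_UN[of H F] assms(2) F by blast+
  obtain v where v: "\<forall>g\<in>H. \<forall>f\<in>F g. v f = w g f"
    using common_weight[of H F w] un(2) by blast
  have "(\<Union>g\<in>H. mn ` F g) \<in> wide (n + r * ?\<kappa>)"
  proof (rule wide_bind[of mn])
    show "mn x \<le> y" if xy: "x \<in> H" "y \<in> mn ` F x" for x y
    proof -
      obtain f where f: "f \<in> F x" "y = mn f" using xy(2) by auto
      then have "y \<in> supp f" using F[OF xy(1)] fam_ne mn_in by metis
      then have "y \<in> supp x" using F(2)[OF xy(1)] f by blast
      then show ?thesis using fam_ne[OF assms(2) xy(1)] by (intro mn_le) auto
    qed
  qed (use assms Fw fam_inj_mn in auto)
  then have "mn ` (\<Union>g\<in>H. F g) \<in> wide (n + r * ?\<kappa>)" by (simp add: image_UN)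
  moreover have "expansion J r h (F h) v" if h: "h \<in> H" for h
    using expansion_cong[OF E[OF h]] v h by blast
  ultimately show ?thesis using that un by blast
qed

end

subsection \<open>Block sequences\<close>

text \<open>Doubling is the growth needed for the geometric series in the repeated averages.\<close>

definition growing :: "(nat \<Rightarrow> nat) \<Rightarrow> bool" where
  "growing d \<longleftrightarrow> (\<forall>k. 1 \<le> d k \<and> 2 * d k \<le> d (Suc k))"

definition small_on_wide :: "(nat \<Rightarrow> nat) \<Rightarrow> (nat \<Rightarrow> real) \<Rightarrow> nat \<Rightarrow> nat \<Rightarrow> real \<Rightarrow> bool" where
  "small_on_wide d a K n \<delta> \<longleftrightarrow> (\<forall>l. 0 \<le> a l) \<and> sum a {0..<K} = 1 \<and> (\<forall>G\<in>wide n. hit_mass d a 0 K G \<le> \<delta>)"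

lemma growing_less: "growing d \<Longrightarrow> d l < d (Suc l)"
proof -
  assume "growing d"
  then have "1 \<le> d l" "2 * d l \<le> d (Suc l)" by (auto simp: growing_def)
  then show ?thesis by linarith
qed

lemma growing_mono: "growing d \<Longrightarrow> i \<le> j \<Longrightarrow> d i \<le> d j"
  by (rule growth_mono) (simp add: growing_def)

lemma growing_disjoint: "growing d \<Longrightarrow> x \<in> {d i..<d (Suc i)} \<Longrightarrow> x \<in> {d j..<d (Suc j)} \<Longrightarrow> i = j"
  by (rule growth_disjoint[of d x i j]) (simp_all add: growing_def)

text \<open>Dependent choice adapted to block sequences: \<open>lo\<close> and \<open>hi\<close> are
  meant as bounds for the support of the chosen object, and \<open>R\<close> ties each choice to the
  preceding one.\<close>

lemma choose_growing_from:
  fixes lo hi :: "'a \<Rightarrow> nat"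
  assumes "P z0" "1 \<le> lo z0" "\<And>n z'. P z' \<Longrightarrow> \<exists>z. P z \<and> n \<le> lo z \<and> R z' z"
  obtains z where "z 0 = z0" "\<And>l. P (z l)" "growing (\<lambda>l. lo (z l))" "\<And>l. hi (z l) \<le> lo (z (Suc l))"
    "\<And>l. R (z l) (z (Suc l))"
proof -
  have "\<exists>f. \<forall>l. (P (f l) \<and> (l = 0 \<longrightarrow> f l = z0)) \<and>
      (max (hi (f l)) (2 * lo (f l)) \<le> lo (f (Suc l)) \<and> R (f l) (f (Suc l)))"
  proof (rule dependent_nat_choice)
    show "\<exists>z. P z \<and> ((0::nat) = 0 \<longrightarrow> z = z0)" using assms(1) by auto
    fix z and l :: nat assume "P z \<and> (l = 0 \<longrightarrow> z = z0)"
    then show "\<exists>y. (P y \<and> (Suc l = 0 \<longrightarrow> y = z0)) \<and> max (hi z) (2 * lo z) \<le> lo y \<and> R z y"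
      using assms(3)[of z "max (hi z) (2 * lo z)"] by auto
  qed
  then obtain z where z: "\<And>l. P (z l) \<and> (l = 0 \<longrightarrow> z l = z0)"
    "\<And>l. max (hi (z l)) (2 * lo (z l)) \<le> lo (z (Suc l)) \<and> R (z l) (z (Suc l))" by blast
  have "1 \<le> lo (z l)" for l
  proof (induction l)
    case 0 then show ?case using z(1)[of 0] assms(2) by simp
  next
    case (Suc l) then show ?case using z(2)[of l] by simp
  qed
  then have "growing (\<lambda>l. lo (z l))" unfolding growing_def using z(2) by simp
  then show ?thesis using that[of z] z by auto
qed

lemma choose_growing:
  fixes lo hi :: "'a \<Rightarrow> nat"
  assumes "\<exists>z. P z \<and> max 1 n0 \<le> lo z" "\<And>n z'. P z' \<Longrightarrow> \<exists>z. P z \<and> n \<le> lo z \<and> R z' z"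
  obtains z where "\<And>l. P (z l)" "n0 \<le> lo (z 0)" "growing (\<lambda>l. lo (z l))" "\<And>l. hi (z l) \<le> lo (z (Suc l))"
    "\<And>l. R (z l) (z (Suc l))"
proof -
  obtain z0 where z0: "P z0" "max 1 n0 \<le> lo z0" using assms(1) by blast
  then have lo: "1 \<le> lo z0" "n0 \<le> lo z0" by simp_all
  obtain z where "z 0 = z0" "\<And>l. P (z l)" "growing (\<lambda>l. lo (z l))" "\<And>l. hi (z l) \<le> lo (z (Suc l))" "\<And>l. R (z l) (z (Suc l))"
    by (rule choose_growing_from[of P z0 lo R hi, OF z0(1) lo(1) assms(2)], assumption) (rule that)
  then show ?thesis using lo(2) by (intro that[of z]) auto
qed

lemma ip_block_sum:
  assumes "growing d" "\<And>l. x l \<in> c00" "\<And>l. supp (x l) \<subseteq> {d l..<d (Suc l)}" "supp f \<subseteq> {d l..<d (Suc l)}" "l < K"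
  shows "ip f (\<lambda>i. \<Sum>l\<in>{0..<K}. a l * x l i) = a l * ip f (x l)"
proof -
  have "ip f (\<lambda>i. \<Sum>l\<in>{0..<K}. a l * x l i) = (\<Sum>l'\<in>{0..<K}. a l' * ip f (x l'))" using assms(2) by (intro ip_sum_right) auto
  also have "\<dots> = (\<Sum>l'\<in>{0..<K}. if l' = l then a l * ip f (x l) else 0)"
  proof (rule sum.cong)
    fix l'
    show "a l' * ip f (x l') = (if l' = l then a l * ip f (x l) else 0)"
    proof (cases "l' = l")
      case False
      have "supp f \<inter> supp (x l') = {}" using assms(3)[of l'] assms(4) growing_disjoint[OF assms(1), of _ l l'] False by blast
      then show ?thesis using False ip_disjoint by simp
    qed simp
  qed simp
  finally show ?thesis using assms(5) by simp
qed

text \<open>Averaging from index 0 on leaves the mass bound \<open>(2 ^ Suc n - 1) / d 0\<close>, so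
  any \<open>\<delta>\<close> is reached by starting far enough out.\<close>

lemma small_convex_combination:
  fixes \<delta> :: real
  assumes "growing d" "\<And>l. p l \<in> {d l..<d (Suc l)}" "2 ^ Suc n \<le> \<delta> * d 0"
  obtains K a where "0 < K" "small_on_wide d a K n \<delta>" "p ` {0..<K} \<in> schreier (Suc n)"
    "\<And>l l'. l < K \<Longrightarrow> l' < K \<Longrightarrow> l \<le> l' \<Longrightarrow> a l' \<le> a l"
proof -
  have d: "\<And>k. 1 \<le> d k" "\<And>k. 2 * d k \<le> d (Suc k)" using assms(1) by (auto simp: growing_def)
  obtain K a where a: "averages d p (Suc n) 1 0 K a"
    "\<And>G. G\<in>wide n \<Longrightarrow> hit_mass d a 0 K G \<le> (2 ^ Suc n - 1) / d 0"
    using special_convex_combination[of d p n 0] d assms(2) by blast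
  have d0: "real (d 0) > 0" using d(1)[of 0] by linarith
  have "(2 ^ Suc n - 1) / d 0 \<le> \<delta>" using assms(3) d0 by (simp add: field_simps)
  then have "small_on_wide d a K n \<delta>" using a by (fastforce simp: small_on_wide_def averages_def)
  moreover obtain As where As: "length As = 1" "set As \<subseteq> schreier (Suc n)" "\<Union>(set As) = p ` {0..<K}"
    using a(1) by (auto simp: averages_def)
  have "\<exists>A. As = [A]" using As(1) by (simp add: length_Suc_conv)
  then have "p ` {0..<K} \<in> schreier (Suc n)" using As(2,3) by auto
  ultimately show ?thesis using that[of K a] a(1) by (auto simp: averages_def)
qed

context coded_space
begin

text \<open>Every functional \<open>g\<close> may spoil one index \<open>e g\<close> of its own,
  provided that it starts before the end of that block. Moving its starting point to the right, into
  the block, keeps the set of starting points wide, so all spoiled indices together carry mass at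
  most \<open>\<delta>\<close>. The choice of \<open>e\<close> is completely free.\<close>

lemma hit_mass_indices:
  assumes "growing d" "small_on_wide d a K n \<delta>" "blocks F" "mn ` F \<in> wide n"
  shows "sum a {l. l < K \<and> (\<exists>g\<in>F. e g = l \<and> mn g < d (Suc l))} \<le> \<delta>"
proof -
  let ?B = "{l. l < K \<and> (\<exists>g\<in>F. e g = l \<and> mn g < d (Suc l))}"
  define \<psi> where "\<psi> = (\<lambda>g. if mn g < d (Suc (e g)) then max (mn g) (d (e g)) else mn g)"
  have "\<psi> ` F \<in> wide n"
    using assms(4) blocks_inj_mn[OF assms(3)] by (rule wide_image_ge) (auto simp: \<psi>_def)
  then have "hit_mass d a 0 K (\<psi> ` F) \<le> \<delta>" using assms(2) by (auto simp: small_on_wide_def)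
  moreover have "sum a ?B \<le> hit_mass d a 0 K (\<psi> ` F)"
  proof -
    have "sum a ?B = (\<Sum>l\<in>?B. if \<psi> ` F \<inter> {d l..<d (Suc l)} = {} then 0 else a l)"
    proof (rule sum.cong)
      fix l assume "l \<in> ?B"
      then obtain g where g: "g \<in> F" "e g = l" "mn g < d (Suc l)" by auto
      then have "\<psi> g \<in> {d l..<d (Suc l)}" using growing_less[OF assms(1), of l] by (auto simp: \<psi>_def)
      then show "a l = (if \<psi> ` F \<inter> {d l..<d (Suc l)} = {} then 0 else a l)" using g(1) by auto
    qed simp
    also have "\<dots> \<le> hit_mass d a 0 K (\<psi> ` F)"
      unfolding hit_mass_def using assms(2) by (intro sum_mono2) (auto simp: small_on_wide_def)
    finally show ?thesis .
  qed
  ultimately show ?thesis by linarith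
qed

text \<open>In a tame vector, \<open>d\<close> is a lower bound for the support, \<open>j\<close> the index up to which weights
  are seen with full strength, and \<open>D\<close> the exceptional weights for which nothing better than the
  norm estimate is available.\<close>

definition tame :: "real \<Rightarrow> nat \<Rightarrow> nat set \<Rightarrow> nat \<Rightarrow> (nat \<Rightarrow> real) \<Rightarrow> bool" where
  "tame C j D d v \<longleftrightarrow> v \<in> c00 \<and> supp v \<subseteq> {d..} \<and> N v \<le> C \<and>
     (\<forall>H s0. fam H \<and> card H \<le> d \<and> 1 \<le> s0 \<and> s0 \<le> j \<and> (\<forall>h\<in>H. h \<notin> signed_units \<and> (\<exists>s\<ge>s0. s \<notin> D \<and> h \<in> Lc s)) \<longrightarrow>
        (\<Sum>h\<in>H. \<bar>ip h v\<bar>) \<le> C / m s0)"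

lemma tameD:
  assumes "tame C j D d v"
  shows "v \<in> c00" "supp v \<subseteq> {d..}" "N v \<le> C" "0 \<le> C"
    "\<And>H s0. fam H \<Longrightarrow> card H \<le> d \<Longrightarrow> 1 \<le> s0 \<Longrightarrow> s0 \<le> j \<Longrightarrow> (\<And>h. h \<in> H \<Longrightarrow> h \<notin> signed_units \<and> (\<exists>s\<ge>s0. s \<notin> D \<and> h \<in> Lc s)) \<Longrightarrow>
       (\<Sum>h\<in>H. \<bar>ip h v\<bar>) \<le> C / m s0"
proof -
  show "v \<in> c00" "supp v \<subseteq> {d..}" "N v \<le> C"
    "\<And>H s0. fam H \<Longrightarrow> card H \<le> d \<Longrightarrow> 1 \<le> s0 \<Longrightarrow> s0 \<le> j \<Longrightarrow> (\<And>h. h \<in> H \<Longrightarrow> h \<notin> signed_units \<and> (\<exists>s\<ge>s0. s \<notin> D \<and> h \<in> Lc s)) \<Longrightarrow>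
       (\<Sum>h\<in>H. \<bar>ip h v\<bar>) \<le> C / m s0" using assms unfolding tame_def by blast+
  then show "0 \<le> C" using N_nonneg[of v] by linarith
qed

text \<open>The key estimate for a family of functionals acting on a block sequence of tame vectors. An
  index \<open>l\<close> is discarded if a functional starts inside the \<open>l\<close>-th block, or if a functional which
  started before has its weight in \<open>D l\<close>. The discarded indices carry little mass, because the
  starting points form a wide set.\<close>

lemma tame_blocks:
  assumes d: "growing d" and a: "small_on_wide d a K n \<delta>"
    and v: "\<And>l. l < K \<Longrightarrow> tame C (j l) (D l) (d l) (v l)" "\<And>l. l < K \<Longrightarrow> supp (v l) \<subseteq> {d l..<d (Suc l)}"
    and D: "\<And>l l'. l < K \<Longrightarrow> l' < K \<Longrightarrow> l \<noteq> l' \<Longrightarrow> D l \<inter> D l' = {}"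
    and F: "fam F" "mn ` F \<in> wide n" "\<And>g. g \<in> F \<Longrightarrow> 0 \<le> w g"
    and s0: "1 \<le> s0" "\<And>l. l < K \<Longrightarrow> s0 \<le> j l"
    and w: "\<And>g. g \<in> F \<Longrightarrow> w g \<le> \<eta> \<or> g \<in> signed_units \<or> w g \<le> \<omega> \<and> (\<exists>s\<ge>s0. g \<in> Lc s)"
    and "0 \<le> \<eta>" "0 \<le> \<omega>"
  shows "\<exists>B\<subseteq>{..<K}. sum a B \<le> 2 * \<delta> \<and>
    (\<forall>l<K. l \<notin> B \<longrightarrow> (\<Sum>g\<in>F. w g * \<bar>ip g (v l)\<bar>) \<le> 2 * C * \<eta> + \<omega> * C / m s0)"
proof -
  have a0: "0 \<le> a l" for l using a by (simp add: small_on_wide_def)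
  \<comment> \<open>\<open>blk g\<close> is the block in which \<open>g\<close> starts,
    \<open>lab g\<close> an index of \<open>g\<close>, and \<open>exc g\<close> the only block whose
    exceptional set contains that index. Where no such value exists, \<open>SOME\<close> returns an
    arbitrary one, which at worst spoils a further index and does not affect the mass bound.\<close>
  define blk where "blk = (\<lambda>g. SOME l. mn g \<in> {d l..<d (Suc l)})"
  define lab where "lab = (\<lambda>g. SOME s. s \<ge> s0 \<and> g \<in> Lc s)"
  define exc where "exc = (\<lambda>g. SOME l. l < K \<and> lab g \<in> D l)"
  define B1 where "B1 = {l. l < K \<and> (\<exists>g\<in>F. blk g = l \<and> mn g < d (Suc l))}"
  define B2 where "B2 = {l. l < K \<and> (\<exists>g\<in>F. exc g = l \<and> mn g < d (Suc l))}"
  have "sum a B1 \<le> \<delta>" "sum a B2 \<le> \<delta>"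
    unfolding B1_def B2_def using hit_mass_indices[OF d a fam_blocks[OF F(1)] F(2)] by blast+
  moreover have "sum a (B1 \<union> B2) \<le> sum a B1 + sum a B2"
    using a0 sum.union_inter[of B1 B2 a] sum_nonneg[of "B1 \<inter> B2" a] by (simp add: B1_def B2_def)
  ultimately have mass: "sum a (B1 \<union> B2) \<le> 2 * \<delta>" by linarith
  have est: "(\<Sum>g\<in>F. w g * \<bar>ip g (v l)\<bar>) \<le> 2 * C * \<eta> + \<omega> * C / m s0" if l: "l < K" "l \<notin> B1 \<union> B2" for l
  proof -
    note t = tameD[OF v(1)[OF l(1)]]
    define A where "A = {g\<in>F. mn g < d l}"
    \<comment> \<open>As \<open>l\<close> is not in \<open>B1\<close>, a functional that does not
      start before the block starts behind it.\<close>
    have zero: "ip g (v l) = 0" if g: "g \<in> F" "\<not> mn g < d l" for g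
    proof -
      have "\<not> mn g < d (Suc l)"
      proof
        assume lt: "mn g < d (Suc l)"
        then have "mn g \<in> {d l..<d (Suc l)}" using g(2) by simp
        then have "blk g = l" unfolding blk_def using growing_disjoint[OF d]
          by (intro some_equality) blast+
        then show False using l g(1) lt by (auto simp: B1_def)
      qed
      then have "supp g \<inter> supp (v l) = {}"
        using v(2)[OF l(1)] mn_le[of g] fam_ne[OF F(1) g(1)] by force
      then show ?thesis by (rule ip_disjoint)
    qed
    have unit0: "ip g (v l) = 0" if g: "g \<in> F" "g \<in> signed_units" for g
    proof (cases "mn g < d l")
      case True
      obtain i where "supp g = {i}" using signed_units_supp[OF g(2)] by auto
      then have "supp g \<inter> supp (v l) = {}" using t(2) True by (auto simp: mn_def)
      then show ?thesis by (rule ip_disjoint)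
    qed (use zero g in blast)
    \<comment> \<open>Among the functionals that start before the block, those with small
      coefficient are handled by \<open>fam_l1\<close> and the others by tameness. A signed unit
      starting before the block vanishes on it.\<close>
    define A1 where "A1 = {g\<in>A. w g \<le> \<eta>}"
    define A2 where "A2 = {g\<in>A. \<not> w g \<le> \<eta> \<and> g \<notin> signed_units}"
    have fA: "fam A" "card A \<le> d l"
    proof -
      show "fam A" using F(1) by (rule fam_subset) (auto simp: A_def)
      then show "card A \<le> d l" by (rule fam_card_less) (auto simp: A_def)
    qed
    have card_sub: "card A' \<le> d l" if "A' \<subseteq> A" for A'
      using card_mono[OF fam_finite[OF fA(1)] that] fA(2) by linarith
    have fin: "finite F" "finite A" using fam_finite F(1) fA(1) by auto
    have "(\<Sum>g\<in>F. w g * \<bar>ip g (v l)\<bar>) = (\<Sum>g\<in>A1 \<union> A2. w g * \<bar>ip g (v l)\<bar>)"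
      using zero unit0 fin by (intro sum.mono_neutral_right) (auto simp: A1_def A2_def A_def)
    also have "\<dots> = (\<Sum>g\<in>A1. w g * \<bar>ip g (v l)\<bar>) + (\<Sum>g\<in>A2. w g * \<bar>ip g (v l)\<bar>)"
      using fin by (intro sum.union_disjoint) (auto simp: A1_def A2_def)
    also have "(\<Sum>g\<in>A1. w g * \<bar>ip g (v l)\<bar>) \<le> (\<Sum>g\<in>A1. \<eta> * \<bar>ip g (v l)\<bar>)"
      by (intro sum_mono mult_right_mono) (auto simp: A1_def)
    also have "\<dots> = \<eta> * (\<Sum>g\<in>A1. \<bar>ip g (v l)\<bar>)" by (simp add: sum_distrib_left)
    also have "\<dots> \<le> \<eta> * (2 * N (v l))"
      using fam_l1[OF fam_subset[OF fA(1)] card_sub t(2), of A1] \<open>0 \<le> \<eta>\<close> by (intro mult_left_mono) (auto simp: A1_def)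
    also have "\<dots> \<le> \<eta> * (2 * C)" using t(3) \<open>0 \<le> \<eta>\<close> by (intro mult_left_mono) auto
    also have "(\<Sum>g\<in>A2. w g * \<bar>ip g (v l)\<bar>) \<le> (\<Sum>g\<in>A2. \<omega> * \<bar>ip g (v l)\<bar>)"
      using w by (intro sum_mono mult_right_mono) (auto simp: A2_def A_def)
    also have "\<dots> = \<omega> * (\<Sum>g\<in>A2. \<bar>ip g (v l)\<bar>)" by (simp add: sum_distrib_left)
    also have "\<dots> \<le> \<omega> * (C / m s0)"
    proof (intro mult_left_mono t(5))
      show "fam A2" "card A2 \<le> d l" using fam_subset[OF fA(1)] card_sub by (auto simp: A2_def)
      show "1 \<le> s0" "s0 \<le> j l" using s0 l by auto
      show "h \<notin> signed_units \<and> (\<exists>s\<ge>s0. s \<notin> D l \<and> h \<in> Lc s)" if h: "h \<in> A2" for h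
      proof -
        have hF: "h \<in> F" "mn h < d l" using h by (auto simp: A2_def A_def)
        have "\<exists>s. s \<ge> s0 \<and> h \<in> Lc s" using w[OF hF(1)] h by (auto simp: A2_def)
        then have lab: "lab h \<ge> s0" "h \<in> Lc (lab h)" unfolding lab_def using someI_ex[of "\<lambda>s. s \<ge> s0 \<and> h \<in> Lc s"] by auto
        have "lab h \<notin> D l"
        proof
          assume "lab h \<in> D l"
          then have "exc h = l" unfolding exc_def using D l(1) by (intro some_equality) blast+
          moreover have "mn h < d (Suc l)" using hF(2) growing_less[OF d, of l] by simp
          ultimately show False using l hF(1) by (auto simp: B2_def)
        qed
        then show ?thesis using lab h by (auto simp: A2_def)
      qed
    qed fact
    finally show ?thesis by (simp add: algebra_simps)
  qed
  show ?thesis using mass est by (intro exI[of _ "B1 \<union> B2"]) (auto simp: B1_def B2_def)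
qed

text \<open>The good indices contribute \<open>\<gamma>\<close> because the coefficients sum to 1;
  on the bad ones only the crude bound \<open>M\<close> is available, but their mass is at most
  \<open>\<beta>\<close>.\<close>

lemma average_estimate:
  assumes a: "small_on_wide d a K n \<delta>" and u: "\<And>l. l < K \<Longrightarrow> u l \<in> c00"
    and P: "finite P" "\<And>l. l < K \<Longrightarrow> (\<Sum>h\<in>P. \<bar>ip h (u l)\<bar>) \<le> M"
    and B: "B \<subseteq> {..<K}" "sum a B \<le> \<beta>" "\<And>l. l < K \<Longrightarrow> l \<notin> B \<Longrightarrow> (\<Sum>h\<in>P. \<bar>ip h (u l)\<bar>) \<le> \<gamma>"
    and "0 \<le> \<gamma>" "0 \<le> M"
  shows "(\<Sum>h\<in>P. \<bar>ip h (\<lambda>i. \<Sum>l\<in>{0..<K}. a l * u l i)\<bar>) \<le> \<gamma> + \<beta> * M"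
proof -
  have a0: "0 \<le> a l" for l using a by (simp add: small_on_wide_def)
  let ?s = "\<lambda>l. \<Sum>h\<in>P. \<bar>ip h (u l)\<bar>"
  have "(\<Sum>h\<in>P. \<bar>ip h (\<lambda>i. \<Sum>l\<in>{0..<K}. a l * u l i)\<bar>) \<le> (\<Sum>h\<in>P. \<Sum>l\<in>{0..<K}. a l * \<bar>ip h (u l)\<bar>)"
  proof (rule sum_mono)
    fix h
    have "ip h (\<lambda>i. \<Sum>l\<in>{0..<K}. a l * u l i) = (\<Sum>l\<in>{0..<K}. a l * ip h (u l))"
      using u by (intro ip_sum_right) auto
    also have "\<bar>\<dots>\<bar> \<le> (\<Sum>l\<in>{0..<K}. \<bar>a l * ip h (u l)\<bar>)" by (rule sum_abs)
    finally show "\<bar>ip h (\<lambda>i. \<Sum>l\<in>{0..<K}. a l * u l i)\<bar> \<le> (\<Sum>l\<in>{0..<K}. a l * \<bar>ip h (u l)\<bar>)"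
      using a0 by (simp add: abs_mult)
  qed
  also have "\<dots> = (\<Sum>l\<in>{0..<K}. a l * ?s l)"
    by (subst sum.swap) (simp add: sum_distrib_left)
  also have "\<dots> \<le> (\<Sum>l\<in>{0..<K}. a l * \<gamma> + (if l \<in> B then a l * M else 0))"
  proof (rule sum_mono)
    fix l assume "l \<in> {0..<K}"
    then show "a l * ?s l \<le> a l * \<gamma> + (if l \<in> B then a l * M else 0)"
      using mult_left_mono[OF P(2)[of l] a0[of l]] mult_left_mono[OF B(3)[of l] a0[of l]] mult_nonneg_nonneg[OF a0[of l] \<open>0 \<le> \<gamma>\<close>]
      by (cases "l \<in> B") auto
  qed
  also have "\<dots> = (\<Sum>l\<in>{0..<K}. a l) * \<gamma> + (\<Sum>l\<in>{0..<K}. if l \<in> B then a l * M else 0)"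
    by (simp add: sum.distrib sum_distrib_right)
  also have "(\<Sum>l\<in>{0..<K}. if l \<in> B then a l * M else 0) = (\<Sum>l\<in>{0..<K} \<inter> B. a l * M)"
    by (rule sum.inter_restrict[symmetric]) simp
  also have "{0..<K} \<inter> B = B" using B(1) by auto
  also have "(\<Sum>l\<in>B. a l * M) = sum a B * M" by (simp add: sum_distrib_right)
  also have "\<dots> \<le> \<beta> * M" using B(2) \<open>0 \<le> M\<close> by (rule mult_right_mono)
  finally show ?thesis using a by (simp add: small_on_wide_def)
qed

text \<open>At each coordinate at most one member of a disjoint family is nonzero, so the whole
  family obeys the estimate for a single functional.\<close>

lemma fam_sup_bound:
  assumes "fam H" "\<And>h i. h \<in> H \<Longrightarrow> \<bar>h i\<bar> \<le> c" "0 \<le> c"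
  shows "(\<Sum>h\<in>H. \<bar>ip h x\<bar>) \<le> c * (\<Sum>i\<in>supp x. \<bar>x i\<bar>)"
proof -
  have pt: "(\<Sum>h\<in>H. \<bar>h i\<bar>) \<le> c" for i
  proof (cases "\<exists>h\<in>H. i \<in> supp h")
    case True
    then obtain h where h: "h \<in> H" "i \<in> supp h" by auto
    have "(\<Sum>g\<in>H. \<bar>g i\<bar>) = (\<Sum>g\<in>H. if g = h then \<bar>h i\<bar> else 0)"
    proof (rule sum.cong)
      fix g assume "g \<in> H"
      then have "g \<noteq> h \<Longrightarrow> i \<notin> supp g" using blocks_unique[OF fam_blocks[OF assms(1)] _ h(1)] h(2) by blast
      then show "\<bar>g i\<bar> = (if g = h then \<bar>h i\<bar> else 0)" by (auto simp: supp_def)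
    qed simp
    then show ?thesis using h assms(2)[OF h(1)] fam_finite[OF assms(1)] by simp
  next
    case False
    then have "(\<Sum>h\<in>H. \<bar>h i\<bar>) = 0" by (intro sum.neutral) (auto simp: supp_def)
    then show ?thesis using assms(3) by simp
  qed
  have "(\<Sum>h\<in>H. \<bar>ip h x\<bar>) \<le> (\<Sum>h\<in>H. \<Sum>i\<in>supp x. \<bar>h i\<bar> * \<bar>x i\<bar>)"
    unfolding ip_def by (intro sum_mono order_trans[OF sum_abs]) (simp add: abs_mult)
  also have "\<dots> = (\<Sum>i\<in>supp x. (\<Sum>h\<in>H. \<bar>h i\<bar>) * \<bar>x i\<bar>)"
    by (subst sum.swap) (simp add: sum_distrib_right)
  also have "\<dots> \<le> (\<Sum>i\<in>supp x. c * \<bar>x i\<bar>)" using pt by (intro sum_mono mult_right_mono) auto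
  finally show ?thesis by (simp add: sum_distrib_left)
qed

text \<open>One level of the tree is opened for a whole family at once. The indices may differ from
  member to member; the bound \<open>J\<close> on all of them limits the cost to
  \<open>k J\<close>.\<close>

lemma children:
  assumes "fam Z" "mn ` Z \<in> wide n" "1 \<le> J"
    "\<And>z. z \<in> Z \<Longrightarrow> z \<notin> signed_units \<and> 1 \<le> s z \<and> s z \<le> J \<and> z \<in> Lc (s z)"
  obtains H where "\<And>z. z \<in> Z \<Longrightarrow> fam (H z) \<and> z = avg (m (s z)) (H z)" "fam (\<Union>z\<in>Z. H z)"
    "\<And>z z'. z \<in> Z \<Longrightarrow> z' \<in> Z \<Longrightarrow> z \<noteq> z' \<Longrightarrow> H z \<inter> H z' = {}"
    "mn ` (\<Union>z\<in>Z. H z) \<in> wide (n + k J)"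
proof -
  have "\<exists>H. fam H \<and> z = avg (m (s z)) H \<and> mn ` H \<in> wide (k (s z))" if z: "z \<in> Z" for z
  proof -
    have "z \<noteq> (\<lambda>_. 0)" using fam_ne[OF assms(1) z] by auto
    then show ?thesis using Lc_decompose[of "s z" z] assms(4)[OF z] by metis
  qed
  then obtain H where H: "\<And>z. z \<in> Z \<Longrightarrow> fam (H z) \<and> z = avg (m (s z)) (H z) \<and> mn ` H z \<in> wide (k (s z))"
    by metis
  have sub: "supp g \<subseteq> supp z" if "z \<in> Z" "g \<in> H z" for z g
  proof -
    have "0 < m (s z)" using m_ge_2[of "s z"] assms(4)[OF that(1)] by auto
    then have "supp (avg (m (s z)) (H z)) = \<Union>(supp ` H z)" using H[OF that(1)] by (intro supp_avg fam_blocks) auto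
    moreover have "avg (m (s z)) (H z) = z" using H[OF that(1)] by simp
    ultimately show ?thesis using that(2) by auto
  qed
  have un: "fam (\<Union>z\<in>Z. H z)" "\<And>z z'. z \<in> Z \<Longrightarrow> z' \<in> Z \<Longrightarrow> z \<noteq> z' \<Longrightarrow> H z \<inter> H z' = {}"
    using fam_UN[of Z H] assms(1) H sub by blast+
  have "(\<Union>z\<in>Z. mn ` H z) \<in> wide (n + k J)"
  proof (rule wide_bind[of mn])
    show "mn ` H z \<in> wide (k J)" if z: "z \<in> Z" for z
      by (rule wide_mono[OF k_mono]) (use assms(4)[OF z] H[OF z] in auto)
    show "mn z \<le> y" if z: "z \<in> Z" "y \<in> mn ` H z" for z y
    proof -
      obtain g where g: "g \<in> H z" "y = mn g" using z by auto
      then have "y \<in> supp g" using H[OF z(1)] fam_ne mn_in by metis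
      then have "y \<in> supp z" using sub[OF z(1) g(1)] by blast
      then show ?thesis using fam_ne[OF assms(1) z(1)] by (intro mn_le) auto
    qed
  qed (use assms fam_inj_mn in auto)
  then have "mn ` (\<Union>z\<in>Z. H z) \<in> wide (n + k J)" by (simp add: image_UN)
  then show ?thesis using that un H by blast
qed

lemma sum_children_le:
  assumes Z: "fam Z" and H: "\<And>z. z \<in> Z \<Longrightarrow> fam (H z) \<and> z = avg (m (s z)) (H z)"
    "\<And>z z'. z \<in> Z \<Longrightarrow> z' \<in> Z \<Longrightarrow> z \<noteq> z' \<Longrightarrow> H z \<inter> H z' = {}"
    and s: "\<And>z. z \<in> Z \<Longrightarrow> 1 \<le> s0 \<and> s0 \<le> s z"
  shows "(\<Sum>z\<in>Z. \<bar>ip z x\<bar>) \<le> 1 / m s0 * (\<Sum>h\<in>(\<Union>z\<in>Z. H z). \<bar>ip h x\<bar>)"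
proof -
  have "\<bar>ip z x\<bar> \<le> 1 / m s0 * (\<Sum>h\<in>H z. \<bar>ip h x\<bar>)" if z: "z \<in> Z" for z
  proof -
    have "m s0 > 0" "m s0 \<le> m (s z)" using m_mono[of s0 "s z"] m_ge_2[of s0] s[OF z] by auto
    then have "1 / real (m (s z)) \<le> 1 / m s0" by (intro divide_left_mono) auto
    have "\<bar>ip z x\<bar> = \<bar>1 / m (s z) * (\<Sum>h\<in>H z. ip h x)\<bar>" using H(1)[OF z] ip_avg by metis
    also have "\<dots> = 1 / m (s z) * \<bar>\<Sum>h\<in>H z. ip h x\<bar>" by (simp add: abs_mult)
    also have "\<dots> \<le> 1 / m (s z) * (\<Sum>h\<in>H z. \<bar>ip h x\<bar>)" by (intro mult_left_mono sum_abs) auto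
    also have "\<dots> \<le> 1 / m s0 * (\<Sum>h\<in>H z. \<bar>ip h x\<bar>)" by (rule mult_right_mono) (use \<open>1 / real (m (s z)) \<le> 1 / m s0\<close> in \<open>auto intro: sum_nonneg\<close>)
    finally show ?thesis .
  qed
  then have "(\<Sum>z\<in>Z. \<bar>ip z x\<bar>) \<le> (\<Sum>z\<in>Z. 1 / m s0 * (\<Sum>h\<in>H z. \<bar>ip h x\<bar>))" by (rule sum_mono)
  also have "\<dots> = 1 / m s0 * (\<Sum>z\<in>Z. \<Sum>h\<in>H z. \<bar>ip h x\<bar>)" by (simp add: sum_distrib_left)
  also have "(\<Sum>z\<in>Z. \<Sum>h\<in>H z. \<bar>ip h x\<bar>) = (\<Sum>h\<in>(\<Union>z\<in>Z. H z). \<bar>ip h x\<bar>)"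
    using H fam_finite[OF Z] fam_finite by (intro sum.UNION_disjoint[symmetric]) auto
  finally show ?thesis .
qed

text \<open>A functional of index \<open>s\<close> that is not a unit has coordinates of modulus at
  most \<open>1 / m s < 1\<close>, so no restriction of it can have a coordinate of modulus
  1.\<close>

lemma Lc_restr_nonunit:
  assumes "h \<in> Lc s" "1 \<le> s" "h \<notin> signed_units" "order_convex I" "supp h \<inter> I \<noteq> {}"
  shows "restr I h \<in> Lc s" "restr I h \<notin> signed_units"
proof -
  have "restr I h \<noteq> (\<lambda>_. 0)" using assms(5) by (simp add: supp_empty_iff[symmetric])
  then show "restr I h \<in> Lc s" using Lc_restr[OF assms(1,4)] by blast
  show "restr I h \<notin> signed_units"
  proof
    assume "restr I h \<in> signed_units"
    then obtain i where i: "\<bar>restr I h i\<bar> = 1" using signed_units_supp by blast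
    have "\<bar>h i\<bar> \<le> 1 / m s" using Lc_bound assms by blast
    also have "\<dots> < 1" using m_ge_2[OF assms(2)] by simp
    finally show False using i by (auto simp: restr_def split: if_splits)
  qed
qed

text \<open>At most \<open>d\<close> starting points, all of them at or above \<open>d\<close>, form
  a set of level 1, and cutting off below \<open>d\<close> is invisible to vectors supported from
  \<open>d\<close> on.\<close>

lemma fam_tail:
  assumes "fam H" "card H \<le> d"
  shows "fam (restr_family {d..} H)" "mn ` restr_family {d..} H \<in> wide 1"
    "supp x \<subseteq> {d..} \<Longrightarrow> (\<Sum>h\<in>restr_family {d..} H. \<bar>ip h x\<bar>) = (\<Sum>h\<in>H. \<bar>ip h x\<bar>)"
proof -
  show f: "fam (restr_family {d..} H)" using assms(1) by (rule fam_restr) simp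
  have fin: "finite (restr_family {d..} H)" using fam_finite[OF f] .
  show "mn ` restr_family {d..} H \<in> wide 1"
  proof (rule wide_1[of _ d])
    show "card (mn ` restr_family {d..} H) \<le> d"
      using card_image_le[OF fin, of mn] card_restr_family[OF fam_finite[OF assms(1)], of "{d..}"] assms(2) by linarith
    fix x assume "x \<in> mn ` restr_family {d..} H"
    then obtain h where h: "h \<in> restr_family {d..} H" "x = mn h" by auto
    then have "x \<in> supp h" using fam_ne[OF f h(1)] mn_in by simp
    then show "d \<le> x" using h(1) by (auto simp: restr_family_def)
  qed (use fin in simp)
  show "(\<Sum>h\<in>restr_family {d..} H. \<bar>ip h x\<bar>) = (\<Sum>h\<in>H. \<bar>ip h x\<bar>)" if "supp x \<subseteq> {d..}"
    using sum_restr_family[OF fam_blocks[OF assms(1)], of "\<lambda>h. \<bar>ip h x\<bar>" "{d..}"] ip_restr[OF that] by simp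
qed

end

text \<open>An abstraction of the span of a block sequence: what matters is linearity and the
  presence of nonzero vectors arbitrarily far out.\<close>

definition block_space :: "(nat \<Rightarrow> real) set \<Rightarrow> bool" where
  "block_space S \<longleftrightarrow> S \<subseteq> c00 \<and> (\<forall>x\<in>S. \<forall>y\<in>S. \<forall>a b. (\<lambda>i. a * x i + b * y i) \<in> S) \<and>
     (\<forall>n. \<exists>x\<in>S. supp x \<noteq> {} \<and> supp x \<subseteq> {n..})"

lemma block_spaceD:
  assumes "block_space S"
  shows "x \<in> S \<Longrightarrow> x \<in> c00" "x \<in> S \<Longrightarrow> y \<in> S \<Longrightarrow> (\<lambda>i. a * x i + b * y i) \<in> S"
    "\<exists>x\<in>S. supp x \<noteq> {} \<and> supp x \<subseteq> {n..}"
  using assms by (auto simp: block_space_def)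

lemma block_space_scale:
  assumes "block_space S" "x \<in> S" shows "(\<lambda>i. c * x i) \<in> S"
proof -
  have "(\<lambda>i. c * x i + 0 * x i) \<in> S" using assms by (intro block_spaceD(2))
  then show ?thesis by simp
qed

lemma block_space_sum:
  assumes "block_space S" "finite A" "\<And>l. l \<in> A \<Longrightarrow> x l \<in> S"
  shows "(\<lambda>i. \<Sum>l\<in>A. a l * x l i) \<in> S"
  using assms(2,3)
proof (induction A rule: finite_induct)
  case empty
  obtain y where "y \<in> S" using block_spaceD(3)[OF assms(1)] by blast
  then show ?case using block_space_scale[OF assms(1), of y 0] by simp
next
  case (insert l A)
  have "x l \<in> S" "(\<lambda>i. \<Sum>l\<in>A. a l * x l i) \<in> S" using insert by auto
  then have "(\<lambda>i. a l * x l i + 1 * (\<Sum>l\<in>A. a l * x l i)) \<in> S"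
    by (rule block_spaceD(2)[OF assms(1)])
  then show ?case using insert by simp
qed

section \<open>Block subspaces and averages of large norm\<close>

context coded_space
begin

lemma k_ge_index: "1 \<le> j \<Longrightarrow> j \<le> k j"
  by (induction j rule: dec_induct) (use k_1 k_less_Suc in \<open>auto simp: Suc_le_eq intro: le_less_trans\<close>)

lemma block_space_normalized:
  assumes "block_space S"
  obtains v d0 e f where "v \<in> S" "n0 \<le> d0" "1 \<le> d0" "supp v \<subseteq> {d0..<e}" "N v = 1"
    "f \<in> LL" "supp f \<subseteq> {d0..<e}" "1 / 2 < ip f v"
proof -
  define d0 where "d0 = max 1 n0"
  obtain x where x: "x \<in> S" "supp x \<noteq> {}" "supp x \<subseteq> {d0..}" using block_spaceD(3)[OF assms] by blast
  have xc: "x \<in> c00" using block_spaceD(1)[OF assms x(1)] .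
  define e where "e = Suc (Max (supp x))"
  have fin: "finite (supp x)" using c00_supp[OF xc] .
  have se: "supp x \<subseteq> {d0..<e}" using x(3) Max_ge[OF fin] by (fastforce simp: e_def less_Suc_eq_le)
  have Nx: "N x > 0" using N_pos[OF xc x(2)] .
  define v where "v = (\<lambda>i. 1 / N x * x i)"
  have Nv: "N v = 1" unfolding v_def N_scale[OF xc] using Nx by simp
  have sv: "supp v = supp x" using Nx by (auto simp: v_def supp_def)
  obtain f where f: "f \<in> LL" "1 / 2 < ip f v" using N_attain[of "1 / 2" v] Nv by auto
  have ipf: "ip (restr {d0..<e} f) v = ip f v" using se sv by (intro ip_restr) auto
  then have "restr {d0..<e} f \<noteq> (\<lambda>_. 0)" using f(2) by auto
  then have "restr {d0..<e} f \<in> LL" using LL_restr[OF f(1), of "{d0..<e}"] by simp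
  moreover have "v \<in> S" unfolding v_def using block_space_scale[OF assms x(1)] .
  moreover have "n0 \<le> d0" "1 \<le> d0" by (auto simp: d0_def)
  moreover have "supp (restr {d0..<e} f) \<subseteq> {d0..<e}" by simp
  moreover have "1 / 2 < ip (restr {d0..<e} f) v" using ipf f(2) by simp
  moreover have "supp v \<subseteq> {d0..<e}" using se sv by simp
  ultimately show ?thesis using that[of v d0 e "restr {d0..<e} f"] Nv by blast
qed

text \<open>The state after \<open>r\<close> doublings in the search for an average of large norm.
  The initial value \<open>1 / 2\<close> comes from a functional that almost norms a normalized
  vector.\<close>

definition stacked :: "(nat \<Rightarrow> real) set \<Rightarrow> nat \<Rightarrow> nat \<Rightarrow> (nat \<Rightarrow> real) \<times> (nat \<Rightarrow> real) set \<times> nat \<times> nat \<Rightarrow> bool" where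
  "stacked S q r = (\<lambda>(v, H, d0, e). v \<in> S \<and> N v \<le> 1 \<and> 1 \<le> d0 \<and> supp v \<subseteq> {d0..<e} \<and> fam H \<and> successive H \<and>
     (\<forall>h\<in>H. supp h \<subseteq> {d0..<e}) \<and> H \<noteq> {} \<and> mn ` H \<in> schreier (r * q) \<and> 2 ^ r / 2 \<le> (\<Sum>h\<in>H. ip h v))"

text \<open>If all averages in question have norm below \<open>1 / 2\<close>, twice an average still
  has norm at most 1. Functionals of the \<open>l\<close>-th family see only the \<open>l\<close>-th
  block, so the sums of values are averaged and then doubled. The families sit on an averaging set
  of level \<open>Suc n\<close>, which is added to the Schreier level.\<close>

lemma stacked_step:
  assumes "block_space S" "0 < \<delta>"
    and IH: "\<And>n0. \<exists>z. stacked S (Suc n) r z \<and> n0 \<le> fst (snd (snd z))"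
    and small: "\<And>u d a K. growing d \<Longrightarrow> n0 \<le> d 0 \<Longrightarrow> small_on_wide d a K n \<delta> \<Longrightarrow>
      (\<And>l. u l \<in> S \<and> N (u l) \<le> 1 \<and> supp (u l) \<subseteq> {d l..<d (Suc l)}) \<Longrightarrow> N (\<lambda>i. \<Sum>l\<in>{0..<K}. a l * u l i) < 1 / 2"
  shows "\<exists>z. stacked S (Suc n) (Suc r) z \<and> n0 \<le> fst (snd (snd z))"
proof -
  let ?q = "Suc n"
  let ?lo = "\<lambda>z::(nat \<Rightarrow> real) \<times> (nat \<Rightarrow> real) set \<times> nat \<times> nat. fst (snd (snd z))"
  let ?hi = "\<lambda>z::(nat \<Rightarrow> real) \<times> (nat \<Rightarrow> real) set \<times> nat \<times> nat. snd (snd (snd z))"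
  define n1 where "n1 = max n0 (nat \<lceil>2 ^ Suc n / \<delta>\<rceil>)"
  have p1: "\<exists>z. stacked S ?q r z \<and> max 1 n1 \<le> ?lo z" by (rule IH)
  have p2: "\<exists>z. stacked S ?q r z \<and> n' \<le> ?lo z \<and> True" for n' using IH[of n'] by blast
  obtain z where z: "\<And>l. stacked S ?q r (z l)" "n1 \<le> ?lo (z 0)" "growing (\<lambda>l. ?lo (z l))" "\<And>l. ?hi (z l) \<le> ?lo (z (Suc l))"
    by (rule choose_growing[of "stacked S ?q r" n1 ?lo "\<lambda>_ _. True" ?hi, OF p1 p2]) (rule that)
  define v where "v = (\<lambda>l. fst (z l))"
  define H where "H = (\<lambda>l. fst (snd (z l)))"
  define d where "d = (\<lambda>l. ?lo (z l))"
  have gd: "growing d" using z(3) by (simp add: d_def)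
  have st: "v l \<in> S \<and> N (v l) \<le> 1 \<and> 1 \<le> d l \<and> supp (v l) \<subseteq> {d l..<d (Suc l)} \<and> fam (H l) \<and> successive (H l) \<and>
     (\<forall>h\<in>H l. supp h \<subseteq> {d l..<d (Suc l)}) \<and> H l \<noteq> {} \<and> mn ` H l \<in> schreier (r * ?q) \<and> 2 ^ r / 2 \<le> (\<Sum>h\<in>H l. ip h (v l))" for l
  proof -
    have sub: "{?lo (z l)..<?hi (z l)} \<subseteq> {d l..<d (Suc l)}" using z(4)[of l] by (auto simp: d_def)
    have s: "v l \<in> S \<and> N (v l) \<le> 1 \<and> 1 \<le> d l \<and> supp (v l) \<subseteq> {?lo (z l)..<?hi (z l)} \<and> fam (H l) \<and> successive (H l) \<and>
      (\<forall>h\<in>H l. supp h \<subseteq> {?lo (z l)..<?hi (z l)}) \<and> H l \<noteq> {} \<and> mn ` H l \<in> schreier (r * ?q) \<and> 2 ^ r / 2 \<le> (\<Sum>h\<in>H l. ip h (v l))"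
      using z(1)[of l] unfolding stacked_def v_def H_def d_def case_prod_beta .
    then have "supp (v l) \<subseteq> {d l..<d (Suc l)}" "\<forall>h\<in>H l. supp h \<subseteq> {d l..<d (Suc l)}" using sub by blast+
    then show ?thesis using s by blast
  qed
  have vc: "v l \<in> c00" for l using st assms(1) by (auto simp: block_space_def)
  define p where "p = (\<lambda>l. Min (mn ` H l))"
  have mnH: "mn h \<in> {d l..<d (Suc l)}" if "h \<in> H l" for h l
    using that st[of l] fam_ne[of "H l" h] mn_in[of h] by blast
  have pH: "p l \<in> mn ` H l" "\<And>h. h \<in> H l \<Longrightarrow> p l \<le> mn h" for l
    unfolding p_def using st[of l] fam_finite by (auto intro!: Min_in Min_le)
  have p: "p l \<in> {d l..<d (Suc l)}" for l
  proof -
    obtain h where "h \<in> H l" "p l = mn h" using pH(1)[of l] by auto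
    then show ?thesis using mnH[of h l] by simp
  qed
  have "2 ^ Suc n / \<delta> \<le> real n1" unfolding n1_def by linarith
  also have "real n1 \<le> d 0" using z(2) by (simp add: d_def)
  finally have "2 ^ Suc n \<le> \<delta> * d 0" using assms(2) by (simp add: field_simps)
  then obtain K a where a: "0 < K" "small_on_wide d a K n \<delta>" "p ` {0..<K} \<in> schreier (Suc n)"
    by (rule small_convex_combination[where d = d and p = p, OF gd p]) (rule that)
  have a0: "0 \<le> a l" "sum a {0..<K} = 1" for l using a(2) by (auto simp: small_on_wide_def)
  define w where "w = (\<lambda>i. \<Sum>l\<in>{0..<K}. a l * v l i)"
  have wc: "w \<in> c00" unfolding w_def using vc by (intro c00_sum) auto
  have n0: "n0 \<le> d 0" using z(2) by (simp add: d_def n1_def)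
  have Nw: "N w < 1 / 2" unfolding w_def using small[OF gd n0 a(2), of v] st by blast
  define G where "G = (\<Union>l\<in>{0..<K}. H l)"
  have dm: "d i \<le> d j" if "i \<le> j" for i j using growing_mono[OF gd that] .
  have same: "l = l'" if "h \<in> H l" "h' \<in> H l'" "i \<in> supp h" "i \<in> supp h'" for l l' h h' i
    using that st[of l] st[of l'] growing_disjoint[OF gd, of i l l'] by blast
  have fG: "fam G"
  proof -
    have "f = g" if "f \<in> G" "g \<in> G" "i \<in> supp f" "i \<in> supp g" for f g i
    proof -
      obtain l l' where "f \<in> H l" "g \<in> H l'" using \<open>f \<in> G\<close> \<open>g \<in> G\<close> by (auto simp: G_def)
      then show ?thesis using same[of f l g l' i] that blocks_unique[of "H l" f g i] st[of l] fam_blocks by auto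
    qed
    then have "disjoint_supports G" unfolding disjoint_supports_def by blast
    moreover have "finite G" unfolding G_def using st fam_finite by blast
    ultimately show ?thesis unfolding fam_def blocks_def using st fam_ne fam_LL by (fastforce simp: G_def)
  qed
  have lt: "set_less (supp f) (supp g)" if "f \<in> H l" "g \<in> H l'" "l < l'" for f g l l'
  proof -
    have "supp f \<subseteq> {d l..<d (Suc l)}" "supp g \<subseteq> {d l'..<d (Suc l')}" using st that by blast+
    moreover have "d (Suc l) \<le> d l'" using dm that(3) by simp
    ultimately show ?thesis unfolding set_less_def by force
  qed
  have sG: "successive G" unfolding successive_def
  proof (intro ballI impI)
    fix f g assume fg: "f \<in> G" "g \<in> G" "mn f < mn g"
    then obtain l l' where l: "f \<in> H l" "g \<in> H l'" by (auto simp: G_def)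
    consider "l < l'" | "l = l'" | "l' < l" by linarith
    then show "set_less (supp f) (supp g)"
    proof cases
      case 2 then show ?thesis using l fg(3) st[of l] by (auto simp: successive_def)
    next
      case 3
      have "mn f \<in> {d l..<d (Suc l)}" "mn g \<in> {d l'..<d (Suc l')}" using mnH l by auto
      then show ?thesis using fg(3) dm[of "Suc l'" l] 3 by auto
    qed (use lt l in blast)
  qed
  have pinj: "inj_on p {0..<K}"
  proof (rule inj_onI)
    fix l l' assume "p l = p l'" then show "l = l'" using growing_disjoint[OF gd, of "p l" l l'] p by metis
  qed
  \<comment> \<open>\<open>schreier_bind\<close> indexes by points, so a block is recovered from its
    smallest starting point \<open>p l\<close>.\<close>
  define A where "A = (\<lambda>x. mn ` H (inv_into {0..<K} p x))"
  have Ap: "A (p l) = mn ` H l" if "l < K" for l using inv_into_f_f[OF pinj, of l] that by (simp add: A_def)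
  have "(\<Union>x\<in>p ` {0..<K}. A x) \<in> schreier (Suc n + r * ?q)"
  proof (rule schreier_bind[OF a(3)])
    show "A x \<in> schreier (r * ?q)" if "x \<in> p ` {0..<K}" for x using that Ap st by auto
    show "x \<le> y" if "x \<in> p ` {0..<K}" "y \<in> A x" for x y using that Ap pH(2) by auto
    show "set_less (A x) (A y)" if xy: "x \<in> p ` {0..<K}" "y \<in> p ` {0..<K}" "x < y" for x y
    proof -
      obtain l l' where l: "l < K" "l' < K" "x = p l" "y = p l'" using xy by auto
      have "\<not> l' \<le> l"
      proof
        assume "l' \<le> l"
        then consider "l' = l" | "l' < l" by linarith
        then show False
        proof cases
          case 2
          then show False using p[of l] p[of l'] dm[of "Suc l'" l] xy(3) l by auto
        qed (use l xy in simp)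
      qed
      then have "d (Suc l) \<le> d l'" using dm by simp
      moreover have "A x \<subseteq> {d l..<d (Suc l)}" "A y \<subseteq> {d l'..<d (Suc l')}" using l Ap mnH by auto
      ultimately show ?thesis unfolding set_less_def by force
    qed
  qed
  moreover have "(\<Union>x\<in>p ` {0..<K}. A x) = mn ` G" unfolding G_def image_UN using Ap by simp
  moreover have "Suc n + r * ?q = Suc r * ?q" by simp
  ultimately have sch: "mn ` G \<in> schreier (Suc r * ?q)" by (simp only:)
  have ipw: "ip h w = a l * ip h (v l)" if h: "h \<in> H l" "l < K" for h l
    unfolding w_def by (rule ip_block_sum[OF gd vc _ _ h(2)]) (use st h(1) in blast)+
  have "(\<Sum>h\<in>G. ip h w) = (\<Sum>l\<in>{0..<K}. \<Sum>h\<in>H l. ip h w)"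
    unfolding G_def using st fam_finite fam_ne same by (intro sum.UNION_disjoint) (auto, blast)
  also have "\<dots> = (\<Sum>l\<in>{0..<K}. a l * (\<Sum>h\<in>H l. ip h (v l)))"
    using ipw by (simp add: sum_distrib_left)
  also have "\<dots> \<ge> (\<Sum>l\<in>{0..<K}. a l * (2 ^ r / 2))"
    using st a0 by (intro sum_mono mult_left_mono) auto
  also (xtrans) have "(\<Sum>l\<in>{0..<K}. a l * (2 ^ r / 2)) = 2 ^ r / 2"
    using a0(2) by (simp add: sum_distrib_right[symmetric] sum_divide_distrib[symmetric])
  finally have sum: "2 ^ r / 2 \<le> (\<Sum>h\<in>G. ip h w)" .
  have ip2: "ip h (\<lambda>i. 2 * w i) = 2 * ip h w" for h by (rule ip_scale_right[OF wc])
  have "stacked S ?q (Suc r) ((\<lambda>i. 2 * w i), G, d 0, d K)" unfolding stacked_def prod.case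
  proof (intro conjI)
    show "(\<lambda>i. 2 * w i) \<in> S" unfolding w_def using st assms(1) by (intro block_space_scale block_space_sum) auto
    show "N (\<lambda>i. 2 * w i) \<le> 1" using N_scale[OF wc, of 2] Nw by simp
    have sub: "{d l..<d (Suc l)} \<subseteq> {d 0..<d K}" if "l < K" for l
      using dm[of 0 l] dm[of "Suc l" K] that by auto
    have "supp (\<lambda>i. 2 * w i) \<subseteq> supp w" by (auto simp: supp_def)
    also have "\<dots> \<subseteq> (\<Union>l\<in>{0..<K}. supp (v l))" unfolding w_def by (rule supp_sum_subset)
    also have "\<dots> \<subseteq> {d 0..<d K}" using st sub by fastforce
    finally show "supp (\<lambda>i. 2 * w i) \<subseteq> {d 0..<d K}" .
    show "\<forall>h\<in>G. supp h \<subseteq> {d 0..<d K}" unfolding G_def using st sub by fastforce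
    show "G \<noteq> {}" unfolding G_def using st a(1) by auto
    show "2 ^ Suc r / 2 \<le> (\<Sum>h\<in>G. ip h (\<lambda>i. 2 * w i))" using sum unfolding ip2 sum_distrib_left[symmetric] by simp
    show "1 \<le> d 0" using st by blast
  qed fact+
  then show ?thesis using n0 by (intro exI[of _ "((\<lambda>i. 2 * w i), G, d 0, d K)"]) simp
qed

text \<open>No direct lower estimate for averages is at hand, so the argument is indirect. If all
  were small, doubling could be repeated \<open>T = t j'\<close> times; the functionals obtained are
  admissible for index \<open>j'\<close> and yield the value \<open>2 ^ T / (2 * m j')\<close> or
  more on a vector of norm at most 1. As \<open>2 ^ T\<close> is at least the square of
  \<open>m j'\<close>, this is at least \<open>m j' / 2 > 1\<close>.\<close>

lemma large_average:
  assumes "block_space S" "0 < \<delta>"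
  obtains u d a K where "growing d" "n0 \<le> d 0" "small_on_wide d a K n \<delta>"
    "\<And>l. u l \<in> S \<and> N (u l) \<le> 1 \<and> supp (u l) \<subseteq> {d l..<d (Suc l)}" "1 / 2 \<le> N (\<lambda>i. \<Sum>l\<in>{0..<K}. a l * u l i)"
proof (rule ccontr)
  assume no: "\<not> thesis"
  note witness = that
  have small: "N (\<lambda>i. \<Sum>l\<in>{0..<K}. a l * u l i) < 1 / 2"
    if *: "growing d" "n1 \<le> d 0" "n0 \<le> n1" "small_on_wide d a K n \<delta>"
      "\<And>l. u l \<in> S \<and> N (u l) \<le> 1 \<and> supp (u l) \<subseteq> {d l..<d (Suc l)}" for u d a K n1
    using witness[OF *(1) _ *(4,5)] *(2,3) no by (meson le_trans not_le)
  let ?q = "Suc n"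
  have all: "\<exists>z. stacked S ?q r z \<and> n1 \<le> fst (snd (snd z))" if "n0 \<le> n1" for r n1
    using that
  proof (induction r arbitrary: n1)
    case 0
    obtain v d0 e f where v: "v \<in> S" "n1 \<le> d0" "1 \<le> d0" "supp v \<subseteq> {d0..<e}" "N v = 1"
      "f \<in> LL" "supp f \<subseteq> {d0..<e}" "1 / 2 < ip f v" using block_space_normalized[OF assms(1)] .
    have ne: "supp f \<noteq> {}" using v(8) ip_disjoint[of f v] by auto
    have "fam {f}" using v(6) LL_wf ne by (auto simp: fam_def blocks_def disjoint_supports_def)
    moreover have "1 \<le> mn f" using mn_in[of f] ne LL_wf[OF v(6)] v(3,7) by fastforce
    ultimately have "stacked S ?q 0 (v, {f}, d0, e)" unfolding stacked_def using v by (auto simp: successive_def)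
    then show ?case using v(2) by (intro exI[of _ "(v, {f}, d0, e)"]) simp
  next
    case (Suc r)
    show ?case
    proof (rule stacked_step[OF assms])
      show "\<exists>z. stacked S ?q r z \<and> n2 \<le> fst (snd (snd z))" for n2
        using Suc.IH[of "max n0 n2"] by auto
    qed (use small Suc.prems in blast)
  qed
  \<comment> \<open>Even, so that arbitrary admissible functionals of this index are available, and
    large enough for \<open>n \<le> k (j' - 1)\<close>; then \<open>T\<close> steps of level
    \<open>Suc n\<close> fit below \<open>k j'\<close>.\<close>
  define j' where "j' = 2 * (n + 1)"
  define T where "T = t j'"
  have j': "2 \<le> j'" "even j'" "n \<le> k (j' - 1)" using k_ge_index[of "j' - 1"] by (auto simp: j'_def)
  obtain z where z: "stacked S ?q T z" using all[of n0 T] by blast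
  obtain v H d0 e where zv: "z = (v, H, d0, e)" by (metis prod_cases4)
  have st: "N v \<le> 1" "fam H" "successive H" "H \<noteq> {}" "mn ` H \<in> schreier (T * ?q)" "2 ^ T / 2 \<le> (\<Sum>h\<in>H. ip h v)"
    using z unfolding stacked_def zv by auto
  have "T * ?q \<le> T * (k (j' - 1) + 1)" using j'(3) by (intro mult_le_mono2) simp
  then have "T * ?q \<le> k j'" using k_step[OF j'(1)] unfolding T_def by linarith
  then have "mn ` H \<in> schreier (k j')" using st(5) schreier_mono by blast
  then have "avg (m j') H \<in> Lc j'"
    using Lc_avg_even[OF j'(2) fam_blocks[OF st(2)] st(4) _ st(3)] st(2) by (auto simp: fam_def)
  then have "avg (m j') H \<in> LL" using j'(1) by (intro LL_I) auto
  then have "ip (avg (m j') H) v \<le> 1" using ip_le_N'[of "avg (m j') H" v] st(1) by linarith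
  moreover have mj: "5 \<le> m j'" using m_ge_5[OF j'(1)] .
  moreover have "real (m j') < ip (avg (m j') H) v * m j'"
  proof -
    have "real ((m j')\<^sup>2) \<le> real (2 ^ T)" using t_bound[OF j'(1)] unfolding T_def by (intro of_nat_mono) blast
    then have sq: "real (m j') ^ 2 \<le> 2 ^ T" by simp
    have "2 * real (m j') < real (m j') * m j'" using mj by simp
    then have "real (m j') < 2 ^ T / 2" using sq by (simp add: power2_eq_square)
    also have "\<dots> \<le> (\<Sum>h\<in>H. ip h v)" by (rule st(6))
    also have "\<dots> = ip (avg (m j') H) v * m j'" unfolding ip_avg using mj by simp
    finally show ?thesis .
  qed
  ultimately show False using mult_right_mono[of "ip (avg (m j') H) v" 1 "real (m j')"] by auto
qed

text \<open>An average of level \<open>k (j - 1) + 1\<close> with large norm. For indices below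
  \<open>j\<close> one level of the tree is opened: this gains \<open>1 / m s0\<close>, and the
  children act on most blocks with total at most 2, which gives \<open>6 / m s0\<close> in all. For
  indices from \<open>j'\<close> on the coordinates are so small that the l1 norm of
  \<open>y\<close> suffices, which gives \<open>1 / m s0\<close>. The indices in between escape and
  become the exceptional set. The number \<open>j'\<close> depends on \<open>y\<close> and is left
  open, as it will be the index of the next vector.\<close>

lemma tame_average_exists:
  assumes "block_space S" "2 \<le> j"
  obtains y ys d0 e where "y \<in> S" "ys \<in> LL" "n0 \<le> d0" "1 \<le> d0" "d0 < e"
    "supp y \<subseteq> {d0..<e}" "supp ys \<subseteq> {d0..<e}" "1 / 4 \<le> ip ys y" "N y \<le> 1"
    "\<And>j'. j \<le> j' \<Longrightarrow> real (m j) * (\<Sum>i\<in>supp y. \<bar>y i\<bar>) \<le> real (m j') \<Longrightarrow> tame 7 j {j..<j'} d0 y"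
proof -
  let ?n = "k (j - 1) + 1"
  have mj: "5 \<le> m j" using m_ge_5[OF assms(2)] .
  have pos: "0 < 1 / real (m j)" using mj by simp
  obtain u d a K where u: "growing d" "n0 \<le> d 0" "small_on_wide d a K ?n (1 / m j)"
    "\<And>l. u l \<in> S \<and> N (u l) \<le> 1 \<and> supp (u l) \<subseteq> {d l..<d (Suc l)}" "1 / 2 \<le> N (\<lambda>i. \<Sum>l\<in>{0..<K}. a l * u l i)"
    by (rule large_average[OF assms(1) pos, of n0 ?n]) (rule that)
  have uc: "u l \<in> c00" for l using u(4) assms(1) by (auto simp: block_space_def)
  have a0: "0 \<le> a l" "sum a {0..<K} = 1" for l using u(3) by (auto simp: small_on_wide_def)
  define y where "y = (\<lambda>i. \<Sum>l\<in>{0..<K}. a l * u l i)"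
  have yc: "y \<in> c00" unfolding y_def using uc by (intro c00_sum) auto
  have Ny: "N y \<le> 1"
  proof -
    have "N y \<le> (\<Sum>l\<in>{0..<K}. \<bar>a l\<bar> * N (u l))" unfolding y_def using uc by (intro N_sum_le) auto
    also have "\<dots> \<le> (\<Sum>l\<in>{0..<K}. a l * 1)" using a0 u(4) by (intro sum_mono mult_mono) (auto simp: N_nonneg)
    finally show ?thesis using a0 by simp
  qed
  define e where "e = d (Suc K)"
  have dm: "d i \<le> d j" if "i \<le> j" for i j using growing_mono[OF u(1) that] .
  have de: "d 0 < e" unfolding e_def using growing_less[OF u(1), of 0] dm[of "Suc 0" "Suc K"] by simp
  have sy: "supp y \<subseteq> {d 0..<e}"
  proof -
    have "{d l..<d (Suc l)} \<subseteq> {d 0..<e}" if "l < K" for l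
      using dm[of 0 l] dm[of "Suc l" "Suc K"] that by (auto simp: e_def)
    then have "(\<Union>l\<in>{0..<K}. supp (u l)) \<subseteq> {d 0..<e}" using u(4) by fastforce
    then show ?thesis unfolding y_def using supp_sum_subset by (rule subset_trans[rotated])
  qed
  obtain f where f: "f \<in> LL" "1 / 4 < ip f y" using N_attain[of "1 / 4" y] u(5) by (auto simp: y_def)
  define ys where "ys = restr {d 0..<e} f"
  have ipys: "ip ys y = ip f y" unfolding ys_def using sy by (rule ip_restr)
  then have "ys \<noteq> (\<lambda>_. 0)" using f(2) by auto
  then have ysL: "ys \<in> LL" using LL_restr[OF f(1), of "{d 0..<e}"] by (simp add: ys_def)
  have tame: "tame 7 j {j..<j'} (d 0) y" if j': "j \<le> j'" "real (m j) * (\<Sum>i\<in>supp y. \<bar>y i\<bar>) \<le> real (m j')" for j'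
    unfolding tame_def
  proof (intro conjI allI impI)
    show "y \<in> c00" "N y \<le> 7" "supp y \<subseteq> {d 0..}" using yc Ny sy by auto
    fix H s0
    assume "fam H \<and> card H \<le> d 0 \<and> 1 \<le> s0 \<and> s0 \<le> j \<and>
      (\<forall>h\<in>H. h \<notin> signed_units \<and> (\<exists>s\<ge>s0. s \<notin> {j..<j'} \<and> h \<in> Lc s))"
    then have H: "fam H" "card H \<le> d 0" "1 \<le> s0" "s0 \<le> j"
      and lab: "\<forall>h\<in>H. h \<notin> signed_units \<and> (\<exists>s\<ge>s0. s \<notin> {j..<j'} \<and> h \<in> Lc s)" by auto
    have mm: "m s0 \<le> m j" "0 < m s0" using m_mono[OF H(3,4)] m_ge_2[OF H(3)] by auto
    define H0 where "H0 = restr_family {d 0..} H"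
    note ft = fam_tail[OF H(1,2), folded H0_def]
    have "\<exists>s\<ge>s0. s \<notin> {j..<j'} \<and> g \<in> Lc s \<and> g \<notin> signed_units" if g: "g \<in> H0" for g
    proof -
      obtain h where h: "h \<in> H" "supp h \<inter> {d 0..} \<noteq> {}" "g = restr {d 0..} h" using g by (auto simp: H0_def restr_family_def)
      obtain s where s: "s \<ge> s0" "s \<notin> {j..<j'}" "h \<in> Lc s" "h \<notin> signed_units" using lab h(1) by blast
      then show ?thesis using Lc_restr_nonunit[OF s(3) _ s(4) order_convex_atLeast h(2)] h(3) H(3) by (intro exI[of _ s]) auto
    qed
    then obtain s where s: "\<And>g. g \<in> H0 \<Longrightarrow> s g \<ge> s0 \<and> s g \<notin> {j..<j'} \<and> g \<in> Lc (s g) \<and> g \<notin> signed_units" by metis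
    define P1 where "P1 = {g\<in>H0. s g < j}"
    define P2 where "P2 = {g\<in>H0. j' \<le> s g}"
    have "s g < j \<or> j' \<le> s g" if "g \<in> H0" for g using s[OF that] by auto
    then have P: "H0 = P1 \<union> P2" "P1 \<inter> P2 = {}" using j'(1) by (auto simp: P1_def P2_def)
    have fP: "fam P1" "fam P2" using ft(1) by (auto simp: P1_def P2_def intro: fam_subset)
    have "(\<Sum>h\<in>H. \<bar>ip h y\<bar>) = (\<Sum>h\<in>H0. \<bar>ip h y\<bar>)" using ft(3)[of y] sy by force
    also have "\<dots> = (\<Sum>h\<in>P1. \<bar>ip h y\<bar>) + (\<Sum>h\<in>P2. \<bar>ip h y\<bar>)"
      unfolding P(1) using P(2) fP fam_finite by (intro sum.union_disjoint) auto
    finally have split: "(\<Sum>h\<in>H. \<bar>ip h y\<bar>) = (\<Sum>h\<in>P1. \<bar>ip h y\<bar>) + (\<Sum>h\<in>P2. \<bar>ip h y\<bar>)" .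
    have e2: "(\<Sum>h\<in>P2. \<bar>ip h y\<bar>) \<le> 1 / m s0"
    proof -
      have mj': "m j \<le> m j'" using m_mono[of j j'] j'(1) assms(2) by simp
      have "(\<Sum>h\<in>P2. \<bar>ip h y\<bar>) \<le> 1 / m j' * (\<Sum>i\<in>supp y. \<bar>y i\<bar>)"
      proof (rule fam_sup_bound[OF fP(2)])
        fix h i assume h: "h \<in> P2"
        then have "\<bar>h i\<bar> \<le> 1 / m (s h)" using s[of h] H(3) by (intro Lc_bound) (auto simp: P2_def)
        also have "\<dots> \<le> 1 / m j'"
          using m_mono[of j' "s h"] h j'(1) assms(2) mj mj' by (intro divide_left_mono) (auto simp: P2_def)
        finally show "\<bar>h i\<bar> \<le> 1 / m j'" .
      qed simp
      also have "\<dots> \<le> 1 / m j" using j'(2) mj mj' by (simp add: field_simps)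
      also have "\<dots> \<le> 1 / m s0" using mm mj by (intro divide_left_mono) auto
      finally show ?thesis .
    qed
    have e1: "(\<Sum>h\<in>P1. \<bar>ip h y\<bar>) \<le> 6 / m s0"
    proof -
      have w1: "mn ` P1 \<in> wide 1" using ft(2) by (rule wide_subset) (auto simp: P1_def)
      have J1: "1 \<le> j - 1" using assms(2) by simp
      have sP: "z \<notin> signed_units \<and> 1 \<le> s z \<and> s z \<le> j - 1 \<and> z \<in> Lc (s z)" if "z \<in> P1" for z
        using s[of z] that H(3) by (auto simp: P1_def)
      obtain C where C: "\<And>z. z \<in> P1 \<Longrightarrow> fam (C z) \<and> z = avg (m (s z)) (C z)" "fam (\<Union>z\<in>P1. C z)"
        "\<And>z z'. z \<in> P1 \<Longrightarrow> z' \<in> P1 \<Longrightarrow> z \<noteq> z' \<Longrightarrow> C z \<inter> C z' = {}" "mn ` (\<Union>z\<in>P1. C z) \<in> wide (1 + k (j - 1))"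
        by (rule children[of P1 1 "j - 1" s, OF fP(1) w1 J1 sP], assumption) (rule that)
      \<comment> \<open>For index 1 tameness with constant 4 is automatic: \<open>fam_l1\<close>
        gives the bound 2, which equals \<open>4 / m 1\<close>.\<close>
      have tu: "tame 4 1 {} (d l) (u l)" for l
        unfolding tame_def
      proof (intro conjI allI impI)
        show "u l \<in> c00" "supp (u l) \<subseteq> {d l..}" "N (u l) \<le> 4" using uc u(4)[of l] by auto
        fix H' s1
        assume H': "fam H' \<and> card H' \<le> d l \<and> 1 \<le> s1 \<and> s1 \<le> 1 \<and> (\<forall>h\<in>H'. h \<notin> signed_units \<and> (\<exists>s\<ge>s1. s \<notin> {} \<and> h \<in> Lc s))"
        have "supp (u l) \<subseteq> {d l..}" using u(4)[of l] by auto
        then have "(\<Sum>h\<in>H'. \<bar>ip h (u l)\<bar>) \<le> 2 * N (u l)" using H' by (intro fam_l1) auto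
        moreover have "s1 = 1" using H' by auto
        ultimately show "(\<Sum>h\<in>H'. \<bar>ip h (u l)\<bar>) \<le> 4 / m s1" using u(4)[of l] m_1 by simp
      qed
      have "\<exists>B\<subseteq>{..<K}. sum a B \<le> 2 * (1 / m j) \<and>
        (\<forall>l<K. l \<notin> B \<longrightarrow> (\<Sum>g\<in>(\<Union>z\<in>P1. C z). 1 * \<bar>ip g (u l)\<bar>) \<le> 2 * 4 * 0 + 1 * 4 / m 1)"
        using u(1,3) tu
      proof (rule tame_blocks)
        show "mn ` (\<Union>z\<in>P1. C z) \<in> wide ?n" using C(4) by (simp add: add.commute)
        show "1 \<le> 0 \<or> g \<in> signed_units \<or> 1 \<le> (1::real) \<and> (\<exists>s\<ge>1. g \<in> Lc s)" if "g \<in> (\<Union>z\<in>P1. C z)" for g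
          using fam_LL[OF C(2) that] by (auto simp: LL_def)
      qed (use u C(2) in auto)
      then obtain B where B: "B \<subseteq> {..<K}" "sum a B \<le> 2 / m j"
        "\<And>l. l < K \<Longrightarrow> l \<notin> B \<Longrightarrow> (\<Sum>g\<in>(\<Union>z\<in>P1. C z). \<bar>ip g (u l)\<bar>) \<le> 2" using m_1 by auto
      have "(\<Sum>h\<in>P1. \<bar>ip h y\<bar>) \<le> 2 / m s0 + 2 / m j * 2"
        unfolding y_def using u(3)
      proof (rule average_estimate)
        show "B \<subseteq> {..<K}" "sum a B \<le> 2 / m j" by fact+
        show "(\<Sum>h\<in>P1. \<bar>ip h (u l)\<bar>) \<le> 2" if "l < K" for l
        proof -
          have "card P1 \<le> card H0" using fam_finite[OF ft(1)] by (intro card_mono) (auto simp: P1_def)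
          also have "\<dots> \<le> card H" unfolding H0_def by (rule card_restr_family[OF fam_finite[OF H(1)]])
          also have "\<dots> \<le> d l" using H(2) dm[of 0 l] by simp
          finally have "(\<Sum>h\<in>P1. \<bar>ip h (u l)\<bar>) \<le> 2 * N (u l)" using u(4)[of l] by (intro fam_l1[OF fP(1)]) auto
          then show ?thesis using u(4)[of l] by simp
        qed
        show "(\<Sum>h\<in>P1. \<bar>ip h (u l)\<bar>) \<le> 2 / m s0" if "l < K" "l \<notin> B" for l
        proof -
          have "(\<Sum>h\<in>P1. \<bar>ip h (u l)\<bar>) \<le> 1 / m s0 * (\<Sum>h\<in>(\<Union>z\<in>P1. C z). \<bar>ip h (u l)\<bar>)"
            by (rule sum_children_le[OF fP(1) C(1) C(3)]) (use s H(3) in \<open>auto simp: P1_def\<close>)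
          also have "\<dots> \<le> 1 / m s0 * 2" using B(3)[OF that] by (intro mult_left_mono) auto
          finally show ?thesis by simp
        qed
      qed (use uc fam_finite fP in auto)
      also have "\<dots> \<le> 6 / m s0"
      proof -
        have "4 / real (m j) \<le> 4 / m s0" using mm mj by (intro divide_left_mono) auto
        then show ?thesis by simp
      qed
      finally show ?thesis .
    qed
    show "(\<Sum>h\<in>H. \<bar>ip h y\<bar>) \<le> 7 / m s0" using split e1 e2 by (simp add: add_divide_distrib[symmetric])
  qed
  show ?thesis
  proof (rule that[of y ys "d 0" e])
    show "y \<in> S" unfolding y_def using u(4) by (intro block_space_sum[OF assms(1)]) auto
    show "1 \<le> d 0" using u(1) by (auto simp: growing_def)
    show "1 / 4 \<le> ip ys y" using f(2) ipys by simp
    show "supp ys \<subseteq> {d 0..<e}" by (simp add: ys_def)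
  qed (use ysL u(2) de sy Ny tame in auto)
qed

section \<open>Rapidly increasing sequences\<close>

lemma log_index:
  assumes "2 \<le> J"
  obtains r where "m J \<le> 2 ^ r" "2 * r \<le> t J + 1" "3 \<le> r"
proof -
  define r where "r = (LEAST r. m J \<le> 2 ^ r)"
  have ex: "m J \<le> 2 ^ r" unfolding r_def by (rule LeastI[of "\<lambda>r. m J \<le> 2 ^ r" "m J"]) (simp add: less_imp_le)
  have m5: "5 \<le> m J" using m_ge_5[OF assms] .
  have r3: "3 \<le> r"
  proof (rule ccontr)
    assume "\<not> 3 \<le> r"
    then have "(2::nat) ^ r \<le> 2 ^ 2" by (intro power_increasing) auto
    then show False using ex m5 by simp
  qed
  have "\<not> m J \<le> 2 ^ (r - 1)" unfolding r_def
  proof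
    assume "m J \<le> 2 ^ ((LEAST r. m J \<le> 2 ^ r) - 1)"
    then have "(LEAST r. m J \<le> 2 ^ r) \<le> (LEAST r. m J \<le> 2 ^ r) - 1" by (rule Least_le)
    then show False using r3 by (simp add: r_def)
  qed
  then have "2 ^ (r - 1) < m J" by simp
  \<comment> \<open>Minimality of \<open>r\<close> is squared in order to compare with
    \<open>2 ^ t J\<close>; the square in the choice of \<open>t\<close> is what leaves half of the
    levels free.\<close>
  then have "(2 ^ (r - 1))\<^sup>2 < (m J)\<^sup>2" by (intro power_strict_mono) auto
  also have "\<dots> \<le> 2 ^ t J" using t_bound[OF assms] by blast
  finally have "(2::nat) ^ (2 * (r - 1)) < 2 ^ t J" by (simp add: power_mult[symmetric] mult.commute)
  then have "2 * (r - 1) < t J" by simp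
  then show ?thesis using that[of r] ex r3 by simp
qed

lemma expansion_ip:
  assumes "expansion J r h F w"
  shows "\<bar>ip h x\<bar> \<le> (\<Sum>g\<in>F. w g * \<bar>ip g x\<bar>)"
proof -
  have h: "h = (\<lambda>i. \<Sum>g\<in>F. w g * g i)" and w: "\<And>g. g \<in> F \<Longrightarrow> 0 \<le> w g"
    using assms unfolding expansion_def by blast+
  have "ip h x = (\<Sum>g\<in>F. w g * ip g x)" using h ip_sum_left[of w F x] by metis
  also have "\<bar>\<dots>\<bar> \<le> (\<Sum>g\<in>F. \<bar>w g * ip g x\<bar>)" by (rule sum_abs)
  also have "\<dots> = (\<Sum>g\<in>F. w g * \<bar>ip g x\<bar>)" using w by (intro sum.cong) (auto simp: abs_mult)
  finally show ?thesis .
qed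

text \<open>Taking \<open>{j l..<j (Suc l)}\<close> as exceptional sets makes the exceptional weights of different terms disjoint and larger
  than \<open>J\<close>.\<close>

definition rapidly_increasing ::
  "nat \<Rightarrow> (nat \<Rightarrow> nat) \<Rightarrow> (nat \<Rightarrow> real) \<Rightarrow> nat \<Rightarrow> (nat \<Rightarrow> nat) \<Rightarrow> (nat \<Rightarrow> nat \<Rightarrow> real) \<Rightarrow> bool" where
  "rapidly_increasing J d a K j y \<longleftrightarrow> 2 \<le> J \<and> growing d \<and> small_on_wide d a K (k J - 1) (1 / real (m J) ^ 3) \<and>
     (\<forall>l. Suc J \<le> j l \<and> j l \<le> j (Suc l) \<and> tame 7 (j l) {j l..<j (Suc l)} (d l) (y l) \<and>
       supp (y l) \<subseteq> {d l..<d (Suc l)} \<and> N (y l) \<le> 1)"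

lemma rapidly_increasingD:
  assumes "rapidly_increasing J d a K j y"
  shows "2 \<le> J" "growing d" "small_on_wide d a K (k J - 1) (1 / real (m J) ^ 3)" "Suc J \<le> j l" "j l \<le> j (Suc l)"
    "tame 7 (j l) {j l..<j (Suc l)} (d l) (y l)" "supp (y l) \<subseteq> {d l..<d (Suc l)}" "N (y l) \<le> 1" "y l \<in> c00"
    "l \<noteq> l' \<Longrightarrow> {j l..<j (Suc l)} \<inter> {j l'..<j (Suc l')} = {}"
proof -
  show r: "2 \<le> J" "growing d" "small_on_wide d a K (k J - 1) (1 / real (m J) ^ 3)" "Suc J \<le> j l" "j l \<le> j (Suc l)"
    "tame 7 (j l) {j l..<j (Suc l)} (d l) (y l)" "supp (y l) \<subseteq> {d l..<d (Suc l)}" "N (y l) \<le> 1" for l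
    using assms unfolding rapidly_increasing_def by blast+
  show "y l \<in> c00" using tameD(1)[OF r(6)] .
  have mono: "j i \<le> j i'" if "i \<le> i'" for i i' using that lift_Suc_mono_le[of j] r(5) by blast
  assume "l \<noteq> l'"
  then consider "Suc l \<le> l'" | "Suc l' \<le> l" by linarith
  then show "{j l..<j (Suc l)} \<inter> {j l'..<j (Suc l')} = {}"
    using mono[of "Suc l" l'] mono[of "Suc l'" l] by cases auto
qed

text \<open>Room for unfolding \<open>r\<close> levels below a family of level
  \<open>2 * k (J - 1) + 1\<close>. It comes down to \<open>r + 2 \<le> t J\<close>, which follows
  from \<open>t J \<ge> 2 * r - 1\<close> and \<open>r \<ge> 3\<close>.\<close>

lemma k_pred_wide:
  assumes "2 \<le> J" "2 * r \<le> t J + 1" "3 \<le> r" shows "2 * k (J - 1) + 1 + r * k (J - 1) \<le> k J - 1"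
proof -
  have "(r + 2) * k (J - 1) + 1 \<le> t J * (k (J - 1) + 1)"
  proof -
    have "r + 2 \<le> t J" using assms by linarith
    then have "(r + 2) * k (J - 1) \<le> t J * k (J - 1)" by (rule mult_le_mono1)
    moreover have "1 \<le> t J" using t_bound[OF assms(1)] by simp
    ultimately show ?thesis by simp
  qed
  then show ?thesis using k_step[OF assms(1)] by (simp add: algebra_simps)
qed

text \<open>The family is unfolded until the coefficients are at most \<open>1 / m J\<close> or an
  index \<open>J\<close> or larger is reached. With tameness constant 7 the first kind contributes
  \<open>14 / m J\<close> and the second kind \<open>7 / m J\<close>.\<close>

lemma rapidly_increasing_family:
  assumes R: "rapidly_increasing J d a K j y" and H: "fam H" "mn ` H \<in> wide (2 * k (J - 1) + 1)"
  shows "\<exists>B\<subseteq>{..<K}. sum a B \<le> 2 * (1 / real (m J) ^ 3) \<and> (\<forall>l<K. l \<notin> B \<longrightarrow> (\<Sum>h\<in>H. \<bar>ip h (y l)\<bar>) \<le> 21 / m J)"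
proof -
  note r = rapidly_increasingD[OF R]
  obtain \<rho> where \<rho>: "m J \<le> 2 ^ \<rho>" "2 * \<rho> \<le> t J + 1" "3 \<le> \<rho>" using log_index[OF r(1)] .
  obtain F w where F: "fam (\<Union>h\<in>H. F h)" "\<And>h h'. h \<in> H \<Longrightarrow> h' \<in> H \<Longrightarrow> h \<noteq> h' \<Longrightarrow> F h \<inter> F h' = {}"
    "\<And>h. h \<in> H \<Longrightarrow> expansion J \<rho> h (F h) w" "mn ` (\<Union>h\<in>H. F h) \<in> wide (2 * k (J - 1) + 1 + \<rho> * k (J - 1))"
    by (rule expand_fam[OF r(1) H, of \<rho>]) (rule that)
  have mJ: "5 \<le> m J" using m_ge_5[OF r(1)] .
  have "real (m J) \<le> real (2 ^ \<rho>)" using \<rho>(1) by (rule of_nat_mono)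
  then have half: "(1/2::real) ^ \<rho> \<le> 1 / m J" using mJ by (simp add: power_divide field_simps)
  let ?G = "\<Union>h\<in>H. F h"
  have ex: "0 \<le> w g \<and> w g \<le> 1 \<and> (w g \<le> (1/2) ^ \<rho> \<or> g \<in> signed_units \<or> (\<exists>s\<ge>J. g \<in> Lc s))" if g: "g \<in> ?G" for g
  proof -
    obtain h where "h \<in> H" "g \<in> F h" using g by auto
    then show ?thesis using F(3)[of h] unfolding expansion_def by blast
  qed
  have "\<exists>B\<subseteq>{..<K}. sum a B \<le> 2 * (1 / real (m J) ^ 3) \<and>
    (\<forall>l<K. l \<notin> B \<longrightarrow> (\<Sum>g\<in>?G. w g * \<bar>ip g (y l)\<bar>) \<le> 2 * 7 * (1 / m J) + 1 * 7 / m J)"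
    using r(2,3,6,7,10)
  proof (rule tame_blocks)
    show "mn ` ?G \<in> wide (k J - 1)" using wide_mono[OF k_pred_wide[OF r(1) \<rho>(2,3)] F(4)] .
    show "w g \<le> 1 / m J \<or> g \<in> signed_units \<or> w g \<le> 1 \<and> (\<exists>s\<ge>J. g \<in> Lc s)" if "g \<in> ?G" for g
      using ex[OF that] half by auto
    show "J \<le> j l" for l using r(4)[of l] by simp
  qed (use F(1) ex r(1) in auto)
  then obtain B where B: "B \<subseteq> {..<K}" "sum a B \<le> 2 * (1 / real (m J) ^ 3)"
    "\<And>l. l < K \<Longrightarrow> l \<notin> B \<Longrightarrow> (\<Sum>g\<in>?G. w g * \<bar>ip g (y l)\<bar>) \<le> 2 * 7 * (1 / m J) + 1 * 7 / m J" by blast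
  have "(\<Sum>h\<in>H. \<bar>ip h (y l)\<bar>) \<le> 21 / m J" if l: "l < K" "l \<notin> B" for l
  proof -
    have "(\<Sum>h\<in>H. \<bar>ip h (y l)\<bar>) \<le> (\<Sum>h\<in>H. \<Sum>g\<in>F h. w g * \<bar>ip g (y l)\<bar>)"
      using expansion_ip[OF F(3)] by (rule sum_mono)
    also have "\<dots> = (\<Sum>g\<in>?G. w g * \<bar>ip g (y l)\<bar>)"
    proof (rule sum.UNION_disjoint[symmetric])
      show "\<forall>h\<in>H. finite (F h)" using F(3) fam_finite unfolding expansion_def by blast
    qed (use fam_finite[OF H(1)] F(2) in auto)
    also have "\<dots> \<le> 21 / m J" using B(3)[OF l] by simp
    finally show ?thesis .
  qed
  then show ?thesis using B by blast
qed

text \<open>Index \<open>J\<close> itself has to be excluded, as functionals of this index will norm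
  the vector. Smaller indices are opened by one level, which improves \<open>21 / m J\<close> by the
  factor \<open>1 / m s0\<close>. Larger indices are controlled by tameness at \<open>Suc J\<close>,
  and \<open>m (Suc J)\<close> exceeds the square of \<open>m J\<close>.\<close>

lemma rapidly_increasing_weights:
  assumes R: "rapidly_increasing J d a K j y" and Z: "fam Z" "mn ` Z \<in> wide (k (J - 1) + 1)"
    and s0: "1 \<le> s0" "s0 \<le> J" and lab: "\<And>z. z \<in> Z \<Longrightarrow> z \<in> signed_units \<or> (\<exists>s\<ge>s0. s \<noteq> J \<and> z \<in> Lc s)"
  shows "\<exists>B\<subseteq>{..<K}. sum a B \<le> 4 * (1 / real (m J) ^ 3) \<and>
    (\<forall>l<K. l \<notin> B \<longrightarrow> (\<Sum>z\<in>Z. \<bar>ip z (y l)\<bar>) \<le> 28 / (real (m s0) * m J))"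
proof -
  note r = rapidly_increasingD[OF R]
  have a0: "0 \<le> a l" for l using r(3) by (simp add: small_on_wide_def)
  define s where "s = (\<lambda>z. SOME s. s \<ge> s0 \<and> s \<noteq> J \<and> z \<in> Lc s)"
  have s: "s z \<ge> s0 \<and> s z \<noteq> J \<and> z \<in> Lc (s z)" if "z \<in> Z" "z \<notin> signed_units" for z
    unfolding s_def by (rule someI_ex) (use lab that in blast)
  define Z1 where "Z1 = {z\<in>Z. z \<notin> signed_units \<and> s z < J}"
  define Z2 where "Z2 = {z\<in>Z. z \<in> signed_units \<or> J < s z}"
  have "s z < J \<or> J < s z" if "z \<in> Z" "z \<notin> signed_units" for z using s[OF that] by linarith
  then have ZZ: "Z = Z1 \<union> Z2" by (auto simp: Z1_def Z2_def)
  have Z12: "Z1 \<inter> Z2 = {}" by (auto simp: Z1_def Z2_def)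
  have f: "fam Z1" "fam Z2" using Z(1) by (auto simp: Z1_def Z2_def intro: fam_subset)
  have w: "mn ` Z1 \<in> wide (k (J - 1) + 1)" "mn ` Z2 \<in> wide (k (J - 1) + 1)"
    by (rule wide_subset[OF Z(2)], force simp: Z1_def Z2_def)+
  have m0: "2 \<le> m s0" "5 \<le> m J" "m s0 \<le> m J" using m_ge_2[OF s0(1)] m_ge_5[OF r(1)] m_mono[OF s0] by auto
  have "1 \<le> J - 1" using r(1) by simp
  have s1: "z \<notin> signed_units \<and> 1 \<le> s z \<and> s z \<le> J - 1 \<and> z \<in> Lc (s z)" if "z \<in> Z1" for z
    using s[of z] that s0(1) by (auto simp: Z1_def)
  obtain H where H: "\<And>z. z \<in> Z1 \<Longrightarrow> fam (H z) \<and> z = avg (m (s z)) (H z)" "fam (\<Union>z\<in>Z1. H z)"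
    "\<And>z z'. z \<in> Z1 \<Longrightarrow> z' \<in> Z1 \<Longrightarrow> z \<noteq> z' \<Longrightarrow> H z \<inter> H z' = {}"
    "mn ` (\<Union>z\<in>Z1. H z) \<in> wide (k (J - 1) + 1 + k (J - 1))"
    by (rule children[of Z1 "k (J - 1) + 1" "J - 1" s, OF f(1) w(1) \<open>1 \<le> J - 1\<close> s1], assumption) (rule that)
  have "k (J - 1) + 1 + k (J - 1) = 2 * k (J - 1) + 1" by simp
  then have "mn ` (\<Union>z\<in>Z1. H z) \<in> wide (2 * k (J - 1) + 1)" using H(4) by (simp only:)
  then obtain B1 where B1: "B1\<subseteq>{..<K}" "sum a B1 \<le> 2 * (1 / real (m J) ^ 3)"
    "\<And>l. l<K \<Longrightarrow> l \<notin> B1 \<Longrightarrow> (\<Sum>h\<in>(\<Union>z\<in>Z1. H z). \<bar>ip h (y l)\<bar>) \<le> 21 / m J"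
    using rapidly_increasing_family[OF R H(2)] by blast
  have "\<exists>B\<subseteq>{..<K}. sum a B \<le> 2 * (1 / real (m J) ^ 3) \<and>
    (\<forall>l<K. l \<notin> B \<longrightarrow> (\<Sum>g\<in>Z2. 1 * \<bar>ip g (y l)\<bar>) \<le> 2 * 7 * 0 + 1 * 7 / m (Suc J))"
    using r(2,3,6,7,10)
  proof (rule tame_blocks)
    obtain \<rho> where \<rho>: "2 * \<rho> \<le> t J + 1" "3 \<le> \<rho>" using log_index[OF r(1)] .
    have "k (J - 1) + 1 \<le> k J - 1" using k_pred_wide[OF r(1) \<rho>] by linarith
    then show "mn ` Z2 \<in> wide (k J - 1)" using wide_mono w(2) by blast
    show "1 \<le> 0 \<or> g \<in> signed_units \<or> 1 \<le> (1::real) \<and> (\<exists>s\<ge>Suc J. g \<in> Lc s)" if g: "g \<in> Z2" for g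
      using g s[of g] by (auto simp: Z2_def Suc_le_eq)
    show "Suc J \<le> j l" for l by (rule r(4))
  qed (use f(2) in auto)
  then obtain B2 where B2: "B2\<subseteq>{..<K}" "sum a B2 \<le> 2 * (1 / real (m J) ^ 3)"
    "\<And>l. l<K \<Longrightarrow> l \<notin> B2 \<Longrightarrow> (\<Sum>g\<in>Z2. \<bar>ip g (y l)\<bar>) \<le> 7 / m (Suc J)" by auto
  have fin: "finite B1" "finite B2" using B1(1) B2(1) finite_subset[OF _ finite_lessThan] by auto
  have "sum a (B1 \<union> B2) \<le> sum a B1 + sum a B2"
    using fin a0 sum.union_inter[of B1 B2 a] sum_nonneg[of "B1 \<inter> B2" a] by auto
  then have mass: "sum a (B1 \<union> B2) \<le> 4 * (1 / real (m J) ^ 3)" using B1(2) B2(2) by linarith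
  have "(\<Sum>z\<in>Z. \<bar>ip z (y l)\<bar>) \<le> 28 / (real (m s0) * m J)" if l: "l < K" "l \<notin> B1 \<union> B2" for l
  proof -
    have "(\<Sum>z\<in>Z. \<bar>ip z (y l)\<bar>) = (\<Sum>z\<in>Z1. \<bar>ip z (y l)\<bar>) + (\<Sum>z\<in>Z2. \<bar>ip z (y l)\<bar>)"
      unfolding ZZ using Z12 f fam_finite by (intro sum.union_disjoint) auto
    also have "(\<Sum>z\<in>Z1. \<bar>ip z (y l)\<bar>) \<le> 1 / m s0 * (\<Sum>h\<in>(\<Union>z\<in>Z1. H z). \<bar>ip h (y l)\<bar>)"
      by (rule sum_children_le[OF f(1) H(1) H(3)]) (use s s0(1) in \<open>auto simp: Z1_def\<close>)
    also have "\<dots> \<le> 1 / m s0 * (21 / m J)" using B1(3) l by (intro mult_left_mono) auto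
    also have "(\<Sum>z\<in>Z2. \<bar>ip z (y l)\<bar>) \<le> 7 / m (Suc J)" using B2(3) l by auto
    also have "7 / m (Suc J) \<le> 7 / (real (m s0) * m J)"
    proof (rule divide_left_mono)
      have "m s0 * m J \<le> m J * m J" using m0 by simp
      also have "\<dots> \<le> m (Suc J)" using m_sq[of J] r(1) by (simp add: power2_eq_square)
      finally show "real (m s0) * m J \<le> m (Suc J)" by (metis of_nat_le_iff of_nat_mult)
      have "0 < m (Suc J)" using m_ge_2[of "Suc J"] by simp
      then show "0 < real (m (Suc J)) * (real (m s0) * real (m J))" using m0 by simp
    qed simp
    finally show ?thesis by (simp add: add_divide_distrib[symmetric])
  qed
  then show ?thesis using mass B1(1) B2(1) by (intro exI[of _ "B1 \<union> B2"]) auto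
qed

text \<open>The second condition is a two-level estimate, tailored to special functionals of index
  \<open>s' = J0\<close> whose members have indices above \<open>J0\<close> and miss the index
  \<open>J\<close> of the vector; a factor is gained on both levels.\<close>

definition controlled :: "real \<Rightarrow> nat \<Rightarrow> nat \<Rightarrow> (nat \<Rightarrow> real) \<Rightarrow> bool" where
  "controlled C J d x \<longleftrightarrow> tame C J {J} d x \<and>
     (\<forall>P Z s'. fam P \<and> card P \<le> d \<and> 1 \<le> s' \<and> s' < J \<and>
        (\<forall>\<phi>\<in>P. supp \<phi> \<subseteq> {d..} \<and> fam (Z \<phi>) \<and> \<phi> = avg (m s') (Z \<phi>) \<and> mn ` Z \<phi> \<in> wide (k s') \<and>
           (\<forall>z\<in>Z \<phi>. z \<in> signed_units \<or> (\<exists>s>s'. s \<noteq> J \<and> z \<in> Lc s))) \<longrightarrow>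
        (\<Sum>\<phi>\<in>P. \<bar>ip \<phi> x\<bar>) \<le> C / (real (m s') * m (Suc s')))"

text \<open>Normalization multiplies the average by up to \<open>4 * m J\<close>. The bounds for the
  blocks have a factor \<open>1 / m J\<close> to spare, and 28 becomes 112; the spoiled blocks add
  at most 32, which makes 144.\<close>

lemma rapidly_increasing_controlled:
  assumes R: "rapidly_increasing J d a K j y" and c: "0 \<le> c" "c \<le> 4 * real (m J)"
  defines "x \<equiv> (\<lambda>i. c * (\<Sum>l\<in>{0..<K}. a l * y l i))"
  shows "controlled 144 J (d 0) x"
proof -
  note r = rapidly_increasingD[OF R]
  let ?\<delta> = "1 / real (m J) ^ 3"
  define w where "w = (\<lambda>i. \<Sum>l\<in>{0..<K}. a l * y l i)"
  have wc: "w \<in> c00" unfolding w_def using r(9) by (intro c00_sum) auto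
  have xw: "x = (\<lambda>i. c * w i)" by (simp add: x_def w_def)
  have xc: "x \<in> c00" unfolding xw by (rule c00_scale[OF wc])
  have ipx: "\<bar>ip h x\<bar> = c * \<bar>ip h w\<bar>" for h unfolding xw ip_scale_right[OF wc] using c by (simp add: abs_mult)
  have mJ: "5 \<le> m J" using m_ge_5[OF r(1)] .
  have dm: "d i \<le> d i'" if "i \<le> i'" for i i' using growing_mono[OF r(2) that] .
  have sw: "supp x \<subseteq> {d 0..}"
  proof -
    have "supp x \<subseteq> supp w" unfolding xw by (auto simp: supp_def)
    also have "\<dots> \<subseteq> (\<Union>l\<in>{0..<K}. supp (y l))" unfolding w_def by (rule supp_sum_subset)
    also have "\<dots> \<subseteq> {d 0..}"
    proof (rule UN_least)
      fix l show "supp (y l) \<subseteq> {d 0..}" using r(7)[of l] dm[of 0 l] by auto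
    qed
    finally show ?thesis .
  qed
  \<comment> \<open>The spoiled blocks have mass at most \<open>4 * ?\<delta>\<close> and satisfy
    the bound 2 each; after multiplication by \<open>4 * m J\<close> this is
    \<open>32 / real (m J) ^ 2\<close>. The cube in \<open>?\<delta>\<close> is chosen so that this
    is dominated by any product of two factors \<open>1 / m i\<close> with
    \<open>i \<le> J\<close>.\<close>
  have est: "(\<Sum>h\<in>P. \<bar>ip h x\<bar>) \<le> 4 * real (m J) * \<gamma> + 32 / real (m J) ^ 2"
    if P: "fam P" "card P \<le> d 0" and B: "B \<subseteq> {..<K}" "sum a B \<le> 4 * ?\<delta>"
      "\<And>l. l < K \<Longrightarrow> l \<notin> B \<Longrightarrow> (\<Sum>h\<in>P. \<bar>ip h (y l)\<bar>) \<le> \<gamma>" "0 \<le> \<gamma>" for P B \<gamma>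
  proof -
    have "(\<Sum>h\<in>P. \<bar>ip h w\<bar>) \<le> \<gamma> + 4 * ?\<delta> * 2"
      unfolding w_def using r(3,9) fam_finite[OF P(1)]
    proof (rule average_estimate)
      fix l
      have "supp (y l) \<subseteq> {d l..}" using r(7)[of l] by auto
      then have "(\<Sum>h\<in>P. \<bar>ip h (y l)\<bar>) \<le> 2 * N (y l)" using P dm[of 0 l] by (intro fam_l1[of P "d l"]) auto
      then show "(\<Sum>h\<in>P. \<bar>ip h (y l)\<bar>) \<le> 2" using r(8)[of l] by linarith
    qed (use B in auto)
    moreover have "0 \<le> (\<Sum>h\<in>P. \<bar>ip h w\<bar>)" by (intro sum_nonneg) simp
    ultimately have "c * (\<Sum>h\<in>P. \<bar>ip h w\<bar>) \<le> 4 * real (m J) * (\<gamma> + 4 * ?\<delta> * 2)"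
      using c by (intro mult_mono) auto
    moreover have "(\<Sum>h\<in>P. \<bar>ip h x\<bar>) = c * (\<Sum>h\<in>P. \<bar>ip h w\<bar>)" using ipx by (simp add: sum_distrib_left)
    moreover have "4 * real (m J) * (\<gamma> + 4 * ?\<delta> * 2) = 4 * real (m J) * \<gamma> + 32 / real (m J) ^ 2"
      using mJ by (simp add: field_simps power2_eq_square power3_eq_cube)
    ultimately show ?thesis by linarith
  qed
  have mm: "1 / real (m J) ^ 2 \<le> 1 / (real (m i) * m i')" if i: "1 \<le> i" "i \<le> J" "1 \<le> i'" "i' \<le> J" for i i'
  proof -
    have mi: "m i \<le> m J" "m i' \<le> m J" "2 \<le> m i" "2 \<le> m i'"
      using m_mono[OF i(1,2)] m_mono[OF i(3,4)] m_ge_2[OF i(1)] m_ge_2[OF i(3)] by auto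
    then have "real (m i) * m i' \<le> real (m J) * m J" by (intro mult_mono) auto
    then show ?thesis unfolding power2_eq_square using mi mJ by (intro divide_left_mono) auto
  qed
  have "N x \<le> 144"
  proof (rule N_leI)
    fix f assume f: "f \<in> LL"
    show "ip f x \<le> 144"
    proof (cases "supp f = {}")
      case True then show ?thesis using ip_disjoint[of f x] by simp
    next
      case False
      have ff: "fam {f}" using f LL_wf[OF f] False by (auto simp: fam_def blocks_def disjoint_supports_def)
      have "mn f \<noteq> 0" using mn_in[of f] LL_wf[OF f] False unfolding supp_def by (metis mem_Collect_eq)
      then have "mn ` {f} \<in> wide 0" by auto
      then have "mn ` {f} \<in> wide (2 * k (J - 1) + 1)" by (rule wide_mono[rotated]) simp
      then obtain B where B: "B\<subseteq>{..<K}" "sum a B \<le> 2 * ?\<delta>" "\<And>l. l<K \<Longrightarrow> l \<notin> B \<Longrightarrow> (\<Sum>h\<in>{f}. \<bar>ip h (y l)\<bar>) \<le> 21 / m J"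
        using rapidly_increasing_family[OF R ff] by blast
      have "1 \<le> d 0" using r(2) by (auto simp: growing_def)
      moreover have "sum a B \<le> 4 * ?\<delta>" using B(2) by (rule order_trans) (auto intro!: divide_right_mono)
      ultimately have "(\<Sum>h\<in>{f}. \<bar>ip h x\<bar>) \<le> 4 * real (m J) * (21 / m J) + 32 / real (m J) ^ 2"
        using B by (intro est[of "{f}" B] ff) auto
      moreover have "1 / real (m J) ^ 2 \<le> 1 / (real (m 1) * m 1)" using r(1) by (intro mm) auto
      then have "32 / real (m J) ^ 2 \<le> 8" using m_1 by simp
      ultimately show ?thesis using mJ by simp
    qed
  qed
  moreover have "(\<Sum>h\<in>H. \<bar>ip h x\<bar>) \<le> 144 / m s0"
    if H: "fam H" "card H \<le> d 0" "1 \<le> s0" "s0 \<le> J" "\<forall>h\<in>H. h \<notin> signed_units \<and> (\<exists>s\<ge>s0. s \<notin> {J} \<and> h \<in> Lc s)" for H s0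
  proof -
    define H0 where "H0 = restr_family {d 0..} H"
    note ft = fam_tail[OF H(1,2), folded H0_def]
    have lab: "g \<in> signed_units \<or> (\<exists>s\<ge>s0. s \<noteq> J \<and> g \<in> Lc s)" if g: "g \<in> H0" for g
    proof -
      obtain h where h: "h \<in> H" "supp h \<inter> {d 0..} \<noteq> {}" "g = restr {d 0..} h" using g by (auto simp: H0_def restr_family_def)
      obtain s where s: "s \<ge> s0" "s \<noteq> J" "h \<in> Lc s" "h \<notin> signed_units" using H(5) h(1) by blast
      then show ?thesis using Lc_restr_nonunit(1)[OF s(3) _ s(4) order_convex_atLeast h(2)] h(3) H(3) by (intro disjI2 exI[of _ s]) auto
    qed
    have "mn ` H0 \<in> wide (k (J - 1) + 1)" by (rule wide_mono[OF _ ft(2)]) simp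
    then obtain B where B: "B\<subseteq>{..<K}" "sum a B \<le> 4 * ?\<delta>"
      "\<And>l. l<K \<Longrightarrow> l \<notin> B \<Longrightarrow> (\<Sum>z\<in>H0. \<bar>ip z (y l)\<bar>) \<le> 28 / (real (m s0) * m J)"
      using rapidly_increasing_weights[OF R ft(1) _ H(3,4) lab] by blast
    have "card H0 \<le> d 0" using card_restr_family[OF fam_finite[OF H(1)], of "{d 0..}"] H(2) by (simp add: H0_def)
    then have "(\<Sum>h\<in>H0. \<bar>ip h x\<bar>) \<le> 4 * real (m J) * (28 / (real (m s0) * m J)) + 32 / real (m J) ^ 2"
      using B by (intro est[OF ft(1)]) auto
    also have "4 * real (m J) * (28 / (real (m s0) * m J)) = 112 / m s0" using mJ by simp
    also have "32 / real (m J) ^ 2 \<le> 32 / m s0"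
    proof -
      have "1 / real (m J) ^ 2 \<le> 1 / (real (m s0) * m 1)" using H r(1) by (intro mm) auto
      also have "\<dots> \<le> 1 / m s0" using m_1 m_ge_2[OF H(3)] by (simp add: field_simps)
      finally show ?thesis by simp
    qed
    finally have "(\<Sum>h\<in>H0. \<bar>ip h x\<bar>) \<le> 144 / m s0" by (simp add: add_divide_distrib[symmetric])
    then show ?thesis using ft(3)[OF sw] by simp
  qed
  ultimately have tame: "tame 144 J {J} (d 0) x" unfolding tame_def using xc sw by blast
  have "(\<Sum>\<phi>\<in>P. \<bar>ip \<phi> x\<bar>) \<le> 144 / (real (m s') * m (Suc s'))"
    if P: "fam P" "card P \<le> d 0" "1 \<le> s'" "s' < J" and Z: "\<forall>\<phi>\<in>P. supp \<phi> \<subseteq> {d 0..} \<and> fam (Z \<phi>) \<and> \<phi> = avg (m s') (Z \<phi>) \<and>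
      mn ` Z \<phi> \<in> wide (k s') \<and> (\<forall>z\<in>Z \<phi>. z \<in> signed_units \<or> (\<exists>s>s'. s \<noteq> J \<and> z \<in> Lc s))" for P Z s'
  proof -
    have m0: "2 \<le> m s'" "2 \<le> m (Suc s')" using m_ge_2 P(3) by auto
    have sub: "supp z \<subseteq> supp \<phi>" if z: "\<phi> \<in> P" "z \<in> Z \<phi>" for \<phi> z
    proof -
      have "supp (avg (m s') (Z \<phi>)) = \<Union>(supp ` Z \<phi>)" using Z z(1) m0 by (intro supp_avg fam_blocks) auto
      moreover have "avg (m s') (Z \<phi>) = \<phi>" using Z z(1) by simp
      ultimately show ?thesis using z(2) by auto
    qed
    have un: "fam (\<Union>\<phi>\<in>P. Z \<phi>)" "\<And>\<phi> \<phi>'. \<phi> \<in> P \<Longrightarrow> \<phi>' \<in> P \<Longrightarrow> \<phi> \<noteq> \<phi>' \<Longrightarrow> Z \<phi> \<inter> Z \<phi>' = {}"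
      using fam_UN[of P Z] P(1) Z sub by blast+
    \<comment> \<open>There are at most \<open>d 0\<close> functionals and all their parts start at
      \<open>d 0\<close> or later, so the union costs just one level beyond
      \<open>k (J - 1)\<close>.\<close>
    have "(\<Union>\<phi>\<in>P. mn ` Z \<phi>) \<in> wide (Suc (k (J - 1)))"
    proof (rule wide_Suc_UN[OF fam_finite[OF P(1)] P(2)])
      show "mn ` Z \<phi> \<in> wide (k (J - 1))" if "\<phi> \<in> P" for \<phi>
        by (rule wide_mono[OF k_mono]) (use P Z that in auto)
      fix \<phi> i assume "\<phi> \<in> P" "i \<in> mn ` Z \<phi>"
      then obtain z where z: "z \<in> Z \<phi>" "i = mn z" by auto
      then have "i \<in> supp z" using Z \<open>\<phi> \<in> P\<close> fam_ne mn_in by metis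
      then have "i \<in> supp \<phi>" using sub \<open>\<phi> \<in> P\<close> z(1) by blast
      then show "d 0 \<le> i" using Z \<open>\<phi> \<in> P\<close> by auto
    qed
    then have wd: "mn ` (\<Union>\<phi>\<in>P. Z \<phi>) \<in> wide (k (J - 1) + 1)" by (simp add: image_UN del: wide.simps)
    have lab: "z \<in> signed_units \<or> (\<exists>s\<ge>Suc s'. s \<noteq> J \<and> z \<in> Lc s)" if "z \<in> (\<Union>\<phi>\<in>P. Z \<phi>)" for z
      using that Z by (auto simp: Suc_le_eq)
    have "1 \<le> Suc s'" "Suc s' \<le> J" using P by auto
    then obtain B where B: "B\<subseteq>{..<K}" "sum a B \<le> 4 * ?\<delta>"
      "\<And>l. l<K \<Longrightarrow> l \<notin> B \<Longrightarrow> (\<Sum>z\<in>(\<Union>\<phi>\<in>P. Z \<phi>). \<bar>ip z (y l)\<bar>) \<le> 28 / (real (m (Suc s')) * m J)"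
      using rapidly_increasing_weights[OF R un(1) wd _ _ lab] by blast
    have "(\<Sum>\<phi>\<in>P. \<bar>ip \<phi> x\<bar>) \<le> 4 * real (m J) * (28 / (real (m s') * (real (m (Suc s')) * m J))) + 32 / real (m J) ^ 2"
    proof (rule est[OF P(1,2) B(1,2)])
      fix l assume l: "l < K" "l \<notin> B"
      have "(\<Sum>\<phi>\<in>P. \<bar>ip \<phi> (y l)\<bar>) \<le> 1 / m s' * (\<Sum>z\<in>(\<Union>\<phi>\<in>P. Z \<phi>). \<bar>ip z (y l)\<bar>)"
        by (rule sum_children_le[where s = "\<lambda>_. s'", OF P(1) _ un(2)]) (use Z P in auto)
      also have "\<dots> \<le> 1 / m s' * (28 / (real (m (Suc s')) * m J))" using B(3)[OF l] by (intro mult_left_mono) auto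
      finally show "(\<Sum>\<phi>\<in>P. \<bar>ip \<phi> (y l)\<bar>) \<le> 28 / (real (m s') * (real (m (Suc s')) * m J))" by simp
    qed simp
    also have "4 * real (m J) * (28 / (real (m s') * (real (m (Suc s')) * m J))) = 112 / (real (m s') * m (Suc s'))" using mJ by simp
    also have "32 / real (m J) ^ 2 \<le> 32 / (real (m s') * m (Suc s'))"
    proof -
      have "1 / real (m J) ^ 2 \<le> 1 / (real (m s') * m (Suc s'))" using P by (intro mm) auto
      then show ?thesis by simp
    qed
    finally show ?thesis by (simp add: add_divide_distrib[symmetric])
  qed
  then show ?thesis unfolding controlled_def using tame by blast
qed

section \<open>Pairs of a vector and a functional of prescribed index\<close>

lemma block_family:
  assumes "growing d" "\<And>l. l < K \<Longrightarrow> h l \<in> LL \<and> supp (h l) \<noteq> {} \<and> supp (h l) \<subseteq> {d l..<d (Suc l)}"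
  shows "fam (h ` {0..<K})" "successive (h ` {0..<K})" "inj_on h {0..<K}"
proof -
  have dm: "d i \<le> d i'" if "i \<le> i'" for i i' using growing_mono[OF assms(1) that] .
  have same: "l = l'" if "l < K" "l' < K" "i \<in> supp (h l)" "i \<in> supp (h l')" for l l' i
    using that assms(2)[of l] assms(2)[of l'] growing_disjoint[OF assms(1), of i l l'] by blast
  have "disjoint_supports (h ` {0..<K})" unfolding disjoint_supports_def using same by fastforce
  then show "fam (h ` {0..<K})" unfolding fam_def blocks_def using assms(2) LL_wf by auto
  show "inj_on h {0..<K}"
  proof (rule inj_onI)
    fix l l' assume l: "l \<in> {0..<K}" "l' \<in> {0..<K}" "h l = h l'"
    obtain i where "i \<in> supp (h l)" using assms(2)[of l] l by auto
    then show "l = l'" using same[of l l' i] l by simp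
  qed
  show "successive (h ` {0..<K})" unfolding successive_def
  proof (intro ballI impI)
    fix f g assume fg: "f \<in> h ` {0..<K}" "g \<in> h ` {0..<K}" "mn f < mn g"
    then obtain l l' where l: "l < K" "l' < K" "f = h l" "g = h l'" by auto
    have sp: "supp f \<subseteq> {d l..<d (Suc l)}" "supp g \<subseteq> {d l'..<d (Suc l')}" using assms(2) l by blast+
    have "mn f \<in> supp f" "mn g \<in> supp g" using assms(2) l LL_wf mn_in by metis+
    then have "mn f \<in> {d l..<d (Suc l)}" "mn g \<in> {d l'..<d (Suc l')}" using sp by blast+
    moreover have "l \<noteq> l'" using fg(3) l by auto
    ultimately have "Suc l \<le> l'" using fg(3) dm[of "Suc l'" l] by (cases "Suc l' \<le> l") auto
    then have "d (Suc l) \<le> d l'" by (rule dm)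
    then show "set_less (supp f) (supp g)" unfolding set_less_def using sp by force
  qed
qed

text \<open>The functional of index \<open>J\<close> is built from almost norming functionals of a
  rapidly increasing sequence. The same coefficients make the starting points admissible and the
  average small on wide sets, so one choice serves the lower and the upper estimate.\<close>

lemma controlled_pair_exists:
  assumes S: "block_space S" and J: "2 \<le> J" "even J"
  obtains x xs d0 e where "x \<in> S" "xs \<in> Lc J" "n0 \<le> d0" "1 \<le> d0" "d0 < e" "supp x \<subseteq> {d0..<e}"
    "supp xs \<subseteq> {d0..<e}" "supp xs \<noteq> {}" "ip xs x = 1" "controlled 144 J d0 x"
proof -
  \<comment> \<open>Tameness is stored as an implication in \<open>j'\<close>, because the upper end
    of the exceptional range is the index of the next member. The relation \<open>R\<close> below
    asks that this index be large enough to discharge the implication.\<close>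
  define P where "P = (\<lambda>(y, ys, d0, e, j). y \<in> S \<and> ys \<in> LL \<and> (1::nat) \<le> d0 \<and> supp y \<subseteq> {d0..<e} \<and> supp ys \<subseteq> {d0..<e} \<and>
    1 / 4 \<le> ip ys y \<and> N y \<le> 1 \<and> Suc J \<le> j \<and>
    (\<forall>j'. j \<le> j' \<longrightarrow> real (m j) * (\<Sum>i\<in>supp y. \<bar>y i\<bar>) \<le> real (m j') \<longrightarrow> tame 7 j {j..<j'} d0 y))"
  define lo where "lo = (\<lambda>(y::nat \<Rightarrow> real, ys::nat \<Rightarrow> real, d0::nat, e::nat, j::nat). d0)"
  define hi where "hi = (\<lambda>(y::nat \<Rightarrow> real, ys::nat \<Rightarrow> real, d0::nat, e::nat, j::nat). e)"
  define ind where "ind = (\<lambda>(y::nat \<Rightarrow> real, ys::nat \<Rightarrow> real, d0::nat, e::nat, j::nat). j)"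
  define vec where "vec = (\<lambda>(y::nat \<Rightarrow> real, ys::nat \<Rightarrow> real, d0::nat, e::nat, j::nat). y)"
  define fn where "fn = (\<lambda>(y::nat \<Rightarrow> real, ys::nat \<Rightarrow> real, d0::nat, e::nat, j::nat). ys)"
  note sel = lo_def hi_def ind_def vec_def fn_def
  define R where "R = (\<lambda>z' z. ind z' \<le> ind z \<and> real (m (ind z')) * (\<Sum>i\<in>supp (vec z'). \<bar>vec z' i\<bar>) \<le> real (m (ind z)))"
  have ex: "\<exists>z. P z \<and> n \<le> lo z \<and> j0 \<le> ind z" for n j0
  proof -
    let ?j = "max j0 (Suc J)"
    have "2 \<le> ?j" using J by simp
    obtain y ys d0 e where "y \<in> S" "ys \<in> LL" "n \<le> d0" "1 \<le> d0" "d0 < e"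
      "supp y \<subseteq> {d0..<e}" "supp ys \<subseteq> {d0..<e}" "1 / 4 \<le> ip ys y" "N y \<le> 1"
      "\<And>j'. ?j \<le> j' \<Longrightarrow> real (m ?j) * (\<Sum>i\<in>supp y. \<bar>y i\<bar>) \<le> real (m j') \<Longrightarrow> tame 7 ?j {?j..<j'} d0 y"
      by (rule tame_average_exists[OF S \<open>2 \<le> ?j\<close>, of n]) (rule that)
    then show ?thesis by (intro exI[of _ "(y, ys, d0, e, ?j)"]) (auto simp: P_def sel)
  qed
  define mJ where "mJ = real (m J)"
  have mJ5: "5 \<le> mJ" using m_ge_5[OF J(1)] by (simp add: mJ_def)
  define n1 where "n1 = max n0 (2 ^ k J * m J ^ 3)"
  have p1: "\<exists>z. P z \<and> max 1 n1 \<le> lo z" using ex by blast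
  have p2: "\<exists>z. P z \<and> n \<le> lo z \<and> R z' z" for n z'
  proof -
    obtain B :: nat where B: "real (m (ind z')) * (\<Sum>i\<in>supp (vec z'). \<bar>vec z' i\<bar>) \<le> real B"
      using real_arch_simple by blast
    obtain z where z: "P z" "n \<le> lo z" "max B (max 1 (ind z')) \<le> ind z" using ex by blast
    have "B \<le> m (ind z)" using m_ge_index[of "ind z"] z(3) by simp
    then have "real B \<le> real (m (ind z))" by simp
    then show ?thesis unfolding R_def using B z by (intro exI[of _ z]) (auto intro: order_trans)
  qed
  obtain z where z: "\<And>l. P (z l)" "n1 \<le> lo (z 0)" "growing (\<lambda>l. lo (z l))" "\<And>l. hi (z l) \<le> lo (z (Suc l))"
    "\<And>l. R (z l) (z (Suc l))"
    by (rule choose_growing[of P n1 lo R hi, OF p1 p2]) (rule that)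
  define y where "y = (\<lambda>l. vec (z l))"
  define ys where "ys = (\<lambda>l. fn (z l))"
  define d where "d = (\<lambda>l. lo (z l))"
  define j where "j = (\<lambda>l. ind (z l))"
  have gd: "growing d" using z(3) by (simp add: d_def)
  have dm: "d i \<le> d i'" if "i \<le> i'" for i i' using growing_mono[OF gd that] .
  have Pz: "y l \<in> S \<and> ys l \<in> LL \<and> supp (y l) \<subseteq> {d l..<hi (z l)} \<and> supp (ys l) \<subseteq> {d l..<hi (z l)} \<and>
    1 / 4 \<le> ip (ys l) (y l) \<and> N (y l) \<le> 1 \<and> Suc J \<le> j l \<and>
    (\<forall>j'. j l \<le> j' \<longrightarrow> real (m (j l)) * (\<Sum>i\<in>supp (y l). \<bar>y l i\<bar>) \<le> real (m j') \<longrightarrow> tame 7 (j l) {j l..<j'} (d l) (y l))" for l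
    using z(1)[of l] unfolding P_def y_def ys_def d_def j_def sel case_prod_beta by blast
  have hd: "hi (z l) \<le> d (Suc l)" for l using z(4) by (simp add: d_def)
  then have sub: "{d l..<hi (z l)} \<subseteq> {d l..<d (Suc l)}" for l using hd[of l] by auto
  have sy: "supp (y l) \<subseteq> {d l..<d (Suc l)}" "supp (ys l) \<subseteq> {d l..<d (Suc l)}" for l using Pz[of l] sub[of l] by blast+
  have yc: "y l \<in> c00" for l using Pz block_spaceD(1)[OF S] by blast
  have ysn: "supp (ys l) \<noteq> {}" for l
  proof
    assume "supp (ys l) = {}"
    then have "ip (ys l) (y l) = 0" by (intro ip_disjoint) simp
    then show False using Pz[of l] by simp
  qed
  define p where "p = (\<lambda>l. mn (ys l))"
  have p: "p l \<in> {d l..<d (Suc l)}" for l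
    using mn_in[of "ys l"] LL_wf[of "ys l"] ysn Pz[of l] sy(2)[of l] by (auto simp: p_def)
  have kJ: "Suc (k J - 1) = k J" using k_ge_1[of J] J by simp
  have "2 ^ k J * m J ^ 3 \<le> d 0" using z(2) by (simp add: d_def n1_def)
  then have "real (2 ^ k J * m J ^ 3) \<le> real (d 0)" by (rule of_nat_mono)
  then have "2 ^ Suc (k J - 1) \<le> 1 / real (m J) ^ 3 * d 0" unfolding kJ using mJ5 by (simp add: mJ_def field_simps)
  then obtain K a where a: "0 < K" "small_on_wide d a K (k J - 1) (1 / real (m J) ^ 3)" "p ` {0..<K} \<in> schreier (Suc (k J - 1))"
    by (rule small_convex_combination[where d = d and p = p, OF gd p]) (rule that)
  have a0: "0 \<le> a l" "sum a {0..<K} = 1" for l using a(2) by (auto simp: small_on_wide_def)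
  have Rl: "j l \<le> j (Suc l) \<and> real (m (j l)) * (\<Sum>i\<in>supp (y l). \<bar>y l i\<bar>) \<le> real (m (j (Suc l)))" for l
    using z(5)[of l] unfolding R_def j_def y_def .
  have ri: "rapidly_increasing J d a K j y" unfolding rapidly_increasing_def
    using J(1) gd a(2) Pz Rl sy(1) by blast
  have hf: "ys l \<in> LL \<and> supp (ys l) \<noteq> {} \<and> supp (ys l) \<subseteq> {d l..<d (Suc l)}" if "l < K" for l
    using Pz ysn sy(2) by blast
  have bf: "fam (ys ` {0..<K})" "successive (ys ` {0..<K})" "inj_on ys {0..<K}"
    using block_family[OF gd, of K ys] hf by blast+
  define xs where "xs = avg (m J) (ys ` {0..<K})"
  have "mn ` ys ` {0..<K} = p ` {0..<K}" by (simp add: p_def image_image)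
  then have xsL: "xs \<in> Lc J" unfolding xs_def
    using a(1,3) kJ bf(1) by (intro Lc_avg_even J(2) bf(2) fam_blocks) (auto simp: fam_def)
  define w where "w = (\<lambda>i. \<Sum>l\<in>{0..<K}. a l * y l i)"
  have wc: "w \<in> c00" unfolding w_def using yc by (intro c00_sum) auto
  define \<theta> where "\<theta> = (\<Sum>l\<in>{0..<K}. a l * ip (ys l) (y l))"
  have ip1: "ip (ys l) (y l) \<le> 1" for l using ip_le_N'[of "ys l" "y l"] Pz[of l] by linarith
  have "(\<Sum>l\<in>{0..<K}. a l * (1 / 4)) \<le> \<theta>" unfolding \<theta>_def using a0 Pz by (intro sum_mono mult_left_mono) auto
  then have \<theta>: "1 / 4 \<le> \<theta>" using a0 by (simp add: sum_distrib_right[symmetric] sum_divide_distrib[symmetric])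
  have ipw: "ip (ys l) w = a l * ip (ys l) (y l)" if l: "l < K" for l
    unfolding w_def by (rule ip_block_sum[OF gd yc sy(1) sy(2) l])
  have ipxs: "ip xs w = \<theta> / m J"
  proof -
    have "(\<Sum>g\<in>ys ` {0..<K}. ip g w) = \<theta>" unfolding \<theta>_def using bf(3) ipw by (simp add: sum.reindex)
    then show ?thesis unfolding xs_def ip_avg by simp
  qed
  \<comment> \<open>Each functional takes a value of at least \<open>1 / 4\<close> on its own
    vector, hence \<open>\<theta> \<ge> 1 / 4\<close> and the normalizing factor stays within
    \<open>4 * m J\<close>.\<close>
  define c where "c = m J / \<theta>"
  define x where "x = (\<lambda>i. c * w i)"
  have cb: "0 \<le> c" "c \<le> 4 * real (m J)"
    using \<theta> mJ5 unfolding c_def mJ_def by (auto simp: field_simps)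
  have ctl: "controlled 144 J (d 0) x" using rapidly_increasing_controlled[OF ri cb] unfolding x_def w_def .
  have ip1: "ip xs x = 1" unfolding x_def ip_scale_right[OF wc] ipxs c_def using \<theta> mJ5 by (simp add: mJ_def)
  have blk: "{d l..<d (Suc l)} \<subseteq> {d 0..<d K}" if "l < K" for l
    using dm[of 0 l] dm[of "Suc l" K] that by auto
  show ?thesis
  proof (rule that[of x xs "d 0" "d K"])
    show "x \<in> S" unfolding x_def w_def using Pz by (intro block_space_scale[OF S] block_space_sum[OF S]) auto
    show "n0 \<le> d 0" using z(2) by (simp add: d_def n1_def)
    show "1 \<le> d 0" using gd by (auto simp: growing_def)
    show "d 0 < d K" using growing_less[OF gd, of 0] dm[of "Suc 0" K] a(1) by simp
    have "supp x \<subseteq> supp w" by (auto simp: x_def supp_def)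
    also have "\<dots> \<subseteq> (\<Union>l\<in>{0..<K}. supp (y l))" unfolding w_def by (rule supp_sum_subset)
    also have "\<dots> \<subseteq> {d 0..<d K}" using sy(1) blk by fastforce
    finally show "supp x \<subseteq> {d 0..<d K}" .
    have sx: "supp xs = (\<Union>l\<in>{0..<K}. supp (ys l))"
      unfolding xs_def using supp_avg[OF fam_blocks[OF bf(1)], of "m J"] mJ5 by (simp add: mJ_def)
    show "supp xs \<subseteq> {d 0..<d K}" unfolding sx using sy(2) blk by fastforce
    show "supp xs \<noteq> {}" unfolding sx using ysn a(1) by auto
  qed (use xsL ctl ip1 in auto)
qed

end

subsection \<open>Dependent sequences\<close>

text \<open>Leibniz: after the first term is split off, the remaining alternating sum lies between 0
  and its own first term, which is at most \<open>b 0\<close>.\<close>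

lemma alternating_sum_bounds:
  fixes b :: "nat \<Rightarrow> real"
  assumes "\<And>i. i < n \<Longrightarrow> 0 \<le> b i" "\<And>i j. i \<le> j \<Longrightarrow> j < n \<Longrightarrow> b j \<le> b i"
  shows "0 \<le> (\<Sum>i<n. (- 1) ^ i * b i) \<and> (0 < n \<longrightarrow> (\<Sum>i<n. (- 1) ^ i * b i) \<le> b 0)"
  using assms
proof (induction n arbitrary: b)
  case (Suc n)
  have "(\<Sum>i<Suc n. (- 1) ^ i * b i) = b 0 - (\<Sum>i<n. (- 1) ^ i * b (Suc i))"
    by (subst sum.lessThan_Suc_shift) (simp add: sum_negf)
  moreover have "0 \<le> (\<Sum>i<n. (- 1) ^ i * b (Suc i)) \<and> (0 < n \<longrightarrow> (\<Sum>i<n. (- 1) ^ i * b (Suc i)) \<le> b (Suc 0))"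
    using Suc.IH[of "\<lambda>i. b (Suc i)"] Suc.prems by simp
  moreover have "b (Suc 0) \<le> b 0" if "0 < n" using Suc.prems(2)[of 0 "Suc 0"] that by simp
  moreover have "0 \<le> b 0" using Suc.prems by simp
  ultimately show ?case by (cases "n = 0") auto
qed simp

text \<open>Bounding by the coefficient at the left end allows a whole run of agreement to be
  charged to a single index, as \<open>hit_mass_indices\<close> requires.\<close>

lemma alternating_sum_interval:
  fixes a :: "nat \<Rightarrow> real"
  assumes "A \<subseteq> {..<K}" "order_convex A" "A \<noteq> {}" "\<And>l. 0 \<le> a l" "\<And>l l'. l \<le> l' \<Longrightarrow> l' < K \<Longrightarrow> a l' \<le> a l"
  shows "\<bar>\<Sum>l\<in>A. (- 1) ^ l * a l\<bar> \<le> a (Min A)"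
proof -
  have fin: "finite A" using assms(1) finite_subset by blast
  define \<alpha> where "\<alpha> = Min A"
  define \<beta> where "\<beta> = Max A"
  define n where "n = Suc \<beta> - \<alpha>"
  have \<alpha>: "\<alpha> \<in> A" "\<beta> \<in> A" "\<And>l. l \<in> A \<Longrightarrow> \<alpha> \<le> l \<and> l \<le> \<beta>"
    using fin assms(3) by (auto simp: \<alpha>_def \<beta>_def)
  have an: "\<alpha> + n = Suc \<beta>" using \<alpha>(3)[OF \<alpha>(1)] by (simp add: n_def)
  have A: "A = {\<alpha>..<\<alpha> + n}"
  proof (intro set_eqI iffI)
    fix l assume "l \<in> {\<alpha>..<\<alpha> + n}"
    then have "\<alpha> \<le> l" "l \<le> \<beta>" using an by auto
    then show "l \<in> A" using assms(2) \<alpha>(1,2) unfolding order_convex_def by blast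
  next
    fix l assume "l \<in> A"
    then show "l \<in> {\<alpha>..<\<alpha> + n}" using \<alpha>(3)[of l] an by simp
  qed
  have "(\<Sum>l\<in>A. (- 1) ^ l * a l) = (\<Sum>i<n. (- 1) ^ (i + \<alpha>) * a (i + \<alpha>))"
    unfolding A by (rule sum.reindex_bij_witness[of _ "\<lambda>i. i + \<alpha>" "\<lambda>l. l - \<alpha>"]) auto
  also have "\<dots> = (- 1) ^ \<alpha> * (\<Sum>i<n. (- 1) ^ i * a (i + \<alpha>))"
    by (simp add: sum_distrib_left power_add mult_ac)
  finally have "\<bar>\<Sum>l\<in>A. (- 1) ^ l * a l\<bar> = \<bar>\<Sum>i<n. (- 1) ^ i * a (i + \<alpha>)\<bar>"
    by (simp add: abs_mult power_abs)
  moreover have "\<alpha> + n \<le> K" using assms(1) \<alpha>(2) an by auto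
  then have "0 \<le> (\<Sum>i<n. (- 1) ^ i * a (i + \<alpha>)) \<and> (0 < n \<longrightarrow> (\<Sum>i<n. (- 1) ^ i * a (i + \<alpha>)) \<le> a (0 + \<alpha>))"
    using assms(4,5) by (intro alternating_sum_bounds) auto
  moreover have "0 < n" using an \<alpha>(3)[OF \<alpha>(2)] by simp
  ultimately show ?thesis by (simp add: \<alpha>_def)
qed

text \<open>\<open>J l\<close> is the index of \<open>xs l\<close>, and \<open>p\<close> measures
  the accuracy: errors are compared with \<open>1 / (m J0 * 2 ^ p)\<close>. The bound
  \<open>2 ^ (2 * p + 2) \<le> m J0\<close> leaves room for \<open>p\<close> extra levels, and
  \<open>J0 + 1 \<le> d 0\<close> allows the first \<open>J0 + 1\<close> members of a special
  sequence to be counted by \<open>d 0\<close>.\<close>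

locale dependent_sequence = coded_space +
  fixes J0 p :: nat and x xs :: "nat \<Rightarrow> nat \<Rightarrow> real" and d J :: "nat \<Rightarrow> nat" and K :: nat and a :: "nat \<Rightarrow> real"
  assumes J0: "odd J0" "3 \<le> J0" "2 ^ (2 * p + 2) \<le> m J0"
    and d: "growing d" "J0 + 1 \<le> d 0"
    and x: "\<And>l. supp (x l) \<subseteq> {d l..<d (Suc l)}" "\<And>l. controlled 144 (J l) (d l) (x l)"
    and xs: "\<And>l. xs l \<in> LL" "\<And>l. supp (xs l) \<noteq> {}" "\<And>l. supp (xs l) \<subseteq> {d l..<d (Suc l)}" "\<And>l. ip (xs l) (x l) = 1"
    and J: "J0 < J 0" "\<And>l. J l < J (Suc l)" "\<And>l. J (Suc l) = \<Phi> (map xs [0..<Suc l])"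
    and G: "\<And>l. map xs [0..<Suc l] \<in> G_set m k"
    and a: "small_on_wide d a K (k J0 - 1) (1 / (real (m J0) * 2 ^ p))" "\<And>l l'. l \<le> l' \<Longrightarrow> l' < K \<Longrightarrow> a l' \<le> a l" "0 < K"
begin

lemma a_nonneg: "0 \<le> a l" using a(1) by (simp add: small_on_wide_def)
lemma a_sum: "sum a {0..<K} = 1" using a(1) by (simp add: small_on_wide_def)
lemma d_mono: "i \<le> j \<Longrightarrow> d i \<le> d j" using growing_mono[OF d(1)] .
lemma J_mono: "i < j \<Longrightarrow> J i < J j" by (rule lift_Suc_mono_less[of J]) (rule J(2))
lemma J_gt: "J0 < J l" using J(1) J_mono[of 0 l] by (cases "l = 0") auto
lemma x_tame: "tame 144 (J l) {J l} (d l) (x l)" using x(2)[of l] unfolding controlled_def by blast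

lemma mJ0: "4 \<le> m J0" "2 ^ p \<le> m J0"
proof -
  have "(2::nat) ^ 2 \<le> 2 ^ (2 * p + 2)" by (intro power_increasing) auto
  then have "2 ^ 2 \<le> m J0" using J0(3) by (rule order_trans)
  then show "4 \<le> m J0" by simp
  have "(2::nat) ^ p \<le> 2 ^ (2 * p + 2)" by (intro power_increasing) auto
  then show "2 ^ p \<le> m J0" using J0(3) by (rule order_trans)
qed

section \<open>Special functionals compared with the dependent sequence\<close>

lemma code_eq:
  assumes "ys \<in> G_set m k" "1 \<le> l" "\<Phi> ys = J l" shows "ys = map xs [0..<l]"
proof -
  obtain l' where "l = Suc l'" using assms(2) by (cases l) auto
  then show ?thesis using \<Phi>_inj[OF assms(1) G[of l']] J(3)[of l'] assms(3) by simp
qed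

definition branch :: "nat \<Rightarrow> (nat \<Rightarrow> real) list \<Rightarrow> real \<Rightarrow> nat \<Rightarrow> (nat \<Rightarrow> real) \<Rightarrow> bool" where
  "branch n zs c s g \<longleftrightarrow> special n J0 zs \<and> (c = 1 \<or> c = - 1) \<and> g = (\<lambda>i. c * restr {s..} (scaled_sum (m J0) zs) i)"

lemma branch_exists:
  assumes "g \<in> Lc J0" "g \<notin> signed_units" "supp g \<noteq> {}"
  shows "\<exists>n zs c s. branch n zs c s g"
proof -
  obtain n where "g \<in> Ls n J0" using assms(1) by (auto simp: Lc_def)
  moreover have "J0 \<noteq> 1" using J0 by auto
  moreover have "g \<noteq> (\<lambda>_. 0)" using assms(3) by auto
  ultimately show ?thesis using Ls_special_cases[OF J0(1)] assms(2) unfolding branch_def by blast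
qed

lemma special_take_G:
  assumes "special n J0 zs" "1 \<le> i" "i \<le> length zs" shows "take i zs \<in> G_set m k"
proof (rule G_set_take[OF _ assms(2,3)])
  show "sorted_wrt (\<lambda>f g. set_less (supp f) (supp g)) zs"
    using assms(1) by (intro admissible_list(5)) (auto simp: special_def)
  show "zs ! l \<in> K_set m k" if "l < i" for l using special_member_LL(2)[OF assms(1)] that assms(3) by simp
qed

text \<open>Codes are at least 2 and increase strictly along initial segments. Thus all members from
  position \<open>J0 + 1\<close> on have indices above \<open>J0\<close>; the earlier ones will be
  cut off.\<close>

lemma special_code_gt: "special n J0 zs \<Longrightarrow> 1 \<le> i \<Longrightarrow> i \<le> length zs \<Longrightarrow> i < \<Phi> (take i zs)"
proof (induction i)
  case (Suc i)
  have g: "take (Suc i) zs \<in> G_set m k" using special_take_G Suc.prems by blast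
  show ?case
  proof (cases "i = 0")
    case True then show ?thesis using \<Phi>_even[OF g] by simp
  next
    case False
    then have "i < \<Phi> (take i zs)" using Suc by simp
    moreover have "take i (take (Suc i) zs) = take i zs" by simp
    then have "\<Phi> (take i zs) < \<Phi> (take (Suc i) zs)" using \<Phi>_mono[OF g, of i] False Suc.prems(3) by simp
    ultimately show ?thesis by simp
  qed
qed simp

definition piece :: "real \<Rightarrow> nat \<Rightarrow> (nat \<Rightarrow> real) \<Rightarrow> nat \<Rightarrow> real" where
  "piece c s h = (\<lambda>i. c * restr {s..} h i)"

lemma piece_alt: "piece 1 s h = restr {s..} h" "piece (- 1) s h = - restr {s..} h"
  by (auto simp: piece_def)

lemma supp_piece: "c = 1 \<or> c = - 1 \<Longrightarrow> supp (piece c s h) = supp h \<inter> {s..}"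
  using piece_alt supp_uminus[of "restr {s..} h"] by auto

definition pieces :: "(nat \<Rightarrow> real) list \<Rightarrow> real \<Rightarrow> nat \<Rightarrow> (nat \<Rightarrow> real) set" where
  "pieces zs c s = piece c s ` {h\<in>set zs. supp h \<inter> {s..} \<noteq> {}}"

lemma pieces_family:
  assumes "branch n zs c s g"
  shows "fam (pieces zs c s)" "g = avg (m J0) (pieces zs c s)" "mn ` pieces zs c s \<in> wide (k J0)"
proof -
  have sp: "special n J0 zs" and c: "c = 1 \<or> c = - 1" and g: "g = (\<lambda>i. c * restr {s..} (scaled_sum (m J0) zs) i)"
    using assms by (auto simp: branch_def)
  note sa = special_avg[OF sp]
  let ?R = "restr_family {s..} (set zs)"
  have f: "fam ?R" using fam_restr[OF sa(1)] by simp
  have e: "restr {s..} (scaled_sum (m J0) zs) = avg (m J0) ?R"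
    unfolding sa(2) using avg_restr_family[OF fam_blocks[OF sa(1)]] by simp
  have "mn ` set zs \<in> wide (k J0)" using sa(3) schreier_subset_wide by blast
  then have w: "mn ` ?R \<in> wide (k J0)" using restr_family_wide[OF fam_blocks[OF sa(1)]] by blast
  have p1: "pieces zs 1 s = ?R" by (simp add: pieces_def restr_family_def piece_alt)
  have p2: "pieces zs (- 1) s = uminus ` ?R" by (simp add: pieces_def restr_family_def piece_alt image_image)
  have m2: "mn ` uminus ` ?R = mn ` ?R" by (simp add: image_image)
  have g2: "g = - restr {s..} (scaled_sum (m J0) zs)" if "c = - 1" using g that by auto
  have g1: "g = restr {s..} (scaled_sum (m J0) zs)" if "c = 1" using g that by auto
  show "fam (pieces zs c s)" using c p1 p2 f fam_uminus[OF f] by auto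
  show "g = avg (m J0) (pieces zs c s)" using c p1 p2 e g1 g2 avg_uminus[of "m J0" ?R] by auto
  show "mn ` pieces zs c s \<in> wide (k J0)" using c p1 p2 w m2 by auto
qed

text \<open>Separates the first \<open>J0 + 1\<close> members, for which no lower bound on the index
  is used, from the later ones. For a shorter sequence the cutoff lies behind the support, so that
  nothing remains above it.\<close>

definition cutoff :: "(nat \<Rightarrow> real) list \<Rightarrow> (nat \<Rightarrow> real) \<Rightarrow> nat" where
  "cutoff zs g = (if J0 + 1 < length zs then mn (zs ! (J0 + 1)) else Suc (Max (supp g)))"

lemma special_sorted:
  assumes "special n J0 zs" "i < i'" "i' < length zs" "u \<in> supp (zs ! i)" "v \<in> supp (zs ! i')" shows "u < v"
proof -
  have "sorted_wrt (\<lambda>f g. set_less (supp f) (supp g)) zs"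
    using assms(1) by (intro admissible_list(5)) (auto simp: special_def)
  then have "set_less (supp (zs ! i)) (supp (zs ! i'))"
    using assms(2,3) unfolding sorted_wrt_iff_nth_less by blast
  then show ?thesis using assms(4,5) unfolding set_less_def by blast
qed

lemma pieces_mem:
  assumes "branch n zs c s g" "z \<in> pieces zs c s"
  obtains i where "i < length zs" "z = piece c s (zs ! i)" "supp z = supp (zs ! i) \<inter> {s..}"
proof -
  obtain h where h: "h \<in> set zs" "z = piece c s h" using assms(2) by (auto simp: pieces_def)
  then obtain i where "i < length zs" "h = zs ! i" by (auto simp: in_set_conv_nth)
  moreover have "c = 1 \<or> c = - 1" using assms(1) by (simp add: branch_def)
  ultimately show ?thesis using that[of i] h supp_piece by blast
qed

lemma nth_wf:
  assumes "special n J0 zs" "i < length zs" shows "finite (supp (zs ! i))" "supp (zs ! i) \<noteq> {}" "mn (zs ! i) \<in> supp (zs ! i)"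
proof -
  show "finite (supp (zs ! i))" "supp (zs ! i) \<noteq> {}" using fam_ne[OF special_avg(1)[OF assms(1)], of "zs ! i"] assms(2) by auto
  then show "mn (zs ! i) \<in> supp (zs ! i)" by (rule mn_in)
qed

lemma pieces_above:
  assumes b: "branch n zs c s g" and z: "z \<in> pieces zs c s" and i: "i < length zs" "z = piece c s (zs ! i)"
    and "u \<in> supp z" "cutoff zs g \<le> u"
  shows "J0 + 1 \<le> i"
proof (rule ccontr)
  assume "\<not> J0 + 1 \<le> i"
  then have lt: "i < J0 + 1" by simp
  have sp: "special n J0 zs" and c: "c = 1 \<or> c = - 1" using b by (auto simp: branch_def)
  have ui: "u \<in> supp (zs ! i)" using assms(5) i(2) supp_piece[OF c] by auto
  show False
  proof (cases "J0 + 1 < length zs")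
    case True
    then have "u < mn (zs ! (J0 + 1))" using special_sorted[OF sp lt True ui] nth_wf(3)[OF sp True] by blast
    then show False using assms(6) True by (simp add: cutoff_def)
  next
    case False
    have sg: "supp g = \<Union>(supp ` pieces zs c s)"
      using pieces_family(1,2)[OF b] supp_avg[OF fam_blocks, of "pieces zs c s" "m J0"] mJ0(1) by simp
    then have "u \<in> supp g" using z assms(5) by blast
    moreover have "finite (supp g)" unfolding sg using fam_finite fam_ne pieces_family(1)[OF b] by blast
    ultimately have "u \<le> Max (supp g)" by simp
    then show False using assms(6) False by (simp add: cutoff_def)
  qed
qed

lemma pieces_below_card:
  assumes b: "branch n zs c s g"
  shows "card (restr_family {..<cutoff zs g} (pieces zs c s)) \<le> J0 + 1"
proof -
  have sp: "special n J0 zs" and c: "c = 1 \<or> c = - 1" using b by (auto simp: branch_def)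
  let ?f = "\<lambda>i. restr {..<cutoff zs g} (piece c s (zs ! i))"
  have "restr_family {..<cutoff zs g} (pieces zs c s) \<subseteq> ?f ` {..<J0 + 1}"
  proof
    fix y assume "y \<in> restr_family {..<cutoff zs g} (pieces zs c s)"
    then obtain z where z: "z \<in> pieces zs c s" "supp z \<inter> {..<cutoff zs g} \<noteq> {}" "y = restr {..<cutoff zs g} z"
      by (auto simp: restr_family_def)
    obtain i where i: "i < length zs" "z = piece c s (zs ! i)" "supp z = supp (zs ! i) \<inter> {s..}" by (rule pieces_mem[OF b z(1)])
    have "i < J0 + 1"
    proof (rule ccontr)
      assume "\<not> i < J0 + 1"
      then have ge: "J0 + 1 \<le> i" by simp
      then have len: "J0 + 1 < length zs" using i(1) by simp
      obtain u where u: "u \<in> supp (zs ! i)" "u < cutoff zs g" using z(2) i(3) by auto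
      have "mn (zs ! (J0 + 1)) \<le> u"
      proof (cases "i = J0 + 1")
        case True then show ?thesis using u(1) nth_wf[OF sp len] mn_le by simp
      next
        case False
        then have "J0 + 1 < i" using ge by simp
        then show ?thesis using special_sorted[OF sp _ i(1) nth_wf(3)[OF sp len] u(1)] by simp
      qed
      then show False using u(2) len by (simp add: cutoff_def)
    qed
    then show "y \<in> ?f ` {..<J0 + 1}" using z(3) i(2) by auto
  qed
  then have "card (restr_family {..<cutoff zs g} (pieces zs c s)) \<le> card (?f ` {..<J0 + 1})"
    by (intro card_mono) auto
  also have "\<dots> \<le> J0 + 1" using card_image_le[of "{..<J0 + 1}" ?f] by simp
  finally show ?thesis .
qed

text \<open>The positions at which the code of a special functional agrees with the code of the dependent
  sequence. Below its largest element, the special functional consists of the \<open>xs l\<close>.\<close>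

definition agree :: "(nat \<Rightarrow> real) list \<Rightarrow> nat set" where
  "agree zs = {i. J0 + 1 \<le> i \<and> i < length zs \<and> \<Phi> (take i zs) = J i}"

text \<open>Blocks on which the special functional is a multiple of \<open>xs l\<close>. The shift
  by two makes \<open>zs ! Suc l\<close> equal to \<open>xs (Suc l)\<close> as well, which keeps all
  later members away from block \<open>l\<close>. The condition \<open>s \<le> d l\<close> says that
  the tail does not cut the block, and \<open>J0 + 1 \<le> l\<close> places \<open>xs l\<close>
  above the cutoff.\<close>

definition common :: "(nat \<Rightarrow> real) list \<Rightarrow> nat \<Rightarrow> nat set" where
  "common zs s = {l. J0 + 1 \<le> l \<and> Suc (Suc l) \<in> agree zs \<and> s \<le> d l}"

lemma agree_take:
  assumes "special n J0 zs" "i \<in> agree zs" shows "take i zs = map xs [0..<i]"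
  using assms(2) by (intro code_eq special_take_G[OF assms(1)]) (auto simp: agree_def)

lemma agree_nth:
  assumes "special n J0 zs" "i \<in> agree zs" "l < i" shows "zs ! l = xs l"
proof -
  have "i < length zs" using assms(2) by (simp add: agree_def)
  then have "zs ! l = take i zs ! l" using assms(3) by simp
  also have "\<dots> = xs l" using agree_take[OF assms(1,2)] assms(3) by simp
  finally show ?thesis .
qed

text \<open>Equal codes mean equal initial segments, and these contain the shorter initial segments.
  Agreement is therefore an interval of positions, which makes the alternating sums run over
  intervals.\<close>

lemma agree_down:
  assumes "special n J0 zs" "i \<in> agree zs" "J0 + 1 \<le> l" "l \<le> i" shows "l \<in> agree zs"
proof -
  have il: "i < length zs" using assms(2) by (simp add: agree_def)
  have "take l zs = take l (take i zs)" using assms(4) by (simp add: min_def)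
  also have "\<dots> = map xs [0..<l]" using agree_take[OF assms(1,2)] assms(4) by (simp add: take_map)
  finally have "\<Phi> (take l zs) = J l" using J(3)[of "l - 1"] assms(3) by (cases l) auto
  then show ?thesis using assms(3,4) il by (simp add: agree_def)
qed

lemma common_convex: assumes sp: "special n J0 zs" shows "order_convex (common zs s)"
  unfolding order_convex_def
proof (intro ballI allI impI)
  fix a c b assume "a \<in> common zs s" "c \<in> common zs s" "a \<le> b \<and> b \<le> c"
  then have *: "J0 + 1 \<le> a" "s \<le> d a" "Suc (Suc c) \<in> agree zs" "a \<le> b" "b \<le> c" by (auto simp: common_def)
  have "Suc (Suc b) \<in> agree zs" using agree_down[OF sp *(3), of "Suc (Suc b)"] * by simp
  moreover have "s \<le> d b" using d_mono[OF *(4)] *(2) by simp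
  ultimately show "b \<in> common zs s" using * by (simp add: common_def)
qed

lemma common_value:
  assumes b: "branch n zs c s g" and l: "l \<in> common zs s" and i: "i \<in> {d l..<d (Suc l)}"
  shows "g i = c / m J0 * xs l i" "i < cutoff zs g \<Longrightarrow> xs l i = 0"
proof -
  have sp: "special n J0 zs" and c: "c = 1 \<or> c = - 1" and g: "g = (\<lambda>i. c * restr {s..} (scaled_sum (m J0) zs) i)"
    using b by (auto simp: branch_def)
  have ll: "J0 + 1 \<le> l" "Suc (Suc l) \<in> agree zs" "s \<le> d l" using l by (auto simp: common_def)
  have len: "Suc (Suc l) < length zs" using ll(2) by (simp add: agree_def)
  have nth: "zs ! l' = xs l'" if "l' < Suc (Suc l)" for l' using agree_nth[OF sp ll(2) that] .
  \<comment> \<open>A member before position \<open>Suc (Suc l)\<close> is some \<open>xs i'\<close>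
    and lives on its own block. A later member lies beyond \<open>zs ! Suc l\<close>, which is
    \<open>xs (Suc l)\<close> and starts behind block \<open>l\<close>.\<close>
  have other: "i \<notin> supp h" if h: "h \<in> set zs" "h \<noteq> xs l" for h
  proof
    assume ih: "i \<in> supp h"
    obtain i' where i': "i' < length zs" "h = zs ! i'" using h(1) by (auto simp: in_set_conv_nth)
    show False
    proof (cases "i' < Suc (Suc l)")
      case True
      then have "h = xs i'" using nth i' by simp
      then have "i \<in> {d i'..<d (Suc i')}" using xs(3)[of i'] ih by blast
      then have "i' = l" using growing_disjoint[OF d(1)] i by blast
      then show False using h(2) \<open>h = xs i'\<close> by simp
    next
      case False
      have "mn (zs ! Suc l) \<in> supp (zs ! Suc l)" using nth_wf(3)[OF sp, of "Suc l"] len by simp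
      then have "mn (zs ! Suc l) < i" using special_sorted[OF sp, of "Suc l" i'] False i' ih by auto
      moreover have "mn (zs ! Suc l) \<in> supp (xs (Suc l))" using \<open>mn (zs ! Suc l) \<in> _\<close> nth[of "Suc l"] by simp
      then have "d (Suc l) \<le> mn (zs ! Suc l)" using xs(3)[of "Suc l"] by auto
      ultimately show False using i by simp
    qed
  qed
  note sa = special_avg[OF sp]
  have "xs l \<in> set zs" using nth[of l] len by (metis Suc_lessD lessI less_SucI nth_mem)
  have "(\<Sum>h\<in>set zs. h i) = (\<Sum>h\<in>set zs. if h = xs l then xs l i else 0)"
    using other by (intro sum.cong) (auto simp: supp_def)
  also have "\<dots> = xs l i" using \<open>xs l \<in> set zs\<close> by simp
  finally have "scaled_sum (m J0) zs i = 1 / m J0 * xs l i" unfolding sa(2) avg_def by simp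
  moreover have "s \<le> i" using ll(3) i by simp
  ultimately show "g i = c / m J0 * xs l i" unfolding g by (simp add: restr_def)
  assume lt: "i < cutoff zs g"
  have cu: "cutoff zs g = mn (xs (J0 + 1))" using nth[of "J0 + 1"] ll(1) len by (simp add: cutoff_def)
  have mnx: "mn (xs (J0 + 1)) \<in> supp (xs (J0 + 1))" using xs(1,2) LL_wf by (intro mn_in) auto
  show "xs l i = 0"
  proof (cases "l = J0 + 1")
    case True
    then have "i \<notin> supp (xs l)" using lt cu mn_le[of "xs l" i] LL_wf[OF xs(1)] by auto
    then show ?thesis by (simp add: supp_def)
  next
    case False
    then have "d (Suc (J0 + 1)) \<le> d l" using ll(1) by (intro d_mono) simp
    then show ?thesis using mnx xs(3)[of "J0 + 1"] lt cu i by auto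
  qed
qed

text \<open>The value does not depend on \<open>l\<close>, thanks to the normalization of the pairs.
  This is what lets consecutive terms of the alternating sum cancel.\<close>

lemma common_ip:
  assumes b: "branch n zs c s g" and l: "l \<in> common zs s"
  shows "ip (restr {cutoff zs g..} g) (x l) = c / m J0" "supp (xs l) \<subseteq> supp g"
proof -
  have v: "restr {cutoff zs g..} g i = c / m J0 * xs l i" if "i \<in> {d l..<d (Suc l)}" for i
    using common_value[OF b l that] by (auto simp: restr_def)
  have "ip (restr {cutoff zs g..} g) (x l) = (\<Sum>i\<in>supp (x l). c / m J0 * xs l i * x l i)"
    unfolding ip_def using v x(1)[of l] by (intro sum.cong) auto
  also have "\<dots> = c / m J0 * ip (xs l) (x l)" unfolding ip_def by (simp add: sum_distrib_left mult.assoc)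
  finally show "ip (restr {cutoff zs g..} g) (x l) = c / m J0" using xs(4) by simp
  have c: "c = 1 \<or> c = - 1" using b by (simp add: branch_def)
  show "supp (xs l) \<subseteq> supp g"
  proof
    fix i assume i: "i \<in> supp (xs l)"
    then have "i \<in> {d l..<d (Suc l)}" using xs(3) by blast
    then have "g i = c / m J0 * xs l i" by (rule common_value(1)[OF b l])
    then show "i \<in> supp g" using i c mJ0(1) by (auto simp: supp_def)
  qed
qed

end

lemma sum_Un_le:
  fixes a :: "nat \<Rightarrow> real"
  assumes "finite A" "finite B" "\<And>l. 0 \<le> a l" "sum a A \<le> \<alpha>" "sum a B \<le> \<beta>"
  shows "sum a (A \<union> B) \<le> \<alpha> + \<beta>"
  using sum.union_inter[OF assms(1,2), of a] sum_nonneg[of "A \<inter> B" a] assms(3-5) by auto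

section \<open>The alternating sum\<close>

context dependent_sequence
begin

text \<open>On block \<open>l\<close> the members above the cutoff have indices above
  \<open>J0\<close>. None has index \<open>J l\<close>: by injectivity of the code such a member
  would sit at position \<open>l\<close> after complete agreement, and then \<open>l\<close> is
  common unless the agreement ends at \<open>l\<close> or \<open>Suc l\<close> or the tail cuts into
  the block, which is excluded. So the two-level estimate in \<open>controlled\<close> applies with
  \<open>s' = J0\<close>.\<close>

lemma remainder_bound:
  assumes Sp: "fam Sp" and br: "\<And>g. g \<in> Sp \<Longrightarrow> branch (n g) (zs g) (c g) (s g) g"
    and l: "1 \<le> l" and st: "\<And>g. g \<in> Sp \<Longrightarrow> mn g \<notin> {d l..<d (Suc l)}"
    and exc: "\<And>g. g \<in> Sp \<Longrightarrow> mn g < d (Suc l) \<Longrightarrow>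
      l \<noteq> Max (agree (zs g)) \<and> Suc l \<noteq> Max (agree (zs g)) \<and> s g \<notin> {d l..<d (Suc l)}"
  shows "(\<Sum>g\<in>{g\<in>Sp. l \<notin> common (zs g) (s g)}. \<bar>ip (restr {cutoff (zs g) g..} g) (x l)\<bar>) \<le>
    144 / (real (m J0) * m (Suc J0))"
proof -
  define I where "I = (\<lambda>g. {d l..<d (Suc l)} \<inter> {cutoff (zs g) g..})"
  define \<psi> where "\<psi> = (\<lambda>g. restr (I g) g)"
  define Q where "Q = {g\<in>Sp. l \<notin> common (zs g) (s g) \<and> supp g \<inter> I g \<noteq> {}}"
  have Ic: "order_convex (I g)" for g unfolding I_def by (intro order_convex_Int) auto
  have fin: "finite Sp" using fam_finite[OF Sp] .
  have fQ: "fam Q" using Sp by (rule fam_subset) (auto simp: Q_def)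
  have ips: "ip (restr {cutoff (zs g) g..} g) (x l) = ip (\<psi> g) (x l)" for g
    using ip_restr[OF x(1)[of l], of "restr {cutoff (zs g) g..} g"] by (simp add: \<psi>_def I_def)
  have "(\<Sum>g\<in>{g\<in>Sp. l \<notin> common (zs g) (s g)}. \<bar>ip (restr {cutoff (zs g) g..} g) (x l)\<bar>) = (\<Sum>g\<in>Q. \<bar>ip (\<psi> g) (x l)\<bar>)"
    unfolding ips using fin ip_disjoint[of "\<psi> _" "x l"]
    by (intro sum.mono_neutral_right) (auto simp: Q_def \<psi>_def restr_zero)
  also have "\<dots> = (\<Sum>y\<in>\<psi> ` Q. \<bar>ip y (x l)\<bar>)"
  proof -
    have "inj_on \<psi> Q"
    proof (rule inj_onI)
      fix g g' assume *: "g \<in> Q" "g' \<in> Q" "\<psi> g = \<psi> g'"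
      obtain u where u: "u \<in> supp (\<psi> g)" using *(1) by (auto simp: Q_def \<psi>_def)
      then have "u \<in> supp (\<psi> g')" using *(3) by simp
      then have "u \<in> supp g" "u \<in> supp g'" using u by (auto simp: \<psi>_def)
      then show "g = g'" using blocks_unique[OF fam_blocks[OF fQ] *(1,2)] by blast
    qed
    then show ?thesis by (simp add: sum.reindex)
  qed
  also have "\<dots> \<le> 144 / (real (m J0) * m (Suc J0))"
  proof -
    \<comment> \<open>\<open>controlled\<close> indexes the parts by the restricted functional, so
      the original one is recovered through an inverse of \<open>\<psi>\<close>.\<close>
    define r where "r = inv_into Q \<psi>"
    have r: "r y \<in> Q" "\<psi> (r y) = y" if "y \<in> \<psi> ` Q" for y
      using that by (auto simp: r_def inv_into_into f_inv_into_f)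
    define Z where "Z = (\<lambda>y. restr_family (I (r y)) (pieces (zs (r y)) (c (r y)) (s (r y))))"
    have QSp: "g \<in> Sp" if "g \<in> Q" for g using that by (simp add: Q_def)
    have fP: "fam (\<psi> ` Q)"
    proof -
      have "fam {\<psi> g}" if g: "g \<in> Q" for g
      proof -
        have "\<psi> g \<noteq> (\<lambda>_. 0)" using g by (auto simp: Q_def \<psi>_def supp_empty_iff[symmetric])
        then have "\<psi> g \<in> LL" using LL_restr[OF fam_LL[OF Sp QSp[OF g]] Ic[of g]] by (simp add: \<psi>_def)
        then show ?thesis using \<open>\<psi> g \<noteq> _\<close> LL_wf by (auto simp: fam_def blocks_def disjoint_supports_def supp_empty_iff)
      qed
      then have "fam (\<Union>g\<in>Q. {\<psi> g})" by (intro fam_UN(1)[OF fQ]) (auto simp: \<psi>_def)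
      moreover have "(\<Union>g\<in>Q. {\<psi> g}) = \<psi> ` Q" by blast
      ultimately show ?thesis by simp
    qed
    have ltQ: "mn g < d (Suc l)" "mn g < d l" if g: "g \<in> Q" for g
    proof -
      obtain u where u: "u \<in> supp g" "u \<in> {d l..<d (Suc l)}" using g unfolding Q_def I_def by blast
      have "mn g \<le> u" using u fam_ne[OF Sp QSp[OF g]] by (intro mn_le) auto
      then show "mn g < d (Suc l)" using u by simp
      then show "mn g < d l" using st[OF QSp[OF g]] by simp
    qed
    have "card Q \<le> d l" by (rule fam_card_less[OF fQ ltQ(2)])
    then have cP: "card (\<psi> ` Q) \<le> d l" using card_image_le[OF fam_finite[OF fQ], of \<psi>] by linarith
    have lab: "z \<in> signed_units \<or> (\<exists>s>J0. s \<noteq> J l \<and> z \<in> Lc s)" if y: "y \<in> \<psi> ` Q" and z: "z \<in> Z y" for y z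
    proof -
      define g where "g = r y"
      have gQ: "g \<in> Q" using r(1)[OF y] by (simp add: g_def)
      have b: "branch (n g) (zs g) (c g) (s g) g" using br[OF QSp[OF gQ]] .
      then have sp: "special (n g) J0 (zs g)" and cc: "c g = 1 \<or> c g = - 1" by (auto simp: branch_def)
      obtain z0 where z0: "z0 \<in> pieces (zs g) (c g) (s g)" "supp z0 \<inter> I g \<noteq> {}" "z = restr (I g) z0"
        using z unfolding Z_def g_def[symmetric] by (auto simp: restr_family_def)
      obtain i where i: "i < length (zs g)" "z0 = piece (c g) (s g) (zs g ! i)" "supp z0 = supp (zs g ! i) \<inter> {s g..}"
        by (rule pieces_mem[OF b z0(1)])
      obtain u where u: "u \<in> supp z0" "u \<in> {d l..<d (Suc l)}" "cutoff (zs g) g \<le> u" using z0(2) unfolding I_def by blast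
      have iJ: "J0 + 1 \<le> i" using pieces_above[OF b z0(1) i(1,2) u(1,3)] .
      define \<sigma> where "\<sigma> = \<Phi> (take i (zs g))"
      have "i < \<sigma>" unfolding \<sigma>_def using special_code_gt[OF sp] iJ i(1) by simp
      then have \<sigma>: "J0 < \<sigma>" using iJ by simp
      have "zs g ! i \<in> Ls (n g) \<sigma>" using sp iJ i(1) by (auto simp: special_def \<sigma>_def)
      then have "zs g ! i \<in> Lc \<sigma>" by (rule LcI)
      moreover have "supp (restr {s g..} (zs g ! i)) \<noteq> {}" using u(1) i(3) by auto
      then have "restr {s g..} (zs g ! i) \<noteq> (\<lambda>_. 0)" using supp_empty_iff by metis
      ultimately have "restr {s g..} (zs g ! i) \<in> Lc \<sigma>" using Lc_restr[of "zs g ! i" \<sigma> "{s g..}"] by auto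
      then have "z0 \<in> Lc \<sigma>" unfolding i(2) using cc piece_alt Lc_uminus by metis
      moreover have "z \<noteq> (\<lambda>_. 0)" using z0(2,3) by (auto simp: supp_empty_iff[symmetric])
      ultimately have zL: "z \<in> Lc \<sigma>" using Lc_restr[OF _ Ic, of z0 \<sigma> g] z0(3) by auto
      have "\<sigma> \<noteq> J l"
      proof
        assume eq: "\<sigma> = J l"
        have "take i (zs g) = map xs [0..<l]"
          using special_take_G[OF sp, of i] iJ i(1) l eq by (intro code_eq) (auto simp: \<sigma>_def)
        then have "length (take i (zs g)) = l" by simp
        then have il: "i = l" using i(1) by simp
        then have la: "l \<in> agree (zs g)" using eq iJ i(1) by (simp add: agree_def \<sigma>_def)
        have fa: "finite (agree (zs g))" by (simp add: agree_def)
        have mem: "Max (agree (zs g)) \<in> agree (zs g)" and le: "l \<le> Max (agree (zs g))"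
          using Max_in[OF fa] Max_ge[OF fa] la by auto
        have ex: "l \<noteq> Max (agree (zs g)) \<and> Suc l \<noteq> Max (agree (zs g)) \<and> s g \<notin> {d l..<d (Suc l)}"
          using exc[OF QSp[OF gQ] ltQ(1)[OF gQ]] .
        then have "Suc (Suc l) \<le> Max (agree (zs g))" using le by linarith
        then have "Suc (Suc l) \<in> agree (zs g)" using agree_down[OF sp mem] iJ il by simp
        moreover have "l \<notin> common (zs g) (s g)" using gQ by (simp add: Q_def)
        ultimately have "\<not> s g \<le> d l" using iJ il by (simp add: common_def)
        moreover have "s g \<le> u" using u(1) i(3) by auto
        ultimately show False using ex u(2) by auto
      qed
      then show ?thesis using zL \<sigma> by blast
    qed
    have "\<forall>y\<in>\<psi> ` Q. supp y \<subseteq> {d l..} \<and> fam (Z y) \<and> y = avg (m J0) (Z y) \<and> mn ` Z y \<in> wide (k J0) \<and>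
      (\<forall>z\<in>Z y. z \<in> signed_units \<or> (\<exists>s>J0. s \<noteq> J l \<and> z \<in> Lc s))"
    proof (intro ballI conjI)
      fix y assume y: "y \<in> \<psi> ` Q"
      define g where "g = r y"
      have gQ: "g \<in> Q" "\<psi> g = y" using r[OF y] by (auto simp: g_def)
      note pf = pieces_family[OF br[OF QSp[OF gQ(1)]]]
      have Zy: "Z y = restr_family (I g) (pieces (zs g) (c g) (s g))" by (simp add: Z_def g_def)
      show "supp y \<subseteq> {d l..}" unfolding gQ(2)[symmetric] by (auto simp: \<psi>_def I_def)
      show "fam (Z y)" unfolding Zy using fam_restr[OF pf(1) Ic] .
      have "avg (m J0) (Z y) = restr (I g) (avg (m J0) (pieces (zs g) (c g) (s g)))"
        unfolding Zy by (rule avg_restr_family[OF fam_blocks[OF pf(1)]])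
      also have "avg (m J0) (pieces (zs g) (c g) (s g)) = g" using pf(2) by simp
      finally show "y = avg (m J0) (Z y)" using gQ(2) by (simp add: \<psi>_def)
      show "mn ` Z y \<in> wide (k J0)" unfolding Zy using restr_family_wide[OF fam_blocks[OF pf(1)] pf(3)] .
      show "z \<in> signed_units \<or> (\<exists>s>J0. s \<noteq> J l \<and> z \<in> Lc s)" if "z \<in> Z y" for z using lab[OF y that] .
    qed
    moreover have "1 \<le> J0" "J0 < J l" using J0 J_gt by auto
    ultimately show ?thesis using x(2)[of l] fP cP unfolding controlled_def by blast
  qed
  finally show ?thesis .
qed

lemma split_cutoff:
  "ip g v = ip (restr {..<b} g) v + ip (restr {b..} g) v"
  unfolding ip_def sum.distrib[symmetric] by (intro sum.cong) (auto simp: restr_def)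

text \<open>Room for \<open>\<rho> + p\<close> levels, one level for the members below the cutoff,
  and \<open>p\<close> more levels. The assumptions give
  \<open>\<rho> + 2 * p + 1 \<le> t J0\<close>; this is the origin of the condition
  \<open>2 ^ (2 * p + 2) \<le> m J0\<close>.\<close>

lemma level_bound:
  assumes "2 * \<rho> \<le> t J0 + 1" "2 * p + 2 \<le> \<rho>"
  shows "(\<rho> + p) * k (J0 - 1) + 1 + p * k (J0 - 1) \<le> k J0 - 1"
proof -
  have "\<rho> + 2 * p + 1 \<le> t J0" using assms by linarith
  then have "(\<rho> + 2 * p + 1) * (k (J0 - 1) + 1) \<le> t J0 * (k (J0 - 1) + 1)" by (rule mult_le_mono1)
  moreover have "(\<rho> + p) * k (J0 - 1) + 1 + p * k (J0 - 1) \<le> (\<rho> + 2 * p + 1) * (k (J0 - 1) + 1)"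
    by (simp add: algebra_simps)
  moreover have "k J0 = t J0 * (k (J0 - 1) + 1) + 1" using k_step[of J0] J0(2) by simp
  ultimately show ?thesis by linarith
qed

lemma tame_family:
  assumes "fam F" "mn ` F \<in> wide (k J0 - 1)" "\<And>g. g \<in> F \<Longrightarrow> 0 \<le> w g" "1 \<le> s0" "s0 \<le> Suc J0"
    "\<And>g. g \<in> F \<Longrightarrow> w g \<le> \<eta> \<or> g \<in> signed_units \<or> w g \<le> \<omega> \<and> (\<exists>s\<ge>s0. g \<in> Lc s)" "0 \<le> \<eta>" "0 \<le> \<omega>"
  shows "\<exists>B\<subseteq>{..<K}. sum a B \<le> 2 * (1 / (real (m J0) * 2 ^ p)) \<and>
    (\<forall>l<K. l \<notin> B \<longrightarrow> (\<Sum>g\<in>F. w g * \<bar>ip g (x l)\<bar>) \<le> 2 * 144 * \<eta> + \<omega> * 144 / m s0)"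
  using d(1) a(1) x_tame x(1)
proof (rule tame_blocks)
  show "{J l} \<inter> {J l'} = {}" if "l \<noteq> l'" for l l' using J_mono[of l l'] J_mono[of l' l] that by (cases "l < l'") auto
  show "s0 \<le> J l" for l using J_gt[of l] assms(5) by simp
qed (use assms in auto)

text \<open>Two members of the disjoint family cannot share a common block, since both supports
  would contain that of \<open>xs l\<close>. Each member contributes an alternating sum over an
  interval of blocks, at most the coefficient at its left end. The left ends are distinct, and each
  member starts before the end of its block, so the coefficients add up to at most
  \<open>\<delta>\<close>.\<close>

lemma alternating_special:
  assumes Sp: "fam Sp" "mn ` Sp \<in> wide (k J0 - 1)" and br: "\<And>g. g \<in> Sp \<Longrightarrow> branch (n g) (zs g) (c g) (s g) g"
    and w: "\<And>g. g \<in> Sp \<Longrightarrow> 0 \<le> w g \<and> w g \<le> 1"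
  defines "SI \<equiv> (\<lambda>l. \<Sum>g\<in>{g\<in>Sp. l \<in> common (zs g) (s g)}. w g * ip (restr {cutoff (zs g) g..} g) (x l))"
  shows "\<bar>SI l\<bar> \<le> 1" "\<bar>\<Sum>l\<in>{0..<K}. (- 1) ^ l * a l * SI l\<bar> \<le> 1 / (real (m J0) * 2 ^ p)"
proof -
  let ?\<delta> = "1 / (real (m J0) * 2 ^ p)"
  have fin: "finite Sp" using fam_finite[OF Sp(1)] .
  have cc: "\<bar>c g\<bar> = 1" if "g \<in> Sp" for g using br[OF that] by (auto simp: branch_def)
  have uniq: "g = g'" if "g \<in> Sp" "g' \<in> Sp" "l \<in> common (zs g) (s g)" "l \<in> common (zs g') (s g')" for g g' l
  proof -
    have "supp (xs l) \<subseteq> supp g" "supp (xs l) \<subseteq> supp g'" using common_ip(2) br that by blast+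
    moreover obtain i where "i \<in> supp (xs l)" using xs(2)[of l] by auto
    ultimately show ?thesis using blocks_unique[OF fam_blocks[OF Sp(1)] that(1,2), of i] by blast
  qed
  have val: "w g * ip (restr {cutoff (zs g) g..} g) (x l) = w g * (c g / m J0)" if "g \<in> Sp" "l \<in> common (zs g) (s g)" for g l
    using common_ip(1)[OF br[OF that(1)] that(2)] by simp
  have bnd: "\<bar>w g * (c g / m J0)\<bar> \<le> 1 / m J0" if "g \<in> Sp" for g
    using w[OF that] cc[OF that] by (auto simp: abs_mult divide_right_mono)
  have m1: "1 / real (m J0) \<le> 1" using mJ0(1) by simp
  show "\<bar>SI l\<bar> \<le> 1"
  proof (cases "\<exists>g\<in>Sp. l \<in> common (zs g) (s g)")
    case True
    then obtain g where g: "g \<in> Sp" "l \<in> common (zs g) (s g)" by auto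
    then have "{g\<in>Sp. l \<in> common (zs g) (s g)} = {g}" using uniq by blast
    then have "SI l = w g * (c g / m J0)" unfolding SI_def using val[OF g] by simp
    then show ?thesis using bnd[OF g(1)] m1 by linarith
  next
    case False
    then have "SI l = 0" unfolding SI_def by (intro sum.neutral) auto
    then show ?thesis by simp
  qed
  define C where "C = (\<lambda>g. common (zs g) (s g) \<inter> {..<K})"
  define Sq where "Sq = {g\<in>Sp. C g \<noteq> {}}"
  have Cfin: "finite (C g)" for g by (simp add: C_def)
  have "(\<Sum>l\<in>{0..<K}. (- 1) ^ l * a l * SI l) = (\<Sum>l\<in>{0..<K}. \<Sum>g\<in>Sp. if l \<in> common (zs g) (s g) then (- 1) ^ l * a l * (w g * (c g / m J0)) else 0)"
  proof (rule sum.cong)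
    fix l
    have "SI l = (\<Sum>g\<in>{g\<in>Sp. l \<in> common (zs g) (s g)}. w g * (c g / m J0))"
      unfolding SI_def using val by (intro sum.cong) auto
    also have "\<dots> = (\<Sum>g\<in>Sp. if l \<in> common (zs g) (s g) then w g * (c g / m J0) else 0)"
      using sum.inter_filter[OF fin, of "\<lambda>g. w g * (c g / m J0)" "\<lambda>g. l \<in> common (zs g) (s g)"] .
    finally have "(- 1) ^ l * a l * SI l = (\<Sum>g\<in>Sp. (- 1) ^ l * a l * (if l \<in> common (zs g) (s g) then w g * (c g / m J0) else 0))"
      unfolding sum_distrib_left[symmetric] by (rule arg_cong)
    also have "\<dots> = (\<Sum>g\<in>Sp. if l \<in> common (zs g) (s g) then (- 1) ^ l * a l * (w g * (c g / m J0)) else 0)"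
      by (intro sum.cong) auto
    finally show "(- 1) ^ l * a l * SI l = (\<Sum>g\<in>Sp. if l \<in> common (zs g) (s g) then (- 1) ^ l * a l * (w g * (c g / m J0)) else 0)" .
  qed simp
  also have "\<dots> = (\<Sum>g\<in>Sp. \<Sum>l\<in>{0..<K}. if l \<in> common (zs g) (s g) then (- 1) ^ l * a l * (w g * (c g / m J0)) else 0)"
    by (rule sum.swap)
  also have "\<dots> = (\<Sum>g\<in>Sp. w g * (c g / m J0) * (\<Sum>l\<in>C g. (- 1) ^ l * a l))"
  proof (rule sum.cong)
    fix g
    have "(\<Sum>l\<in>{0..<K}. if l \<in> common (zs g) (s g) then (- 1) ^ l * a l * (w g * (c g / m J0)) else 0) =
      (\<Sum>l\<in>{l\<in>{0..<K}. l \<in> common (zs g) (s g)}. (- 1) ^ l * a l * (w g * (c g / m J0)))"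
      by (rule sum.inter_filter[symmetric]) simp
    also have "{l\<in>{0..<K}. l \<in> common (zs g) (s g)} = C g" by (auto simp: C_def)
    also have "(\<Sum>l\<in>C g. (- 1) ^ l * a l * (w g * (c g / m J0))) = w g * (c g / m J0) * (\<Sum>l\<in>C g. (- 1) ^ l * a l)"
      unfolding sum_distrib_left by (intro sum.cong) (auto simp: mult_ac)
    finally show "(\<Sum>l\<in>{0..<K}. if l \<in> common (zs g) (s g) then (- 1) ^ l * a l * (w g * (c g / m J0)) else 0) =
      w g * (c g / m J0) * (\<Sum>l\<in>C g. (- 1) ^ l * a l)" .
  qed simp
  also have "\<dots> = (\<Sum>g\<in>Sq. w g * (c g / m J0) * (\<Sum>l\<in>C g. (- 1) ^ l * a l))"
    using fin by (intro sum.mono_neutral_right) (auto simp: Sq_def)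
  finally have eq: "(\<Sum>l\<in>{0..<K}. (- 1) ^ l * a l * SI l) = (\<Sum>g\<in>Sq. w g * (c g / m J0) * (\<Sum>l\<in>C g. (- 1) ^ l * a l))" .
  have "\<bar>\<Sum>l\<in>{0..<K}. (- 1) ^ l * a l * SI l\<bar> \<le> (\<Sum>g\<in>Sq. \<bar>w g * (c g / m J0) * (\<Sum>l\<in>C g. (- 1) ^ l * a l)\<bar>)"
    unfolding eq by (rule sum_abs)
  also have "\<dots> \<le> (\<Sum>g\<in>Sq. 1 * a (Min (C g)))"
  proof (rule sum_mono)
    fix g assume g: "g \<in> Sq"
    have "special (n g) J0 (zs g)" using br g by (auto simp: Sq_def branch_def)
    then have "order_convex (C g)" unfolding C_def by (intro order_convex_Int common_convex) auto
    then have "\<bar>\<Sum>l\<in>C g. (- 1) ^ l * a l\<bar> \<le> a (Min (C g))"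
      using g a_nonneg a(2) by (intro alternating_sum_interval[of _ K]) (auto simp: C_def Sq_def)
    moreover have "\<bar>w g * (c g / m J0)\<bar> \<le> 1" using bnd[of g] g m1 by (auto simp: Sq_def)
    ultimately show "\<bar>w g * (c g / m J0) * (\<Sum>l\<in>C g. (- 1) ^ l * a l)\<bar> \<le> 1 * a (Min (C g))"
      unfolding abs_mult[of _ "sum _ _"] by (intro mult_mono) auto
  qed
  also have "\<dots> = sum a ((\<lambda>g. Min (C g)) ` Sq)"
  proof -
    have "inj_on (\<lambda>g. Min (C g)) Sq"
    proof (rule inj_onI)
      fix g g' assume *: "g \<in> Sq" "g' \<in> Sq" "Min (C g) = Min (C g')"
      have "Min (C g) \<in> C g" "Min (C g') \<in> C g'" using *(1,2) Min_in[OF Cfin] unfolding Sq_def by blast+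
      then show "g = g'" using uniq[of g g' "Min (C g)"] * by (auto simp: Sq_def C_def)
    qed
    then show ?thesis by (simp add: sum.reindex)
  qed
  also have "\<dots> \<le> sum a {l. l < K \<and> (\<exists>g\<in>Sp. Min (C g) = l \<and> mn g < d (Suc l))}"
  proof (rule sum_mono2)
    show "(\<lambda>g. Min (C g)) ` Sq \<subseteq> {l. l < K \<and> (\<exists>g\<in>Sp. Min (C g) = l \<and> mn g < d (Suc l))}"
    proof
      fix l assume "l \<in> (\<lambda>g. Min (C g)) ` Sq"
      then obtain g where g: "g \<in> Sq" "l = Min (C g)" by auto
      have lC: "l \<in> C g" using g Cfin by (auto simp: Sq_def)
      have gS: "g \<in> Sp" using g by (simp add: Sq_def)
      have "supp (xs l) \<subseteq> supp g" using common_ip(2)[OF br[OF gS]] lC by (simp add: C_def)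
      moreover obtain i where i: "i \<in> supp (xs l)" using xs(2)[of l] by auto
      ultimately have "mn g \<le> i" using fam_ne[OF Sp(1) gS] by (intro mn_le) auto
      then have "mn g < d (Suc l)" using i xs(3)[of l] by auto
      then show "l \<in> {l. l < K \<and> (\<exists>g\<in>Sp. Min (C g) = l \<and> mn g < d (Suc l))}" using lC gS g(2) by (auto simp: C_def)
    qed
  qed (use a_nonneg in auto)
  also have "\<dots> \<le> ?\<delta>" by (rule hit_mass_indices[OF d(1) a(1) fam_blocks[OF Sp(1)] Sp(2)])
  finally show "\<bar>\<Sum>l\<in>{0..<K}. (- 1) ^ l * a l * SI l\<bar> \<le> ?\<delta>" .
qed

text \<open>Below the cutoff at most \<open>J0 + 1 \<le> d 0\<close> parts of each functional
  remain, so they cost one level instead of \<open>k J0\<close>. The weight has already contributed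
  \<open>1 / m J0\<close>, and unfolding \<open>p\<close> further levels supplies the missing factor
  \<open>1 / 2 ^ p\<close>.\<close>

lemma low_part:
  assumes Sp: "fam Sp" "mn ` Sp \<in> wide n0" "\<And>g. g \<in> Sp \<Longrightarrow> supp g \<subseteq> {d 0..}"
    and br: "\<And>g. g \<in> Sp \<Longrightarrow> branch (n g) (zs g) (c g) (s g) g" and w: "\<And>g. g \<in> Sp \<Longrightarrow> 0 \<le> w g \<and> w g \<le> 1"
  shows "\<exists>U u. fam U \<and> mn ` U \<in> wide (n0 + 1 + p * k (J0 - 1)) \<and>
    (\<forall>g\<in>U. 0 \<le> u g \<and> (u g \<le> 1 / m J0 * (1 / 2) ^ p \<or> g \<in> signed_units \<or> u g \<le> 1 / m J0 \<and> (\<exists>s\<ge>J0. g \<in> Lc s))) \<and>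
    (\<forall>v. \<bar>\<Sum>g\<in>Sp. w g * ip (restr {..<cutoff (zs g) g} g) v\<bar> \<le> (\<Sum>g\<in>U. u g * \<bar>ip g v\<bar>))"
proof -
  define A where "A = (\<lambda>g. restr_family {..<cutoff (zs g) g} (pieces (zs g) (c g) (s g)))"
  note pf = pieces_family[OF br]
  have fA: "fam (A g)" if "g \<in> Sp" for g unfolding A_def using fam_restr[OF pf(1)[OF that]] by simp
  have gA: "restr {..<cutoff (zs g) g} g = avg (m J0) (A g)" if "g \<in> Sp" for g
    unfolding A_def using avg_restr_family[OF fam_blocks[OF pf(1)[OF that]], of "m J0"] pf(2)[OF that] by simp
  have sA: "supp h \<subseteq> supp g" if "g \<in> Sp" "h \<in> A g" for g h
  proof -
    have "supp (avg (m J0) (A g)) = \<Union>(supp ` A g)" using mJ0(1) by (intro supp_avg fam_blocks[OF fA[OF that(1)]]) simp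
    then have "supp h \<subseteq> supp (restr {..<cutoff (zs g) g} g)" using gA[OF that(1)] that(2) by auto
    then show ?thesis by auto
  qed
  define H where "H = (\<Union>g\<in>Sp. A g)"
  have fH: "fam H" "\<And>g g'. g \<in> Sp \<Longrightarrow> g' \<in> Sp \<Longrightarrow> g \<noteq> g' \<Longrightarrow> A g \<inter> A g' = {}"
    unfolding H_def using fam_UN[of Sp A] Sp(1) fA sA by blast+
  have mnA: "mn g \<le> i" "d 0 \<le> i" if g: "g \<in> Sp" "i \<in> mn ` A g" for g i
  proof -
    obtain h where h: "h \<in> A g" "i = mn h" using g(2) by auto
    have "i \<in> supp h" using h fam_ne[OF fA[OF g(1)] h(1)] mn_in by simp
    then have ig: "i \<in> supp g" using sA[OF g(1) h(1)] by blast
    show "mn g \<le> i" using ig fam_ne[OF Sp(1) g(1)] by (intro mn_le) auto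
    show "d 0 \<le> i" using ig Sp(3)[OF g(1)] by auto
  qed
  have "(\<Union>g\<in>Sp. mn ` A g) \<in> wide (n0 + 1)"
  proof (rule wide_bind[of mn])
    show "mn ` A g \<in> wide 1" if g: "g \<in> Sp" for g
    proof (rule wide_1[of _ "d 0"])
      have "card (mn ` A g) \<le> card (A g)" using card_image_le[OF fam_finite[OF fA[OF g]]] .
      also have "\<dots> \<le> J0 + 1" unfolding A_def by (rule pieces_below_card[OF br[OF g]])
      also have "\<dots> \<le> d 0" by (rule d(2))
      finally show "card (mn ` A g) \<le> d 0" .
    qed (use fam_finite[OF fA[OF g]] mnA(2)[OF g] in auto)
  qed (use Sp(2) fam_inj_mn[OF Sp(1)] mnA(1) in auto)
  then have wH: "mn ` H \<in> wide (n0 + 1)" by (simp add: H_def image_UN)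
  have "2 \<le> J0" using J0 by simp
  obtain F v where F: "fam (\<Union>h\<in>H. F h)" "\<And>h h'. h \<in> H \<Longrightarrow> h' \<in> H \<Longrightarrow> h \<noteq> h' \<Longrightarrow> F h \<inter> F h' = {}"
    "\<And>h. h \<in> H \<Longrightarrow> expansion J0 p h (F h) v" "mn ` (\<Union>h\<in>H. F h) \<in> wide (n0 + 1 + p * k (J0 - 1))"
    by (rule expand_fam[OF \<open>2 \<le> J0\<close> fH(1) wH, of p]) (rule that)
  define U where "U = (\<Union>h\<in>H. F h)"
  obtain \<omega> where \<omega>: "\<forall>g\<in>Sp. \<forall>h\<in>A g. \<omega> h = w g / m J0"
    using common_weight[of Sp A "\<lambda>g h. w g / m J0"] fH(2) by blast
  obtain u where u: "\<forall>h\<in>H. \<forall>g\<in>F h. u g = \<omega> h * v g"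
    using common_weight[of H F "\<lambda>h g. \<omega> h * v g"] F(2) by blast
  have \<omega>b: "0 \<le> \<omega> h \<and> \<omega> h \<le> 1 / m J0" if "h \<in> H" for h
  proof -
    obtain g where "g \<in> Sp" "h \<in> A g" using \<open>h \<in> H\<close> by (auto simp: H_def)
    then show ?thesis using \<omega> w[of g] by (auto simp: divide_right_mono)
  qed
  have U: "0 \<le> u g \<and> (u g \<le> 1 / m J0 * (1 / 2) ^ p \<or> g \<in> signed_units \<or> u g \<le> 1 / m J0 \<and> (\<exists>s\<ge>J0. g \<in> Lc s))" if g: "g \<in> U" for g
  proof -
    obtain h where h: "h \<in> H" "g \<in> F h" using g by (auto simp: U_def)
    have v: "0 \<le> v g" "v g \<le> 1" "v g \<le> (1/2) ^ p \<or> g \<in> signed_units \<or> (\<exists>s\<ge>J0. g \<in> Lc s)"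
      using F(3)[OF h(1)] h(2) unfolding expansion_def by blast+
    have ug: "u g = \<omega> h * v g" using u h by blast
    have "u g \<le> 1 / m J0 * (1 / 2) ^ p" if "v g \<le> (1/2) ^ p"
      unfolding ug using \<omega>b[OF h(1)] v(1) that by (intro mult_mono) auto
    moreover have "u g \<le> 1 / m J0 * 1" unfolding ug using \<omega>b[OF h(1)] v by (intro mult_mono) auto
    moreover have "0 \<le> u g" unfolding ug using \<omega>b[OF h(1)] v(1) by simp
    ultimately show ?thesis using v(3) by auto
  qed
  have est: "\<bar>\<Sum>g\<in>Sp. w g * ip (restr {..<cutoff (zs g) g} g) y\<bar> \<le> (\<Sum>g\<in>U. u g * \<bar>ip g y\<bar>)" for y
  proof -
    have "\<bar>\<Sum>g\<in>Sp. w g * ip (restr {..<cutoff (zs g) g} g) y\<bar> \<le> (\<Sum>g\<in>Sp. \<bar>w g * ip (restr {..<cutoff (zs g) g} g) y\<bar>)"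
      by (rule sum_abs)
    also have "\<dots> \<le> (\<Sum>g\<in>Sp. \<Sum>h\<in>A g. \<omega> h * \<bar>ip h y\<bar>)"
    proof (rule sum_mono)
      fix g assume g: "g \<in> Sp"
      have "\<bar>w g * ip (restr {..<cutoff (zs g) g} g) y\<bar> = w g / m J0 * \<bar>\<Sum>h\<in>A g. ip h y\<bar>"
        unfolding gA[OF g] ip_avg using w[OF g] by (simp add: abs_mult)
      also have "\<dots> \<le> w g / m J0 * (\<Sum>h\<in>A g. \<bar>ip h y\<bar>)" using w[OF g] by (intro mult_left_mono sum_abs) auto
      also have "\<dots> = (\<Sum>h\<in>A g. \<omega> h * \<bar>ip h y\<bar>)" unfolding sum_distrib_left using \<omega> g by (intro sum.cong) auto
      finally show "\<bar>w g * ip (restr {..<cutoff (zs g) g} g) y\<bar> \<le> (\<Sum>h\<in>A g. \<omega> h * \<bar>ip h y\<bar>)" .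
    qed
    also have "\<dots> = (\<Sum>h\<in>H. \<omega> h * \<bar>ip h y\<bar>)"
      unfolding H_def using fam_finite[OF Sp(1)] fam_finite[OF fA] fH(2) by (intro sum.UNION_disjoint[symmetric]) auto
    also have "\<dots> \<le> (\<Sum>h\<in>H. \<omega> h * (\<Sum>g\<in>F h. v g * \<bar>ip g y\<bar>))"
      using \<omega>b expansion_ip[OF F(3)] by (intro sum_mono mult_left_mono) auto
    also have "\<dots> = (\<Sum>h\<in>H. \<Sum>g\<in>F h. u g * \<bar>ip g y\<bar>)"
      unfolding sum_distrib_left using u by (intro sum.cong) (auto simp: mult.assoc)
    also have "\<dots> = (\<Sum>g\<in>U. u g * \<bar>ip g y\<bar>)" unfolding U_def
    proof (rule sum.UNION_disjoint[symmetric])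
      show "\<forall>h\<in>H. finite (F h)" using F(3) fam_finite unfolding expansion_def by blast
    qed (use fam_finite[OF fH(1)] F(2) in auto)
    finally show ?thesis .
  qed
  show ?thesis using F(1,4) U est unfolding U_def[symmetric] by blast
qed

text \<open>Index \<open>J0\<close> is the critical one. After unfolding, all other members have
  tiny coefficients, are units, or have indices above \<open>J0\<close>, and tameness suffices
  without using the signs. A member of index \<open>J0\<close> is split at its cutoff; above it the
  common blocks cancel and the remaining blocks obey \<open>remainder_bound\<close>.\<close>

lemma alternating_small:
  assumes f: "f \<in> LL"
  shows "\<bar>\<Sum>l\<in>{0..<K}. (- 1) ^ l * a l * ip f (x l)\<bar> \<le> 2400 / (real (m J0) * 2 ^ p)"
proof -
  define E where "E = 1 / (real (m J0) * 2 ^ p)"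
  have E0: "0 \<le> E" by (simp add: E_def)
  have J2: "2 \<le> J0" using J0 by simp
  let ?f = "restr {d 0..} f"
  have ipf: "ip f (x l) = ip ?f (x l)" for l
    using x(1)[of l] d_mono[of 0 l] by (intro ip_restr[symmetric]) auto
  show ?thesis
  proof (cases "supp ?f = {}")
    case True
    then have "ip ?f (x l) = 0" for l by (intro ip_disjoint) auto
    then show ?thesis unfolding ipf by simp
  next
    case False
    then have "?f \<noteq> (\<lambda>_. 0)" using supp_empty_iff by blast
    then have fL: "?f \<in> LL" using LL_restr[OF f, of "{d 0..}"] by simp
    obtain \<rho> where \<rho>: "m J0 \<le> 2 ^ \<rho>" "2 * \<rho> \<le> t J0 + 1" "3 \<le> \<rho>" using log_index[OF J2] .
    have "(2::nat) ^ (2 * p + 2) \<le> 2 ^ \<rho>" using J0(3) \<rho>(1) by (rule order_trans)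
    then have \<rho>p: "2 * p + 2 \<le> \<rho>" by (rule power_le_imp_le_exp[rotated]) simp
    note lev = level_bound[OF \<rho>(2) \<rho>p]
    obtain F w where F: "expansion J0 (\<rho> + p) ?f F w" "mn ` F \<in> wide ((\<rho> + p) * k (J0 - 1))"
      using expand[OF J2 fL False] by blast
    have fF: "fam F" and wF: "\<And>g. g \<in> F \<Longrightarrow> 0 \<le> w g \<and> w g \<le> 1 \<and> supp g \<subseteq> supp ?f"
      and repF: "?f = (\<lambda>i. \<Sum>g\<in>F. w g * g i)"
      and labF: "\<And>g. g \<in> F \<Longrightarrow> w g \<le> (1/2) ^ (\<rho> + p) \<or> g \<in> signed_units \<or> (\<exists>s\<ge>J0. g \<in> Lc s)"
      using F(1) unfolding expansion_def by blast+
    have finF: "finite F" using fam_finite[OF fF] .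
    \<comment> \<open>Membership in several \<open>Lc s\<close> is possible; whatever lies in
      \<open>Lc J0\<close> goes here, so that the rest, where an index is relevant, has one of at
      least \<open>Suc J0\<close>.\<close>
    define Sp where "Sp = {g\<in>F. \<not> w g \<le> (1/2) ^ (\<rho> + p) \<and> g \<notin> signed_units \<and> g \<in> Lc J0}"
    define F1 where "F1 = F - Sp"
    have fS: "fam Sp" "fam F1" using fF by (auto simp: Sp_def F1_def intro: fam_subset)
    have wS: "mn ` Sp \<in> wide ((\<rho> + p) * k (J0 - 1))" "mn ` F1 \<in> wide ((\<rho> + p) * k (J0 - 1))"
      by (rule wide_subset[OF F(2)], force simp: Sp_def F1_def)+
    have up: "G \<in> wide (k J0 - 1)" if "G \<in> wide ((\<rho> + p) * k (J0 - 1))" for G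
      by (rule wide_mono[OF _ that]) (use lev in linarith)
    have "\<exists>n zs c s. branch n zs c s g" if "g \<in> Sp" for g
      using that fam_ne[OF fS(1) that] by (intro branch_exists) (auto simp: Sp_def)
    then obtain n zs c s where br: "\<And>g. g \<in> Sp \<Longrightarrow> branch (n g) (zs g) (c g) (s g) g" by metis
    have wSp: "0 \<le> w g \<and> w g \<le> 1" if "g \<in> Sp" for g using wF[of g] that by (auto simp: Sp_def)
    have sSp: "supp g \<subseteq> {d 0..}" if "g \<in> Sp" for g using wF[of g] that by (auto simp: Sp_def)
    have "\<exists>U u. fam U \<and> mn ` U \<in> wide ((\<rho> + p) * k (J0 - 1) + 1 + p * k (J0 - 1)) \<and>
      (\<forall>g\<in>U. 0 \<le> u g \<and> (u g \<le> 1 / m J0 * (1 / 2) ^ p \<or> g \<in> signed_units \<or> u g \<le> 1 / m J0 \<and> (\<exists>s\<ge>J0. g \<in> Lc s))) \<and>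
      (\<forall>v. \<bar>\<Sum>g\<in>Sp. w g * ip (restr {..<cutoff (zs g) g} g) v\<bar> \<le> (\<Sum>g\<in>U. u g * \<bar>ip g v\<bar>))"
      by (rule low_part[of Sp "(\<rho> + p) * k (J0 - 1)" n zs c s w]) (fact fS(1) wS(1) sSp br wSp)+
    then obtain U u where UU: "fam U \<and> mn ` U \<in> wide ((\<rho> + p) * k (J0 - 1) + 1 + p * k (J0 - 1)) \<and>
      (\<forall>g\<in>U. 0 \<le> u g \<and> (u g \<le> 1 / m J0 * (1 / 2) ^ p \<or> g \<in> signed_units \<or> u g \<le> 1 / m J0 \<and> (\<exists>s\<ge>J0. g \<in> Lc s))) \<and>
      (\<forall>v. \<bar>\<Sum>g\<in>Sp. w g * ip (restr {..<cutoff (zs g) g} g) v\<bar> \<le> (\<Sum>g\<in>U. u g * \<bar>ip g v\<bar>))"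
      by (elim exE)
    then have U: "fam U" "mn ` U \<in> wide ((\<rho> + p) * k (J0 - 1) + 1 + p * k (J0 - 1))"
      "g\<in>U \<Longrightarrow> 0 \<le> u g \<and> (u g \<le> 1 / m J0 * (1 / 2) ^ p \<or> g \<in> signed_units \<or> u g \<le> 1 / m J0 \<and> (\<exists>s\<ge>J0. g \<in> Lc s))"
      "\<bar>\<Sum>g\<in>Sp. w g * ip (restr {..<cutoff (zs g) g} g) v\<bar> \<le> (\<Sum>g\<in>U. u g * \<bar>ip g v\<bar>)" for g v
      by (simp_all only: simp_thms)
    have mp: "0 < real (m J0)" using mJ0(1) by simp
    have hm: "2 ^ p \<le> real (m J0)"
    proof -
      have "real (2 ^ p) \<le> real (m J0)" using mJ0(2) by (rule of_nat_mono)
      then show ?thesis by simp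
    qed
    have Em: "1 / real (m J0) * (1 / m J0) \<le> E"
      unfolding E_def using hm mp by (simp add: field_simps)
    have m': "real (m J0) * m J0 \<le> m (Suc J0)"
    proof -
      have "(m J0)\<^sup>2 \<le> m (Suc J0)" using m_sq[of J0] J0(2) by simp
      then have "real ((m J0)\<^sup>2) \<le> m (Suc J0)" by (rule of_nat_mono)
      then show ?thesis by (simp add: power2_eq_square)
    qed
    have Em': "1 / real (m (Suc J0)) \<le> E"
    proof -
      have "0 < m (Suc J0)" using m_ge_2[of "Suc J0"] by simp
      then have "1 / real (m (Suc J0)) \<le> 1 / (real (m J0) * m J0)" using m' mp by (intro divide_left_mono mult_pos_pos) auto
      then show ?thesis using Em by simp
    qed
    have Em2: "1 / (real (m J0) * m (Suc J0)) \<le> E"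
    proof -
      have "1 * real (m (Suc J0)) \<le> real (m J0) * m (Suc J0)" using mJ0(1) by (intro mult_right_mono) auto
      moreover have "0 < m (Suc J0)" using m_ge_2[of "Suc J0"] by simp
      ultimately have "1 / (real (m J0) * m (Suc J0)) \<le> 1 / m (Suc J0)" using mp by (intro divide_left_mono) auto
      then show ?thesis using Em' by simp
    qed
    have Eh: "(1 / 2 :: real) ^ (\<rho> + p) \<le> E"
    proof -
      have "real (m J0) \<le> real (2 ^ \<rho>)" using \<rho>(1) by (rule of_nat_mono)
      then have "real (m J0) * 2 ^ p \<le> 2 ^ (\<rho> + p)" by (simp add: power_add)
      then show ?thesis unfolding E_def using mp by (simp add: power_divide divide_left_mono)
    qed
    obtain BA where BA: "BA\<subseteq>{..<K}" "sum a BA \<le> 2 * E"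
      "\<And>l. l < K \<Longrightarrow> l \<notin> BA \<Longrightarrow> (\<Sum>g\<in>F1. w g * \<bar>ip g (x l)\<bar>) \<le> 2 * 144 * (1/2) ^ (\<rho> + p) + 1 * 144 / m (Suc J0)"
    proof -
      have "w g \<le> (1/2) ^ (\<rho> + p) \<or> g \<in> signed_units \<or> w g \<le> 1 \<and> (\<exists>s\<ge>Suc J0. g \<in> Lc s)" if g: "g \<in> F1" for g
      proof (cases "w g \<le> (1/2) ^ (\<rho> + p) \<or> g \<in> signed_units")
        case False
        have gF: "g \<in> F" using g by (simp add: F1_def)
        obtain s where s: "s \<ge> J0" "g \<in> Lc s" using labF[OF gF] False by blast
        have "s \<noteq> J0" using s g False by (auto simp: F1_def Sp_def)
        then show ?thesis using s wF[OF gF] by (intro disjI2 conjI exI[of _ s]) auto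
      qed blast
      moreover have "0 \<le> w g" if "g \<in> F1" for g using wF[of g] that by (simp add: F1_def)
      ultimately have "\<exists>B\<subseteq>{..<K}. sum a B \<le> 2 * (1 / (real (m J0) * 2 ^ p)) \<and>
        (\<forall>l<K. l \<notin> B \<longrightarrow> (\<Sum>g\<in>F1. w g * \<bar>ip g (x l)\<bar>) \<le> 2 * 144 * (1/2) ^ (\<rho> + p) + 1 * 144 / m (Suc J0))"
        by (intro tame_family[OF fS(2) up[OF wS(2)]]) auto
      then show ?thesis using that unfolding E_def by blast
    qed
    obtain BU where BU: "BU\<subseteq>{..<K}" "sum a BU \<le> 2 * E"
      "\<And>l. l < K \<Longrightarrow> l \<notin> BU \<Longrightarrow> (\<Sum>g\<in>U. u g * \<bar>ip g (x l)\<bar>) \<le> 2 * 144 * (1 / m J0 * (1 / 2) ^ p) + 1 / m J0 * 144 / m J0"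
    proof -
      have "\<exists>B\<subseteq>{..<K}. sum a B \<le> 2 * (1 / (real (m J0) * 2 ^ p)) \<and>
        (\<forall>l<K. l \<notin> B \<longrightarrow> (\<Sum>g\<in>U. u g * \<bar>ip g (x l)\<bar>) \<le> 2 * 144 * (1 / m J0 * (1 / 2) ^ p) + 1 / m J0 * 144 / m J0)"
        using U(3) J0(2) by (intro tame_family[OF U(1) wide_mono[OF lev U(2)]]) auto
      then show ?thesis using that unfolding E_def by blast
    qed
    \<comment> \<open>The four indices a special functional may spoil: the last position of its
      agreement and the one before, the block cut by its tail, and the block in which it starts. If
      \<open>Max\<close> or \<open>SOME\<close> has no proper value, an arbitrary index is spoiled,
      which \<open>hit_mass_indices\<close> permits.\<close>
    define e1 where "e1 = (\<lambda>g. Max (agree (zs g)))"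
    define e2 where "e2 = (\<lambda>g. Max (agree (zs g)) - 1)"
    define e3 where "e3 = (\<lambda>g. SOME l. s g \<in> {d l..<d (Suc l)})"
    define e4 where "e4 = (\<lambda>g. SOME l. mn g \<in> {d l..<d (Suc l)})"
    define Bs where "Bs = (\<lambda>e::(nat \<Rightarrow> real) \<Rightarrow> nat. {l. l < K \<and> (\<exists>g\<in>Sp. e g = l \<and> mn g < d (Suc l))})"
    have mB: "sum a (Bs e) \<le> E" for e
      unfolding Bs_def E_def by (rule hit_mass_indices[OF d(1) a(1) fam_blocks[OF fS(1)] up[OF wS(1)]])
    \<comment> \<open>Index 0 is discarded too, since \<open>J 0\<close> is prescribed and not a
      code, so the argument by injectivity does not reach it.\<close>
    have m0: "sum a {0} \<le> E"
    proof -
      have "d 0 \<noteq> 0" using d(2) by simp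
      then have "{d 0} \<in> wide 0" by auto
      then have "{d 0} \<in> wide (k J0 - 1)" by (rule wide_mono[rotated]) simp
      then have "hit_mass d a 0 K {d 0} \<le> E" using a(1) unfolding small_on_wide_def E_def by blast
      moreover have "a 0 \<le> hit_mass d a 0 K {d 0}"
      proof -
        have "(\<Sum>l\<in>{0}. if {d 0} \<inter> {d l..<d (Suc l)} = {} then 0 else a l) \<le> hit_mass d a 0 K {d 0}"
          unfolding hit_mass_def using a(3) a_nonneg by (intro sum_mono2) auto
        then show ?thesis using growing_less[OF d(1), of 0] by simp
      qed
      ultimately show ?thesis by simp
    qed
    define B where "B = BA \<union> (BU \<union> (Bs e1 \<union> (Bs e2 \<union> (Bs e3 \<union> (Bs e4 \<union> {0})))))"
    have finB: "finite BA" "finite BU" "finite (Bs e)" for e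
      using BA(1) BU(1) finite_subset[OF _ finite_lessThan[of K]] by (auto simp: Bs_def)
    \<comment> \<open>Two applications of \<open>tame_family\<close> at \<open>2 * E\<close> each,
      four spoiled indices and index 0: altogether \<open>9 * E\<close>.\<close>
    have mass: "sum a B \<le> 2 * E + (2 * E + (E + (E + (E + (E + E)))))"
      unfolding B_def by (intro sum_Un_le finB finite_UnI a_nonneg BA(2) BU(2) mB m0) auto
    have BK: "B \<subseteq> {..<K}" using BA(1) BU(1) a(3) by (auto simp: B_def Bs_def)
    define SI where "SI = (\<lambda>l. \<Sum>g\<in>{g\<in>Sp. l \<in> common (zs g) (s g)}. w g * ip (restr {cutoff (zs g) g..} g) (x l))"
    have SI: "\<bar>SI l\<bar> \<le> 1" "\<bar>\<Sum>l\<in>{0..<K}. (- 1) ^ l * a l * SI l\<bar> \<le> E" for l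
      unfolding SI_def E_def
      by (rule alternating_special[of Sp n zs c s w]; fact fS(1) up[OF wS(1)] br wSp)+
    define T where "T = (\<lambda>l. ip f (x l))"
    \<comment> \<open>144 bounds the norm of \<open>x l\<close>, and 1 bounds
      \<open>SI l\<close>.\<close>
    have bad: "\<bar>T l - SI l\<bar> \<le> 145" for l
      using ip_le_N[OF f, of "x l"] tameD(3)[OF x_tame[of l]] SI(1)[of l] unfolding T_def by linarith
    have good: "\<bar>T l - SI l\<bar> \<le> 1008 * E" if l: "l < K" "l \<notin> B" for l
    proof -
      have "T l = (\<Sum>g\<in>F. w g * ip g (x l))"
        unfolding T_def ipf using repF ip_sum_left[of w F "x l"] by metis
      also have "\<dots> = (\<Sum>g\<in>F1. w g * ip g (x l)) + (\<Sum>g\<in>Sp. w g * ip g (x l))"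
        unfolding F1_def using finF by (intro sum.subset_diff) (auto simp: Sp_def)
      also have "(\<Sum>g\<in>Sp. w g * ip g (x l)) = (\<Sum>g\<in>Sp. w g * ip (restr {..<cutoff (zs g) g} g) (x l)) +
          (\<Sum>g\<in>Sp. w g * ip (restr {cutoff (zs g) g..} g) (x l))"
        unfolding sum.distrib[symmetric] distrib_left[symmetric] using split_cutoff by (intro sum.cong) auto
      also have "(\<Sum>g\<in>Sp. w g * ip (restr {cutoff (zs g) g..} g) (x l)) = SI l +
          (\<Sum>g\<in>{g\<in>Sp. l \<notin> common (zs g) (s g)}. w g * ip (restr {cutoff (zs g) g..} g) (x l))"
        unfolding SI_def using fam_finite[OF fS(1)]
        by (subst sum.union_disjoint[symmetric]) (auto intro!: sum.cong)
      finally have TT: "T l - SI l = (\<Sum>g\<in>F1. w g * ip g (x l)) + (\<Sum>g\<in>Sp. w g * ip (restr {..<cutoff (zs g) g} g) (x l)) +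
          (\<Sum>g\<in>{g\<in>Sp. l \<notin> common (zs g) (s g)}. w g * ip (restr {cutoff (zs g) g..} g) (x l))" by simp
      have "\<bar>\<Sum>g\<in>F1. w g * ip g (x l)\<bar> \<le> (\<Sum>g\<in>F1. w g * \<bar>ip g (x l)\<bar>)"
        using wF by (intro order_trans[OF sum_abs] sum_mono) (auto simp: F1_def abs_mult)
      also have "\<dots> \<le> 2 * 144 * (1/2) ^ (\<rho> + p) + 1 * 144 / m (Suc J0)" using BA(3) l by (auto simp: B_def)
      also have "\<dots> \<le> 432 * E" using Eh Em' by simp
      finally have b1: "\<bar>\<Sum>g\<in>F1. w g * ip g (x l)\<bar> \<le> 432 * E" .
      have "\<bar>\<Sum>g\<in>Sp. w g * ip (restr {..<cutoff (zs g) g} g) (x l)\<bar> \<le> (\<Sum>g\<in>U. u g * \<bar>ip g (x l)\<bar>)" by (rule U(4))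
      also have "\<dots> \<le> 2 * 144 * (1 / m J0 * (1 / 2) ^ p) + 1 / m J0 * 144 / m J0" using BU(3) l by (auto simp: B_def)
      also have "\<dots> \<le> 432 * E"
      proof -
        have "1 / real (m J0) * (1 / 2) ^ p = E" by (simp add: E_def power_divide)
        then show ?thesis using Em by simp
      qed
      finally have b2: "\<bar>\<Sum>g\<in>Sp. w g * ip (restr {..<cutoff (zs g) g} g) (x l)\<bar> \<le> 432 * E" .
      have "\<bar>\<Sum>g\<in>{g\<in>Sp. l \<notin> common (zs g) (s g)}. w g * ip (restr {cutoff (zs g) g..} g) (x l)\<bar> \<le>
        (\<Sum>g\<in>{g\<in>Sp. l \<notin> common (zs g) (s g)}. \<bar>ip (restr {cutoff (zs g) g..} g) (x l)\<bar>)"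
      proof (intro order_trans[OF sum_abs] sum_mono)
        fix g assume "g \<in> {g\<in>Sp. l \<notin> common (zs g) (s g)}"
        then show "\<bar>w g * ip (restr {cutoff (zs g) g..} g) (x l)\<bar> \<le> \<bar>ip (restr {cutoff (zs g) g..} g) (x l)\<bar>"
          using wSp[of g] mult_right_mono[of "w g" 1 "\<bar>ip (restr {cutoff (zs g) g..} g) (x l)\<bar>"] by (simp add: abs_mult)
      qed
      also have "\<dots> \<le> 144 / (real (m J0) * m (Suc J0))"
      proof (rule remainder_bound[OF fS(1) br])
        show "1 \<le> l" using l(2) by (cases l) (auto simp: B_def)
        have nB: "l \<noteq> e g" if "g \<in> Sp" "mn g < d (Suc l)" "l \<notin> Bs e" for e g using that l(1) by (auto simp: Bs_def)
        have out: "l \<notin> Bs e1" "l \<notin> Bs e2" "l \<notin> Bs e3" "l \<notin> Bs e4" using l(2) by (auto simp: B_def)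
        have some: "(SOME l. v \<in> {d l..<d (Suc l)}) = l" if "v \<in> {d l..<d (Suc l)}" for v
          using that growing_disjoint[OF d(1)] by (intro some_equality) blast+
        show "mn g \<notin> {d l..<d (Suc l)}" if "g \<in> Sp" for g
        proof
          assume v: "mn g \<in> {d l..<d (Suc l)}"
          then have "e4 g = l" unfolding e4_def by (rule some)
          then show False using nB[OF that _ out(4)] v by auto
        qed
        show "l \<noteq> Max (agree (zs g)) \<and> Suc l \<noteq> Max (agree (zs g)) \<and> s g \<notin> {d l..<d (Suc l)}" if g: "g \<in> Sp" "mn g < d (Suc l)" for g
        proof (intro conjI notI)
          show False if "l = Max (agree (zs g))" using nB[OF g out(1)] that by (simp add: e1_def)
          show False if "Suc l = Max (agree (zs g))" using nB[OF g out(2)] that by (simp add: e2_def)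
          show False if v: "s g \<in> {d l..<d (Suc l)}"
          proof -
            have "e3 g = l" unfolding e3_def using v by (rule some)
            then show False using nB[OF g out(3)] by simp
          qed
        qed
      qed
      also have "\<dots> \<le> 144 * E" using Em2 by simp
      finally have "\<bar>\<Sum>g\<in>{g\<in>Sp. l \<notin> common (zs g) (s g)}. w g * ip (restr {cutoff (zs g) g..} g) (x l)\<bar> \<le> 144 * E" .
      then show ?thesis using b1 b2 TT by linarith
    qed
    have "(\<Sum>l\<in>{0..<K}. (- 1) ^ l * a l * T l) = (\<Sum>l\<in>{0..<K}. (- 1) ^ l * a l * (T l - SI l)) + (\<Sum>l\<in>{0..<K}. (- 1) ^ l * a l * SI l)"
      unfolding sum.distrib[symmetric] by (intro sum.cong) (auto simp: algebra_simps)
    moreover have "\<bar>\<Sum>l\<in>{0..<K}. (- 1) ^ l * a l * (T l - SI l)\<bar> \<le> 1008 * E + 9 * E * 145"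
    proof -
      have "\<bar>\<Sum>l\<in>{0..<K}. (- 1) ^ l * a l * (T l - SI l)\<bar> \<le> (\<Sum>l\<in>{0..<K}. a l * \<bar>T l - SI l\<bar>)"
        using a_nonneg by (intro order_trans[OF sum_abs] sum_mono) (auto simp: abs_mult power_abs)
      also have "\<dots> \<le> (\<Sum>l\<in>{0..<K}. a l * (1008 * E) + (if l \<in> B then a l * 145 else 0))"
      proof (rule sum_mono)
        fix l assume "l \<in> {0..<K}"
        then show "a l * \<bar>T l - SI l\<bar> \<le> a l * (1008 * E) + (if l \<in> B then a l * 145 else 0)"
          using mult_left_mono[OF good[of l] a_nonneg[of l]] mult_left_mono[OF bad[of l] a_nonneg[of l]] mult_nonneg_nonneg[OF a_nonneg[of l] E0]
          by (cases "l \<in> B") auto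
      qed
      also have "\<dots> = (\<Sum>l\<in>{0..<K}. a l) * (1008 * E) + (\<Sum>l\<in>{0..<K} \<inter> B. a l * 145)"
        by (simp add: sum.distrib sum_distrib_right sum.inter_restrict)
      also have "{0..<K} \<inter> B = B" using BK by auto
      also have "(\<Sum>l\<in>B. a l * 145) = sum a B * 145" by (simp add: sum_distrib_right)
      also have "\<dots> \<le> 9 * E * 145" using mass by simp
      finally show ?thesis using a_sum by simp
    qed
    \<comment> \<open>The good blocks give 1008, the bad ones \<open>9 * 145 = 1305\<close> and the
      cancelling part 1, so the total is 2314.\<close>
    ultimately have "\<bar>\<Sum>l\<in>{0..<K}. (- 1) ^ l * a l * T l\<bar> \<le> 2400 * E" using SI(2) E0 by linarith
    then show ?thesis by (simp add: T_def E_def)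
  qed
qed

end

section \<open>Construction of dependent sequences and the lower estimate\<close>

context coded_space
begin

text \<open>Supports going to infinity provide infinitely many functionals, and injectivity gives
  them infinitely many codes. This secures the first increase \<open>J 0 < J 1\<close>: the coding
  condition compares a code with the smallest index in the sense of \<open>K\<close>, which may lie
  below the index under which the functional was chosen.\<close>

lemma code_unbounded:
  assumes "\<And>n. \<exists>f\<in>X. f \<in> LL \<and> supp f \<noteq> {} \<and> supp f \<subseteq> {n..}"
  shows "\<exists>f\<in>X. f \<in> LL \<and> supp f \<noteq> {} \<and> b < \<Phi> [f]"
proof (rule ccontr)
  assume no: "\<not> ?thesis"
  define Y where "Y = {f\<in>X. f \<in> LL \<and> supp f \<noteq> {}}"
  have G: "[f] \<in> G_set m k" if "f \<in> Y" for f
  proof -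
    have "f \<noteq> (\<lambda>_. 0)" using that by (auto simp: Y_def)
    then show ?thesis using that LL_subset_K by (auto simp: Y_def G_set_def)
  qed
  have "inj_on (\<lambda>f. \<Phi> [f]) Y"
  proof (rule inj_onI)
    fix f g assume "f \<in> Y" "g \<in> Y" "\<Phi> [f] = \<Phi> [g]"
    then show "f = g" using \<Phi>_inj[OF G G] by blast
  qed
  moreover have "(\<lambda>f. \<Phi> [f]) ` Y \<subseteq> {..b}" using no by (auto simp: Y_def not_less)
  ultimately have "finite Y" by (meson finite_atMost finite_imageD finite_subset)
  then have fin: "finite (\<Union>f\<in>Y. supp f)" using LL_wf by (auto simp: Y_def)
  let ?M = "Suc (Max (\<Union>f\<in>Y. supp f))"
  obtain f where "f \<in> X" "f \<in> LL" "supp f \<noteq> {}" "supp f \<subseteq> {?M..}" using assms[of ?M] by blast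
  then have f: "f \<in> Y" "supp f \<subseteq> {?M..}" by (simp_all add: Y_def)
  then obtain i where i: "i \<in> supp f" by (auto simp: Y_def)
  then have "i \<le> Max (\<Union>f\<in>Y. supp f)" using fin f(1) by (intro Max_ge) auto
  then show False using i f(2) by auto
qed

lemma dependent_sequence_exists:
  assumes S: "\<And>l::nat. block_space (S l)" and J0: "3 \<le> J0"
  obtains x xs d J where "growing d" "n1 \<le> d 0" "\<And>l. x l \<in> S l" "\<And>l. xs l \<in> Lc (J l)" "\<And>l. 2 \<le> J l"
    "\<And>l. supp (x l) \<subseteq> {d l..<d (Suc l)}" "\<And>l. supp (xs l) \<subseteq> {d l..<d (Suc l)}" "\<And>l. supp (xs l) \<noteq> {}"
    "\<And>l. ip (xs l) (x l) = 1" "\<And>l. controlled 144 (J l) (d l) (x l)" "J 0 = 2 * (J0 + 1)" "\<And>l. J l < J (Suc l)"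
    "\<And>l. J (Suc l) = \<Phi> (map xs [0..<Suc l])" "\<And>l. map xs [0..<Suc l] \<in> G_set m k"
proof -
  define good where "good = (\<lambda>l j x xs d0 e. x \<in> S l \<and> xs \<in> Lc j \<and> 2 \<le> j \<and> (1::nat) \<le> d0 \<and> d0 < e \<and> supp x \<subseteq> {d0..<e} \<and>
    supp xs \<subseteq> {d0..<e} \<and> supp xs \<noteq> {} \<and> ip xs x = 1 \<and> controlled 144 j d0 x)"
  have ex: "\<exists>x xs d0 e. good l j x xs d0 e \<and> n \<le> d0" if j: "2 \<le> j" "even j" for l j n
  proof -
    obtain x xs d0 e where "x \<in> S l" "xs \<in> Lc j" "n \<le> d0" "1 \<le> d0" "d0 < e" "supp x \<subseteq> {d0..<e}"
      "supp xs \<subseteq> {d0..<e}" "supp xs \<noteq> {}" "ip xs x = 1" "controlled 144 j d0 x"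
      by (rule controlled_pair_exists[OF S[of l] j, of n]) (rule that)
    then show ?thesis unfolding good_def using j by blast
  qed
  have goodL: "xs \<in> LL" "xs \<in> K_set m k" if g: "good l j x xs d0 e" for l j x xs d0 e
  proof -
    show LL: "xs \<in> LL" using g LL_I by (auto simp: good_def)
    have "xs \<noteq> (\<lambda>_. 0)" using g by (auto simp: good_def)
    then show "xs \<in> K_set m k" using LL_subset_K LL by blast
  qed
  let ?j0 = "2 * (J0 + 1)"
  \<comment> \<open>All candidates for the first functional. They exist arbitrarily far out, so one
    of them has a code above its index \<open>?j0\<close>.\<close>
  define X where "X = {xs. \<exists>x d0 e. good 0 ?j0 x xs d0 e \<and> max 1 n1 \<le> d0}"
  have "\<exists>f\<in>X. f \<in> LL \<and> supp f \<noteq> {} \<and> supp f \<subseteq> {n..}" for n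
  proof -
    obtain x xs d0 e where g: "good 0 ?j0 x xs d0 e" "max n (max 1 n1) \<le> d0" using ex[of ?j0 0 "max n (max 1 n1)"] by auto
    then have "supp xs \<subseteq> {n..}" by (auto simp: good_def)
    moreover have "xs \<in> X" using g unfolding X_def by auto
    moreover have "supp xs \<noteq> {}" using g(1) by (simp add: good_def)
    ultimately show ?thesis using goodL(1)[OF g(1)] by blast
  qed
  then obtain f0 where f0: "f0 \<in> X" "?j0 < \<Phi> [f0]" using code_unbounded[of X ?j0] by blast
  then obtain x0 d0 e0 where g0: "good 0 ?j0 x0 f0 d0 e0" "max 1 n1 \<le> d0" by (auto simp: X_def)
  define vec where "vec = (\<lambda>(x::nat \<Rightarrow> real, fs::(nat \<Rightarrow> real) list, d0::nat, e::nat, j::nat). x)"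
  define fns where "fns = (\<lambda>(x::nat \<Rightarrow> real, fs::(nat \<Rightarrow> real) list, d0::nat, e::nat, j::nat). fs)"
  define lo where "lo = (\<lambda>(x::nat \<Rightarrow> real, fs::(nat \<Rightarrow> real) list, d0::nat, e::nat, j::nat). d0)"
  define hi where "hi = (\<lambda>(x::nat \<Rightarrow> real, fs::(nat \<Rightarrow> real) list, d0::nat, e::nat, j::nat). e)"
  define ind where "ind = (\<lambda>(x::nat \<Rightarrow> real, fs::(nat \<Rightarrow> real) list, d0::nat, e::nat, j::nat). j)"
  note sel = vec_def fns_def lo_def hi_def ind_def
  \<comment> \<open>The state keeps the whole list of functionals, because the next index is the
    code of all of them. The last conjunct makes the indices increase; later on it follows from the
    growth of \<open>\<Phi>\<close> along initial segments.\<close>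
  define P where "P = (\<lambda>z. fns z \<noteq> [] \<and> good (length (fns z) - 1) (ind z) (vec z) (last (fns z)) (lo z) (hi z) \<and>
    fns z \<in> G_set m k \<and> (\<forall>f\<in>set (fns z). supp f \<subseteq> {..<hi z}) \<and> ind z < \<Phi> (fns z))"
  define R where "R = (\<lambda>z' z. length (fns z) = Suc (length (fns z')) \<and> take (length (fns z')) (fns z) = fns z' \<and> ind z = \<Phi> (fns z'))"
  define z0 where "z0 = (x0, [f0], d0, e0, ?j0)"
  have "[f0] \<in> G_set m k" using goodL[OF g0(1)] by (auto simp: G_set_def)
  moreover have "supp f0 \<subseteq> {..<e0}" using g0(1) by (auto simp: good_def)
  ultimately have P0: "P z0" using g0 f0 by (simp add: P_def sel z0_def)
  have lo0: "1 \<le> lo z0" using g0(2) by (simp add: sel z0_def)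
  have step: "\<exists>z. P z \<and> n \<le> lo z \<and> R z' z" if P': "P z'" for n z'
  proof -
    let ?h = "fns z'"
    have h: "?h \<noteq> []" "?h \<in> G_set m k" "\<forall>f\<in>set ?h. supp f \<subseteq> {..<hi z'}" using P' by (auto simp: P_def)
    define j where "j = \<Phi> ?h"
    have j: "2 \<le> j" "even j" using \<Phi>_even[OF h(2)] by (auto simp: j_def)
    obtain y ys d1 e1 where g: "good (length ?h) j y ys d1 e1" "max n (hi z') \<le> d1" using ex[OF j] by blast
    let ?z = "(y, ?h @ [ys], d1, e1, j)"
    have sl: "set_less (supp f) (supp ys)" if f: "f \<in> set ?h" for f
    proof -
      have "supp f \<subseteq> {..<hi z'}" "supp ys \<subseteq> {d1..<e1}" using f h(3) g(1) by (auto simp: good_def)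
      then show ?thesis using g(2) unfolding set_less_def by force
    qed
    have G: "?h @ [ys] \<in> G_set m k" using h(2) sl goodL(2)[OF g(1)] by (auto simp: G_set_def sorted_wrt_append)
    have "take (length ?h) (?h @ [ys]) = ?h" by simp
    moreover have "1 \<le> length ?h" using h(1) by (cases ?h) auto
    ultimately have "\<Phi> ?h < \<Phi> (?h @ [ys])" using \<Phi>_mono[OF G, of "length ?h"] by simp
    moreover have "\<forall>f\<in>set (?h @ [ys]). supp f \<subseteq> {..<e1}"
    proof
      fix f assume "f \<in> set (?h @ [ys])"
      moreover have "hi z' \<le> e1" "supp ys \<subseteq> {d1..<e1}" using g by (auto simp: good_def)
      ultimately show "supp f \<subseteq> {..<e1}" using h(3) by fastforce
    qed
    ultimately have "P ?z" using g(1) G by (simp add: P_def sel j_def)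
    moreover have "R z' ?z" by (simp add: R_def sel j_def)
    moreover have "n \<le> lo ?z" using g(2) by (simp add: sel)
    ultimately show ?thesis by blast
  qed
  obtain z where z: "z 0 = z0" "\<And>l. P (z l)" "growing (\<lambda>l. lo (z l))" "\<And>l. hi (z l) \<le> lo (z (Suc l))" "\<And>l. R (z l) (z (Suc l))"
    by (rule choose_growing_from[of P z0 lo R hi, OF P0 lo0 step], assumption) (rule that)
  define x where "x = (\<lambda>l. vec (z l))"
  define xs where "xs = (\<lambda>l. last (fns (z l)))"
  define d where "d = (\<lambda>l. lo (z l))"
  define J where "J = (\<lambda>l. ind (z l))"
  have len: "length (fns (z l)) = Suc l" for l
  proof (induction l)
    case 0 then show ?case by (simp add: z(1) z0_def sel)
  next
    case (Suc l) then show ?case using z(5)[of l] by (simp add: R_def)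
  qed
  have fns: "fns (z l) = map xs [0..<Suc l]" for l
  proof (induction l)
    case 0 then show ?case by (simp add: z(1) z0_def sel xs_def)
  next
    case (Suc l)
    have "fns (z (Suc l)) = butlast (fns (z (Suc l))) @ [last (fns (z (Suc l)))]" using len[of "Suc l"] by (intro append_butlast_last_id[symmetric]) auto
    also have "butlast (fns (z (Suc l))) = fns (z l)" using z(5)[of l] len[of "Suc l"] len[of l] by (simp add: R_def butlast_conv_take)
    also have "last (fns (z (Suc l))) = xs (Suc l)" unfolding xs_def ..
    finally have "fns (z (Suc l)) = map xs [0..<Suc l] @ [xs (Suc l)]" unfolding Suc .
    also have "\<dots> = map xs [0..<Suc (Suc l)]" unfolding upt_Suc_append[OF le0, of "Suc l"] by simp
    finally show ?case .
  qed
  have g: "good l (J l) (x l) (xs l) (d l) (hi (z l))" for l using z(2)[of l] len[of l] by (simp add: P_def J_def x_def xs_def d_def)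
  have sub: "{d l..<hi (z l)} \<subseteq> {d l..<d (Suc l)}" for l using z(4)[of l] by (auto simp: d_def)
  show ?thesis
  proof (rule that[of d x xs J])
    show "growing d" using z(3) by (simp add: d_def)
    show "n1 \<le> d 0" using g0(2) by (simp add: d_def z(1) z0_def sel)
    show "J 0 = 2 * (J0 + 1)" by (simp add: J_def z(1) z0_def sel)
    show JS: "J (Suc l) = \<Phi> (map xs [0..<Suc l])" for l using z(5)[of l] fns[of l] by (simp add: R_def J_def)
    show "J l < J (Suc l)" for l using z(2)[of l] JS[of l] fns[of l] by (simp add: P_def J_def)
    show "map xs [0..<Suc l] \<in> G_set m k" for l using z(2)[of l] fns[of l] by (simp add: P_def)
    show "supp (x l) \<subseteq> {d l..<d (Suc l)}" "supp (xs l) \<subseteq> {d l..<d (Suc l)}" for l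
      using g[of l] sub[of l] unfolding good_def by blast+
  qed (use g in \<open>auto simp: good_def\<close>)
qed

text \<open>The members come from various stages, and monotonicity of the stages brings finitely
  many of them to a common one. There the list is special by construction of the indices. Every
  \<open>xs l\<close> meets only the vector with the same number, with value 1.\<close>

lemma special_lower:
  assumes J0: "odd J0" "3 \<le> J0" and d: "growing d"
    and x: "\<And>l. x l \<in> c00" "\<And>l. supp (x l) \<subseteq> {d l..<d (Suc l)}"
    and xs: "\<And>l. xs l \<in> Lc (J l)" "\<And>l. 2 \<le> J l" "\<And>l. supp (xs l) \<noteq> {}" "\<And>l. supp (xs l) \<subseteq> {d l..<d (Suc l)}" "\<And>l. ip (xs l) (x l) = 1"
    and J: "J 0 = 2 * (J0 + 1)" "\<And>l. J (Suc l) = \<Phi> (map xs [0..<Suc l])"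
    and a: "sum a {0..<K} = 1" "0 < K" "(\<lambda>l. mn (xs l)) ` {0..<K} \<in> schreier (k J0)"
  shows "1 / m J0 \<le> N (\<lambda>i. \<Sum>l\<in>{0..<K}. a l * x l i)"
proof -
  define fs where "fs = map xs [0..<K]"
  have xL: "xs l \<in> LL" for l using LL_I[OF xs(1)] xs(2)[of l] by simp
  have "\<exists>n. \<forall>l<K'. xs l \<in> Ls n (J l)" for K'
  proof (induction K')
    case (Suc K')
    then obtain n where n: "\<forall>l<K'. xs l \<in> Ls n (J l)" by blast
    obtain n' where n': "xs K' \<in> Ls n' (J K')" using xs(1)[of K'] by (auto simp: Lc_def)
    have "xs l \<in> Ls (max n n') (J l)" if "l < Suc K'" for l
      using that n n' Ls_mono[of n "max n n'"] Ls_mono[of n' "max n n'"] by (cases "l = K'") auto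
    then show ?case by blast
  qed simp
  then obtain n where n: "\<And>l. l < K \<Longrightarrow> xs l \<in> Ls n (J l)" by blast
  have bf: "fam (xs ` {0..<K})" "inj_on xs {0..<K}"
    using block_family[OF d, of K xs] xL xs(3,4) by blast+
  have dm: "d i \<le> d i'" if "i \<le> i'" for i i' using growing_mono[OF d that] .
  have "admissible (schreier (k J0)) (map supp fs)" unfolding admissible_def
  proof (intro conjI)
    show "\<forall>E\<in>set (map supp fs). finite E \<and> E \<noteq> {}" using xL LL_wf xs(3) by (auto simp: fs_def)
    show "Min ` set (map supp fs) \<in> schreier (k J0)" unfolding mn_image using a(3) by (simp add: fs_def image_image)
    have "sorted_wrt (\<lambda>l l'. set_less (supp (xs l)) (supp (xs l'))) [0..<K]"
    proof (rule sorted_wrt_mono_rel[of _ "(<)"])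
      show "set_less (supp (xs l)) (supp (xs l'))" if "l < l'" for l l'
      proof -
        have "d (Suc l) \<le> d l'" using dm that by simp
        then show ?thesis using xs(4)[of l] xs(4)[of l'] unfolding set_less_def by force
      qed
    qed simp
    then show "sorted_wrt set_less (map supp fs)" by (simp add: fs_def sorted_wrt_map)
  qed
  \<comment> \<open>This is why the first index was prescribed as
    \<open>2 * (J0 + 1)\<close>.\<close>
  moreover have "\<exists>r>J0. hd fs \<in> Ls n (2 * r)" using n[OF a(2)] a(2) J(1) by (intro exI[of _ "J0 + 1"]) (auto simp: fs_def hd_map)
  moreover have "fs ! i \<in> Ls n (\<Phi> (take i fs))" if i: "1 \<le> i \<and> i < length fs" for i
  proof -
    have "take i fs = map xs [0..<i]" using i by (simp add: fs_def take_map)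
    moreover have "J i = \<Phi> (map xs [0..<i])" using J(2)[of "i - 1"] i by simp
    ultimately show ?thesis using n[of i] i by (simp add: fs_def)
  qed
  ultimately have sp: "special n J0 fs" using a(2) by (auto simp: special_def fs_def)
  define F where "F = avg (m J0) (xs ` {0..<K})"
  have eq: "scaled_sum (m J0) fs = F" using special_avg(2)[OF sp] by (simp add: fs_def F_def)
  have "F 0 = 0" unfolding F_def avg_def using xL LL_wf by (simp add: sum.neutral)
  then have "restr {1..} F = F" by (rule restr_ge_1)
  moreover have "J0 \<noteq> 1" using J0 by auto
  ultimately have "F \<in> Ls (Suc n) J0" unfolding Ls_Suc_odd[OF J0(1) \<open>J0 \<noteq> 1\<close>] using sp eq
    by (intro CollectI exI[of _ "1::nat"] exI[of _ F]) auto
  then have "F \<in> LL" using LL_I[OF LcI] J0(2) by auto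
  moreover have "ip F (\<lambda>i. \<Sum>l\<in>{0..<K}. a l * x l i) = 1 / m J0"
  proof -
    have "(\<Sum>g\<in>xs ` {0..<K}. ip g (\<lambda>i. \<Sum>l\<in>{0..<K}. a l * x l i)) = (\<Sum>l\<in>{0..<K}. a l)"
      using bf(2) ip_block_sum[OF d x xs(4), of _ K a] xs(5) by (simp add: sum.reindex)
    then show ?thesis unfolding F_def ip_avg using a(1) by simp
  qed
  ultimately show ?thesis using ip_le_N'[of F] by metis
qed

text \<open>The even terms are taken from \<open>S\<close> and the odd ones from \<open>S'\<close>,
  so the alternating sum is the difference of the two partial sums.\<close>

lemma block_spaces_close:
  assumes S: "block_space S" "block_space S'" and "0 < \<epsilon>"
  obtains x y where "x \<in> S" "y \<in> S'" "0 < N (\<lambda>i. x i + y i)" "N (\<lambda>i. x i - y i) \<le> \<epsilon> * N (\<lambda>i. x i + y i)"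
proof -
  obtain p where p: "2400 / \<epsilon> < 2 ^ p" using real_arch_pow[of 2 "2400 / \<epsilon>"] by auto
  \<comment> \<open>Odd by construction; \<open>m_ge_index\<close> turns the size of the index into
    the required size of \<open>m J0\<close>.\<close>
  define J0 :: nat where "J0 = 2 * 2 ^ (2 * p + 2) + 1"
  have "(2::nat) ^ 1 \<le> 2 ^ (2 * p + 2)" by (intro power_increasing) auto
  then have J0: "odd J0" "3 \<le> J0" by (auto simp: J0_def)
  have mJ: "2 ^ (2 * p + 2) \<le> m J0" using m_ge_index[of J0] J0(2) by (simp add: J0_def)
  have kJ: "Suc (k J0 - 1) = k J0" using k_ge_1[of J0] J0 by simp
  define SS where "SS = (\<lambda>l::nat. if even l then S else S')"
  have SSb: "block_space (SS l)" for l using S by (simp add: SS_def)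
  define n1 where "n1 = max (J0 + 1) (2 ^ k J0 * (m J0 * 2 ^ p))"
  obtain x xs d J where q: "growing d" "n1 \<le> d 0" "\<And>l. x l \<in> SS l" "\<And>l. xs l \<in> Lc (J l)" "\<And>l. 2 \<le> J l"
    "\<And>l. supp (x l) \<subseteq> {d l..<d (Suc l)}" "\<And>l. supp (xs l) \<subseteq> {d l..<d (Suc l)}" "\<And>l. supp (xs l) \<noteq> {}"
    "\<And>l. ip (xs l) (x l) = 1" "\<And>l. controlled 144 (J l) (d l) (x l)" "J 0 = 2 * (J0 + 1)" "\<And>l. J l < J (Suc l)"
    "\<And>l. J (Suc l) = \<Phi> (map xs [0..<Suc l])" "\<And>l. map xs [0..<Suc l] \<in> G_set m k"
    by (rule dependent_sequence_exists[of SS J0 n1, OF SSb J0(2)]) (rule that)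
  have xc: "x l \<in> c00" for l using block_spaceD(1)[OF SSb q(3)] .
  have xL: "xs l \<in> LL" for l using LL_I[OF q(4)] q(5)[of l] by simp
  have mn: "mn (xs l) \<in> {d l..<d (Suc l)}" for l
    using mn_in[of "xs l"] LL_wf[OF xL] q(7,8)[of l] by blast
  have mp: "0 < real (m J0) * 2 ^ p" using m_ge_2[of J0] J0(2) by simp
  have "2 ^ k J0 * (m J0 * 2 ^ p) \<le> d 0" using q(2) by (simp add: n1_def)
  then have "real (2 ^ k J0 * (m J0 * 2 ^ p)) \<le> real (d 0)" by (rule of_nat_mono)
  then have "2 ^ Suc (k J0 - 1) \<le> 1 / (real (m J0) * 2 ^ p) * d 0" unfolding kJ using mp by (simp add: field_simps)
  then obtain K a where a: "0 < K" "small_on_wide d a K (k J0 - 1) (1 / (real (m J0) * 2 ^ p))"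
    "(\<lambda>l. mn (xs l)) ` {0..<K} \<in> schreier (Suc (k J0 - 1))" "\<And>l l'. l < K \<Longrightarrow> l' < K \<Longrightarrow> l \<le> l' \<Longrightarrow> a l' \<le> a l"
    by (rule small_convex_combination[where d = d and p = "\<lambda>l. mn (xs l)", OF q(1) mn]) (rule that)
  interpret D: dependent_sequence m t k \<Phi> J0 p x xs d J K a
    by unfold_locales (use J0 mJ q xL a in \<open>auto simp: n1_def\<close>)
  have xS: "even l \<Longrightarrow> x l \<in> S" "odd l \<Longrightarrow> x l \<in> S'" for l using q(3)[of l] by (auto simp: SS_def)
  let ?E = "{l\<in>{0..<K}. even l}" and ?O = "{l\<in>{0..<K}. odd l}"
  define X where "X = (\<lambda>i. \<Sum>l\<in>?E. a l * x l i)"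
  define Y where "Y = (\<lambda>i. \<Sum>l\<in>?O. a l * x l i)"
  have split: "(\<Sum>l\<in>{0..<K}. h l) = (\<Sum>l\<in>?E. h l) + (\<Sum>l\<in>?O. h l)" for h :: "nat \<Rightarrow> real"
    by (subst sum.union_disjoint[symmetric]) (auto intro!: sum.cong)
  have plus: "(\<lambda>i. X i + Y i) = (\<lambda>i. \<Sum>l\<in>{0..<K}. a l * x l i)" unfolding X_def Y_def split ..
  have minus: "(\<lambda>i. X i - Y i) = (\<lambda>i. \<Sum>l\<in>{0..<K}. ((- 1) ^ l * a l) * x l i)"
    unfolding X_def Y_def split by (auto simp: sum_negf)
  have low: "1 / m J0 \<le> N (\<lambda>i. X i + Y i)" unfolding plus
    using D.a_sum a(1,3) kJ by (intro special_lower[OF J0 q(1) xc q(6,4,5,8,7,9,11,13)]) auto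
  have up: "N (\<lambda>i. X i - Y i) \<le> 2400 / (real (m J0) * 2 ^ p)"
  proof (rule N_leI)
    fix f assume f: "f \<in> LL"
    have "ip f (\<lambda>i. X i - Y i) = (\<Sum>l\<in>{0..<K}. (- 1) ^ l * a l * ip f (x l))"
      unfolding minus using xc by (intro ip_sum_right) auto
    then show "ip f (\<lambda>i. X i - Y i) \<le> 2400 / (real (m J0) * 2 ^ p)" using D.alternating_small[OF f] by linarith
  qed
  have m0: "0 < real (m J0)" using m_ge_2[of J0] J0(2) by simp
  have "2400 / (real (m J0) * 2 ^ p) = 2400 / 2 ^ p * (1 / m J0)" by simp
  also have "\<dots> \<le> \<epsilon> * (1 / m J0)" using p assms(3) m0 by (intro mult_right_mono) (auto simp: field_simps)
  also have "\<dots> \<le> \<epsilon> * N (\<lambda>i. X i + Y i)" using low assms(3) by (intro mult_left_mono) auto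
  finally have "N (\<lambda>i. X i - Y i) \<le> \<epsilon> * N (\<lambda>i. X i + Y i)" using up by linarith
  moreover have "0 < N (\<lambda>i. X i + Y i)" using low m0 by (smt (verit) zero_less_divide_1_iff)
  moreover have "X \<in> S" unfolding X_def using xS by (intro block_space_sum[OF S(1)]) auto
  moreover have "Y \<in> S'" unfolding Y_def using xS by (intro block_space_sum[OF S(2)]) auto
  ultimately show ?thesis using that by blast
qed

end

subsection \<open>The completion\<close>

text \<open>Continuity of the inverse at 0 bounds the first projection, by scaling \<open>y\<close>
  to norm 1.\<close>

lemma direct_sum_bound:
  fixes W Y Z :: "'b::real_normed_vector set"
  assumes "topological_direct_sum W Y Z"
  obtains C where "0 < C" "\<And>y z. y \<in> Y \<Longrightarrow> z \<in> Z \<Longrightarrow> norm y \<le> C * norm (y + z)"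
proof -
  obtain g where sub: "subspace W" "subspace Y" "subspace Z"
    and g: "homeomorphism (Y \<times> Z) W (\<lambda>(y, z). y + z) g"
    using assms unfolding topological_direct_sum_def by blast
  have gi: "g (y + z) = (y, z)" and W: "y + z \<in> W" if "y \<in> Y" "z \<in> Z" for y z
    using homeomorphism_apply1[OF g, of "(y, z)"] homeomorphism_image1[OF g] that by force+
  have zero: "0 \<in> Y" "0 \<in> Z" using sub by (auto intro: subspace_0)
  have "continuous_on W g" using homeomorphism_cont2[OF g] .
  then obtain \<delta> where \<delta>: "0 < \<delta>" "\<And>w. w \<in> W \<Longrightarrow> dist w 0 < \<delta> \<Longrightarrow> dist (g w) (g 0) < 1"
    using W[OF zero] unfolding continuous_on_iff by (metis add_0 zero_less_one)
  have g0: "g 0 = (0, 0)" using gi[OF zero] by simp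
  have "norm y \<le> 1 / \<delta> * norm (y + z)" if yz: "y \<in> Y" "z \<in> Z" for y z
  proof (cases "y = 0")
    case True then show ?thesis using \<delta>(1) by simp
  next
    case False
    define r where "r = 1 / norm y"
    have ry: "r *\<^sub>R y \<in> Y" "r *\<^sub>R z \<in> Z" using yz sub by (auto intro: subspace_scale)
    have eq: "r *\<^sub>R y + r *\<^sub>R z = r *\<^sub>R (y + z)" by (simp add: scaleR_add_right)
    have "norm (r *\<^sub>R y) = 1" using False by (simp add: r_def)
    moreover have "norm (r *\<^sub>R y) \<le> norm (r *\<^sub>R y, r *\<^sub>R z)" by (metis norm_fst_le fst_conv)
    moreover have "g (r *\<^sub>R (y + z)) = (r *\<^sub>R y, r *\<^sub>R z)" "r *\<^sub>R (y + z) \<in> W" using gi[OF ry] W[OF ry] eq by auto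
    ultimately have "\<not> dist (g (r *\<^sub>R (y + z))) (g 0) < 1" using g0 by (simp add: zero_prod_def[symmetric] del: norm_Pair)
    then have "\<delta> \<le> norm (r *\<^sub>R (y + z))" using \<delta>(2)[of "r *\<^sub>R (y + z)"] \<open>r *\<^sub>R (y + z) \<in> W\<close> by (force simp: not_less)
    then have "\<delta> \<le> norm (y + z) / norm y" by (simp add: r_def)
    then show ?thesis using False \<delta>(1) by (simp add: field_simps)
  qed
  then show ?thesis using that[of "1 / \<delta>"] \<delta>(1) by simp
qed

text \<open>Each functional lowers the dimension by at most one: if its kernel lay in a finite
  dimensional span, adding one vector outside the kernel would span the whole space.\<close>

lemma infinite_dimensional_kernel:
  fixes Y :: "'b::real_vector set" and c :: "nat \<Rightarrow> 'b \<Rightarrow> real"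
  assumes "subspace Y" "infinite_dimensional Y"
    "\<And>i x y \<alpha> \<beta>. x \<in> Y \<Longrightarrow> y \<in> Y \<Longrightarrow> c i (\<alpha> *\<^sub>R x + \<beta> *\<^sub>R y) = \<alpha> * c i x + \<beta> * c i y"
  shows "subspace {y\<in>Y. \<forall>i<n. c i y = 0} \<and> infinite_dimensional {y\<in>Y. \<forall>i<n. c i y = 0}"
proof (induction n)
  case 0 then show ?case using assms by simp
next
  case (Suc n)
  let ?K = "\<lambda>n. {y\<in>Y. \<forall>i<n. c i y = 0}"
  have c0: "c i 0 = 0" for i using assms(3)[of 0 0 i 0 0] subspace_0[OF assms(1)] by simp
  have cadd: "c i (x + y) = c i x + c i y" if "x \<in> Y" "y \<in> Y" for i x y using assms(3)[OF that, of i 1 1] by simp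
  have csc: "c i (\<alpha> *\<^sub>R x) = \<alpha> * c i x" if "x \<in> Y" for i x \<alpha> using assms(3)[OF that that, of i \<alpha> 0] by simp
  have sub: "subspace (?K (Suc n))"
    unfolding subspace_def using assms(1) c0 cadd csc by (auto intro: subspace_0 subspace_add subspace_scale)
  moreover have "infinite_dimensional (?K (Suc n))"
  proof (rule ccontr)
    assume "\<not> infinite_dimensional (?K (Suc n))"
    then obtain B where B: "finite B" "?K (Suc n) \<subseteq> span B" by (auto simp: infinite_dimensional_def)
    have "\<exists>B. finite B \<and> ?K n \<subseteq> span B"
    proof (cases "\<exists>y\<in>?K n. c n y \<noteq> 0")
      case False
      then have "?K n \<subseteq> ?K (Suc n)" by (auto simp: less_Suc_eq)
      then show ?thesis using B subset_trans by (intro exI[of _ B] conjI)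
    next
      case True
      then obtain y0 where y0: "y0 \<in> ?K n" "c n y0 \<noteq> 0" by blast
      have "?K n \<subseteq> span (insert y0 B)"
      proof
        fix y assume y: "y \<in> ?K n"
        define w where "w = 1 *\<^sub>R y + (- (c n y / c n y0)) *\<^sub>R y0"
        have "w \<in> Y" unfolding w_def using y y0 assms(1) by (intro subspace_add subspace_scale) auto
        moreover have "c i w = 0" if "i < Suc n" for i
          unfolding w_def using assms(3)[of y y0 i 1 "- (c n y / c n y0)"] y y0 that by (cases "i = n") auto
        ultimately have "w \<in> span (insert y0 B)" using B(2) span_mono[of B "insert y0 B"] by blast
        then have "w + (c n y / c n y0) *\<^sub>R y0 \<in> span (insert y0 B)" by (intro span_add span_scale) (auto intro: span_base)
        then show "y \<in> span (insert y0 B)" by (simp add: w_def)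
      qed
      then show ?thesis using B(1) by blast
    qed
    then show False using Suc by (simp add: infinite_dimensional_def)
  qed
  ultimately show ?case by blast
qed

lemma infinite_dimensional_common_zero:
  fixes Y :: "'b::real_vector set" and c :: "nat \<Rightarrow> 'b \<Rightarrow> real"
  assumes "subspace Y" "infinite_dimensional Y"
    "\<And>i x y \<alpha> \<beta>. x \<in> Y \<Longrightarrow> y \<in> Y \<Longrightarrow> c i (\<alpha> *\<^sub>R x + \<beta> *\<^sub>R y) = \<alpha> * c i x + \<beta> * c i y"
  obtains y where "y \<in> Y" "y \<noteq> 0" "\<And>i. i < n \<Longrightarrow> c i y = 0"
proof -
  have inf: "infinite_dimensional {y\<in>Y. \<forall>i<n. c i y = 0}" 
    by (rule conjunct2[OF infinite_dimensional_kernel[OF assms(1,2)]]) (rule assms(3))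
  have "\<not> {y\<in>Y. \<forall>i<n. c i y = 0} \<subseteq> {0}"
  proof
    assume "{y\<in>Y. \<forall>i<n. c i y = 0} \<subseteq> {0}"
    then have "{y\<in>Y. \<forall>i<n. c i y = 0} \<subseteq> span {}" by simp
    then show False using inf unfolding infinite_dimensional_def by blast
  qed
  then show ?thesis using that by blast
qed

section \<open>Block subspaces near arbitrary subspaces of the completion\<close>

locale completed_space = coded_space +
  fixes \<iota> :: "(nat \<Rightarrow> real) \<Rightarrow> 'b::banach" and X :: "'b set"
  assumes completion: "is_completion (norm_by (L_set m k \<Phi>)) \<iota> X"
begin

lemma iota_linear: "x \<in> c00 \<Longrightarrow> y \<in> c00 \<Longrightarrow> \<iota> (\<lambda>i. a * x i + b * y i) = a *\<^sub>R \<iota> x + b *\<^sub>R \<iota> y"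
  using completion unfolding is_completion_def by blast

lemma norm_iota: "x \<in> c00 \<Longrightarrow> norm (\<iota> x) = N x"
  using completion unfolding is_completion_def N_def by blast

lemma X_closure: "X = closure (\<iota> ` c00)"
  using completion unfolding is_completion_def by blast

lemma c00_lin: "x \<in> c00 \<Longrightarrow> y \<in> c00 \<Longrightarrow> (\<lambda>i. a * x i + b * y i) \<in> c00"
  using c00_sum[of "{True, False}" "\<lambda>t. if t then x else y" "\<lambda>t. if t then a else b"] by simp

lemma iota_diff: "x \<in> c00 \<Longrightarrow> y \<in> c00 \<Longrightarrow> \<iota> (\<lambda>i. x i - y i) = \<iota> x - \<iota> y"
  using iota_linear[of x y 1 "- 1"] by simp

lemma iota_add: "x \<in> c00 \<Longrightarrow> y \<in> c00 \<Longrightarrow> \<iota> (\<lambda>i. x i + y i) = \<iota> x + \<iota> y"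
  using iota_linear[of x y 1 1] by simp

lemma iota_scale: "x \<in> c00 \<Longrightarrow> \<iota> (\<lambda>i. a * x i) = a *\<^sub>R \<iota> x"
  using iota_linear[of x x a 0] by simp

lemma iota_sum:
  assumes "finite A" "\<And>l. l \<in> A \<Longrightarrow> x l \<in> c00"
  shows "\<iota> (\<lambda>i. \<Sum>l\<in>A. a l * x l i) = (\<Sum>l\<in>A. a l *\<^sub>R \<iota> (x l))"
  using assms
proof (induction A rule: finite_induct)
  case empty
  have "(\<lambda>_. 0) \<in> c00" by (simp add: c00_def)
  from iota_scale[OF this, of 0] show ?case by simp
next
  case (insert l A)
  then have c: "x l \<in> c00" "(\<lambda>i. \<Sum>l\<in>A. a l * x l i) \<in> c00" by (auto intro: c00_sum)
  have "\<iota> (\<lambda>i. \<Sum>l\<in>insert l A. a l * x l i) = \<iota> (\<lambda>i. a l * x l i + 1 * (\<Sum>l\<in>A. a l * x l i))" using insert by simp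
  also have "\<dots> = a l *\<^sub>R \<iota> (x l) + 1 *\<^sub>R \<iota> (\<lambda>i. \<Sum>l\<in>A. a l * x l i)" by (rule iota_linear[OF c])
  finally show ?case using insert by simp
qed

text \<open>Coordinates are dominated by the norm, hence uniformly continuous on the image of
  \<open>c00\<close>; they extend to the closure, and linearity passes to the limit.\<close>

lemma coordinate_functional:
  obtains c where "continuous_on X c" "\<And>x. x \<in> c00 \<Longrightarrow> c (\<iota> x) = x i"
    "\<And>x y \<alpha> \<beta>. x \<in> X \<Longrightarrow> y \<in> X \<Longrightarrow> c (\<alpha> *\<^sub>R x + \<beta> *\<^sub>R y) = \<alpha> * c x + \<beta> * (c y :: real)"
proof -
  have dist: "\<bar>x i - y i\<bar> \<le> norm (\<iota> x - \<iota> y)" if "x \<in> c00" "y \<in> c00" for x y i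
  proof -
    have d: "(\<lambda>i. x i - y i) \<in> c00" using c00_lin[OF that, of 1 "- 1"] by simp
    then have "\<bar>x i - y i\<bar> \<le> N (\<lambda>i. x i - y i)" using coord_le_N[OF d, of i] by simp
    also have "\<dots> = norm (\<iota> x - \<iota> y)" using norm_iota[OF d] iota_diff[OF that] by simp
    finally show ?thesis .
  qed
  have inj: "inj_on \<iota> c00"
  proof (rule inj_onI)
    fix x y assume xy: "x \<in> c00" "y \<in> c00" "\<iota> x = \<iota> y"
    then have "x i = y i" for i using dist[OF xy(1,2), of i] by simp
    then show "x = y" by auto
  qed
  define f where "f = (\<lambda>b. inv_into c00 \<iota> b i)"
  have f: "f (\<iota> x) = x i" if "x \<in> c00" for x using inv_into_f_f[OF inj that] by (simp add: f_def)
  have "uniformly_continuous_on (\<iota> ` c00) f"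
    unfolding uniformly_continuous_on_def
  proof (intro allI impI)
    fix e :: real assume "0 < e"
    then show "\<exists>\<delta>>0. \<forall>x\<in>\<iota> ` c00. \<forall>x'\<in>\<iota> ` c00. dist x' x < \<delta> \<longrightarrow> dist (f x') (f x) < e"
    proof (intro exI[of _ e] conjI ballI impI)
      fix b b' assume "b \<in> \<iota> ` c00" "b' \<in> \<iota> ` c00" and close: "dist b' b < e"
      then obtain x x' where x: "x \<in> c00" "x' \<in> c00" "b = \<iota> x" "b' = \<iota> x'" by blast
      have "dist (f b') (f b) \<le> dist b' b" using dist[OF x(2,1), of i] f x by (simp add: dist_norm)
      then show "dist (f b') (f b) < e" using close by simp
    qed
  qed
  then obtain c where c: "uniformly_continuous_on (closure (\<iota> ` c00)) c" "\<And>b. b \<in> \<iota> ` c00 \<Longrightarrow> f b = c b"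
    by (rule uniformly_continuous_on_extension_on_closure) blast
  have cont: "continuous_on X c" using c(1) uniformly_continuous_imp_continuous X_closure by blast
  have ci: "c (\<iota> x) = x i" if "x \<in> c00" for x using c(2)[of "\<iota> x"] f[OF that] that by simp
  have "c (\<alpha> *\<^sub>R x + \<beta> *\<^sub>R y) = \<alpha> * c x + \<beta> * c y" if xy: "x \<in> X" "y \<in> X" for x y \<alpha> \<beta>
  proof -
    obtain u where u: "\<And>n. u n \<in> \<iota> ` c00" "u \<longlonglongrightarrow> x" using xy(1) unfolding X_closure closure_sequential by blast
    obtain v where v: "\<And>n. v n \<in> \<iota> ` c00" "v \<longlonglongrightarrow> y" using xy(2) unfolding X_closure closure_sequential by blast
    have uv: "\<alpha> *\<^sub>R u n + \<beta> *\<^sub>R v n \<in> \<iota> ` c00 \<and> c (\<alpha> *\<^sub>R u n + \<beta> *\<^sub>R v n) = \<alpha> * c (u n) + \<beta> * c (v n)" for n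
    proof -
      obtain a b where ab: "a \<in> c00" "b \<in> c00" "u n = \<iota> a" "v n = \<iota> b" using u(1)[of n] v(1)[of n] by auto
      have "\<alpha> *\<^sub>R u n + \<beta> *\<^sub>R v n = \<iota> (\<lambda>i. \<alpha> * a i + \<beta> * b i)" using iota_linear[OF ab(1,2)] ab by simp
      then show ?thesis using ci[OF c00_lin[OF ab(1,2)]] ci ab c00_lin[OF ab(1,2)] by auto
    qed
    have lim: "(\<lambda>n. \<alpha> *\<^sub>R u n + \<beta> *\<^sub>R v n) \<longlonglongrightarrow> \<alpha> *\<^sub>R x + \<beta> *\<^sub>R y" using u(2) v(2) by (intro tendsto_intros)
    have inX: "b \<in> X" if "b \<in> \<iota> ` c00" for b unfolding X_closure by (rule subsetD[OF closure_subset that])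
    have "\<alpha> *\<^sub>R x + \<beta> *\<^sub>R y \<in> X" unfolding X_closure closure_sequential
      by (intro exI[of _ "\<lambda>n. \<alpha> *\<^sub>R u n + \<beta> *\<^sub>R v n"] conjI allI conjunct1[OF uv] lim)
    then have "(\<lambda>n. c (\<alpha> *\<^sub>R u n + \<beta> *\<^sub>R v n)) \<longlonglongrightarrow> c (\<alpha> *\<^sub>R x + \<beta> *\<^sub>R y)"
      by (intro continuous_on_tendsto_compose[OF cont lim] always_eventually allI inX[OF conjunct1[OF uv]])
    moreover have "(\<lambda>n. \<alpha> * c (u n) + \<beta> * c (v n)) \<longlonglongrightarrow> \<alpha> * c x + \<beta> * c y"
    proof (intro tendsto_intros)
      show "(\<lambda>n. c (u n)) \<longlonglongrightarrow> c x"
        by (intro continuous_on_tendsto_compose[OF cont u(2) xy(1)] always_eventually allI inX[OF u(1)])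
      show "(\<lambda>n. c (v n)) \<longlonglongrightarrow> c y"
        by (intro continuous_on_tendsto_compose[OF cont v(2) xy(2)] always_eventually allI inX[OF v(1)])
    qed
    ultimately show ?thesis using uv LIMSEQ_unique by auto
  qed
  then show ?thesis using that cont ci by blast
qed

text \<open>Take a normalized vector of \<open>Y\<close> whose first \<open>n\<close> coordinates
  vanish. Approximants from \<open>c00\<close> have first coordinates tending to 0, so their heads,
  whose norm is at most their l1 norm, can be cut off.\<close>

lemma far_approximation:
  assumes Y: "subspace Y" "infinite_dimensional Y" "Y \<subseteq> X" and "0 < \<eta>"
  obtains u y where "u \<in> c00" "N u = 1" "supp u \<subseteq> {n..}" "y \<in> Y" "norm (\<iota> u - y) \<le> \<eta>"
proof -
  \<comment> \<open>Approximation and removal of the head cost \<open>2 * e\<close> in total. Since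
    \<open>2 * e \<le> 1 / 2\<close>, the norm stays at least \<open>1 / 2\<close>, and
    normalization at most doubles the error to \<open>4 * e \<le> \<eta>\<close>.\<close>
  define e where "e = min (1 / 4) (\<eta> / 4)"
  have e: "0 < e" "e \<le> 1 / 4" "4 * e \<le> \<eta>" using assms(4) by (auto simp: e_def)
  have "\<forall>i. \<exists>c::'b \<Rightarrow> real. continuous_on X c \<and> (\<forall>x\<in>c00. c (\<iota> x) = x i) \<and>
    (\<forall>x\<in>X. \<forall>y\<in>X. \<forall>\<alpha> \<beta>. c (\<alpha> *\<^sub>R x + \<beta> *\<^sub>R y) = \<alpha> * c x + \<beta> * c y)"
    using coordinate_functional by metis
  then obtain c :: "nat \<Rightarrow> 'b \<Rightarrow> real" where c: "\<And>i. continuous_on X (c i)" "\<And>i x. x \<in> c00 \<Longrightarrow> c i (\<iota> x) = x i"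
    "\<And>i x y \<alpha> \<beta>. x \<in> X \<Longrightarrow> y \<in> X \<Longrightarrow> c i (\<alpha> *\<^sub>R x + \<beta> *\<^sub>R y) = \<alpha> * c i x + \<beta> * c i y" by metis
  have lin: "c i (\<alpha> *\<^sub>R x + \<beta> *\<^sub>R y) = \<alpha> * c i x + \<beta> * c i y" if "x \<in> Y" "y \<in> Y" for i x y \<alpha> \<beta>
    using c(3) that Y(3) by blast
  obtain y0 where y0: "y0 \<in> Y" "y0 \<noteq> 0" "\<And>i. i < n \<Longrightarrow> c i y0 = 0"
    by (rule infinite_dimensional_common_zero[OF Y(1,2), of c n]) (rule lin, assumption+, rule that)
  define y1 where "y1 = (1 / norm y0) *\<^sub>R y0"
  have y1: "y1 \<in> Y" "norm y1 = 1" using y0 subspace_scale[OF Y(1)] by (auto simp: y1_def)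
  have y1c: "c i y1 = 0" if "i < n" for i using lin[OF y0(1,1), of i "1 / norm y0" 0] y0(3)[OF that] by (simp add: y1_def)
  have "y1 \<in> closure (\<iota> ` c00)" using y1(1) Y(3) X_closure by blast
  then obtain b where b: "\<And>l. b l \<in> \<iota> ` c00" "b \<longlonglongrightarrow> y1" unfolding closure_sequential by blast
  have "\<forall>l. \<exists>v. v \<in> c00 \<and> b l = \<iota> v" using b(1) by blast
  from choice[OF this] obtain w where w: "\<And>l. w l \<in> c00" "\<And>l. b l = \<iota> (w l)" by blast
  have inX: "b l \<in> X" for l unfolding X_closure by (rule subsetD[OF closure_subset b(1)])
  have "(\<lambda>l. w l i) \<longlonglongrightarrow> 0" if "i < n" for i
  proof -
    have "(\<lambda>l. c i (b l)) \<longlonglongrightarrow> c i y1"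
      using y1(1) Y(3) by (intro continuous_on_tendsto_compose[OF c(1) b(2)] always_eventually allI inX) blast
    then show ?thesis using w c(2) y1c[OF that] by simp
  qed
  then have "(\<lambda>l. \<Sum>i<n. \<bar>w l i\<bar>) \<longlonglongrightarrow> (\<Sum>i<n. \<bar>0\<bar>)" by (intro tendsto_sum tendsto_rabs) auto
  then have "(\<lambda>l. \<Sum>i<n. \<bar>w l i\<bar>) \<longlonglongrightarrow> 0" by simp
  then have "\<forall>\<^sub>F l in sequentially. (\<Sum>i<n. \<bar>w l i\<bar>) < e" using e(1) by (rule order_tendstoD(2))
  moreover have "\<forall>\<^sub>F l in sequentially. dist (b l) y1 < e" using b(2) e(1) by (rule tendstoD)
  ultimately have "\<forall>\<^sub>F l in sequentially. (\<Sum>i<n. \<bar>w l i\<bar>) < e \<and> dist (b l) y1 < e" by (rule eventually_conj)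
  then obtain l where l: "(\<Sum>i<n. \<bar>w l i\<bar>) < e" "dist (b l) y1 < e"
    using eventually_happens'[OF sequentially_bot] by blast
  define hd where "hd = restr {..<n} (w l)"
  define u where "u = restr {n..} (w l)"
  have fin: "finite (supp (w l))" "w l 0 = 0" using w(1)[of l] by (auto simp: c00_def)
  have cu: "hd \<in> c00" "u \<in> c00" using fin by (auto simp: c00_def hd_def u_def) (auto simp: restr_def)
  have sum: "w l = (\<lambda>i. hd i + u i)" by (auto simp: hd_def u_def restr_def)
  have Nh: "N hd < e"
  proof -
    have "N hd \<le> (\<Sum>i\<in>supp hd. \<bar>hd i\<bar>)" by (rule N_le_l1)
    also have "\<dots> \<le> (\<Sum>i<n. \<bar>w l i\<bar>)"
      by (rule order_trans[OF sum_mono2[of "{..<n}"]]) (auto simp: hd_def restr_def supp_def intro!: sum_mono split: if_splits)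
    finally show ?thesis using l(1) by simp
  qed
  have close: "norm (\<iota> u - y1) < 2 * e"
  proof -
    have "\<iota> u - y1 = (b l - y1) - \<iota> hd" using iota_add[OF cu] sum w(2)[of l] by simp
    then have "norm (\<iota> u - y1) \<le> norm (b l - y1) + norm (\<iota> hd)" by (metis norm_triangle_ineq4)
    then show ?thesis using l(2) Nh norm_iota[OF cu(1)] by (simp add: dist_norm)
  qed
  have Nu: "1 / 2 \<le> N u"
  proof -
    have "norm y1 \<le> norm (\<iota> u) + norm (\<iota> u - y1)" using norm_triangle_ineq2[of y1 "\<iota> u"] by (simp add: norm_minus_commute)
    then show ?thesis using close e(2) y1(2) norm_iota[OF cu(2)] by linarith
  qed
  show ?thesis
  proof (rule that[of "\<lambda>i. 1 / N u * u i" "(1 / N u) *\<^sub>R y1"])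
    show "(\<lambda>i. 1 / N u * u i) \<in> c00" using c00_scale[OF cu(2)] .
    show "N (\<lambda>i. 1 / N u * u i) = 1" unfolding N_scale[OF cu(2)] using Nu by simp
    show "supp (\<lambda>i. 1 / N u * u i) \<subseteq> {n..}" by (auto simp: supp_def u_def restr_def split: if_splits)
    show "(1 / N u) *\<^sub>R y1 \<in> Y" using subspace_scale[OF Y(1) y1(1)] .
    have "\<iota> (\<lambda>i. 1 / N u * u i) - (1 / N u) *\<^sub>R y1 = (1 / N u) *\<^sub>R (\<iota> u - y1)"
      unfolding iota_scale[OF cu(2)] by (rule scaleR_diff_right[symmetric])
    then have "norm (\<iota> (\<lambda>i. 1 / N u * u i) - (1 / N u) *\<^sub>R y1) = 1 / N u * norm (\<iota> u - y1)" using Nu by simp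
    also have "\<dots> \<le> 2 * (2 * e)" using close Nu by (intro mult_mono) (auto simp: field_simps)
    finally show "norm (\<iota> (\<lambda>i. 1 / N u * u i) - (1 / N u) *\<^sub>R y1) \<le> \<eta>" using e(3) by linarith
  qed
qed

text \<open>A gliding hump with summable errors. The coefficients of a combination are bounded by
  its norm, because restriction to an interval does not increase the norm, so the errors add up to
  at most \<open>\<tau>\<close> times the norm.\<close>

lemma block_space_approximation:
  assumes Y: "subspace Y" "infinite_dimensional Y" "Y \<subseteq> X" and \<tau>: "0 < \<tau>"
  obtains S where "block_space S" "\<And>x. x \<in> S \<Longrightarrow> \<exists>y\<in>Y. norm (\<iota> x - y) \<le> \<tau> * N x"
proof -
  \<comment> \<open>The error is tied to the lower bound \<open>d0\<close> of the support, as the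
    position in the sequence is not known at this point; growth gives \<open>l \<le> d l\<close>
    later.\<close>
  define P where "P = (\<lambda>(u, y, d0, e). u \<in> c00 \<and> N u = 1 \<and> supp u \<subseteq> {d0..<e} \<and> y \<in> Y \<and> norm (\<iota> u - y) \<le> \<tau> / 2 ^ Suc d0)"
  define lo where "lo = (\<lambda>(u::nat \<Rightarrow> real, y::'b, d0::nat, e::nat). d0)"
  define hi where "hi = (\<lambda>(u::nat \<Rightarrow> real, y::'b, d0::nat, e::nat). e)"
  have ex: "\<exists>z. P z \<and> n \<le> lo z" for n
  proof -
    obtain u y where u: "u \<in> c00" "N u = 1" "supp u \<subseteq> {n..}" "y \<in> Y" "norm (\<iota> u - y) \<le> \<tau> / 2 ^ Suc n"
      by (rule far_approximation[OF Y, of "\<tau> / 2 ^ Suc n" n]) (use \<tau> in auto)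
    have "supp u \<subseteq> {n..<Suc (Max (supp u))}" using u(3) c00_supp[OF u(1)] by (auto simp: less_Suc_eq_le)
    then have "P (u, y, n, Suc (Max (supp u)))" using u by (simp add: P_def)
    then show ?thesis by (intro exI[of _ "(u, y, n, Suc (Max (supp u)))"]) (simp add: lo_def)
  qed
  have p1: "\<exists>z. P z \<and> max 1 0 \<le> lo z" using ex by blast
  have p2: "\<exists>z. P z \<and> n \<le> lo z \<and> True" for n using ex by blast
  obtain z where z: "\<And>l. P (z l)" "growing (\<lambda>l. lo (z l))" "\<And>l. hi (z l) \<le> lo (z (Suc l))"
    by (rule choose_growing[of P 0 lo "\<lambda>_ _. True" hi, OF p1 p2]) (rule that)
  define u where "u = (\<lambda>l. fst (z l))"
  define y where "y = (\<lambda>l. fst (snd (z l)))"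
  define d where "d = (\<lambda>l. lo (z l))"
  have gd: "growing d" using z(2) by (simp add: d_def)
  have Pz: "u l \<in> c00 \<and> N (u l) = 1 \<and> supp (u l) \<subseteq> {d l..<hi (z l)} \<and> y l \<in> Y \<and> norm (\<iota> (u l) - y l) \<le> \<tau> / 2 ^ Suc (d l)" for l
    using z(1)[of l] unfolding P_def u_def y_def d_def lo_def hi_def case_prod_beta .
  have su: "supp (u l) \<subseteq> {d l..<d (Suc l)}" for l
  proof -
    have "{d l..<hi (z l)} \<subseteq> {d l..<d (Suc l)}" using z(3)[of l] by (auto simp: d_def)
    then show ?thesis using Pz[of l] by blast
  qed
  have ld: "l \<le> d l" for l
  proof (induction l)
    case (Suc l) then show ?case using growing_less[OF gd, of l] by simp
  qed simp
  define S where "S = {(\<lambda>i. \<Sum>l\<in>{0..<n}. b l * u l i) |n b. True}"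
  have "block_space S"
    unfolding block_space_def
  proof (intro conjI ballI allI)
    show "S \<subseteq> c00" unfolding S_def using Pz by (auto intro: c00_sum)
    fix n
    have "u n \<in> S"
    proof -
      have "(\<Sum>l\<in>{0..<Suc n}. (if l = n then 1 else 0) * u l i) = u n i" for i
        by (simp add: if_distrib[of "\<lambda>b. b * _"] cong: if_cong)
      then have "u n = (\<lambda>i. \<Sum>l\<in>{0..<Suc n}. (if l = n then 1 else 0) * u l i)" by auto
      then show ?thesis unfolding S_def by (intro CollectI exI[of _ "Suc n"] exI[of _ "\<lambda>l. if l = n then 1 else 0"] conjI TrueI)
    qed
    moreover have "supp (u n) \<noteq> {}"
    proof
      assume "supp (u n) = {}"
      then have "N (u n) \<le> 0" using N_le_l1[of "u n"] by simp
      then show False using Pz[of n] by simp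
    qed
    moreover have "supp (u n) \<subseteq> {n..}" using su[of n] ld[of n] by auto
    ultimately show "\<exists>x\<in>S. supp x \<noteq> {} \<and> supp x \<subseteq> {n..}" by blast
  next
    fix x x' \<alpha> \<beta> assume "x \<in> S" "x' \<in> S"
    then obtain n b n' b' where x: "x = (\<lambda>i. \<Sum>l\<in>{0..<n}. b l * u l i)" "x' = (\<lambda>i. \<Sum>l\<in>{0..<n'}. b' l * u l i)"
      by (auto simp: S_def)
    have pad: "(\<Sum>l\<in>{0..<q}. \<beta> l * u l i) = (\<Sum>l\<in>{0..<q'}. (if l < q then \<beta> l else 0) * u l i)" if q: "q \<le> q'" for q q' \<beta> i
      by (rule sum.mono_neutral_cong_left) (use q in auto)
    define c where "c = (\<lambda>l. \<alpha> * (if l < n then b l else 0) + \<beta> * (if l < n' then b' l else 0))"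
    have "\<alpha> * x i + \<beta> * x' i = (\<Sum>l\<in>{0..<max n n'}. c l * u l i)" for i
      unfolding x pad[OF max.cobounded1[of n n']] pad[OF max.cobounded2[of n' n]]
      by (simp add: c_def sum_distrib_left sum.distrib algebra_simps)
    then have "(\<lambda>i. \<alpha> * x i + \<beta> * x' i) = (\<lambda>i. \<Sum>l\<in>{0..<max n n'}. c l * u l i)" by (rule ext)
    then show "(\<lambda>i. \<alpha> * x i + \<beta> * x' i) \<in> S" unfolding S_def by blast
  qed
  moreover have "\<exists>y\<in>Y. norm (\<iota> x - y) \<le> \<tau> * N x" if x: "x \<in> S" for x
  proof -
    obtain n b where xb: "x = (\<lambda>i. \<Sum>l\<in>{0..<n}. b l * u l i)" using x by (auto simp: S_def)
    have cx: "x \<in> c00" unfolding xb using Pz by (auto intro: c00_sum)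
    define w where "w = (\<Sum>l\<in>{0..<n}. b l *\<^sub>R y l)"
    have b: "\<bar>b l\<bar> \<le> N x" if l: "l < n" for l
    proof -
      have "restr {d l..<d (Suc l)} x i = b l * u l i" for i
      proof (cases "i \<in> {d l..<d (Suc l)}")
        case True
        have "b l' * u l' i = 0" if "l' \<in> {0..<n} - {l}" for l'
          using that True su[of l'] growing_disjoint[OF gd, of i l' l] by (auto simp: supp_def)
        then have "(\<Sum>l'\<in>{0..<n} - {l}. b l' * u l' i) = 0" by (rule sum.neutral[OF ballI])
        then have "x i = b l * u l i" using l sum.remove[of "{0..<n}" l "\<lambda>l. b l * u l i"] by (simp add: xb)
        then show ?thesis using True by (simp add: restr_def)
      next
        case False then show ?thesis using su[of l] by (auto simp: restr_def supp_def)
      qed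
      then have "restr {d l..<d (Suc l)} x = (\<lambda>i. b l * u l i)" by (rule ext)
      then have "N (\<lambda>i. b l * u l i) \<le> N x" using N_restr[OF cx order_convex_Ico, of "d l" "d (Suc l)"] by simp
      then show ?thesis using N_scale[of "u l" "b l"] Pz[of l] by simp
    qed
    have "norm (\<iota> x - w) = norm (\<Sum>l\<in>{0..<n}. b l *\<^sub>R (\<iota> (u l) - y l))"
      unfolding xb w_def using Pz by (subst iota_sum) (auto simp: sum_subtractf scaleR_diff_right)
    also have "\<dots> \<le> (\<Sum>l\<in>{0..<n}. N x * \<tau> * (1 / 2) ^ Suc l)"
    proof (rule sum_norm_le)
      fix l assume l: "l \<in> {0..<n}"
      have "(1 / 2 :: real) ^ Suc (d l) \<le> (1 / 2) ^ Suc l" using ld[of l] by (intro power_decreasing) auto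
      then have "\<tau> / 2 ^ Suc (d l) \<le> \<tau> * (1 / 2) ^ Suc l" using \<tau> by (simp add: power_divide field_simps)
      then have "norm (\<iota> (u l) - y l) \<le> \<tau> * (1 / 2) ^ Suc l" using Pz[of l] by linarith
      then have "\<bar>b l\<bar> * norm (\<iota> (u l) - y l) \<le> N x * (\<tau> * (1 / 2) ^ Suc l)" using b[of l] l by (intro mult_mono) (auto simp: N_nonneg)
      then show "norm (b l *\<^sub>R (\<iota> (u l) - y l)) \<le> N x * \<tau> * (1 / 2) ^ Suc l" by (simp add: mult.assoc)
    qed
    also have "\<dots> = N x * \<tau> * (\<Sum>l\<in>{0..<n}. (1 / 2) ^ Suc l)" by (simp add: sum_distrib_left)
    also have "(\<Sum>l\<in>{0..<n}. (1 / 2 :: real) ^ Suc l) = 1 - (1 / 2) ^ n" by (induction n) auto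
    also have "N x * \<tau> * (1 - (1 / 2) ^ n) \<le> N x * \<tau> * 1" using \<tau> N_nonneg[of x] by (intro mult_left_mono) auto
    finally have "norm (\<iota> x - w) \<le> \<tau> * N x" by (simp add: mult.commute)
    moreover have "w \<in> Y" unfolding w_def using Pz Y(1) by (intro subspace_sum subspace_scale) auto
    ultimately show ?thesis by blast
  qed
  ultimately show ?thesis using that by blast
qed

text \<open>Two nearly equal vectors from the approximating block subspaces are moved into
  \<open>Y\<close> and \<open>Z\<close>. Both have norm at most \<open>A\<close>, the norm of their
  sum, so each perturbation costs at most \<open>\<tau> * A\<close>.\<close>

lemma subspaces_not_separated:
  assumes Y: "subspace Y" "infinite_dimensional Y" "Y \<subseteq> X" and Z: "subspace Z" "infinite_dimensional Z" "Z \<subseteq> X" and D: "1 \<le> D"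
  obtains y z where "y \<in> Y" "z \<in> Z" "D * norm (y - z) < norm (y + z)"
proof -
  \<comment> \<open>With this choice \<open>D * norm (y - z)\<close> is at most
    \<open>3 / 8 * A\<close>, while \<open>norm (y + z)\<close> is at least
    \<open>6 / 8 * A\<close>.\<close>
  define \<tau> where "\<tau> = 1 / (8 * D)"
  have \<tau>: "0 < \<tau>" "D * \<tau> = 1 / 8" using D by (auto simp: \<tau>_def)
  then have \<tau>8: "\<tau> \<le> 1 / 8" using mult_right_mono[OF D, of \<tau>] by linarith
  obtain S where S: "block_space S" "\<And>x. x \<in> S \<Longrightarrow> \<exists>y\<in>Y. norm (\<iota> x - y) \<le> \<tau> * N x"
    by (rule block_space_approximation[OF Y \<tau>(1)]) (rule that)
  obtain S' where S': "block_space S'" "\<And>x. x \<in> S' \<Longrightarrow> \<exists>y\<in>Z. norm (\<iota> x - y) \<le> \<tau> * N x"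
    by (rule block_space_approximation[OF Z \<tau>(1)]) (rule that)
  obtain x x' where x: "x \<in> S" "x' \<in> S'" "0 < N (\<lambda>i. x i + x' i)" "N (\<lambda>i. x i - x' i) \<le> \<tau> * N (\<lambda>i. x i + x' i)"
    by (rule block_spaces_close[OF S(1) S'(1) \<tau>(1)]) (rule that)
  define A where "A = N (\<lambda>i. x i + x' i)"
  have c: "x \<in> c00" "x' \<in> c00" using block_spaceD(1)[OF S(1) x(1)] block_spaceD(1)[OF S'(1) x(2)] .
  have c': "(\<lambda>i. x i + x' i) \<in> c00" "(\<lambda>i. x i - x' i) \<in> c00"
    using c00_lin[OF c, of 1 1] c00_lin[OF c, of 1 "- 1"] by auto
  have plus: "norm (\<iota> x + \<iota> x') = A" using norm_iota[OF c'(1)] iota_add[OF c] by (simp add: A_def)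
  have minus: "norm (\<iota> x - \<iota> x') \<le> \<tau> * A" using norm_iota[OF c'(2)] iota_diff[OF c] x(4) by (simp add: A_def)
  have "\<tau> * A \<le> 1 * A" using x(3) \<tau>8 by (intro mult_right_mono) (auto simp: A_def)
  then have sum_bound: "norm (\<iota> x + \<iota> x') + norm (\<iota> x - \<iota> x') \<le> 2 * A" using plus minus by linarith
  have "norm ((\<iota> x + \<iota> x') + (\<iota> x - \<iota> x')) \<le> 2 * A" using sum_bound norm_triangle_ineq order_trans by blast
  moreover have "(\<iota> x + \<iota> x') + (\<iota> x - \<iota> x') = 2 *\<^sub>R \<iota> x" by (simp add: scaleR_2)
  ultimately have Nx: "N x \<le> A" using norm_iota[OF c(1)] by simp
  have "norm ((\<iota> x + \<iota> x') - (\<iota> x - \<iota> x')) \<le> 2 * A" using sum_bound norm_triangle_ineq4 order_trans by blast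
  moreover have "(\<iota> x + \<iota> x') - (\<iota> x - \<iota> x') = 2 *\<^sub>R \<iota> x'" by (simp add: scaleR_2)
  ultimately have Nx': "N x' \<le> A" using norm_iota[OF c(2)] by simp
  obtain y z where yz: "y \<in> Y" "z \<in> Z" "norm (\<iota> x - y) \<le> \<tau> * N x" "norm (\<iota> x' - z) \<le> \<tau> * N x'"
    using S(2)[OF x(1)] S'(2)[OF x(2)] by blast
  have e: "norm (\<iota> x - y) \<le> \<tau> * A" "norm (\<iota> x' - z) \<le> \<tau> * A"
    using yz(3,4) mult_left_mono[OF Nx, of \<tau>] mult_left_mono[OF Nx', of \<tau>] \<tau>(1) by linarith+
  have "norm (y - z) \<le> norm (\<iota> x - \<iota> x') + norm (\<iota> x - y) + norm (\<iota> x' - z)"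
    by norm
  then have "norm (y - z) \<le> 3 * (\<tau> * A)" using minus e by linarith
  then have "D * norm (y - z) \<le> D * (3 * (\<tau> * A))" using D by (intro mult_left_mono) auto
  also have "\<dots> = 3 * (D * \<tau>) * A" by simp
  finally have "D * norm (y - z) \<le> 3 / 8 * A" using \<tau>(2) by simp
  moreover have "norm (\<iota> x + \<iota> x') \<le> norm (y + z) + norm (\<iota> x - y) + norm (\<iota> x' - z)"
    by norm
  moreover have "\<tau> * A \<le> 1 / 8 * A" using \<tau>8 x(3) by (intro mult_right_mono) (auto simp: A_def)
  ultimately have "D * norm (y - z) < norm (y + z)" using plus e x(3) unfolding A_def by linarith
  then show ?thesis using that yz(1,2) by blast
qed

end

theorem corollary3p4:
  fixes m t k :: "nat \<Rightarrow> nat"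
    and \<Phi> :: "(nat \<Rightarrow> real) list \<Rightarrow> nat"
    and \<iota> :: "(nat \<Rightarrow> real) \<Rightarrow> 'b::banach"
    and X :: "'b set"
  assumes "m 1 = 2"
    and "\<And>j. 2 \<le> j \<Longrightarrow> m (j - 1) ^ m (j - 1) < m j"
    and "\<And>n. 2 \<le> n \<Longrightarrow> 0 < t n \<and> (m n)\<^sup>2 \<le> 2 ^ t n"
    and "k 1 = 1"
    and "\<And>n. 2 \<le> n \<Longrightarrow> k n = t n * (k (n - 1) + 1) + 1"
    and "coding_function m k \<Phi>"
    and "is_completion (norm_by (L_set m k \<Phi>)) \<iota> X"
  shows "hereditarily_indecomposable X"
proof -
  interpret completed_space m t k \<Phi> \<iota> X by unfold_locales (use assms in auto)
  show ?thesis unfolding hereditarily_indecomposable_def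
  proof (intro notI, elim exE conjE)
    fix W Y Z assume *: "W \<subseteq> X" "infinite_dimensional Y" "infinite_dimensional Z" and dsum: "topological_direct_sum W Y Z"
    obtain g where sub: "subspace Y" "subspace Z" and g: "homeomorphism (Y \<times> Z) W (\<lambda>(y, z). y + z) g"
      using dsum unfolding topological_direct_sum_def by blast
    have W: "y + z \<in> W" if "y \<in> Y" "z \<in> Z" for y z using homeomorphism_image1[OF g] that by force
    have "Y \<subseteq> X" "Z \<subseteq> X" using W[of _ 0] W[of 0] subspace_0[OF sub(1)] subspace_0[OF sub(2)] *(1) by fastforce+
    obtain C where C: "0 < C" "\<And>y z. y \<in> Y \<Longrightarrow> z \<in> Z \<Longrightarrow> norm y \<le> C * norm (y + z)"
      using direct_sum_bound[OF dsum] by blast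
    \<comment> \<open>The constant comes from
      \<open>norm (y + z) \<le> 2 * norm y + norm (y - z)\<close> together with
      \<open>norm y \<le> C * norm (y - z)\<close>, the latter being the projection bound applied to
      \<open>y\<close> and \<open>- z\<close>.\<close>
    obtain y z where yz: "y \<in> Y" "z \<in> Z" "(2 * C + 1) * norm (y - z) < norm (y + z)"
      by (rule subspaces_not_separated[OF sub(1) *(2) \<open>Y \<subseteq> X\<close> sub(2) *(3) \<open>Z \<subseteq> X\<close>, of "2 * C + 1"]) (use C(1) in auto)
    have "norm y \<le> C * norm (y - z)" using C(2)[OF yz(1) subspace_neg[OF sub(2) yz(2)]] by simp
    moreover have "norm (y + z) \<le> 2 * norm y + norm (y - z)" by norm
    ultimately show False using yz(3) by (simp add: algebra_simps)
  qed
qed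

end
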